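(* Let $a,b,r,T>0$, $\sigma\neq0$, $\mu\in\mathbb{R}$, $\eta>\theta>0$ and $d,\gamma\in\mathbb{R}$ be constants. Define $$g_1(t):=\frac{[a\theta-a\eta+(d-\gamma)r]\,[e^{r(T-t)}-1]}{r},\qquad A_1:=-\frac{(\mu-r)^2}{2\sigma^2}-\frac{a^2\eta^2}{2b^2}.$$ Consider, for $s\in[0,T)$ and $y\in\mathbb{R}$, the control problem with value function $$V(s,y)=\inf_{u(\cdot)\in\mathcal{U}^F_{ad}[s,T]}\tfrac12\mathbb{E}\,x(T)^2,$$ where $u(\cdot)=(\pi(\cdot),q(\cdot))'$, $x(s)=y$ and $$dx(t)=\big[rx(t)+a\eta q(t)+(\mu-r)\pi(t)+a\theta-a\eta+(d-\gamma)r\big]dt+bq(t)\,dW^0(t)+\sigma\pi(t)\,dW^1(t),\quad t\in[s,T].$$ Then the value function $$V(t,x)=\begin{cases}\frac12\big[e^{r(T-t)}x+g_1(t)\big]^2,&\text{if }x+g_1(t)e^{-r(T-t)}\ge0,\\[2pt] \frac12\big[e^{(A_1+r)(T-t)}x+e^{(T-t)A_1}g_1(t)\big]^2,&\text{if }x+g_1(t)e^{-r(T-t)}<0,\end{cases}$$ is a continuous viscosity solution of the Hamilton–Jacobi–Bellman equation $$\left\{\begin{aligned}&\frac{\partial v}{\partial t}(t,x)+\inf_{q\ge0,\pi\ge0}\Big\{\frac{\partial v}{\partial x}(t,x)\big[rx+a\eta q+(\mu-r)\pi+a\theta-a\eta+(d-\gamma)r\big]+\frac12\big[b^2q^2+\sigma^2\pi^2\big]\frac{\partial^2v}{\partial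 x^2}(t,x)\Big\}=0,\quad t\in[0,T],\\ &v(T,x)=\tfrac12x^2,\end{aligned}\right.$$ and $$u^*(t,x)=(\pi^*(t,x),q^*(t,x))'=\begin{cases}\Big(-\frac{\mu-r}{\sigma^2}\big[x+g_1(t)e^{-r(T-t)}\big],\,-\frac{a\eta}{b^2}\big[x+g_1(t)e^{-r(T-t)}\big]\Big)',&\text{if }x+g_1(t)e^{-r(T-t)}<0,\\ (0,0)',&\text{if }x+g_1(t)e^{-r(T-t)}\ge0,\end{cases}$$ is the associated optimal feedback control.
   Context: $W^0,W^1,W^2$ are mutually independent one-dimensional standard Brownian motions on a complete probability space and $\{\mathcal{F}_t\}$ is the filtration they generate. $\mathcal{U}^F_{ad}[s,T]$ is the set of $\mathcal{F}_t$-progressively measurable processes $u(\cdot)=(\pi(\cdot),q(\cdot))'$ on $[s,T]$ with values in $[0,\infty)\times[0,\infty)$ such that $\mathbb{E}\int_s^T\pi^2(t)dt<\infty$ and $\mathbb{E}\int_s^Tq^2(t)dt<\infty$ (a prime denotes transpose). Here $\pi$ is the amount invested in a risky asset with constant return rate $\mu$ and volatility $\sigma$, $q$ is the retained proportion of claims, $r$ is the constant interest rate, $a,b$ are the parameters of the claim process $dC(t)=a\,dt-b\,dW^0(t)$, and $\theta,\eta$ are the safety loadings of insurer and reinsurer. Viscosity solution: writing $G(t,x,u,p,P)=p[rx+a\eta q+(\mu-r)\pi+a\theta-a\eta+(d-\gamma)r]+\frac12P[b^2q^2+\sigma^2\pi^2]$ for $u=(\pi,q)$, a continuous function $V$ on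 $[0,T]\times\mathbb{R}$ with $V(T,x)=\frac12x^2$ is a viscosity subsolution (resp. supersolution) of the equation if for every $\varphi\in C^{1,2}([0,T]\times\mathbb{R})$ such that $V-\varphi$ has a local maximum (resp. minimum) at $(t,x)\in[0,T)\times\mathbb{R}$, one has $\varphi_t(t,x)+\inf_{u\in[0,\infty)^2}G(t,x,u,\varphi_x(t,x),\varphi_{xx}(t,x))\ge0$ (resp. $\le0$); it is a viscosity solution if it is both. "Optimal feedback control" means that the control $u(t)=u^*(t,x^*(t))$, with $x^*$ the corresponding state process, attains the infimum defining $V$.
   Formalization: The formal theorem assumes μ ≥ r instead of μ ∈ ℝ: for μ < r the stated π* is negative where x + g₁(t)e^{-r(T-t)} < 0, hence not admissible, and V fails the subsolution inequality where x + g₁(t)e^{-r(T-t)} > 0. *)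

theory Defs
  imports "HOL-Probability.Probability"
begin

section \<open>Brownian motion and its filtration\<close>

definition brownian_motion :: "'w measure \<Rightarrow> (real \<Rightarrow> 'w \<Rightarrow> real) \<Rightarrow> bool" where
  "brownian_motion M B \<longleftrightarrow>
     prob_space M \<and>
     (\<forall>t\<ge>0. B t \<in> borel_measurable M) \<and>
     (AE \<omega> in M. B 0 \<omega> = 0) \<and>
     (AE \<omega> in M. continuous_on {0..} (\<lambda>t. B t \<omega>)) \<and>
     (\<forall>t t'. 0 \<le> t \<and> t < t' \<longrightarrow>
        distributed M lborel (\<lambda>\<omega>. B t' \<omega> - B t \<omega>)
          (\<lambda>z. ennreal (normal_density 0 (sqrt (t' - t)) z))) \<and>
     (\<forall>(n::nat) p. 0 \<le> p 0 \<and> (\<forall>i<n. p i \<le> p (Suc i)) \<longrightarrow>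
        prob_space.indep_vars M (\<lambda>_. borel) (\<lambda>i \<omega>. B (p (Suc i)) \<omega> - B (p i) \<omega>) {..<n})"

definition independent_processes ::
    "'w measure \<Rightarrow> nat set \<Rightarrow> (nat \<Rightarrow> real \<Rightarrow> 'w \<Rightarrow> real) \<Rightarrow> bool" where
  "independent_processes M J W \<longleftrightarrow>
     prob_space.indep_vars M (\<lambda>_. PiM {0..} (\<lambda>_. borel))
       (\<lambda>i \<omega>. restrict (\<lambda>t. W i t \<omega>) {0..}) J"

definition natural_filtration ::
    "'w measure \<Rightarrow> nat set \<Rightarrow> (nat \<Rightarrow> real \<Rightarrow> 'w \<Rightarrow> real) \<Rightarrow> real \<Rightarrow> 'w measure" where
  "natural_filtration M J W t =
     sigma (space M) {W i \<tau> -` A \<inter> space M | i \<tau> A. i \<in> J \<and> 0 \<le> \<tau> \<and> \<tau> \<le> t \<and> A \<in> sets borel}"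

definition progressively_measurable ::
    "(real \<Rightarrow> 'w measure) \<Rightarrow> real \<Rightarrow> real \<Rightarrow> (real \<Rightarrow> 'w \<Rightarrow> 'b::topological_space) \<Rightarrow> bool" where
  "progressively_measurable F s T X \<longleftrightarrow>
     (\<forall>t\<in>{s..T}. (\<lambda>(\<tau>, \<omega>). X \<tau> \<omega>) \<in> borel_measurable (restrict_space borel {s..t} \<Otimes>\<^sub>M F t))"

definition square_integrable_process ::
    "'w measure \<Rightarrow> real \<Rightarrow> real \<Rightarrow> (real \<Rightarrow> 'w \<Rightarrow> real) \<Rightarrow> bool" where
  "square_integrable_process M s T X \<longleftrightarrow>
     (\<integral>\<^sup>+\<omega>. (\<integral>\<^sup>+\<tau>\<in>{s..T}. ennreal ((X \<tau> \<omega>)\<^sup>2) \<partial>lborel) \<partial>M) < \<infinity>"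

section \<open>The Ito integral\<close>

text \<open>A simple integrand on the interval from s to T is given by a partition
  \<open>s = p 0 \<le> \<dots> \<le> p n = T\<close> and bounded weights \<open>\<xi> i\<close>, known at time \<open>p i\<close>; its value is
  \<open>\<xi> i\<close> on the interval from \<open>p i\<close> (excluded) to \<open>p (i + 1)\<close> (included).\<close>

definition simple_integrand ::
    "'w measure \<Rightarrow> (real \<Rightarrow> 'w measure) \<Rightarrow> real \<Rightarrow> real \<Rightarrow> nat \<Rightarrow> (nat \<Rightarrow> real) \<Rightarrow>
     (nat \<Rightarrow> 'w \<Rightarrow> real) \<Rightarrow> bool" where
  "simple_integrand M F s T n p \<xi> \<longleftrightarrow>
     p 0 = s \<and> p n = T \<and> (\<forall>i<n. p i \<le> p (Suc i)) \<and>
     (\<forall>i<n. \<xi> i \<in> borel_measurable (F (p i))) \<and>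
     (\<exists>C. \<forall>i<n. \<forall>\<omega>\<in>space M. \<bar>\<xi> i \<omega>\<bar> \<le> C)"

definition simple_process ::
    "nat \<Rightarrow> (nat \<Rightarrow> real) \<Rightarrow> (nat \<Rightarrow> 'w \<Rightarrow> real) \<Rightarrow> real \<Rightarrow> 'w \<Rightarrow> real" where
  "simple_process n p \<xi> t \<omega> = (\<Sum>i<n. \<xi> i \<omega> * indicator {p i<..p (Suc i)} t)"

definition simple_integral ::
    "(real \<Rightarrow> 'w \<Rightarrow> real) \<Rightarrow> nat \<Rightarrow> (nat \<Rightarrow> real) \<Rightarrow> (nat \<Rightarrow> 'w \<Rightarrow> real) \<Rightarrow> real \<Rightarrow> 'w \<Rightarrow> real" where
  "simple_integral B n p \<xi> t \<omega> =
     (\<Sum>i<n. \<xi> i \<omega> * (B (min (p (Suc i)) t) \<omega> - B (min (p i) t) \<omega>))"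

text \<open>\<open>is_ito_integral M F B s T H I\<close> says that \<open>I\<close> is a continuous version of the process
  \<open>t \<mapsto> \<integral> H dB\<close> (integral from s to t) on the interval from s to T, constructed as usual for
  progressively measurable square-integrable \<open>H\<close>: as the \<open>L\<^sup>2\<close> limit of the integrals of
  simple integrands converging to \<open>H\<close>. By the Ito isometry the choice of the approximating
  sequence is immaterial, so \<open>I\<close> is unique up to indistinguishability.\<close>

definition is_ito_integral ::
    "'w measure \<Rightarrow> (real \<Rightarrow> 'w measure) \<Rightarrow> (real \<Rightarrow> 'w \<Rightarrow> real) \<Rightarrow> real \<Rightarrow> real \<Rightarrow>
     (real \<Rightarrow> 'w \<Rightarrow> real) \<Rightarrow> (real \<Rightarrow> 'w \<Rightarrow> real) \<Rightarrow> bool" where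
  "is_ito_integral M F B s T H I \<longleftrightarrow>
     progressively_measurable F s T H \<and> square_integrable_process M s T H \<and>
     (\<forall>t\<in>{s..T}. I t \<in> borel_measurable M) \<and>
     (AE \<omega> in M. continuous_on {s..T} (\<lambda>t. I t \<omega>)) \<and>
     (\<exists>n p \<xi>. (\<forall>k::nat. simple_integrand M F s T (n k) (p k) (\<xi> k)) \<and>
        (\<lambda>k. \<integral>\<^sup>+\<omega>. (\<integral>\<^sup>+\<tau>\<in>{s..T}.
            ennreal ((H \<tau> \<omega> - simple_process (n k) (p k) (\<xi> k) \<tau> \<omega>)\<^sup>2) \<partial>lborel) \<partial>M)
          \<longlonglongrightarrow> 0 \<and>
        (\<forall>t\<in>{s..T}.
          (\<lambda>k. \<integral>\<^sup>+\<omega>. ennreal ((I t \<omega> - simple_integral B (n k) (p k) (\<xi> k) t \<omega>)\<^sup>2) \<partial>M)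
            \<longlonglongrightarrow> 0))"

section \<open>The control problem\<close>

text \<open>Controls are pairs \<open>u = (\<pi>, q)\<close>: the amount invested in the risky asset and the
  retained proportion of claims.\<close>

definition admissible_controls ::
    "'w measure \<Rightarrow> (real \<Rightarrow> 'w measure) \<Rightarrow> real \<Rightarrow> real \<Rightarrow> (real \<Rightarrow> 'w \<Rightarrow> real \<times> real) set" where
  "admissible_controls M F s T =
     {u. progressively_measurable F s T u \<and>
         (\<forall>t\<in>{s..T}. \<forall>\<omega>\<in>space M. u t \<omega> \<in> {0..} \<times> {0..}) \<and>
         square_integrable_process M s T (\<lambda>t \<omega>. fst (u t \<omega>)) \<and>
         square_integrable_process M s T (\<lambda>t \<omega>. snd (u t \<omega>))}"

text \<open>\<open>state_process M F W s T f \<beta>\<^sub>0 \<beta>\<^sub>1 y u x\<close>: on the interval from s to T, the process \<open>x\<close> is a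
  (strong) solution of
  \<open>dx = f(x, u) dt + \<beta>\<^sub>0(u) dW\<^sup>0 + \<beta>\<^sub>1(u) dW\<^sup>1\<close> with \<open>x(s) = y\<close>.\<close>

definition state_process ::
    "'w measure \<Rightarrow> (real \<Rightarrow> 'w measure) \<Rightarrow> (nat \<Rightarrow> real \<Rightarrow> 'w \<Rightarrow> real) \<Rightarrow> real \<Rightarrow> real \<Rightarrow>
     (real \<Rightarrow> real \<times> real \<Rightarrow> real) \<Rightarrow> (real \<times> real \<Rightarrow> real) \<Rightarrow> (real \<times> real \<Rightarrow> real) \<Rightarrow>
     real \<Rightarrow> (real \<Rightarrow> 'w \<Rightarrow> real \<times> real) \<Rightarrow> (real \<Rightarrow> 'w \<Rightarrow> real) \<Rightarrow> bool" where
  "state_process M F W s T f \<beta>\<^sub>0 \<beta>\<^sub>1 y u x \<longleftrightarrow>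
     (\<forall>t\<in>{s..T}. x t \<in> borel_measurable (F t)) \<and>
     (AE \<omega> in M. continuous_on {s..T} (\<lambda>t. x t \<omega>)) \<and>
     (\<exists>I\<^sub>0 I\<^sub>1.
        is_ito_integral M F (W 0) s T (\<lambda>t \<omega>. \<beta>\<^sub>0 (u t \<omega>)) I\<^sub>0 \<and>
        is_ito_integral M F (W 1) s T (\<lambda>t \<omega>. \<beta>\<^sub>1 (u t \<omega>)) I\<^sub>1 \<and>
        (AE \<omega> in M. set_integrable lborel {s..T} (\<lambda>\<tau>. f (x \<tau> \<omega>) (u \<tau> \<omega>)) \<and>
           (\<forall>t\<in>{s..T}.
              x t \<omega> = y + (LINT \<tau>:{s..t}|lborel. f (x \<tau> \<omega>) (u \<tau> \<omega>)) + I\<^sub>0 t \<omega> + I\<^sub>1 t \<omega>)))"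

text \<open>For admissible controls \<open>x(T)\<close> is automatically square-integrable, so the Bochner
  integral below is the genuine expectation and the set in the value function consists of
  genuine costs (bounded below by 0).\<close>

definition terminal_cost :: "'w measure \<Rightarrow> real \<Rightarrow> (real \<Rightarrow> 'w \<Rightarrow> real) \<Rightarrow> real" where
  "terminal_cost M T x = 1/2 * (\<integral>\<omega>. (x T \<omega>)\<^sup>2 \<partial>M)"

definition value_function ::
    "'w measure \<Rightarrow> (real \<Rightarrow> 'w measure) \<Rightarrow> (nat \<Rightarrow> real \<Rightarrow> 'w \<Rightarrow> real) \<Rightarrow> real \<Rightarrow>
     (real \<Rightarrow> real \<times> real \<Rightarrow> real) \<Rightarrow> (real \<times> real \<Rightarrow> real) \<Rightarrow> (real \<times> real \<Rightarrow> real) \<Rightarrow>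
     real \<Rightarrow> real \<Rightarrow> real" where
  "value_function M F W T f \<beta>\<^sub>0 \<beta>\<^sub>1 s y =
     Inf {terminal_cost M T x | u x.
            u \<in> admissible_controls M F s T \<and> state_process M F W s T f \<beta>\<^sub>0 \<beta>\<^sub>1 y u x}"

text \<open>Closed-loop state: \<open>x\<close> is the state process of the admissible control
  \<open>t \<mapsto> \<phi>(t, x(t))\<close>.\<close>

definition closed_loop_state ::
    "'w measure \<Rightarrow> (real \<Rightarrow> 'w measure) \<Rightarrow> (nat \<Rightarrow> real \<Rightarrow> 'w \<Rightarrow> real) \<Rightarrow> real \<Rightarrow> real \<Rightarrow>
     (real \<Rightarrow> real \<times> real \<Rightarrow> real) \<Rightarrow> (real \<times> real \<Rightarrow> real) \<Rightarrow> (real \<times> real \<Rightarrow> real) \<Rightarrow>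
     real \<Rightarrow> (real \<Rightarrow> real \<Rightarrow> real \<times> real) \<Rightarrow> (real \<Rightarrow> 'w \<Rightarrow> real) \<Rightarrow> bool" where
  "closed_loop_state M F W s T f \<beta>\<^sub>0 \<beta>\<^sub>1 y \<phi> x \<longleftrightarrow>
     (\<lambda>t \<omega>. \<phi> t (x t \<omega>)) \<in> admissible_controls M F s T \<and>
     state_process M F W s T f \<beta>\<^sub>0 \<beta>\<^sub>1 y (\<lambda>t \<omega>. \<phi> t (x t \<omega>)) x"

text \<open>The first conjunct prevents the second from holding vacuously.\<close>

definition optimal_feedback_control ::
    "'w measure \<Rightarrow> (real \<Rightarrow> 'w measure) \<Rightarrow> (nat \<Rightarrow> real \<Rightarrow> 'w \<Rightarrow> real) \<Rightarrow> real \<Rightarrow>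
     (real \<Rightarrow> real \<times> real \<Rightarrow> real) \<Rightarrow> (real \<times> real \<Rightarrow> real) \<Rightarrow> (real \<times> real \<Rightarrow> real) \<Rightarrow>
     (real \<Rightarrow> real \<Rightarrow> real \<times> real) \<Rightarrow> bool" where
  "optimal_feedback_control M F W T f \<beta>\<^sub>0 \<beta>\<^sub>1 \<phi> \<longleftrightarrow>
     (\<forall>s\<in>{0..<T}. \<forall>y.
        (\<exists>x. closed_loop_state M F W s T f \<beta>\<^sub>0 \<beta>\<^sub>1 y \<phi> x) \<and>
        (\<forall>x. closed_loop_state M F W s T f \<beta>\<^sub>0 \<beta>\<^sub>1 y \<phi> x \<longrightarrow>
           terminal_cost M T x = value_function M F W T f \<beta>\<^sub>0 \<beta>\<^sub>1 s y))"

section \<open>Viscosity solutions\<close>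

text \<open>\<open>\<phi>\<close> is of class \<open>C\<^sup>1\<^sup>,\<^sup>2\<close> on \<open>[0,T] \<times> \<real>\<close> with the partial derivatives
  \<open>\<phi>t\<close>, \<open>\<phi>x\<close>, \<open>\<phi>xx\<close>; time derivatives are one-sided at 0 and T.\<close>

definition C12_on ::
    "real \<Rightarrow> (real \<Rightarrow> real \<Rightarrow> real) \<Rightarrow> (real \<Rightarrow> real \<Rightarrow> real) \<Rightarrow> (real \<Rightarrow> real \<Rightarrow> real) \<Rightarrow>
     (real \<Rightarrow> real \<Rightarrow> real) \<Rightarrow> bool" where
  "C12_on T \<phi> \<phi>t \<phi>x \<phi>xx \<longleftrightarrow>
     (\<forall>t\<in>{0..T}. \<forall>x.
        ((\<lambda>\<tau>. \<phi> \<tau> x) has_real_derivative \<phi>t t x) (at t within {0..T}) \<and>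
        ((\<lambda>z. \<phi> t z) has_real_derivative \<phi>x t x) (at x) \<and>
        ((\<lambda>z. \<phi>x t z) has_real_derivative \<phi>xx t x) (at x)) \<and>
     (\<forall>h\<in>{\<phi>, \<phi>t, \<phi>x, \<phi>xx}. continuous_on ({0..T} \<times> UNIV) (\<lambda>(t, x). h t x))"

definition local_max_on ::
    "real \<Rightarrow> (real \<Rightarrow> real \<Rightarrow> real) \<Rightarrow> real \<Rightarrow> real \<Rightarrow> bool" where
  "local_max_on T h t x \<longleftrightarrow>
     (\<forall>\<^sub>F z in at (t, x) within {0..T} \<times> UNIV. h (fst z) (snd z) \<le> h t x)"

definition local_min_on ::
    "real \<Rightarrow> (real \<Rightarrow> real \<Rightarrow> real) \<Rightarrow> real \<Rightarrow> real \<Rightarrow> bool" where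
  "local_min_on T h t x \<longleftrightarrow>
     (\<forall>\<^sub>F z in at (t, x) within {0..T} \<times> UNIV. h t x \<le> h (fst z) (snd z))"

text \<open>The equation is \<open>v\<^sub>t + inf\<^sub>u G(t, x, u, v\<^sub>x, v\<^sub>x\<^sub>x) = 0\<close> with terminal value \<open>g\<close>.
  The infimum is taken in the extended reals, since it is \<open>-\<infinity>\<close> at test
  functions along which \<open>G\<close> is unbounded below in \<open>u\<close>, e.g. for a negative second derivative.\<close>

definition inf_hamiltonian ::
    "(real \<Rightarrow> real \<Rightarrow> real \<times> real \<Rightarrow> real \<Rightarrow> real \<Rightarrow> real) \<Rightarrow>
     real \<Rightarrow> real \<Rightarrow> real \<Rightarrow> real \<Rightarrow> ereal" where
  "inf_hamiltonian G t x p P = (INF u\<in>{0..} \<times> {0..}. ereal (G t x u p P))"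

definition viscosity_subsolution ::
    "real \<Rightarrow> (real \<Rightarrow> real \<Rightarrow> real \<times> real \<Rightarrow> real \<Rightarrow> real \<Rightarrow> real) \<Rightarrow> (real \<Rightarrow> real) \<Rightarrow>
     (real \<Rightarrow> real \<Rightarrow> real) \<Rightarrow> bool" where
  "viscosity_subsolution T G g V \<longleftrightarrow>
     continuous_on ({0..T} \<times> UNIV) (\<lambda>(t, x). V t x) \<and> (\<forall>x. V T x = g x) \<and>
     (\<forall>\<phi> \<phi>t \<phi>x \<phi>xx. C12_on T \<phi> \<phi>t \<phi>x \<phi>xx \<longrightarrow>
        (\<forall>t\<in>{0..<T}. \<forall>x. local_max_on T (\<lambda>t x. V t x - \<phi> t x) t x \<longrightarrow>
           ereal (\<phi>t t x) + inf_hamiltonian G t x (\<phi>x t x) (\<phi>xx t x) \<ge> 0))"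

definition viscosity_supersolution ::
    "real \<Rightarrow> (real \<Rightarrow> real \<Rightarrow> real \<times> real \<Rightarrow> real \<Rightarrow> real \<Rightarrow> real) \<Rightarrow> (real \<Rightarrow> real) \<Rightarrow>
     (real \<Rightarrow> real \<Rightarrow> real) \<Rightarrow> bool" where
  "viscosity_supersolution T G g V \<longleftrightarrow>
     continuous_on ({0..T} \<times> UNIV) (\<lambda>(t, x). V t x) \<and> (\<forall>x. V T x = g x) \<and>
     (\<forall>\<phi> \<phi>t \<phi>x \<phi>xx. C12_on T \<phi> \<phi>t \<phi>x \<phi>xx \<longrightarrow>
        (\<forall>t\<in>{0..<T}. \<forall>x. local_min_on T (\<lambda>t x. V t x - \<phi> t x) t x \<longrightarrow>
           ereal (\<phi>t t x) + inf_hamiltonian G t x (\<phi>x t x) (\<phi>xx t x) \<le> 0))"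

definition viscosity_solution ::
    "real \<Rightarrow> (real \<Rightarrow> real \<Rightarrow> real \<times> real \<Rightarrow> real \<Rightarrow> real \<Rightarrow> real) \<Rightarrow> (real \<Rightarrow> real) \<Rightarrow>
     (real \<Rightarrow> real \<Rightarrow> real) \<Rightarrow> bool" where
  "viscosity_solution T G g V \<longleftrightarrow> viscosity_subsolution T G g V \<and> viscosity_supersolution T G g V"

end

theory Submission
  imports Defs
begin

text \<open>Put \<open>z = x + g1(t) exp(- r (T - t))\<close>, so that \<open>w = exp(r (T - t)) z\<close> equals \<open>x\<close> at time \<open>T\<close> and
  the zero control leaves \<open>w\<close> constant. A control \<open>u\<close> adds to the drift of the state the amount
  \<open>\<lambda>0 vol0(u) + \<lambda>1 vol1(u) \<ge> 0\<close>, where \<open>\<lambda>0 = a \<eta> / b\<close>, \<open>\<lambda>1 = (\<mu> - r) / \<sigma>\<close> and \<open>vol0\<close>, \<open>vol1\<close> are the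
  diffusion coefficients. Hence \<open>E x(T) \<ge> w(s)\<close>, which gives the lower bound for \<open>w(s) \<ge> 0\<close>. If \<open>Z\<close>
  denotes the exponential density with parameters \<open>\<lambda>0\<close>, \<open>\<lambda>1\<close>, then \<open>E[Z x(T)] = w(s)\<close> for every
  control, and Cauchy-Schwarz with \<open>E Z\<^sup>2 = exp((\<lambda>0\<^sup>2 + \<lambda>1\<^sup>2) (T - s))\<close> gives the lower bound for
  \<open>w(s) < 0\<close>. Equality holds for the zero control and for a terminal state proportional to \<open>Z\<close>,
  respectively; the latter is reached by the feedback control, along which \<open>z\<close> is a geometric Brownian
  motion. The duality \<open>E[Z\<^sub>\<tau> \<integral> H dW\<^sub>i] = - \<lambda>i E[Z\<^sub>\<tau> \<integral> H d\<tau>]\<close> and the Ito isometry replace the Ito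
  formula throughout. Any two closed-loop states agree at time \<open>T\<close> by a Gronwall argument for the
  mean square distance of their negative parts. The value function is \<open>C\<^sup>1\<close> and fails to be \<open>C\<^sup>2\<close> only
  where \<open>z = 0\<close>; there it is nonnegative and vanishes, so that a test function touching it from above
  is convex to second order.\<close>

section \<open>Square-integrable functions\<close>

text \<open>The filtration is generated by the motions and is not completed by null sets, while Ito
  integrals are determined only up to null sets; controls and states must nevertheless be adapted
  exactly. The optimal state is therefore not obtained from a fixed point argument: it is written
  down as an explicit functional of the paths, and its equation is verified afterwards. Optimality
  asks for a closed-loop state to exist and for all of them to have minimal cost; hence an existence
  theorem for particular Ito integrals and a uniqueness theorem are both needed. The definition of
  the Ito integral offers only L2 limits of simple integrals, one time at a time. Hence the
  arguments are phrased through inner products, which pass to such limits. Lower bounds by duality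
  also avoid a verification argument, which would call for second derivatives that the value
  function lacks. The assumption \<open>\<mu> \<ge> r\<close> makes the excess drift of an
  admissible control nonnegative and the feedback itself admissible. The constant \<open>A1\<close>
  is minus one half of the exponential rate at which the second moment of the density grows.\<close>

definition L2 :: "'a measure \<Rightarrow> ('a \<Rightarrow> real) \<Rightarrow> bool" where
  "L2 N f \<longleftrightarrow> f \<in> borel_measurable N \<and> integrable N (\<lambda>x. (f x)\<^sup>2)"

text \<open>Convergence is measured by a nonnegative integral, as in the definition of the Ito
  integral, so that it can be stated before the limit is known to be square integrable;
  \<open>L2_lim_L2\<close> then yields that.\<close>

definition L2_lim :: "'a measure \<Rightarrow> (nat \<Rightarrow> 'a \<Rightarrow> real) \<Rightarrow> ('a \<Rightarrow> real) \<Rightarrow> bool" where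
  "L2_lim N fk f \<longleftrightarrow> (\<lambda>k. \<integral>\<^sup>+x. ennreal ((f x - fk k x)\<^sup>2) \<partial>N) \<longlonglongrightarrow> 0"

lemma L2_meas: "L2 N f \<Longrightarrow> f \<in> borel_measurable N"
  by (simp add: L2_def)

lemma L2_sq: "L2 N f \<Longrightarrow> integrable N (\<lambda>x. (f x)\<^sup>2)"
  by (simp add: L2_def)

lemma L2_iff_nn:
  "L2 N f \<longleftrightarrow> f \<in> borel_measurable N \<and> (\<integral>\<^sup>+x. ennreal ((f x)\<^sup>2) \<partial>N) < \<infinity>"
  unfolding L2_def by (auto simp: integrable_iff_bounded)

lemma L2_nn: "L2 N f \<Longrightarrow> (\<integral>\<^sup>+x. ennreal ((f x)\<^sup>2) \<partial>N) = ennreal (\<integral>x. (f x)\<^sup>2 \<partial>N)"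
  by (intro nn_integral_eq_integral) (auto simp: L2_def)

lemma L2_mult:
  assumes "L2 N f" "L2 N g" shows "integrable N (\<lambda>x. f x * g x)"
proof (rule Bochner_Integration.integrable_bound)
  show "integrable N (\<lambda>x. (f x)\<^sup>2 + (g x)\<^sup>2)" using assms by (auto simp: L2_def)
  show "(\<lambda>x. f x * g x) \<in> borel_measurable N" using assms by (auto simp: L2_def)
  have "\<bar>u * v\<bar> \<le> u\<^sup>2 + v\<^sup>2" for u v :: real
  proof -
    have "0 \<le> \<bar>u\<bar> * \<bar>v\<bar>" by simp
    moreover have "2 * (\<bar>u\<bar> * \<bar>v\<bar>) \<le> u\<^sup>2 + v\<^sup>2"
      using sum_squares_bound[of "\<bar>u\<bar>" "\<bar>v\<bar>"] by (simp add: mult.assoc)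
    ultimately show ?thesis unfolding abs_mult by linarith
  qed
  then show "AE x in N. norm (f x * g x) \<le> norm ((f x)\<^sup>2 + (g x)\<^sup>2)"
    by (auto simp: order_trans[OF _ abs_ge_self])
qed

lemma L2_add: assumes "L2 N f" "L2 N g" shows "L2 N (\<lambda>x. f x + g x)"
proof -
  have "integrable N (\<lambda>x. (f x)\<^sup>2 + (g x)\<^sup>2 + 2 * (f x * g x))"
    using assms L2_mult[OF assms] by (auto simp: L2_def)
  then show ?thesis using assms by (auto simp: L2_def power2_sum algebra_simps)
qed

lemma L2_cmult: "L2 N f \<Longrightarrow> L2 N (\<lambda>x. c * f x)"
  by (auto simp: L2_def power_mult_distrib)

lemma L2_uminus: "L2 N f \<Longrightarrow> L2 N (\<lambda>x. - f x)"
  by (auto simp: L2_def)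

lemma L2_diff: "L2 N f \<Longrightarrow> L2 N g \<Longrightarrow> L2 N (\<lambda>x. f x - g x)"
  using L2_add[of N f "\<lambda>x. - g x"] L2_uminus[of N g] by simp

lemma L2_sum: "(\<And>i. i \<in> A \<Longrightarrow> L2 N (f i)) \<Longrightarrow> L2 N (\<lambda>x. \<Sum>i\<in>A. f i x)"
proof (induction A rule: infinite_finite_induct)
  case (insert x F)
  then show ?case using L2_add[of N "f x" "\<lambda>y. \<Sum>i\<in>F. f i y"] by simp
qed (auto simp: L2_def)

lemma L2_cong_AE:
  assumes "L2 N f" "AE x in N. f x = g x" "g \<in> borel_measurable N" shows "L2 N g"
proof -
  have "integrable N (\<lambda>x. (f x)\<^sup>2) = integrable N (\<lambda>x. (g x)\<^sup>2)"
    by (rule integrable_cong_AE) (use assms in \<open>auto simp: L2_def\<close>)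
  then show ?thesis using assms by (auto simp: L2_def)
qed

lemma L2_bound:
  assumes "L2 N f" "g \<in> borel_measurable N" "AE x in N. \<bar>g x\<bar> \<le> \<bar>f x\<bar>" shows "L2 N g"
proof -
  have "integrable N (\<lambda>x. (g x)\<^sup>2)"
    by (rule Bochner_Integration.integrable_bound[of _ "\<lambda>x. (f x)\<^sup>2"])
      (use assms in \<open>auto simp: L2_def abs_le_square_iff elim!: eventually_mono\<close>)
  then show ?thesis using assms by (auto simp: L2_def)
qed

lemma (in finite_measure) L2_const: "L2 M (\<lambda>x. c)"
  by (auto simp: L2_def)

lemma (in finite_measure) L2_integrable: "L2 M f \<Longrightarrow> integrable M f"
  by (auto simp: L2_def intro: square_integrable_imp_integrable)

lemma L2_Cauchy_Schwarz:
  assumes "L2 N f" "L2 N g"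
  shows "(\<integral>x. f x * g x \<partial>N)\<^sup>2 \<le> (\<integral>x. (f x)\<^sup>2 \<partial>N) * (\<integral>x. (g x)\<^sup>2 \<partial>N)"
proof -
  let ?a = "\<integral>x. (f x)\<^sup>2 \<partial>N" and ?b = "\<integral>x. f x * g x \<partial>N" and ?c = "\<integral>x. (g x)\<^sup>2 \<partial>N"
  have ineq: "0 \<le> ?a - 2 * t * ?b + t\<^sup>2 * ?c" for t
  proof -
    have "0 \<le> (\<integral>x. (f x - t * g x)\<^sup>2 \<partial>N)" by simp
    also have "\<dots> = (\<integral>x. (f x)\<^sup>2 - 2 * t * (f x * g x) + t\<^sup>2 * (g x)\<^sup>2 \<partial>N)"
      by (simp add: power2_diff power_mult_distrib algebra_simps)
    also have "\<dots> = ?a - 2 * t * ?b + t\<^sup>2 * ?c"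
      using assms L2_mult[OF assms] by (simp add: L2_def)
    finally show ?thesis .
  qed
  have c: "?c \<ge> 0" by simp
  show ?thesis
  proof (cases "?c = 0")
    case True
    have "?b = 0"
    proof (rule ccontr)
      assume "?b \<noteq> 0"
      \<comment> \<open>With \<open>?c = 0\<close> the quadratic is affine in \<open>t\<close>; at
        this \<open>t\<close> it takes the value -1.\<close>
      then show False using ineq[of "(?a + 1) / (2 * ?b)"] True by (simp add: field_simps)
    qed
    then show ?thesis using True by simp
  next
    case False
    then have c: "?c > 0" using c by linarith
    \<comment> \<open>\<open>?b / ?c\<close> is the minimiser of the quadratic.\<close>
    have "0 \<le> ?a - 2 * (?b / ?c) * ?b + (?b / ?c)\<^sup>2 * ?c" by (rule ineq)
    also have "\<dots> = ?a - ?b\<^sup>2 / ?c" using False by (simp add: field_simps power2_eq_square)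
    finally show ?thesis using c by (simp add: field_simps)
  qed
qed

section \<open>Limits in L2 and continuity of the inner product\<close>

lemma L2_lim_iff:
  assumes "\<And>k. L2 N (fk k)" "L2 N f"
  shows "L2_lim N fk f \<longleftrightarrow> (\<lambda>k. \<integral>x. (f x - fk k x)\<^sup>2 \<partial>N) \<longlonglongrightarrow> 0"
proof -
  have "(\<integral>\<^sup>+x. ennreal ((f x - fk k x)\<^sup>2) \<partial>N) = ennreal (\<integral>x. (f x - fk k x)\<^sup>2 \<partial>N)" for k
    by (rule L2_nn) (intro L2_diff assms)
  then have "L2_lim N fk f \<longleftrightarrow> (\<lambda>k. ennreal (\<integral>x. (f x - fk k x)\<^sup>2 \<partial>N)) \<longlonglongrightarrow> ennreal 0"
    by (simp add: L2_lim_def)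
  also have "\<dots> \<longleftrightarrow> (\<lambda>k. \<integral>x. (f x - fk k x)\<^sup>2 \<partial>N) \<longlonglongrightarrow> 0"
    by (rule tendsto_ennreal_iff) auto
  finally show ?thesis .
qed

lemma L2_lim_L2:
  assumes "\<And>k. L2 N (fk k)" "f \<in> borel_measurable N" "L2_lim N fk f"
  shows "L2 N f"
proof -
  \<comment> \<open>One approximant at squared distance below 1 suffices: the limit is that
    approximant plus a square-integrable difference.\<close>
  have "eventually (\<lambda>k. (\<integral>\<^sup>+x. ennreal ((f x - fk k x)\<^sup>2) \<partial>N) < 1) sequentially"
    using assms(3) unfolding L2_lim_def by (rule order_tendstoD) simp
  then obtain k where k: "(\<integral>\<^sup>+x. ennreal ((f x - fk k x)\<^sup>2) \<partial>N) < 1"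
    by (auto simp: eventually_sequentially)
  have "L2 N (\<lambda>x. f x - fk k x)" unfolding L2_iff_nn
    using assms(1)[of k] assms(2) less_trans[OF k, of \<infinity>] by (auto simp: L2_def)
  from L2_add[OF this assms(1)[of k]] show ?thesis by simp
qed

lemma L2_lim_mult_null:
  assumes "\<And>k. L2 N (fk k)" "L2 N g" "(\<lambda>k. \<integral>x. (fk k x)\<^sup>2 \<partial>N) \<longlonglongrightarrow> 0"
  shows "(\<lambda>k. \<integral>x. fk k x * g x \<partial>N) \<longlonglongrightarrow> 0"
proof -
  have "(\<lambda>k. (\<integral>x. fk k x * g x \<partial>N)\<^sup>2) \<longlonglongrightarrow> 0"
  proof (rule tendsto_sandwich[OF _ _ tendsto_const])
    show "\<forall>\<^sub>F k in sequentially. (\<integral>x. fk k x * g x \<partial>N)\<^sup>2 \<le> (\<integral>x. (fk k x)\<^sup>2 \<partial>N) * (\<integral>x. (g x)\<^sup>2 \<partial>N)"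
      using L2_Cauchy_Schwarz assms by (intro always_eventually) blast
    show "(\<lambda>k. (\<integral>x. (fk k x)\<^sup>2 \<partial>N) * (\<integral>x. (g x)\<^sup>2 \<partial>N)) \<longlonglongrightarrow> 0"
      by (rule tendsto_mult_left_zero[OF assms(3)])
  qed simp
  then show ?thesis using tendsto_real_sqrt[of _ 0] by (fastforce simp: tendsto_rabs_zero_iff)
qed

text \<open>Isometry and duality are proved for simple integrands; joint continuity of the inner
  product carries them over to general ones.\<close>

lemma L2_lim_inner:
  assumes fk: "\<And>k. L2 N (fk k)" and gk: "\<And>k. L2 N (gk k)" and f: "L2 N f" and g: "L2 N g"
    and "L2_lim N fk f" "L2_lim N gk g"
  shows "(\<lambda>k. \<integral>x. fk k x * gk k x \<partial>N) \<longlonglongrightarrow> (\<integral>x. f x * g x \<partial>N)"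
proof -
  have df: "L2 N (\<lambda>x. f x - fk k x)" and dg: "L2 N (\<lambda>x. g x - gk k x)" for k
    by (intro L2_diff assms)+
  have nf: "(\<lambda>k. \<integral>x. (f x - fk k x)\<^sup>2 \<partial>N) \<longlonglongrightarrow> 0" and ng: "(\<lambda>k. \<integral>x. (g x - gk k x)\<^sup>2 \<partial>N) \<longlonglongrightarrow> 0"
    using assms by (simp_all add: L2_lim_iff)
  have 1: "(\<lambda>k. \<integral>x. (f x - fk k x) * g x \<partial>N) \<longlonglongrightarrow> 0" by (rule L2_lim_mult_null[OF df g nf])
  have 2: "(\<lambda>k. \<integral>x. (g x - gk k x) * f x \<partial>N) \<longlonglongrightarrow> 0" by (rule L2_lim_mult_null[OF dg f ng])
  have 3: "(\<lambda>k. \<integral>x. (f x - fk k x) * (g x - gk k x) \<partial>N) \<longlonglongrightarrow> 0"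
  proof -
    have "(\<lambda>k. (\<integral>x. (f x - fk k x) * (g x - gk k x) \<partial>N)\<^sup>2) \<longlonglongrightarrow> 0"
    proof (rule tendsto_sandwich[OF _ _ tendsto_const])
      show "\<forall>\<^sub>F k in sequentially. (\<integral>x. (f x - fk k x) * (g x - gk k x) \<partial>N)\<^sup>2
          \<le> (\<integral>x. (f x - fk k x)\<^sup>2 \<partial>N) * (\<integral>x. (g x - gk k x)\<^sup>2 \<partial>N)"
        using L2_Cauchy_Schwarz[OF df dg] by (intro always_eventually) blast
      show "(\<lambda>k. (\<integral>x. (f x - fk k x)\<^sup>2 \<partial>N) * (\<integral>x. (g x - gk k x)\<^sup>2 \<partial>N)) \<longlonglongrightarrow> 0"
        using tendsto_mult[OF nf ng] by simp
    qed simp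
    then show ?thesis using tendsto_real_sqrt[of _ 0] by (fastforce simp: tendsto_rabs_zero_iff)
  qed
  \<comment> \<open>Expansion around the limits: the two linear errors and the product of the errors
    each tend to zero by Cauchy-Schwarz.\<close>
  have "(\<integral>x. fk k x * gk k x \<partial>N) = (\<integral>x. f x * g x \<partial>N) - (\<integral>x. (f x - fk k x) * g x \<partial>N)
      - (\<integral>x. (g x - gk k x) * f x \<partial>N) + (\<integral>x. (f x - fk k x) * (g x - gk k x) \<partial>N)" for k
  proof -
    have i: "integrable N (\<lambda>x. f x * g x)" "integrable N (\<lambda>x. (f x - fk k x) * g x)"
       "integrable N (\<lambda>x. (g x - gk k x) * f x)" "integrable N (\<lambda>x. (f x - fk k x) * (g x - gk k x))"
      using L2_mult f g df dg by blast+
    have "(\<integral>x. fk k x * gk k x \<partial>N) = (\<integral>x. f x * g x - (f x - fk k x) * g x - (g x - gk k x) * f x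
       + (f x - fk k x) * (g x - gk k x) \<partial>N)"
      by (intro Bochner_Integration.integral_cong) (auto simp: algebra_simps)
    also have "\<dots> = (\<integral>x. f x * g x \<partial>N) - (\<integral>x. (f x - fk k x) * g x \<partial>N)
      - (\<integral>x. (g x - gk k x) * f x \<partial>N) + (\<integral>x. (f x - fk k x) * (g x - gk k x) \<partial>N)"
      by (simp only: Bochner_Integration.integral_add Bochner_Integration.integral_diff i
          Bochner_Integration.integrable_diff Bochner_Integration.integrable_add)
    finally show ?thesis .
  qed
  then show ?thesis
    using tendsto_add[OF tendsto_diff[OF tendsto_diff[OF tendsto_const[of "\<integral>x. f x * g x \<partial>N"] 1] 2] 3] by simp
qed

lemma L2_lim_const: "L2_lim N (\<lambda>k. f) f"
  by (simp add: L2_lim_def)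

text \<open>Evaluating at grid points to the left gives a jointly measurable modification of a process with
  continuous paths that stays adapted to a filtration that need not be complete.\<close>

definition left_grid :: "real \<Rightarrow> nat \<Rightarrow> real \<Rightarrow> real" where
  "left_grid s k t = max s (real_of_int \<lfloor>real (Suc k) * t\<rfloor> / real (Suc k))"

definition grid_limit :: "real \<Rightarrow> (real \<Rightarrow> 'w \<Rightarrow> real) \<Rightarrow> real \<Rightarrow> 'w \<Rightarrow> real" where
  "grid_limit s X t \<omega> = lim (\<lambda>k. X (left_grid s k t) \<omega>)"

lemma left_grid_bounds: "s \<le> t \<Longrightarrow> s \<le> left_grid s k t \<and> left_grid s k t \<le> t"
  unfolding left_grid_def by (auto simp: divide_le_eq mult.commute)

lemma left_grid_tendsto:
  assumes "s \<le> t" shows "(\<lambda>k. left_grid s k t) \<longlonglongrightarrow> t"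
proof (rule tendsto_sandwich[of "\<lambda>k. t - 1 / real (Suc k)" _ _ "\<lambda>k. t"])
  have "t - 1 / real (Suc k) \<le> left_grid s k t" for k
  proof -
    have "real (Suc k) * t - 1 \<le> real_of_int \<lfloor>real (Suc k) * t\<rfloor>" by linarith
    then have "(real (Suc k) * t - 1) / real (Suc k) \<le> real_of_int \<lfloor>real (Suc k) * t\<rfloor> / real (Suc k)"
      by (rule divide_right_mono) simp
    moreover have "(real (Suc k) * t - 1) / real (Suc k) = t - 1 / real (Suc k)"
      by (simp add: diff_divide_distrib)
    ultimately show ?thesis unfolding left_grid_def by linarith
  qed
  then show "\<forall>\<^sub>F k in sequentially. t - 1 / real (Suc k) \<le> left_grid s k t" by simp
  show "\<forall>\<^sub>F k in sequentially. left_grid s k t \<le> t" using left_grid_bounds[OF assms] by simp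
  have "(\<lambda>k. t - 1 / real (Suc k)) \<longlonglongrightarrow> t - 0"
    by (intro tendsto_diff tendsto_const) (rule LIMSEQ_Suc[OF lim_1_over_n])
  then show "(\<lambda>k. t - 1 / real (Suc k)) \<longlonglongrightarrow> t" by simp
qed simp

lemma grid_limit_eq:
  assumes "continuous_on {s..t'} (\<lambda>t. X t \<omega>)" "t \<in> {s..t'}"
  shows "grid_limit s X t \<omega> = X t \<omega>"
proof -
  have "(\<lambda>k. X (left_grid s k t) \<omega>) \<longlonglongrightarrow> X t \<omega>"
    by (rule continuous_on_tendsto_compose[OF assms(1) left_grid_tendsto])
      (use assms(2) left_grid_bounds[of s t] in \<open>auto intro!: always_eventually intro: order_trans\<close>)
  then show ?thesis by (simp add: grid_limit_def limI)
qed

text \<open>Grid points lie to the left of \<open>\<tau>\<close>, so only values of \<open>X\<close>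
  up to time \<open>t\<close> enter; this is what gives progressive measurability when
  \<open>N\<close> is \<open>F t\<close>. Each approximant samples \<open>X\<close> at countably
  many times, selected by a floor.\<close>

lemma grid_limit_measurable:
  assumes X: "\<And>\<tau>. s \<le> \<tau> \<Longrightarrow> \<tau> \<le> t \<Longrightarrow> X \<tau> \<in> borel_measurable N"
  shows "(\<lambda>(\<tau>, \<omega>). grid_limit s X \<tau> \<omega>) \<in> borel_measurable (restrict_space borel {s..t} \<Otimes>\<^sub>M N)"
proof -
  have "(\<lambda>z. X (left_grid s k (fst z)) (snd z)) \<in> borel_measurable (restrict_space borel {s..t} \<Otimes>\<^sub>M N)" for k
  proof -
    \<comment> \<open>Clamping to \<open>{s..t}\<close> makes \<open>g j\<close> measurable for
      every integer \<open>j\<close>, also for those that no \<open>\<tau>\<close> in the interval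
      selects.\<close>
    define g where "g j \<omega> = X (min t (max s (real_of_int j / real (Suc k)))) \<omega>" for j :: int and \<omega>
    have "(\<lambda>z. g \<lfloor>real (Suc k) * fst z\<rfloor> (snd z)) \<in> borel_measurable (restrict_space borel {s..t} \<Otimes>\<^sub>M N)"
    proof (cases "s \<le> t")
      case True
      show ?thesis
      proof (rule measurable_compose_countable)
        have "(\<lambda>z. fst z) \<in> borel_measurable (restrict_space borel {s..t} \<Otimes>\<^sub>M N)"
          by (rule measurable_compose[OF measurable_fst]) (rule measurable_restrict_space1, simp)
        then show "(\<lambda>z. \<lfloor>real (Suc k) * fst z\<rfloor>) \<in> restrict_space borel {s..t} \<Otimes>\<^sub>M N \<rightarrow>\<^sub>M count_space UNIV"
          by measurable
        fix j have "g j \<in> borel_measurable N" unfolding g_def[abs_def] using True by (intro X) auto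
        then show "(\<lambda>x. g j (snd x)) \<in> borel_measurable (restrict_space borel {s..t} \<Otimes>\<^sub>M N)"
          by measurable
      qed
    next
      case False
      then have "space (restrict_space borel {s..t} \<Otimes>\<^sub>M N) = {}" by (simp add: space_pair_measure space_restrict_space)
      then show ?thesis by (simp add: measurable_def sets_eq_bot)
    qed
    moreover have "g \<lfloor>real (Suc k) * fst z\<rfloor> (snd z) = X (left_grid s k (fst z)) (snd z)"
      if "z \<in> space (restrict_space borel {s..t} \<Otimes>\<^sub>M N)" for z
    proof -
      have "s \<le> fst z" "fst z \<le> t" using that by (auto simp: space_pair_measure space_restrict_space)
      then show ?thesis using left_grid_bounds[of s "fst z" k]
        unfolding g_def left_grid_def by (simp add: min_absorb2)
    qed
    ultimately show ?thesis by (simp cong: measurable_cong)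
  qed
  then show ?thesis unfolding grid_limit_def case_prod_beta by (rule borel_measurable_lim_metric)
qed

text \<open>Variation of constants: with \<open>Y\<close> the integral of \<open>x\<close>, the
  function \<open>exp (r * (T - t)) * Y t\<close> has derivative
  \<open>exp (r * (T - t)) * h t\<close>, because \<open>x - r * Y = h\<close>. Applied path by
  path, it removes the unknown state from its own equation before anything is known about its
  moments.\<close>

lemma volterra_resolvent:
  fixes x h :: "real \<Rightarrow> real"
  assumes "s \<le> T" "continuous_on {s..T} x"
    and eq: "\<And>t. t \<in> {s..T} \<Longrightarrow> x t = h t + r * (LINT \<tau>:{s..t}|lborel. x \<tau>)"
  shows "x T = h T + r * (LINT \<tau>:{s..T}|lborel. exp (r * (T - \<tau>)) * h \<tau>)"
proof -
  define Y where "Y t = (LINT \<tau>:{s..t}|lborel. x \<tau>)" for t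
  have Yint: "Y t = integral {s..t} x" if "t \<in> {s..T}" for t
  proof -
    have "continuous_on {s..t} x" using assms(2) by (rule continuous_on_subset) (use that in auto)
    then have "set_integrable lborel {s..t} x" by (rule borel_integrable_atLeastAtMost')
    then show ?thesis unfolding Y_def by (rule set_borel_integral_eq_integral(2))
  qed
  have dY: "(Y has_real_derivative x t) (at t within {s..T})" if "t \<in> {s..T}" for t
  proof -
    have "((\<lambda>u. integral {s..u} x) has_vector_derivative x t) (at t within {s..T})"
      by (rule integral_has_vector_derivative[OF assms(2) that])
    then have "((\<lambda>u. integral {s..u} x) has_real_derivative x t) (at t within {s..T})"
      by (simp add: has_real_derivative_iff_has_vector_derivative)
    then show ?thesis using that by (rule has_field_derivative_transform_within[OF _ zero_less_one]) (auto simp: Yint)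
  qed
  have cY: "continuous_on {s..T} Y" using dY by (meson DERIV_continuous_on)
  \<comment> \<open>Continuity of \<open>h\<close> is read off the equation, since \<open>h\<close>
    is \<open>x - r * Y\<close> on the interval.\<close>
  have ch: "continuous_on {s..T} h"
  proof -
    have "continuous_on {s..T} (\<lambda>t. x t - r * Y t)" by (intro continuous_intros assms cY)
    then show ?thesis by (rule continuous_on_eq) (use eq in \<open>auto simp: Y_def\<close>)
  qed
  define w where "w t = exp (r * (T - t)) * Y t" for t
  have "((\<lambda>\<tau>. exp (r * (T - \<tau>)) * h \<tau>) has_integral (w T - w s)) {s..T}"
  proof (rule fundamental_theorem_of_calculus[OF assms(1)])
    fix t assume t: "t \<in> {s..T}"
    have "(w has_real_derivative exp (r * (T - t)) * x t + (- r * exp (r * (T - t))) * Y t) (at t within {s..T})"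
      unfolding w_def by (auto intro!: derivative_eq_intros dY[OF t])
    also have "exp (r * (T - t)) * x t + (- r * exp (r * (T - t))) * Y t = exp (r * (T - t)) * h t"
      using eq[OF t] by (simp add: Y_def algebra_simps)
    finally show "(w has_vector_derivative exp (r * (T - t)) * h t) (at t within {s..T})"
      by (simp add: has_real_derivative_iff_has_vector_derivative)
  qed
  moreover have "set_integrable lborel {s..T} (\<lambda>\<tau>. exp (r * (T - \<tau>)) * h \<tau>)"
    by (rule borel_integrable_atLeastAtMost') (intro continuous_intros ch)
  ultimately have "(LINT \<tau>:{s..T}|lborel. exp (r * (T - \<tau>)) * h \<tau>) = w T - w s"
    using set_borel_integral_eq_integral(2) integral_unique by metis
  moreover have "w s = 0" using Yint[of s] assms(1) by (simp add: w_def)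
  ultimately show ?thesis using eq[of T] assms(1) by (simp add: w_def Y_def)
qed

section \<open>Independence of the past and the increments\<close>

text \<open>The definition of Brownian motion provides independence only of finitely many successive
  increments. It is lifted to the sigma-algebra of the past by Dynkin's argument: cylinder events
  are stable under intersection and generate it, and on a suitable partition a cylinder event is, up
  to a null set, an event of the increments before time \<open>a\<close>.\<close>

lemma (in prob_space) brownian_past_increment_indep:
  assumes B: "brownian_motion M B" and ab: "0 \<le> a" "a \<le> b"
  shows "indep_set (sigma_sets (space M) {B \<tau> -` A \<inter> space M | \<tau> A. 0 \<le> \<tau> \<and> \<tau> \<le> a \<and> A \<in> sets borel})
     {(\<lambda>\<omega>. B b \<omega> - B a \<omega>) -` A \<inter> space M | A. A \<in> sets borel}"
proof -
  have Bm: "B t \<in> borel_measurable M" if "t \<ge> 0" for t using B that by (auto simp: brownian_motion_def)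
  have B0: "AE \<omega> in M. B 0 \<omega> = 0" using B by (auto simp: brownian_motion_def)
  define G where "G = {{\<omega>\<in>space M. \<forall>\<tau>\<in>S. B \<tau> \<omega> \<in> A \<tau>} | S A. finite S \<and> S \<subseteq> {0..a} \<and> (\<forall>\<tau>. A \<tau> \<in> sets (borel :: real measure))}"
  define D where "D = {(\<lambda>\<omega>. B b \<omega> - B a \<omega>) -` A \<inter> space M | A. A \<in> sets (borel :: real measure)}"
  have Gev: "G \<subseteq> events"
  proof
    fix E assume "E \<in> G"
    then obtain S A where E: "E = {\<omega>\<in>space M. \<forall>\<tau>\<in>S. B \<tau> \<omega> \<in> A \<tau>}" "finite S" "S \<subseteq> {0..a}" "\<And>\<tau>. A \<tau> \<in> sets (borel :: real measure)"
      unfolding G_def by blast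
    have "B \<tau> -` A \<tau> \<inter> space M \<in> events" if "\<tau> \<in> S" for \<tau>
      using E that by (intro measurable_sets[OF Bm]) auto
    then have "{\<omega>\<in>space M. B \<tau> \<omega> \<in> A \<tau>} \<in> events" if "\<tau> \<in> S" for \<tau>
      using that by (simp add: vimage_def Int_def conj_commute)
    then show "E \<in> events" unfolding E using E(2) by (rule sets.sets_Collect_finite_All)
  qed
  have Dev: "D \<subseteq> events"
    unfolding D_def using Bm ab by (auto intro!: measurable_sets[of _ M borel] borel_measurable_diff)
  have "indep_set G D"
    unfolding indep_sets2_eq
  proof (intro conjI Gev Dev ballI)
    fix E C assume "E \<in> G" "C \<in> D"
    then obtain S A A' where E: "E = {\<omega>\<in>space M. \<forall>\<tau>\<in>S. B \<tau> \<omega> \<in> A \<tau>}" "finite S" "S \<subseteq> {0..a}" "\<And>\<tau>. A \<tau> \<in> sets (borel :: real measure)"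
      and C: "C = (\<lambda>\<omega>. B b \<omega> - B a \<omega>) -` A' \<inter> space M" "A' \<in> sets borel"
      unfolding G_def D_def by blast
    \<comment> \<open>Inserting 0 lets values be recovered as sums of increments; inserting
      \<open>a\<close> makes the interval from \<open>a\<close> to \<open>b\<close> the last cell,
      with index \<open>n\<close>.\<close>
    define L where "L = sorted_list_of_set (insert 0 (insert a S))"
    have setL: "set L = insert 0 (insert a S)" and sL: "sorted L"
      using E(2) by (simp_all add: L_def del: sorted_list_of_set_insert_remove)
    have neL: "L \<noteq> []" using setL by auto
    define n where "n = length L - 1"
    have len: "length L = Suc n" using neL by (cases L) (auto simp: n_def)
    have inL: "L ! i \<in> {0..a}" if "i \<le> n" for i
      using nth_mem[of i L] that len setL E(3) ab by auto
    have L0: "L ! 0 = 0"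
    proof -
      obtain i where i: "i \<le> n" "L ! i = 0" using setL len by (metis in_set_conv_nth insertI1 less_Suc_eq_le)
      have "L ! 0 \<le> L ! i" using i len by (intro sorted_nth_mono[OF sL]) auto
      then show ?thesis using i inL[of 0] by auto
    qed
    have Ln: "L ! n = a"
    proof -
      obtain i where i: "i \<le> n" "L ! i = a" using setL len by (metis in_set_conv_nth insertI1 insertI2 less_Suc_eq_le)
      have "L ! i \<le> L ! n" using i len by (intro sorted_nth_mono[OF sL]) auto
      then show ?thesis using i inL[of n] by auto
    qed
    define p where "p i = (if i \<le> n then L ! i else b)" for i
    define V where "V i \<omega> = B (p (Suc i)) \<omega> - B (p i) \<omega>" for i \<omega>
    have "0 \<le> p 0 \<and> (\<forall>i<Suc n. p i \<le> p (Suc i))"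
      using L0 Ln ab len by (auto simp: p_def intro!: sorted_nth_mono[OF sL]) (metis le_antisym not_less_eq_eq less_Suc_eq_le)
    then have iv: "indep_vars (\<lambda>_. borel) V {..<Suc n}"
      using B unfolding brownian_motion_def V_def[abs_def] by blast
    have ivr: "indep_var (PiM {..<n} (\<lambda>_. borel)) (\<lambda>\<omega>. restrict (\<lambda>i. V i \<omega>) {..<n})
        (PiM {n} (\<lambda>_. borel)) (\<lambda>\<omega>. restrict (\<lambda>i. V i \<omega>) {n})"
      by (rule indep_var_restrict[OF iv]) auto
    have telescope: "(\<Sum>i<j. V i \<omega>) = B (L ! j) \<omega> - B 0 \<omega>" if "j \<le> n" for j \<omega>
      using that L0 by (induction j) (auto simp: V_def p_def)
    define idx where "idx \<tau> = (SOME j. j \<le> n \<and> L ! j = \<tau>)" for \<tau>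
    have idx: "idx \<tau> \<le> n \<and> L ! idx \<tau> = \<tau>" if "\<tau> \<in> S" for \<tau>
    proof -
      have "\<exists>j. j \<le> n \<and> L ! j = \<tau>" using setL that len by (metis in_set_conv_nth insertI2 less_Suc_eq_le)
      then show ?thesis unfolding idx_def by (rule someI_ex)
    qed
    define K where "K = {v \<in> space (PiM {..<n} (\<lambda>_. borel :: real measure)). \<forall>\<tau>\<in>S. (\<Sum>i<idx \<tau>. v i) \<in> A \<tau>}"
    have K: "K \<in> sets (PiM {..<n} (\<lambda>_. borel))"
      unfolding K_def
    proof (rule sets.sets_Collect_finite_All[OF _ E(2)])
      fix \<tau> assume \<tau>: "\<tau> \<in> S"
      have "(\<lambda>v. \<Sum>i<idx \<tau>. v i) \<in> borel_measurable (PiM {..<n} (\<lambda>_. borel :: real measure))"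
        using idx[OF \<tau>] by (intro borel_measurable_sum measurable_component_singleton) auto
      from measurable_sets[OF this E(4)[of \<tau>]]
      show "{v \<in> space (PiM {..<n} (\<lambda>_. borel)). (\<Sum>i<idx \<tau>. v i) \<in> A \<tau>} \<in> sets (PiM {..<n} (\<lambda>_. borel))"
        by (simp add: vimage_def Int_def conj_commute)
    qed
    \<comment> \<open>The same event for \<open>B \<tau> - B 0\<close>: it is a function of the
      increments, and it differs from \<open>E\<close> by a null set only, since \<open>B 0\<close>
      vanishes almost surely but perhaps not everywhere.\<close>
    define E' where "E' = (\<lambda>\<omega>. restrict (\<lambda>i. V i \<omega>) {..<n}) -` K \<inter> space M"
    have Vm: "(\<lambda>\<omega>. restrict (\<lambda>i. V i \<omega>) {..<n}) \<in> M \<rightarrow>\<^sub>M PiM {..<n} (\<lambda>_. borel)"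
      using ivr unfolding indep_var_eq by blast
    have E'ev: "E' \<in> events" unfolding E'_def by (rule measurable_sets[OF Vm K])
    have E'_eq: "E' = {\<omega>\<in>space M. \<forall>\<tau>\<in>S. B \<tau> \<omega> - B 0 \<omega> \<in> A \<tau>}"
    proof -
      have "(\<Sum>i<idx \<tau>. restrict (\<lambda>i. V i \<omega>) {..<n} i) = B \<tau> \<omega> - B 0 \<omega>" if "\<tau> \<in> S" for \<tau> \<omega>
      proof -
        have "(\<Sum>i<idx \<tau>. restrict (\<lambda>i. V i \<omega>) {..<n} i) = (\<Sum>i<idx \<tau>. V i \<omega>)"
          using idx[OF that] by (intro sum.cong) auto
        then show ?thesis using telescope[of "idx \<tau>" \<omega>] idx[OF that] by simp
      qed
      then show ?thesis unfolding E'_def K_def by (auto simp: space_PiM)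
    qed
    have CV: "C = (\<lambda>\<omega>. restrict (\<lambda>i. V i \<omega>) {n}) -` {v \<in> space (PiM {n} (\<lambda>_. borel)). v n \<in> A'} \<inter> space M"
      using Ln by (auto simp: C V_def p_def space_PiM)
    have "{v \<in> space (PiM {n} (\<lambda>_. borel)). v n \<in> A'} \<in> sets (PiM {n} (\<lambda>_. borel))"
    proof -
      have "(\<lambda>v. v n) \<in> borel_measurable (PiM {n} (\<lambda>_. borel :: real measure))"
        by (intro measurable_component_singleton) auto
      from measurable_sets[OF this C(2)] show ?thesis by (simp add: vimage_def Int_def conj_commute)
    qed
    with ivr K have "prob (E' \<inter> C) = prob E' * prob C"
      unfolding indep_var_eq indep_sets2_eq E'_def CV by (blast intro: sigma_sets.Basic)
    moreover have "AE \<omega> in M. \<omega> \<in> E \<longleftrightarrow> \<omega> \<in> E'"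
      using B0 by eventually_elim (auto simp: E'_eq E)
    moreover have "E \<in> events" "C \<in> events" using \<open>E \<in> G\<close> \<open>C \<in> D\<close> Gev Dev by auto
    moreover have "prob E = prob E'" by (rule finite_measure_eq_AE) (use calculation E'ev in auto)
    moreover have "prob (E \<inter> C) = prob (E' \<inter> C)"
    proof (rule finite_measure_eq_AE)
      show "AE x in M. (x \<in> E \<inter> C) = (x \<in> E' \<inter> C)" using calculation(2) by eventually_elim auto
    qed (use calculation E'ev in auto)
    ultimately show "prob (E \<inter> C) = prob E * prob C" by simp
  qed
  moreover have "Int_stable G"
    unfolding Int_stable_def
  proof (intro ballI)
    fix E E' assume "E \<in> G" "E' \<in> G"
    then obtain S A S' A' where E: "E = {\<omega>\<in>space M. \<forall>\<tau>\<in>S. B \<tau> \<omega> \<in> A \<tau>}" "finite S" "S \<subseteq> {0..a}" "\<And>\<tau>. A \<tau> \<in> sets (borel :: real measure)"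
      and E': "E' = {\<omega>\<in>space M. \<forall>\<tau>\<in>S'. B \<tau> \<omega> \<in> A' \<tau>}" "finite S'" "S' \<subseteq> {0..a}" "\<And>\<tau>. A' \<tau> \<in> sets (borel :: real measure)"
      unfolding G_def by blast
    \<comment> \<open>A time that occurs in only one of the two index sets gets the trivial
      constraint \<open>UNIV\<close> from the other.\<close>
    have "E \<inter> E' = {\<omega>\<in>space M. \<forall>\<tau>\<in>S \<union> S'. B \<tau> \<omega> \<in> (if \<tau> \<in> S then A \<tau> else UNIV) \<inter> (if \<tau> \<in> S' then A' \<tau> else UNIV)}"
      unfolding E E' by auto
    moreover have "\<And>\<tau>. (if \<tau> \<in> S then A \<tau> else UNIV) \<inter> (if \<tau> \<in> S' then A' \<tau> else UNIV) \<in> sets (borel :: real measure)"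
      using E(4) E'(4) by auto
    ultimately show "E \<inter> E' \<in> G" unfolding G_def using E(2,3) E'(2,3)
      by (intro CollectI exI[of _ "S \<union> S'"] exI[of _ "\<lambda>\<tau>. (if \<tau> \<in> S then A \<tau> else UNIV) \<inter> (if \<tau> \<in> S' then A' \<tau> else UNIV)"]) auto
  qed
  moreover have "Int_stable D"
    unfolding Int_stable_def D_def
  proof safe
    fix A A' :: "real set" assume "A \<in> sets borel" "A' \<in> sets borel"
    then show "\<exists>Aa. (\<lambda>\<omega>. B b \<omega> - B a \<omega>) -` A \<inter> space M \<inter> ((\<lambda>\<omega>. B b \<omega> - B a \<omega>) -` A' \<inter> space M)
        = (\<lambda>\<omega>. B b \<omega> - B a \<omega>) -` Aa \<inter> space M \<and> Aa \<in> sets borel"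
      by (intro exI[of _ "A \<inter> A'"]) auto
  qed
  ultimately have "indep_set (sigma_sets (space M) G) (sigma_sets (space M) D)"
    by (rule indep_set_sigma_sets)
  moreover have "{B \<tau> -` A \<inter> space M | \<tau> A. 0 \<le> \<tau> \<and> \<tau> \<le> a \<and> A \<in> sets borel} \<subseteq> G"
  proof safe
    fix \<tau> and A :: "real set" assume "0 \<le> \<tau>" "\<tau> \<le> a" "A \<in> sets borel"
    then show "B \<tau> -` A \<inter> space M \<in> G" unfolding G_def
      by (intro CollectI exI[of _ "{\<tau>}"] exI[of _ "\<lambda>_. A"]) auto
  qed
  then have "sigma_sets (space M) {B \<tau> -` A \<inter> space M | \<tau> A. 0 \<le> \<tau> \<and> \<tau> \<le> a \<and> A \<in> sets borel} \<subseteq> sigma_sets (space M) G"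
    by (rule sigma_sets_subseteq)
  moreover have "D \<subseteq> sigma_sets (space M) D" by auto
  ultimately show ?thesis unfolding indep_sets2_eq D_def[symmetric] by blast
qed

locale brownian_triple = prob_space M for M :: "'w measure" +
  fixes W :: "nat \<Rightarrow> real \<Rightarrow> 'w \<Rightarrow> real" and F :: "real \<Rightarrow> 'w measure"
  assumes bm: "i \<in> {0, 1, 2} \<Longrightarrow> brownian_motion M (W i)"
    and indep_W: "independent_processes M {0, 1, 2} W"
    and F_eq: "F = natural_filtration M {0, 1, 2} W"
begin

section \<open>The generated filtration\<close>

lemma W_meas: "i \<in> {0, 1, 2} \<Longrightarrow> 0 \<le> t \<Longrightarrow> W i t \<in> borel_measurable M"
  using bm[of i] by (simp add: brownian_motion_def)

lemma W_continuous: "i \<in> {0, 1, 2} \<Longrightarrow> AE \<omega> in M. continuous_on {0..} (\<lambda>t. W i t \<omega>)"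
  using bm[of i] by (simp add: brownian_motion_def)

abbreviation past_gen :: "real \<Rightarrow> 'w set set" where
  "past_gen t \<equiv> {W i \<tau> -` A \<inter> space M | i \<tau> A. i \<in> {0, 1, 2} \<and> 0 \<le> \<tau> \<and> \<tau> \<le> t \<and> A \<in> sets borel}"

lemma sets_F: "sets (F t) = sigma_sets (space M) (past_gen t)"
  unfolding F_eq natural_filtration_def by (rule sets_measure_of) auto

lemma space_F [simp]: "space (F t) = space M"
  unfolding F_eq natural_filtration_def by (rule space_measure_of) auto

lemma past_gen_events: "past_gen t \<subseteq> events"
  using measurable_sets[OF W_meas] by blast

lemma sets_F_events: "sets (F t) \<subseteq> events"
  unfolding sets_F by (rule sets.sigma_sets_subset[OF past_gen_events])

lemma F_M: "X \<in> F t \<rightarrow>\<^sub>M N \<Longrightarrow> X \<in> M \<rightarrow>\<^sub>M N"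
  by (rule subsetD[OF measurable_mono]) (use sets_F_events in auto)

lemma F_mono: "X \<in> F t \<rightarrow>\<^sub>M N \<Longrightarrow> t \<le> t' \<Longrightarrow> X \<in> F t' \<rightarrow>\<^sub>M N"
proof (rule subsetD[OF measurable_mono])
  assume "t \<le> t'"
  then show "sets (F t) \<subseteq> sets (F t')" unfolding sets_F by (intro sigma_sets_subseteq) force
qed auto

lemma W_F: "i \<in> {0, 1, 2} \<Longrightarrow> 0 \<le> \<tau> \<Longrightarrow> \<tau> \<le> t \<Longrightarrow> W i \<tau> \<in> borel_measurable (F t)"
proof (rule measurableI)
  fix A :: "real set" assume "i \<in> {0, 1, 2}" "0 \<le> \<tau>" "\<tau> \<le> t" "A \<in> sets borel"
  then show "W i \<tau> -` A \<inter> space (F t) \<in> sets (F t)" unfolding sets_F space_F by (intro sigma_sets.Basic) blast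
qed auto

section \<open>Joint independence of the pasts and the increments\<close>

definition past :: "nat \<Rightarrow> real \<Rightarrow> 'w set set" where
  "past i a = sigma_sets (space M) {W i \<tau> -` A \<inter> space M | \<tau> A. 0 \<le> \<tau> \<and> \<tau> \<le> a \<and> A \<in> sets borel}"

definition incr :: "nat \<Rightarrow> real \<Rightarrow> real \<Rightarrow> 'w set set" where
  "incr i a b = {(\<lambda>\<omega>. W i b \<omega> - W i a \<omega>) -` A \<inter> space M | A. A \<in> sets borel}"

lemma past_incr_indep: "i \<in> {0, 1, 2} \<Longrightarrow> 0 \<le> a \<Longrightarrow> a \<le> b \<Longrightarrow> indep_set (past i a) (incr i a b)"
  unfolding past_def incr_def by (intro brownian_past_increment_indep bm)

lemma space_past: "space M \<in> past i a"
  unfolding past_def by (rule sigma_sets_top)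

lemma space_incr: "space M \<in> incr i a b"
  unfolding incr_def by (intro CollectI exI[of _ UNIV]) auto

lemma Int_stable_past: "Int_stable (past i a)"
proof -
  have "sigma_algebra (space M) (past i a)" unfolding past_def by (rule sigma_algebra_sigma_sets) auto
  then interpret sigma_algebra "space M" "past i a" .
  show ?thesis by (auto simp: Int_stable_def)
qed

lemma Int_stable_incr: "Int_stable (incr i a b)"
  unfolding Int_stable_def incr_def
proof safe
  fix A A' :: "real set" assume "A \<in> sets borel" "A' \<in> sets borel"
  then show "\<exists>Aa. (\<lambda>\<omega>. W i b \<omega> - W i a \<omega>) -` A \<inter> space M \<inter> ((\<lambda>\<omega>. W i b \<omega> - W i a \<omega>) -` A' \<inter> space M)
      = (\<lambda>\<omega>. W i b \<omega> - W i a \<omega>) -` Aa \<inter> space M \<and> Aa \<in> sets borel"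
    by (intro exI[of _ "A \<inter> A'"]) auto
qed

text \<open>Events determined by the whole path of one motion. \<open>independent_processes\<close>
  speaks of exactly these, and both the past and the increments of that motion are among
  them.\<close>

definition path_events :: "nat \<Rightarrow> 'w set set" where
  "path_events i = sigma_sets (space M)
     {(\<lambda>\<omega>. restrict (\<lambda>t. W i t \<omega>) {0..}) -` A \<inter> space M | A. A \<in> sets (PiM {0..} (\<lambda>_. borel))}"

lemma path_events_indep: "indep_sets path_events {0, 1, 2}"
  using indep_W unfolding independent_processes_def indep_vars_def path_events_def by blast

lemma path_events_W:
  assumes "0 \<le> t" "i \<in> {0, 1, 2}"
  shows "W i t \<in> borel_measurable (sigma (space M) (path_events i))"
proof -
  have sub: "path_events i \<subseteq> Pow (space M)" using path_events_indep assms sets.sets_into_space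
    unfolding indep_sets_def by blast
  have alg: "sigma_sets (space M) (path_events i) = path_events i"
    unfolding path_events_def by (rule sigma_sets_sigma_sets_eq) auto
  show ?thesis
  proof (rule measurableI)
    fix A :: "real set" assume A: "A \<in> sets borel"
    let ?R = "\<lambda>\<omega>. restrict (\<lambda>t. W i t \<omega>) {0..}"
    have "(\<lambda>f. f t) \<in> borel_measurable (PiM {0..} (\<lambda>_. borel :: real measure))"
      using assms(1) by (intro measurable_component_singleton) auto
    from measurable_sets[OF this A] have "?R -` ((\<lambda>f. f t) -` A \<inter> space (PiM {0..} (\<lambda>_. borel))) \<inter> space M \<in> path_events i"
      unfolding path_events_def by (intro sigma_sets.Basic) blast
    also have "?R -` ((\<lambda>f. f t) -` A \<inter> space (PiM {0..} (\<lambda>_. borel))) \<inter> space M = W i t -` A \<inter> space M"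
      using assms(1) by (auto simp: space_PiM)
    finally show "W i t -` A \<inter> space (sigma (space M) (path_events i)) \<in> sets (sigma (space M) (path_events i))"
      using sub by (simp add: alg)
  qed auto
qed

lemma sets_path_events: "i \<in> {0, 1, 2} \<Longrightarrow> sets (sigma (space M) (path_events i)) = path_events i"
proof -
  assume "i \<in> {0, 1, 2}"
  then have sub: "path_events i \<subseteq> Pow (space M)" using path_events_indep sets.sets_into_space
    unfolding indep_sets_def by blast
  have "sigma_sets (space M) (path_events i) = path_events i"
    unfolding path_events_def by (rule sigma_sets_sigma_sets_eq) auto
  then show ?thesis using sub by simp
qed

lemma space_path_events [simp]: "space (sigma (space M) (path_events i)) = space M"
  by (rule space_measure_of_conv)

lemma past_path: assumes "i \<in> {0, 1, 2}" shows "past i a \<subseteq> path_events i"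
proof -
  have "{W i \<tau> -` A \<inter> space M | \<tau> A. 0 \<le> \<tau> \<and> \<tau> \<le> a \<and> A \<in> sets borel} \<subseteq> path_events i"
    using measurable_sets[OF path_events_W[OF _ assms]] sets_path_events[OF assms] by auto
  then have "past i a \<subseteq> sigma_sets (space M) (path_events i)"
    unfolding past_def by (rule sigma_sets_subseteq)
  then show ?thesis unfolding path_events_def by (subst (asm) sigma_sets_sigma_sets_eq) auto
qed

lemma incr_path: assumes "i \<in> {0, 1, 2}" "0 \<le> a" "a \<le> b" shows "incr i a b \<subseteq> path_events i"
proof
  fix E assume "E \<in> incr i a b"
  then obtain A where A: "E = (\<lambda>\<omega>. W i b \<omega> - W i a \<omega>) -` A \<inter> space M" "A \<in> sets borel" unfolding incr_def by blast
  have "(\<lambda>\<omega>. W i b \<omega> - W i a \<omega>) \<in> borel_measurable (sigma (space M) (path_events i))"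
    using assms by (intro borel_measurable_diff path_events_W) auto
  from measurable_sets[OF this A(2)] show "E \<in> path_events i" using A(1) sets_path_events[OF assms(1)] by simp
qed

text \<open>Two independences are combined: across the motions, at the level of whole paths, and
  between past and increment within one motion. In the index pair, \<open>False\<close> stands for
  the past and \<open>True\<close> for the increment.\<close>

lemma past_increments_indep:
  assumes ab: "0 \<le> a" "a \<le> b"
  shows "indep_sets (\<lambda>(i, c). if c then incr i a b else past i a) ({0, 1, 2} \<times> UNIV)"
proof (subst indep_sets_finite)
  let ?H = "\<lambda>(i, c). if c then incr i a b else past i a"
  show "({0, 1, 2} \<times> UNIV :: (nat \<times> bool) set) \<noteq> {}" "finite ({0, 1, 2} \<times> UNIV :: (nat \<times> bool) set)" by auto
  have pe: "path_events i \<subseteq> events" if "i \<in> {0,1,2}" for i using path_events_indep that by (auto simp: indep_sets_def)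
  show "?H j \<subseteq> events" if "j \<in> {0, 1, 2} \<times> UNIV" for j
    using that incr_path[of "fst j" a b] past_path[of "fst j" a] pe[of "fst j"] ab by (cases j) (auto split: if_splits)
  show "space M \<in> ?H j" if "j \<in> {0, 1, 2} \<times> UNIV" for j
    using space_past space_incr by (cases j) auto
  show "\<forall>A\<in>Pi ({0, 1, 2} \<times> UNIV) ?H. prob (\<Inter>j\<in>{0, 1, 2} \<times> UNIV. A j) = (\<Prod>j\<in>{0, 1, 2} \<times> UNIV. prob (A j))"
  proof
    fix A assume A: "A \<in> Pi ({0, 1, 2} \<times> UNIV) ?H"
    have Af: "A (i, False) \<in> past i a" and At: "A (i, True) \<in> incr i a b" if "i \<in> {0,1,2}" for i
      using Pi_mem[OF A, of "(i, False)"] Pi_mem[OF A, of "(i, True)"] that by auto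
    have mem: "A (i, False) \<inter> A (i, True) \<in> path_events i" if i: "i \<in> {0,1,2}" for i
    proof -
      have "A (i, False) \<in> path_events i" "A (i, True) \<in> path_events i"
        using past_path[OF i, of a] incr_path[OF i ab] Af[OF i] At[OF i] by auto
      then show ?thesis
        using sets.Int[of _ "sigma (space M) (path_events i)"] sets_path_events[OF i] by metis
    qed
    have "(\<Inter>j\<in>{0, 1, 2} \<times> UNIV. A j) = (\<Inter>i\<in>{0,1,2}. A (i, False) \<inter> A (i, True))"
    proof -
      have "(\<Inter>j\<in>S \<times> UNIV. A j) = (\<Inter>i\<in>S. A (i, False) \<inter> A (i, True))" for S :: "nat set"
        unfolding UNIV_bool by auto
      then show ?thesis .
    qed
    also have "prob \<dots> = (\<Prod>i\<in>{0,1,2}. prob (A (i, False) \<inter> A (i, True)))"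
      by (rule indep_setsD[OF path_events_indep]) (use mem in auto)
    also have "\<dots> = (\<Prod>i\<in>{0,1,2}. prob (A (i, False)) * prob (A (i, True)))"
      using indep_setD[OF past_incr_indep[OF _ ab] Af At] by (intro prod.cong refl) blast
    also have "\<dots> = (\<Prod>j\<in>{0, 1, 2} \<times> UNIV. prob (A j))"
    proof -
      have "(\<Prod>j\<in>{0, 1, 2} \<times> UNIV. prob (A j)) = (\<Prod>i\<in>{0,1,2}. \<Prod>c\<in>UNIV. prob (A (i, c)))"
        by (simp only: prod.cartesian_product) (simp add: case_prod_beta)
      then show ?thesis by (simp add: UNIV_bool mult_ac)
    qed
    finally show "prob (\<Inter>j\<in>{0, 1, 2} \<times> UNIV. A j) = (\<Prod>j\<in>{0, 1, 2} \<times> UNIV. prob (A j))" .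
  qed
qed

text \<open>Independent families stay independent when grouped into disjoint blocks. Index 2 carries
  the pasts of all three motions, whose join contains \<open>F a\<close>; indices 0 and 1 carry one
  increment each.\<close>

lemma indep_past_two_increments:
  fixes X :: "'w \<Rightarrow> real" and g0 g1 :: "real \<Rightarrow> real"
  assumes ab: "0 \<le> a" "a \<le> b" and X: "X \<in> borel_measurable (F a)"
    and g: "g0 \<in> borel_measurable borel" "g1 \<in> borel_measurable borel"
  shows "indep_vars (\<lambda>_. borel) (\<lambda>i :: nat. if i = 2 then X else if i = 0 then (\<lambda>\<omega>. g0 (W 0 b \<omega> - W 0 a \<omega>))
           else (\<lambda>\<omega>. g1 (W 1 b \<omega> - W 1 a \<omega>))) {0, 1, 2}"
proof -
  let ?H = "\<lambda>(i, c). if c then incr i a b else past i a"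
  let ?I = "\<lambda>j :: nat. if j = 2 then {0, 1, 2} \<times> {False} else {(j, True)}"
  have "indep_sets (\<lambda>j. sigma_sets (space M) (\<Union>i\<in>?I j. ?H i)) {0, 1, 2}"
  proof (rule indep_sets_collect_sigma)
    show "indep_sets ?H (\<Union>j\<in>{0, 1, 2}. ?I j)"
      by (rule indep_sets_mono_index[OF _ past_increments_indep[OF ab]]) (auto split: if_splits)
    show "Int_stable (?H i)" for i by (cases i) (auto simp: Int_stable_past Int_stable_incr)
    show "disjoint_family_on ?I {0, 1, 2}" by (auto simp: disjoint_family_on_def split: if_splits)
  qed
  then have ind: "indep_sets (\<lambda>j. if j = 2 then sets (F a) else sigma_sets (space M) (incr j a b)) {0, 1, 2 :: nat}"
  proof (rule indep_sets_mono_sets)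
    fix j :: nat assume "j \<in> {0, 1, 2}"
    have "past_gen a \<subseteq> (\<Union>i\<in>{0,1,2}. past i a)" unfolding past_def by (auto intro!: sigma_sets.Basic)
    then have "sets (F a) \<subseteq> sigma_sets (space M) (\<Union>i\<in>{0,1,2}. past i a)"
      unfolding sets_F by (rule sigma_sets_subseteq)
    moreover have "(\<Union>i\<in>?I 2. ?H i) = (\<Union>i\<in>{0,1,2}. past i a)" by auto
    ultimately show "(if j = 2 then sets (F a) else sigma_sets (space M) (incr j a b)) \<subseteq> sigma_sets (space M) (\<Union>i\<in>?I j. ?H i)"
      by auto
  qed
  have W': "(\<lambda>\<omega>. W i b \<omega> - W i a \<omega>) \<in> borel_measurable M" if "i \<in> {0,1,2}" for i
    using that ab by (intro borel_measurable_diff W_meas) auto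
  show ?thesis
    unfolding indep_vars_def2
  proof (intro conjI ballI)
    fix i :: nat assume "i \<in> {0,1,2}"
    then show "(if i = 2 then X else if i = 0 then (\<lambda>\<omega>. g0 (W 0 b \<omega> - W 0 a \<omega>)) else (\<lambda>\<omega>. g1 (W 1 b \<omega> - W 1 a \<omega>))) \<in> borel_measurable M"
      using F_M[OF X] measurable_compose[OF W'[of 0] g(1)] measurable_compose[OF W'[of 1] g(2)] by auto
  next
    show "indep_sets (\<lambda>i. {(if i = 2 then X else if i = 0 then (\<lambda>\<omega>. g0 (W 0 b \<omega> - W 0 a \<omega>))
           else (\<lambda>\<omega>. g1 (W 1 b \<omega> - W 1 a \<omega>))) -` A \<inter> space M | A. A \<in> sets borel}) {0, 1, 2 :: nat}"
    proof (rule indep_sets_mono_sets[OF ind])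
      fix i :: nat assume i: "i \<in> {0,1,2}"
      have c: "(\<lambda>\<omega>. g (W i b \<omega> - W i a \<omega>)) -` A \<inter> space M \<in> sigma_sets (space M) (incr i a b)"
        if "g \<in> borel_measurable borel" "A \<in> sets borel" for g and A :: "real set" and i
      proof -
        have "(\<lambda>\<omega>. g (W i b \<omega> - W i a \<omega>)) -` A = (\<lambda>\<omega>. W i b \<omega> - W i a \<omega>) -` (g -` A)" by auto
        moreover have "g -` A \<in> sets borel" using measurable_sets[OF that] by simp
        ultimately show ?thesis unfolding incr_def by (intro sigma_sets.Basic) auto
      qed
      consider "i = 2" | "i = 0" | "i = 1" using i by auto
      then show "{(if i = 2 then X else if i = 0 then (\<lambda>\<omega>. g0 (W 0 b \<omega> - W 0 a \<omega>))
           else (\<lambda>\<omega>. g1 (W 1 b \<omega> - W 1 a \<omega>))) -` A \<inter> space M | A. A \<in> sets borel}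
           \<subseteq> (if i = 2 then sets (F a) else sigma_sets (space M) (incr i a b))"
      proof cases
        case 1 then show ?thesis using measurable_sets[OF X] by auto
      next
        case 2 then show ?thesis using c[OF g(1), of _ 0] by auto
      next
        case 3 then show ?thesis using c[OF g(2), of _ 1] by auto
      qed
    qed
  qed
qed

lemma
  fixes X :: "'w \<Rightarrow> real" and g0 g1 :: "real \<Rightarrow> real"
  assumes ab: "0 \<le> a" "a \<le> b" and X: "X \<in> borel_measurable (F a)" "integrable M X"
    and g: "g0 \<in> borel_measurable borel" "g1 \<in> borel_measurable borel"
    and i: "integrable M (\<lambda>\<omega>. g0 (W 0 b \<omega> - W 0 a \<omega>))" "integrable M (\<lambda>\<omega>. g1 (W 1 b \<omega> - W 1 a \<omega>))"
  shows integrable_past_increments: "integrable M (\<lambda>\<omega>. X \<omega> * g0 (W 0 b \<omega> - W 0 a \<omega>) * g1 (W 1 b \<omega> - W 1 a \<omega>))"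
    and integral_past_increments: "(\<integral>\<omega>. X \<omega> * g0 (W 0 b \<omega> - W 0 a \<omega>) * g1 (W 1 b \<omega> - W 1 a \<omega>) \<partial>M)
        = (\<integral>\<omega>. X \<omega> \<partial>M) * (\<integral>\<omega>. g0 (W 0 b \<omega> - W 0 a \<omega>) \<partial>M) * (\<integral>\<omega>. g1 (W 1 b \<omega> - W 1 a \<omega>) \<partial>M)"
proof -
  let ?Y = "\<lambda>i :: nat. if i = 2 then X else if i = 0 then (\<lambda>\<omega>. g0 (W 0 b \<omega> - W 0 a \<omega>))
           else (\<lambda>\<omega>. g1 (W 1 b \<omega> - W 1 a \<omega>))"
  have ind: "indep_vars (\<lambda>_. borel) ?Y {0, 1, 2}" by (rule indep_past_two_increments) fact+
  have int: "integrable M (?Y j)" if "j \<in> {0, 1, 2}" for j using that X i by auto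
  have e: "(\<lambda>\<omega>. X \<omega> * g0 (W 0 b \<omega> - W 0 a \<omega>) * g1 (W 1 b \<omega> - W 1 a \<omega>)) = (\<lambda>\<omega>. \<Prod>j\<in>{0, 1, 2}. ?Y j \<omega>)"
    by (auto simp: fun_eq_iff)
  show "integrable M (\<lambda>\<omega>. X \<omega> * g0 (W 0 b \<omega> - W 0 a \<omega>) * g1 (W 1 b \<omega> - W 1 a \<omega>))"
    unfolding e by (rule indep_vars_integrable[OF _ ind int]) auto
  show "(\<integral>\<omega>. X \<omega> * g0 (W 0 b \<omega> - W 0 a \<omega>) * g1 (W 1 b \<omega> - W 1 a \<omega>) \<partial>M)
        = (\<integral>\<omega>. X \<omega> \<partial>M) * (\<integral>\<omega>. g0 (W 0 b \<omega> - W 0 a \<omega>) \<partial>M) * (\<integral>\<omega>. g1 (W 1 b \<omega> - W 1 a \<omega>) \<partial>M)"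
    unfolding e by (subst indep_vars_lebesgue_integral[OF _ ind int]) auto
qed

end

section \<open>Exponential densities\<close>

text \<open>Completing the square: exponential tilting of a centred normal law shifts its mean by
  \<open>u * \<sigma>\<^sup>2\<close> and produces the moment generating function as a
  factor.\<close>

lemma exp_normal_density:
  "\<sigma> > 0 \<Longrightarrow> normal_density 0 \<sigma> z * exp (u * z) = exp (u\<^sup>2 * \<sigma>\<^sup>2 / 2) * normal_density (u * \<sigma>\<^sup>2) \<sigma> z"
  by (simp add: normal_density_def exp_add[symmetric] field_simps power2_eq_square)

context brownian_triple
begin

section \<open>Exponential moments of Brownian increments\<close>

lemma increment_distributed:
  "i \<in> {0, 1, 2} \<Longrightarrow> 0 \<le> a \<Longrightarrow> a < b \<Longrightarrow>
    distributed M lborel (\<lambda>\<omega>. W i b \<omega> - W i a \<omega>) (\<lambda>z. ennreal (normal_density 0 (sqrt (b - a)) z))"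
  using bm[of i] by (auto simp: brownian_motion_def)

text \<open>By tilting, the exponential moment is a total mass and the mixed moment a mean of a
  shifted normal law. The case \<open>u = 0\<close> of the mixed moment is the vanishing mean of the
  increment.\<close>

lemma
  assumes i: "i \<in> {0, 1, 2}" and ab: "0 \<le> a" "a \<le> b"
  shows increment_exp_integrable: "integrable M (\<lambda>\<omega>. exp (u * (W i b \<omega> - W i a \<omega>)))"
    and increment_exp: "(\<integral>\<omega>. exp (u * (W i b \<omega> - W i a \<omega>)) \<partial>M) = exp (u\<^sup>2 * (b - a) / 2)"
    and increment_mult_exp_integrable: "integrable M (\<lambda>\<omega>. (W i b \<omega> - W i a \<omega>) * exp (u * (W i b \<omega> - W i a \<omega>)))"
    and increment_mult_exp: "(\<integral>\<omega>. (W i b \<omega> - W i a \<omega>) * exp (u * (W i b \<omega> - W i a \<omega>)) \<partial>M)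
        = u * (b - a) * exp (u\<^sup>2 * (b - a) / 2)"
    and increment_square_integrable: "integrable M (\<lambda>\<omega>. (W i b \<omega> - W i a \<omega>)\<^sup>2)"
    and increment_square: "(\<integral>\<omega>. (W i b \<omega> - W i a \<omega>)\<^sup>2 \<partial>M) = b - a"
proof -
  let ?D = "\<lambda>\<omega>. W i b \<omega> - W i a \<omega>" and ?nd = "normal_density 0 (sqrt (b - a))"
  let ?c = "exp (u\<^sup>2 * (b - a) / 2)"
  have "integrable M (\<lambda>\<omega>. exp (u * ?D \<omega>)) \<and> (\<integral>\<omega>. exp (u * ?D \<omega>) \<partial>M) = ?c \<and>
    integrable M (\<lambda>\<omega>. ?D \<omega> * exp (u * ?D \<omega>)) \<and> (\<integral>\<omega>. ?D \<omega> * exp (u * ?D \<omega>) \<partial>M) = u * (b - a) * ?c \<and>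
    integrable M (\<lambda>\<omega>. (?D \<omega>)\<^sup>2) \<and> (\<integral>\<omega>. (?D \<omega>)\<^sup>2 \<partial>M) = b - a"
  \<comment> \<open>The definition prescribes the law of an increment only for distinct
    times.\<close>
  proof (cases "a = b")
    case True then show ?thesis by (simp add: prob_space)
  next
    case False
    then have lt: "a < b" using ab by simp
    then have \<sigma>: "sqrt (b - a) > 0" "(sqrt (b - a))\<^sup>2 = b - a" by auto
    note d = increment_distributed[OF i ab(1) lt]
    have e1: "?nd z * exp (u * z) = ?c * normal_density (u * (b - a)) (sqrt (b - a)) z" for z
      using exp_normal_density[OF \<sigma>(1), of z u] \<sigma>(2) by simp
    have e2: "?nd z * (z * exp (u * z)) = ?c * (normal_density (u * (b - a)) (sqrt (b - a)) z * z)" for z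
      using e1[of z] by (metis mult.commute mult.assoc)
    have e3: "?nd z * z\<^sup>2 = ?nd z * (z - 0)\<^sup>2" for z by simp
    have n: "\<And>x. 0 \<le> ?nd x" by simp
    have i1: "integrable M (\<lambda>\<omega>. exp (u * ?D \<omega>))"
      by (subst distributed_integrable[OF d _ n, symmetric], measurable)
        (simp add: e1 lt)
    have v1: "(\<integral>\<omega>. exp (u * ?D \<omega>) \<partial>M) = ?c"
      by (subst distributed_integral[OF d _ n, symmetric], measurable)
        (simp add: e1 lt)
    have i2: "integrable M (\<lambda>\<omega>. ?D \<omega> * exp (u * ?D \<omega>))"
      by (subst distributed_integrable[OF d _ n, symmetric, where g = "\<lambda>z. z * exp (u * z)"], measurable)
        (simp add: e2 lt integrable_normal_moment_nz_1)
    have v2: "(\<integral>\<omega>. ?D \<omega> * exp (u * ?D \<omega>) \<partial>M) = u * (b - a) * ?c"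
      by (subst distributed_integral[OF d _ n, symmetric, where g = "\<lambda>z. z * exp (u * z)"], measurable)
        (simp add: e2 lt integral_normal_moment_nz_1)
    have i3: "integrable M (\<lambda>\<omega>. (?D \<omega>)\<^sup>2)"
      by (subst distributed_integrable[OF d _ n, symmetric, where g = "\<lambda>z. z\<^sup>2"], measurable)
        (subst e3, rule integrable_normal_moment[OF \<sigma>(1)])
    have v3: "(\<integral>\<omega>. (?D \<omega>)\<^sup>2 \<partial>M) = b - a"
      by (subst distributed_integral[OF d _ n, symmetric, where g = "\<lambda>z. z\<^sup>2"], measurable)
        (use integral_normal_moment_even[OF \<sigma>(1), of 0 1] \<sigma> in \<open>simp add: numeral_2_eq_2 field_simps\<close>)
    show ?thesis using i1 v1 i2 v2 i3 v3 by blast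
  qed
  then show "integrable M (\<lambda>\<omega>. exp (u * ?D \<omega>))" "(\<integral>\<omega>. exp (u * ?D \<omega>) \<partial>M) = ?c"
    "integrable M (\<lambda>\<omega>. ?D \<omega> * exp (u * ?D \<omega>))" "(\<integral>\<omega>. ?D \<omega> * exp (u * ?D \<omega>) \<partial>M) = u * (b - a) * ?c"
    "integrable M (\<lambda>\<omega>. (?D \<omega>)\<^sup>2)" "(\<integral>\<omega>. (?D \<omega>)\<^sup>2 \<partial>M) = b - a"
    by blast+
qed

lemma increment_integrable: "i \<in> {0, 1, 2} \<Longrightarrow> 0 \<le> a \<Longrightarrow> a \<le> b \<Longrightarrow> integrable M (\<lambda>\<omega>. W i b \<omega> - W i a \<omega>)"
  using increment_mult_exp_integrable[of i a b 0] by simp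

lemma increment_mean: "i \<in> {0, 1, 2} \<Longrightarrow> 0 \<le> a \<Longrightarrow> a \<le> b \<Longrightarrow> (\<integral>\<omega>. W i b \<omega> - W i a \<omega> \<partial>M) = 0"
  using increment_mult_exp[of i a b 0] by simp

lemma L2_increment: "i \<in> {0, 1, 2} \<Longrightarrow> 0 \<le> a \<Longrightarrow> a \<le> b \<Longrightarrow> L2 M (\<lambda>\<omega>. W i b \<omega> - W i a \<omega>)"
  unfolding L2_def using increment_square_integrable[of i a b] W_meas[of i] by auto

lemma
  assumes i: "i \<in> {0, 1}" and ab: "0 \<le> a" "a \<le> b" and X: "X \<in> borel_measurable (F a)" "integrable M X"
  shows past_mult_increment_integrable: "integrable M (\<lambda>\<omega>. X \<omega> * (W i b \<omega> - W i a \<omega>))"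
    and past_mult_increment: "(\<integral>\<omega>. X \<omega> * (W i b \<omega> - W i a \<omega>) \<partial>M) = 0"
proof -
  have j: "integrable M (\<lambda>\<omega>. W j b \<omega> - W j a \<omega>)" "(\<integral>\<omega>. W j b \<omega> - W j a \<omega> \<partial>M) = 0" if "j \<in> {0, 1}" for j
    using increment_integrable[of j a b] increment_mean[of j a b] ab that by auto
  have m: "(\<lambda>z. z) \<in> borel_measurable borel" "(\<lambda>z. 1) \<in> borel_measurable borel" "integrable M (\<lambda>\<omega>. 1)" for z :: real by auto
  have "integrable M (\<lambda>\<omega>. X \<omega> * (W i b \<omega> - W i a \<omega>)) \<and> (\<integral>\<omega>. X \<omega> * (W i b \<omega> - W i a \<omega>) \<partial>M) = 0"
  proof (cases "i = 0")
    case True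
    have "integrable M (\<lambda>\<omega>. X \<omega> * (W 0 b \<omega> - W 0 a \<omega>))"
      using integrable_past_increments[OF ab X m(1,2) j(1) m(3)] by (simp only: mult_1_right) simp
    moreover have "(\<integral>\<omega>. X \<omega> * (W 0 b \<omega> - W 0 a \<omega>) \<partial>M) = 0"
      using integral_past_increments[OF ab X m(1,2) j(1) m(3)] j(2)[of 0] by (simp only: mult_1_right mult_zero_left mult_zero_right) simp
    ultimately show ?thesis using True by simp
  next
    case False
    have "integrable M (\<lambda>\<omega>. X \<omega> * (W 1 b \<omega> - W 1 a \<omega>))"
      using integrable_past_increments[OF ab X m(2,1) m(3) j(1)] by (simp only: mult_1_right) simp
    moreover have "(\<integral>\<omega>. X \<omega> * (W 1 b \<omega> - W 1 a \<omega>) \<partial>M) = 0"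
      using integral_past_increments[OF ab X m(2,1) m(3) j(1)] j(2)[of 1] by (simp only: mult_1_right mult_zero_left mult_zero_right) simp
    ultimately show ?thesis using False i by auto
  qed
  then show "integrable M (\<lambda>\<omega>. X \<omega> * (W i b \<omega> - W i a \<omega>))" "(\<integral>\<omega>. X \<omega> * (W i b \<omega> - W i a \<omega>) \<partial>M) = 0" by blast+
qed

text \<open>For one and the same motion the squared increment is a single factor independent of the
  past; for different motions each increment is a factor of its own and has mean zero.\<close>

lemma past_mult_two_increments:
  assumes i: "i \<in> {0, 1}" "j \<in> {0, 1}" and ab: "0 \<le> a" "a \<le> b" and X: "X \<in> borel_measurable (F a)" "integrable M X"
  shows "(\<integral>\<omega>. X \<omega> * (W i b \<omega> - W i a \<omega>) * (W j b \<omega> - W j a \<omega>) \<partial>M)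
     = (if i = j then (b - a) * (\<integral>\<omega>. X \<omega> \<partial>M) else 0)"
proof -
  let ?D = "\<lambda>i \<omega>. W i b \<omega> - W i a \<omega>"
  have d: "integrable M (?D j)" "(\<integral>\<omega>. ?D j \<omega> \<partial>M) = 0" "integrable M (\<lambda>\<omega>. (?D j \<omega>)\<^sup>2)" "(\<integral>\<omega>. (?D j \<omega>)\<^sup>2 \<partial>M) = b - a"
    if "j \<in> {0, 1}" for j
    using increment_integrable[of j a b] increment_mean[of j a b] increment_square_integrable[of j a b]
      increment_square[of j a b] ab that by auto
  have m: "(\<lambda>z :: real. z) \<in> borel_measurable borel" "(\<lambda>z :: real. 1 :: real) \<in> borel_measurable borel"
    "(\<lambda>z :: real. z\<^sup>2) \<in> borel_measurable borel" "integrable M (\<lambda>\<omega>. 1 :: real)" "(\<integral>\<omega>. (1 :: real) \<partial>M) = 1"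
    by (auto simp: prob_space)
  have sq: "X \<omega> * ?D j \<omega> * ?D j \<omega> = X \<omega> * (?D j \<omega>)\<^sup>2" for j \<omega> by (simp only: power2_eq_square mult.assoc)
  consider "i = 0" "j = 0" | "i = 1" "j = 1" | "i = 0" "j = 1" | "i = 1" "j = 0" using i by auto
  then show ?thesis
  proof cases
    case 1
    have "(\<integral>\<omega>. X \<omega> * (?D 0 \<omega>)\<^sup>2 \<partial>M) = (\<integral>\<omega>. X \<omega> \<partial>M) * (b - a)"
      using integral_past_increments[OF ab X m(3,2) d(3) m(4)] by (simp only: mult_1_right m(5) d(4)) simp
    then show ?thesis unfolding 1 sq by simp
  next
    case 2
    have "(\<integral>\<omega>. X \<omega> * (?D 1 \<omega>)\<^sup>2 \<partial>M) = (\<integral>\<omega>. X \<omega> \<partial>M) * (b - a)"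
      using integral_past_increments[OF ab X m(2,3) m(4) d(3)] d(4)[of 1] by (simp only: mult_1_right m(5)) simp
    then show ?thesis unfolding 2 sq by simp
  next
    case 3
    then show ?thesis using integral_past_increments[OF ab X m(1,1) d(1) d(1)] d(2)[of 0] by (simp only: mult_zero_right mult_zero_left) simp
  next
    case 4
    have "X \<omega> * ?D i \<omega> * ?D j \<omega> = X \<omega> * ?D 0 \<omega> * ?D 1 \<omega>" for \<omega> unfolding 4 by (simp only: mult_ac)
    then show ?thesis using 4 integral_past_increments[OF ab X m(1,1) d(1) d(1)] d(2)[of 0] by (simp only: mult_zero_right mult_zero_left) simp
  qed
qed

text \<open>The density process of a Girsanov change of measure with drift \<open>(- k0, - k1)\<close>.\<close>

definition dens :: "real \<Rightarrow> real \<Rightarrow> real \<Rightarrow> real \<Rightarrow> 'w \<Rightarrow> real" where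
  "dens k0 k1 a b \<omega> = exp (- k0 * (W 0 b \<omega> - W 0 a \<omega>)) * exp (- k1 * (W 1 b \<omega> - W 1 a \<omega>))
     * exp (- ((k0\<^sup>2 + k1\<^sup>2) / 2 * (b - a)))"

lemma dens_pos: "0 < dens k0 k1 a b \<omega>"
  by (simp add: dens_def)

lemma dens_same [simp]: "dens k0 k1 a a \<omega> = 1"
  by (simp add: dens_def)

lemma dens_zero [simp]: "dens 0 0 a b \<omega> = 1"
  by (simp add: dens_def)

lemma dens_mult: "dens k0 k1 a b \<omega> * dens k0 k1 b c \<omega> = dens k0 k1 a c \<omega>"
  unfolding dens_def exp_add[symmetric] by (rule arg_cong[where f = exp]) (simp add: field_simps)

lemma dens_F: "0 \<le> a \<Longrightarrow> a \<le> t \<Longrightarrow> 0 \<le> b \<Longrightarrow> b \<le> t \<Longrightarrow> dens k0 k1 a b \<in> borel_measurable (F t)"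
  unfolding dens_def[abs_def]
  using W_F[of 0 a t] W_F[of 1 a t] W_F[of 0 b t] W_F[of 1 b t] by simp

text \<open>Martingale property of the density process: the increments are independent of
  \<open>F a\<close>, and the deterministic factor in \<open>dens\<close> is the reciprocal of the
  product of the two exponential moments.\<close>

lemma
  assumes ab: "0 \<le> a" "a \<le> b" and X: "X \<in> borel_measurable (F a)" "integrable M X"
  shows integrable_past_dens: "integrable M (\<lambda>\<omega>. X \<omega> * dens k0 k1 a b \<omega>)"
    and integral_past_dens: "(\<integral>\<omega>. X \<omega> * dens k0 k1 a b \<omega> \<partial>M) = (\<integral>\<omega>. X \<omega> \<partial>M)"
proof -
  let ?c = "exp (- ((k0\<^sup>2 + k1\<^sup>2) / 2 * (b - a)))"
  have e: "(\<lambda>\<omega>. X \<omega> * dens k0 k1 a b \<omega>) = (\<lambda>\<omega>. ?c * (X \<omega> * exp (- k0 * (W 0 b \<omega> - W 0 a \<omega>)) * exp (- k1 * (W 1 b \<omega> - W 1 a \<omega>))))"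
    by (auto simp: dens_def fun_eq_iff)
  note i = increment_exp_integrable[of 0 a b "-k0"] increment_exp_integrable[of 1 a b "-k1"]
  show "integrable M (\<lambda>\<omega>. X \<omega> * dens k0 k1 a b \<omega>)"
    unfolding e by (intro integrable_mult_right integrable_past_increments[OF ab X, of "\<lambda>z. exp (-k0 * z)" "\<lambda>z. exp (-k1 * z)"])
      (use i ab in auto)
  have "(\<integral>\<omega>. X \<omega> * dens k0 k1 a b \<omega> \<partial>M) = ?c * ((\<integral>\<omega>. X \<omega> \<partial>M) * exp (k0\<^sup>2 * (b - a) / 2) * exp (k1\<^sup>2 * (b - a) / 2))"
    unfolding e using integral_past_increments[OF ab X, of "\<lambda>z. exp (-k0 * z)" "\<lambda>z. exp (-k1 * z)"] i
      increment_exp[of 0 a b "-k0"] increment_exp[of 1 a b "-k1"] ab by simp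
  also have "\<dots> = (\<integral>\<omega>. X \<omega> \<partial>M) * (?c * exp (k0\<^sup>2 * (b - a) / 2) * exp (k1\<^sup>2 * (b - a) / 2))" by simp
  also have "?c * exp (k0\<^sup>2 * (b - a) / 2) * exp (k1\<^sup>2 * (b - a) / 2) = 1"
    unfolding exp_add[symmetric] by (simp add: field_simps)
  finally show "(\<integral>\<omega>. X \<omega> * dens k0 k1 a b \<omega> \<partial>M) = (\<integral>\<omega>. X \<omega> \<partial>M)" by simp
qed

text \<open>Girsanov's theorem for a single increment: under the density its mean becomes
  \<open>- k0 * (b - a)\<close> or \<open>- k1 * (b - a)\<close>, whatever weight known at time
  \<open>a\<close> it carries.\<close>

lemma
  assumes i: "i \<in> {0, 1}" and ab: "0 \<le> a" "a \<le> b" and X: "X \<in> borel_measurable (F a)" "integrable M X"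
  shows integrable_past_increment_dens: "integrable M (\<lambda>\<omega>. X \<omega> * (W i b \<omega> - W i a \<omega>) * dens k0 k1 a b \<omega>)"
    and integral_past_increment_dens: "(\<integral>\<omega>. X \<omega> * (W i b \<omega> - W i a \<omega>) * dens k0 k1 a b \<omega> \<partial>M)
      = - (if i = 0 then k0 else k1) * (b - a) * (\<integral>\<omega>. X \<omega> \<partial>M)"
proof -
  let ?c = "exp (- ((k0\<^sup>2 + k1\<^sup>2) / 2 * (b - a)))"
  note j = increment_exp_integrable[of 0 a b "-k0"] increment_exp_integrable[of 1 a b "-k1"]
      increment_mult_exp_integrable[of 0 a b "-k0"] increment_mult_exp_integrable[of 1 a b "-k1"]
  have c: "?c * (exp (k0\<^sup>2 * (b - a) / 2) * exp (k1\<^sup>2 * (b - a) / 2)) = 1"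
    unfolding exp_add[symmetric] by (simp add: field_simps)
  have "integrable M (\<lambda>\<omega>. X \<omega> * (W i b \<omega> - W i a \<omega>) * dens k0 k1 a b \<omega>) \<and>
     (\<integral>\<omega>. X \<omega> * (W i b \<omega> - W i a \<omega>) * dens k0 k1 a b \<omega> \<partial>M)
      = - (if i = 0 then k0 else k1) * (b - a) * (\<integral>\<omega>. X \<omega> \<partial>M)"
  proof (cases "i = 0")
    case True
    let ?Y = "\<lambda>\<omega>. X \<omega> * ((W 0 b \<omega> - W 0 a \<omega>) * exp (- k0 * (W 0 b \<omega> - W 0 a \<omega>))) * exp (- k1 * (W 1 b \<omega> - W 1 a \<omega>))"
    have e: "(\<lambda>\<omega>. X \<omega> * (W i b \<omega> - W i a \<omega>) * dens k0 k1 a b \<omega>) = (\<lambda>\<omega>. ?c * ?Y \<omega>)"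
      by (auto simp: dens_def fun_eq_iff True)
    have "integrable M ?Y"
      by (rule integrable_past_increments[OF ab X, of "\<lambda>z. z * exp (-k0 * z)" "\<lambda>z. exp (-k1 * z)"]) (use j ab in auto)
    moreover have "(\<integral>\<omega>. ?Y \<omega> \<partial>M) = (\<integral>\<omega>. X \<omega> \<partial>M) * (- k0 * (b - a) * exp (k0\<^sup>2 * (b - a) / 2)) * exp (k1\<^sup>2 * (b - a) / 2)"
      using integral_past_increments[OF ab X, of "\<lambda>z. z * exp (-k0 * z)" "\<lambda>z. exp (-k1 * z)"] j
      increment_mult_exp[of 0 a b "-k0"] increment_exp[of 1 a b "-k1"] ab by simp
    then have "?c * (\<integral>\<omega>. ?Y \<omega> \<partial>M) = (\<integral>\<omega>. X \<omega> \<partial>M) * (- k0 * (b - a)) * (?c * (exp (k0\<^sup>2 * (b - a) / 2) * exp (k1\<^sup>2 * (b - a) / 2)))"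
      by (simp only: mult_ac)
    ultimately show ?thesis unfolding e c using True by simp
  next
    case False
    then have i1: "i = 1" using i by auto
    let ?Y = "\<lambda>\<omega>. X \<omega> * exp (- k0 * (W 0 b \<omega> - W 0 a \<omega>)) * ((W 1 b \<omega> - W 1 a \<omega>) * exp (- k1 * (W 1 b \<omega> - W 1 a \<omega>)))"
    have e: "(\<lambda>\<omega>. X \<omega> * (W i b \<omega> - W i a \<omega>) * dens k0 k1 a b \<omega>) = (\<lambda>\<omega>. ?c * ?Y \<omega>)"
      by (auto simp: dens_def fun_eq_iff i1)
    have "integrable M ?Y"
      by (rule integrable_past_increments[OF ab X, of "\<lambda>z. exp (-k0 * z)" "\<lambda>z. z * exp (-k1 * z)"]) (use j ab in auto)
    moreover have "(\<integral>\<omega>. ?Y \<omega> \<partial>M) = (\<integral>\<omega>. X \<omega> \<partial>M) * exp (k0\<^sup>2 * (b - a) / 2) * (- k1 * (b - a) * exp (k1\<^sup>2 * (b - a) / 2))"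
      using integral_past_increments[OF ab X, of "\<lambda>z. exp (-k0 * z)" "\<lambda>z. z * exp (-k1 * z)"] j
      increment_mult_exp[of 1 a b "-k1"] increment_exp[of 0 a b "-k0"] ab by simp
    then have "?c * (\<integral>\<omega>. ?Y \<omega> \<partial>M) = (\<integral>\<omega>. X \<omega> \<partial>M) * (- k1 * (b - a)) * (?c * (exp (k0\<^sup>2 * (b - a) / 2) * exp (k1\<^sup>2 * (b - a) / 2)))"
      by (simp only: mult_ac)
    ultimately show ?thesis unfolding e c using i1 by simp
  qed
  then show "integrable M (\<lambda>\<omega>. X \<omega> * (W i b \<omega> - W i a \<omega>) * dens k0 k1 a b \<omega>)"
    "(\<integral>\<omega>. X \<omega> * (W i b \<omega> - W i a \<omega>) * dens k0 k1 a b \<omega> \<partial>M)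
      = - (if i = 0 then k0 else k1) * (b - a) * (\<integral>\<omega>. X \<omega> \<partial>M)" by blast+
qed

text \<open>A power of the density is, up to a constant, the density with both parameters multiplied
  by \<open>m\<close>. Here \<open>m = 1\<close> serves for the total mass, \<open>m = 2\<close> for
  square integrability and the lower bound of the cost, and \<open>m = 4\<close> for a truncation
  error.\<close>

lemma
  assumes ab: "0 \<le> a" "a \<le> b"
  shows dens_power_integrable: "integrable M (\<lambda>\<omega>. dens k0 k1 a b \<omega> ^ m)"
    and dens_power: "(\<integral>\<omega>. dens k0 k1 a b \<omega> ^ m \<partial>M) = exp ((real m ^ 2 - real m) * (k0\<^sup>2 + k1\<^sup>2) / 2 * (b - a))"
proof -
  have e: "(\<lambda>\<omega>. dens k0 k1 a b \<omega> ^ m) = (\<lambda>\<omega>. exp ((real m ^ 2 - real m) * (k0\<^sup>2 + k1\<^sup>2) / 2 * (b - a)) * (1 * dens (real m * k0) (real m * k1) a b \<omega>))"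
    unfolding dens_def power_mult_distrib exp_of_nat_mult[symmetric] mult_1
    unfolding exp_add[symmetric] by (rule ext, rule arg_cong[where f = exp]) (simp add: field_simps power2_eq_square)
  show "integrable M (\<lambda>\<omega>. dens k0 k1 a b \<omega> ^ m)"
    unfolding e by (intro integrable_mult_right integrable_past_dens ab) auto
  show "(\<integral>\<omega>. dens k0 k1 a b \<omega> ^ m \<partial>M) = exp ((real m ^ 2 - real m) * (k0\<^sup>2 + k1\<^sup>2) / 2 * (b - a))"
  proof -
    have "(\<integral>\<omega>. 1 * dens (real m * k0) (real m * k1) a b \<omega> \<partial>M) = (\<integral>\<omega>. 1 \<partial>M)"
      by (rule integral_past_dens[OF ab]) auto
    then show ?thesis unfolding e Bochner_Integration.integral_mult_right_zero by (simp add: prob_space)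
  qed
qed

lemma L2_dens: "0 \<le> a \<Longrightarrow> a \<le> b \<Longrightarrow> L2 M (dens k0 k1 a b)"
  unfolding L2_def using dens_power_integrable[of a b k0 k1 2] F_M[OF dens_F[of a b b]] by auto

text \<open>The martingale property reduces the product at two times to the second moment at the
  earlier one.\<close>

lemma dens_covariance:
  assumes "0 \<le> s" "s \<le> a" "a \<le> b"
  shows "(\<integral>\<omega>. dens k0 k1 s a \<omega> * dens k0 k1 s b \<omega> \<partial>M) = exp ((k0\<^sup>2 + k1\<^sup>2) * (a - s))"
proof -
  have "(\<integral>\<omega>. dens k0 k1 s a \<omega> * dens k0 k1 s b \<omega> \<partial>M) = (\<integral>\<omega>. (dens k0 k1 s a \<omega>)\<^sup>2 * dens k0 k1 a b \<omega> \<partial>M)"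
    by (simp add: power2_eq_square mult.assoc dens_mult)
  also have "\<dots> = (\<integral>\<omega>. (dens k0 k1 s a \<omega>)\<^sup>2 \<partial>M)"
    using assms dens_power_integrable[of s a k0 k1 2] dens_F[of s a a k0 k1] by (intro integral_past_dens) auto
  also have "\<dots> = exp ((k0\<^sup>2 + k1\<^sup>2) * (a - s))"
    using assms by (subst dens_power) (auto simp: field_simps)
  finally show ?thesis .
qed

end

section \<open>Isometry and duality for Ito integrals\<close>

lemma L2_bounded_mult:
  assumes "L2 N f" "g \<in> borel_measurable N" "\<And>x. x \<in> space N \<Longrightarrow> \<bar>g x\<bar> \<le> C"
  shows "L2 N (\<lambda>x. g x * f x)"
proof (rule L2_bound[OF L2_cmult[OF assms(1), of C]])
  show "(\<lambda>x. g x * f x) \<in> borel_measurable N" using assms by (auto simp: L2_def)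
  show "AE x in N. \<bar>g x * f x\<bar> \<le> \<bar>C * f x\<bar>"
  proof (rule AE_I2)
    fix x assume "x \<in> space N"
    then show "\<bar>g x * f x\<bar> \<le> \<bar>C * f x\<bar>"
      using assms(3)[of x] unfolding abs_mult by (intro mult_right_mono) linarith+
  qed
qed

lemma L2_diff_square:
  assumes "L2 N f" "L2 N g"
  shows "(\<integral>x. (f x - g x)\<^sup>2 \<partial>N) = (\<integral>x. f x * f x \<partial>N) - 2 * (\<integral>x. f x * g x \<partial>N) + (\<integral>x. g x * g x \<partial>N)"
proof -
  have "(\<integral>x. (f x - g x)\<^sup>2 \<partial>N) = (\<integral>x. f x * f x - 2 * (f x * g x) + g x * g x \<partial>N)"
    by (simp add: power2_eq_square algebra_simps)
  then show ?thesis using L2_mult[OF assms] L2_mult[OF assms(1,1)] L2_mult[OF assms(2,2)] by simp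
qed

lemma L2_lim_bounded_mult:
  assumes "L2_lim N fk f" "\<And>k. fk k \<in> borel_measurable N" "f \<in> borel_measurable N"
    "\<And>x. \<bar>g x\<bar> \<le> 1"
  shows "L2_lim N (\<lambda>k x. fk k x * g x) (\<lambda>x. f x * g x)"
  unfolding L2_lim_def
proof (rule tendsto_sandwich[OF _ _ tendsto_const assms(1)[unfolded L2_lim_def]])
  have "(f x * g x - fk k x * g x)\<^sup>2 \<le> (f x - fk k x)\<^sup>2" for k x
  proof -
    have "(f x * g x - fk k x * g x)\<^sup>2 = (f x - fk k x)\<^sup>2 * (g x)\<^sup>2"
      by (simp add: power2_eq_square algebra_simps)
    also have "\<dots> \<le> (f x - fk k x)\<^sup>2 * 1"
      by (rule mult_left_mono) (use assms(4)[of x] in \<open>auto simp: abs_square_le_1\<close>)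
    finally show ?thesis by simp
  qed
  then show "\<forall>\<^sub>F k in sequentially. (\<integral>\<^sup>+x. ennreal ((f x * g x - fk k x * g x)\<^sup>2) \<partial>N)
      \<le> (\<integral>\<^sup>+x. ennreal ((f x - fk k x)\<^sup>2) \<partial>N)"
    by (intro always_eventually allI nn_integral_mono ennreal_leI)
qed simp

lemma measure_lborel_Ioc_max: "measure lborel {u<..v :: real} = max 0 (v - u)"
  by (cases "u \<le> v") auto

context brownian_triple
begin

section \<open>Inner products of weighted increments\<close>

lemma L2_weighted_increment:
  assumes "i \<in> {0, 1}" "0 \<le> a" "a \<le> b" "\<xi> \<in> borel_measurable M" "\<And>\<omega>. \<omega> \<in> space M \<Longrightarrow> \<bar>\<xi> \<omega>\<bar> \<le> C"
  shows "L2 M (\<lambda>\<omega>. \<xi> \<omega> * (W i b \<omega> - W i a \<omega>))"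
  by (rule L2_bounded_mult[OF L2_increment]) (use assms in auto)

lemma orthogonal_increment:
  assumes "i \<in> {0, 1}" "0 \<le> a" "a \<le> b" "X \<in> borel_measurable (F a)" "L2 M X"
  shows "(\<integral>\<omega>. X \<omega> * (W i b \<omega> - W i a \<omega>) \<partial>M) = 0" "integrable M (\<lambda>\<omega>. X \<omega> * (W i b \<omega> - W i a \<omega>))"
  by (rule past_mult_increment[OF assms(1-4) L2_integrable[OF assms(5)]]
      past_mult_increment_integrable[OF assms(1-4) L2_integrable[OF assms(5)]])+

lemma W_increment_F: "i \<in> {0, 1} \<Longrightarrow> 0 \<le> a \<Longrightarrow> a \<le> b \<Longrightarrow> b \<le> t \<Longrightarrow> (\<lambda>\<omega>. W i b \<omega> - W i a \<omega>) \<in> borel_measurable (F t)"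
  by (rule borel_measurable_diff[OF W_F W_F]) auto

text \<open>Only the overlap of the two intervals contributes; every other piece contains an
  increment that lies after everything it is multiplied with and so has mean zero.\<close>

lemma weighted_increments_inner_aux:
  assumes i: "i \<in> {0, 1}" "j \<in> {0, 1}" and ab: "0 \<le> a" "a \<le> b" "c \<le> d" "a \<le> c"
    and \<xi>: "\<xi> \<in> borel_measurable (F a)" "\<And>\<omega>. \<omega> \<in> space M \<Longrightarrow> \<bar>\<xi> \<omega>\<bar> \<le> C"
    and \<xi>': "\<xi>' \<in> borel_measurable (F c)" "\<And>\<omega>. \<omega> \<in> space M \<Longrightarrow> \<bar>\<xi>' \<omega>\<bar> \<le> C'"
  shows "(\<integral>\<omega>. (\<xi> \<omega> * (W i b \<omega> - W i a \<omega>)) * (\<xi>' \<omega> * (W j d \<omega> - W j c \<omega>)) \<partial>M)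
    = (if i = j then max 0 (min b d - max a c) * (\<integral>\<omega>. \<xi> \<omega> * \<xi>' \<omega> \<partial>M) else 0)"
proof -
  have \<xi>c: "\<xi> \<in> borel_measurable (F c)" using \<xi>(1) ab by (intro F_mono[OF \<xi>(1)])
  note M = F_M[OF \<xi>(1)] F_M[OF \<xi>'(1)]
  have c0: "0 \<le> c" using ab by simp
  show ?thesis
  proof (cases "b \<le> c")
    case True
    let ?X = "\<lambda>\<omega>. \<xi>' \<omega> * (\<xi> \<omega> * (W i b \<omega> - W i a \<omega>))"
    have "L2 M ?X"
      by (rule L2_bounded_mult[OF L2_weighted_increment[OF i(1) ab(1,2) M(1) \<xi>(2)] M(2) \<xi>'(2)])
    moreover have "?X \<in> borel_measurable (F c)"
      using W_increment_F[OF i(1) ab(1,2) True] \<xi>c \<xi>'(1) by simp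
    ultimately have "(\<integral>\<omega>. ?X \<omega> * (W j d \<omega> - W j c \<omega>) \<partial>M) = 0"
      using orthogonal_increment[OF i(2) c0 ab(3)] by blast
    then show ?thesis using True ab by (simp add: mult_ac)
  next
    case False
    define m where "m = min b d"
    have m: "c \<le> m" "m \<le> b" "m \<le> d" "m = b \<or> m = d" using False ab by (auto simp: m_def)
    have m0: "0 \<le> m" using m c0 by simp
    let ?\<eta> = "\<lambda>\<omega>. \<xi> \<omega> * \<xi>' \<omega>"
    have C: "0 \<le> C" if "\<omega> \<in> space M" for \<omega> using \<xi>(2)[OF that] by linarith
    have \<eta>: "?\<eta> \<in> borel_measurable (F c)" "\<And>\<omega>. \<omega> \<in> space M \<Longrightarrow> \<bar>?\<eta> \<omega>\<bar> \<le> C * C'"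
      using \<xi>c \<xi>'(1) \<xi>(2) \<xi>'(2) C by (auto simp: abs_mult intro!: mult_mono)
    have \<eta>m: "?\<eta> \<in> borel_measurable (F m)" by (rule F_mono[OF \<eta>(1) m(1)])
    note \<eta>M = F_M[OF \<eta>(1)]
    let ?u = "\<lambda>\<omega>. ?\<eta> \<omega> * (W i c \<omega> - W i a \<omega>)" and ?v = "\<lambda>\<omega>. ?\<eta> \<omega> * (W i m \<omega> - W i c \<omega>)"
      and ?v' = "\<lambda>\<omega>. ?\<eta> \<omega> * (W j m \<omega> - W j c \<omega>)"
    have u: "?u \<in> borel_measurable (F c)" "L2 M ?u"
      using W_increment_F[OF i(1) ab(1,4) order_refl] \<eta> L2_weighted_increment[OF i(1) ab(1,4) \<eta>M \<eta>(2)] by auto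
    have v: "?v \<in> borel_measurable (F m)" "L2 M ?v"
      using W_increment_F[OF i(1) c0 m(1) order_refl] \<eta>m L2_weighted_increment[OF i(1) c0 m(1) \<eta>M \<eta>(2)] by auto
    have v': "?v' \<in> borel_measurable (F m)" "L2 M ?v'"
      using W_increment_F[OF i(2) c0 m(1) order_refl] \<eta>m L2_weighted_increment[OF i(2) c0 m(1) \<eta>M \<eta>(2)] by auto
    note o1 = orthogonal_increment[OF i(2) c0 ab(3) u]
    note o2 = orthogonal_increment[OF i(2) m0 m(3) v]
    note o3 = orthogonal_increment[OF i(1) m0 m(2) v']
    have i\<eta>: "integrable M ?\<eta>"
      by (rule integrable_const_bound[of _ "C * C'"]) (use \<eta> \<eta>M in auto)
    have o4: "(\<integral>\<omega>. ?v \<omega> * (W j m \<omega> - W j c \<omega>) \<partial>M) = (if i = j then (m - c) * (\<integral>\<omega>. ?\<eta> \<omega> \<partial>M) else 0)"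
      using past_mult_two_increments[OF i c0 m(1) \<eta>(1) i\<eta>] by simp
    have i4: "integrable M (\<lambda>\<omega>. ?v \<omega> * (W j m \<omega> - W j c \<omega>))"
      by (rule L2_mult[OF v(2) L2_increment]) (use i m c0 in auto)
    \<comment> \<open>The increments are cut at \<open>c\<close> and \<open>m\<close>. The product
      of the two parts after \<open>m\<close> is missing because \<open>m\<close> is
      \<open>b\<close> or \<open>d\<close>, so that one of them vanishes.\<close>
    have e: "(\<xi> \<omega> * (W i b \<omega> - W i a \<omega>)) * (\<xi>' \<omega> * (W j d \<omega> - W j c \<omega>))
        = ?u \<omega> * (W j d \<omega> - W j c \<omega>) + ?v \<omega> * (W j d \<omega> - W j m \<omega>) + ?v' \<omega> * (W i b \<omega> - W i m \<omega>)
         + ?v \<omega> * (W j m \<omega> - W j c \<omega>)" for \<omega>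
      using m(4) by (auto simp: algebra_simps)
    have "(\<integral>\<omega>. (\<xi> \<omega> * (W i b \<omega> - W i a \<omega>)) * (\<xi>' \<omega> * (W j d \<omega> - W j c \<omega>)) \<partial>M)
       = (if i = j then (m - c) * (\<integral>\<omega>. ?\<eta> \<omega> \<partial>M) else 0)"
      unfolding e using o1 o2 o3 o4 i4 by (simp del: if_split)
    then show ?thesis using False ab m by (auto simp: m_def max_def)
  qed
qed

lemma weighted_increments_inner:
  assumes i: "i \<in> {0, 1}" "j \<in> {0, 1}" and ab: "0 \<le> a" "a \<le> b" "0 \<le> c" "c \<le> d"
    and \<xi>: "\<xi> \<in> borel_measurable (F a)" "\<And>\<omega>. \<omega> \<in> space M \<Longrightarrow> \<bar>\<xi> \<omega>\<bar> \<le> C"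
    and \<xi>': "\<xi>' \<in> borel_measurable (F c)" "\<And>\<omega>. \<omega> \<in> space M \<Longrightarrow> \<bar>\<xi>' \<omega>\<bar> \<le> C'"
  shows "(\<integral>\<omega>. (\<xi> \<omega> * (W i b \<omega> - W i a \<omega>)) * (\<xi>' \<omega> * (W j d \<omega> - W j c \<omega>)) \<partial>M)
    = (if i = j then max 0 (min b d - max a c) * (\<integral>\<omega>. \<xi> \<omega> * \<xi>' \<omega> \<partial>M) else 0)"
proof (cases "a \<le> c")
  case True
  then show ?thesis using weighted_increments_inner_aux[OF i ab(1,2,4) True \<xi> \<xi>'] by simp
next
  case False
  then have ca: "c \<le> a" by simp
  have "(\<integral>\<omega>. (\<xi> \<omega> * (W i b \<omega> - W i a \<omega>)) * (\<xi>' \<omega> * (W j d \<omega> - W j c \<omega>)) \<partial>M)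
      = (\<integral>\<omega>. (\<xi>' \<omega> * (W j d \<omega> - W j c \<omega>)) * (\<xi> \<omega> * (W i b \<omega> - W i a \<omega>)) \<partial>M)"
    by (simp add: mult_ac)
  also have "\<dots> = (if j = i then max 0 (min d b - max c a) * (\<integral>\<omega>. \<xi>' \<omega> * \<xi> \<omega> \<partial>M) else 0)"
    by (rule weighted_increments_inner_aux[OF i(2,1) ab(3,4,2) ca \<xi>' \<xi>])
  finally show ?thesis by (auto simp: min.commute max.commute mult.commute)
qed

text \<open>Duality for one term of a simple integral. The part of the increment after
  \<open>\<tau>\<close> is orthogonal to the density, which is known by then; on the part up to
  \<open>m = min b \<tau>\<close> the Girsanov shift of the mean applies.\<close>

lemma weighted_increment_dens:
  assumes i: "i \<in> {0, 1}" and ab: "0 \<le> s" "s \<le> \<tau>" "s \<le> a" "a \<le> b"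
    and \<xi>: "\<xi> \<in> borel_measurable (F a)" "\<And>\<omega>. \<omega> \<in> space M \<Longrightarrow> \<bar>\<xi> \<omega>\<bar> \<le> C"
  shows "(\<integral>\<omega>. dens k0 k1 s \<tau> \<omega> * (\<xi> \<omega> * (W i b \<omega> - W i a \<omega>)) \<partial>M)
    = - (if i = 0 then k0 else k1) * max 0 (min b \<tau> - a) * (\<integral>\<omega>. dens k0 k1 s \<tau> \<omega> * \<xi> \<omega> \<partial>M)"
proof -
  let ?d = "dens k0 k1" and ?k = "if i = 0 then k0 else k1"
  have a0: "0 \<le> a" using ab by simp
  note \<xi>M = F_M[OF \<xi>(1)]
  have d\<xi>: "L2 M (\<lambda>\<omega>. \<xi> \<omega> * ?d s u \<omega>)" if "s \<le> u" for u
    by (rule L2_bounded_mult[OF L2_dens \<xi>M \<xi>(2)]) (use ab that in auto)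
  show ?thesis
  proof (cases "\<tau> \<le> a")
    case True
    have "(\<lambda>\<omega>. \<xi> \<omega> * ?d s \<tau> \<omega>) \<in> borel_measurable (F a)"
      using \<xi>(1) dens_F[of s a \<tau> k0 k1] ab True by simp
    then have "(\<integral>\<omega>. (\<xi> \<omega> * ?d s \<tau> \<omega>) * (W i b \<omega> - W i a \<omega>) \<partial>M) = 0"
      using orthogonal_increment[OF i a0 ab(4)] d\<xi>[OF ab(2)] by blast
    then show ?thesis using True by (simp add: mult_ac)
  next
    case False
    define m where "m = min b \<tau>"
    have m: "a \<le> m" "m \<le> b" "m \<le> \<tau>" "m = b \<or> m = \<tau>" "0 \<le> m" using False ab by (auto simp: m_def)
    let ?Y = "\<lambda>\<omega>. (\<xi> \<omega> * ?d s \<tau> \<omega>) * (W i b \<omega> - W i m \<omega>)"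
    have Y: "(\<integral>\<omega>. ?Y \<omega> \<partial>M) = 0 \<and> integrable M ?Y"
    proof (cases "m = b")
      case False
      then have "m = \<tau>" using m by simp
      have "(\<lambda>\<omega>. \<xi> \<omega> * ?d s \<tau> \<omega>) \<in> borel_measurable (F m)"
        using F_mono[OF \<xi>(1) m(1)] dens_F[of s m \<tau> k0 k1] ab \<open>m = \<tau>\<close> by simp
      then show ?thesis using orthogonal_increment[OF i m(5) m(2)] d\<xi>[OF ab(2)] by blast
    qed simp
    \<comment> \<open>The density is factored at \<open>a\<close> and at \<open>m\<close>:
      \<open>?X\<close> is known at time \<open>a\<close>, and the last factor, from
      \<open>m\<close> to \<open>\<tau>\<close>, is removed by the martingale property.\<close>
    let ?X = "\<lambda>\<omega>. \<xi> \<omega> * ?d s a \<omega>"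
    have X: "?X \<in> borel_measurable (F a)" "integrable M ?X"
      using \<xi>(1) dens_F[of s a a k0 k1] ab d\<xi>[OF ab(3), THEN L2_integrable] by auto
    let ?Z = "\<lambda>\<omega>. ?X \<omega> * (W i m \<omega> - W i a \<omega>) * ?d a m \<omega>"
    have Z: "?Z \<in> borel_measurable (F m)" "integrable M ?Z"
      using F_mono[OF X(1) m(1)] W_increment_F[OF i a0 m(1) order_refl] dens_F[of a m m k0 k1] a0 m
        integrable_past_increment_dens[OF i a0 m(1) X] by auto
    have "(\<integral>\<omega>. ?Z \<omega> * ?d m \<tau> \<omega> \<partial>M) = - ?k * (m - a) * (\<integral>\<omega>. ?X \<omega> \<partial>M)"
      using integral_past_dens[OF m(5,3) Z] integral_past_increment_dens[OF i a0 m(1) X] by simp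
    moreover have "integrable M (\<lambda>\<omega>. ?Z \<omega> * ?d m \<tau> \<omega>)" by (rule integrable_past_dens[OF m(5,3) Z])
    moreover have "(\<integral>\<omega>. ?X \<omega> \<partial>M) = (\<integral>\<omega>. ?d s \<tau> \<omega> * \<xi> \<omega> \<partial>M)"
    proof -
      have "(\<integral>\<omega>. ?d s \<tau> \<omega> * \<xi> \<omega> \<partial>M) = (\<integral>\<omega>. ?X \<omega> * ?d a \<tau> \<omega> \<partial>M)"
        by (simp only: mult.assoc dens_mult) (simp only: mult.commute)
      also have "\<dots> = (\<integral>\<omega>. ?X \<omega> \<partial>M)" using integral_past_dens[OF a0 _ X, of \<tau> k0 k1] False by simp
      finally show ?thesis by simp
    qed
    moreover have "?d s \<tau> \<omega> * (\<xi> \<omega> * (W i b \<omega> - W i a \<omega>)) = ?Z \<omega> * ?d m \<tau> \<omega> + ?Y \<omega>" for \<omega>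
    proof -
      have "?Z \<omega> * ?d m \<tau> \<omega> = \<xi> \<omega> * (W i m \<omega> - W i a \<omega>) * (?d s a \<omega> * (?d a m \<omega> * ?d m \<tau> \<omega>))"
        by (simp only: mult_ac)
      also have "\<dots> = \<xi> \<omega> * (W i m \<omega> - W i a \<omega>) * ?d s \<tau> \<omega>" by (simp only: dens_mult)
      finally show ?thesis by (simp add: algebra_simps)
    qed
    ultimately have "(\<integral>\<omega>. ?d s \<tau> \<omega> * (\<xi> \<omega> * (W i b \<omega> - W i a \<omega>)) \<partial>M) = - ?k * (m - a) * (\<integral>\<omega>. ?d s \<tau> \<omega> * \<xi> \<omega> \<partial>M)"
      using Y by (simp del: if_split)
    then show ?thesis using False m by (simp add: m_def max_def split: if_split_asm)
  qed
qed

text \<open>Integrands are treated as elements of L2 over this product. The scenario comes first and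
  time second, opposite to the order in \<open>progressively_measurable\<close>, hence
  \<open>H (snd z) (fst z)\<close> throughout.\<close>

abbreviation Q :: "real \<Rightarrow> real \<Rightarrow> ('w \<times> real) measure" where
  "Q s T \<equiv> M \<Otimes>\<^sub>M restrict_space lborel {s..T}"

lemma finite_measure_interval: "finite_measure (restrict_space lborel {s..T :: real})"
proof (rule finite_measureI)
  have "emeasure (restrict_space lborel {s..T}) (space (restrict_space lborel {s..T})) = emeasure lborel {s..T}"
    by (subst emeasure_restrict_space) (auto simp: space_restrict_space)
  then show "emeasure (restrict_space lborel {s..T}) (space (restrict_space lborel {s..T})) \<noteq> \<infinity>"
    by (simp add: emeasure_lborel_Icc_eq)
qed

lemma pair_sigma_finite_Q: "pair_sigma_finite M (restrict_space lborel {s..T :: real})"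
proof -
  interpret finite_measure "restrict_space lborel {s..T}" by (rule finite_measure_interval)
  show ?thesis by unfold_locales
qed

lemma finite_measure_Q: "finite_measure (Q s T)"
  by (rule finite_measure_pair_measure[OF finite_measure_interval finite_measure_axioms])

lemma space_Q: "space (Q s T) = space M \<times> {s..T}"
  by (simp add: space_pair_measure space_restrict_space)

lemma snd_Q [measurable]: "snd \<in> borel_measurable (Q s T)"
  by (rule measurable_compose[OF measurable_snd]) (simp add: measurable_restrict_space1)

lemma nn_integral_Q:
  assumes "f \<in> borel_measurable (Q s T)"
  shows "(\<integral>\<^sup>+\<omega>. (\<integral>\<^sup>+\<tau>\<in>{s..T}. f (\<omega>, \<tau>) \<partial>lborel) \<partial>M) = (\<integral>\<^sup>+z. f z \<partial>Q s T)"
proof -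
  interpret finite_measure "restrict_space lborel {s..T}" by (rule finite_measure_interval)
  show ?thesis by (simp add: nn_integral_fst[OF assms, symmetric] nn_integral_restrict_space)
qed

lemma
  assumes A: "A \<in> sets borel" and X: "integrable M X"
  shows integrable_Q_rect: "integrable (Q s T) (\<lambda>z. X (fst z) * indicator A (snd z))"
    and integral_Q_rect: "(\<integral>z. X (fst z) * indicator A (snd z) \<partial>Q s T) = measure lborel (A \<inter> {s..T}) * (\<integral>\<omega>. X \<omega> \<partial>M)"
proof -
  interpret P: pair_sigma_finite M "restrict_space lborel {s..T}" by (rule pair_sigma_finite_Q)
  interpret R: finite_measure "restrict_space lborel {s..T}" by (rule finite_measure_interval)
  have [measurable]: "X \<in> borel_measurable M" "(indicator A :: real \<Rightarrow> real) \<in> borel_measurable (restrict_space lborel {s..T})"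
    using X A by (auto intro!: measurable_restrict_space1)
  have iA: "integrable (restrict_space lborel {s..T}) (indicator A :: real \<Rightarrow> real)"
    by (rule R.integrable_const_bound[of _ 1]) auto
  have mA: "(\<integral>\<tau>. indicator A \<tau> \<partial>restrict_space lborel {s..T}) = measure lborel (A \<inter> {s..T})"
    using A by (subst integral_restrict_space) (auto simp: indicator_inter_arith[symmetric] mult.commute)
  show i: "integrable (Q s T) (\<lambda>z. X (fst z) * indicator A (snd z))"
  proof (rule P.Fubini_integrable)
    show "(\<lambda>z. X (fst z) * indicator A (snd z)) \<in> borel_measurable (Q s T)" by measurable
    show "integrable M (\<lambda>x. \<integral>y. norm (X (fst (x, y)) * indicator A (snd (x, y))) \<partial>restrict_space lborel {s..T})"
      using X iA by (simp add: abs_mult)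
    show "AE x in M. integrable (restrict_space lborel {s..T}) (\<lambda>y. X (fst (x, y)) * indicator A (snd (x, y)))"
      using iA by simp
  qed
  show "(\<integral>z. X (fst z) * indicator A (snd z) \<partial>Q s T) = measure lborel (A \<inter> {s..T}) * (\<integral>\<omega>. X \<omega> \<partial>M)"
    using iA mA by (subst P.integral_fst'[OF i, symmetric]) (simp add: mult.commute)
qed

section \<open>Isometry and duality for simple integrals\<close>

lemma simple_integrand_bounds:
  assumes "simple_integrand M F s T n p \<xi>" "l \<le> m" "m \<le> n"
  shows "p l \<le> p m" "s \<le> p l" "p m \<le> T"
proof -
  have step: "p i \<le> p (Suc i)" if "i < n" for i using assms that by (auto simp: simple_integrand_def)
  have mono: "p i \<le> p j" if "i \<le> j" "j \<le> n" for i j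
    using that(1,2) by (induction j rule: dec_induct) (auto intro: order_trans[OF _ step])
  show "p l \<le> p m" "s \<le> p l" "p m \<le> T"
    using mono[of l m] mono[of 0 l] mono[of m n] assms by (auto simp: simple_integrand_def)
qed

lemma simple_integrand_weight:
  assumes "simple_integrand M F s T n p \<xi>"
  obtains C where "\<And>l. l < n \<Longrightarrow> \<xi> l \<in> borel_measurable (F (p l))"
    "\<And>l \<omega>. l < n \<Longrightarrow> \<omega> \<in> space M \<Longrightarrow> \<bar>\<xi> l \<omega>\<bar> \<le> C"
  using assms unfolding simple_integrand_def by blast

text \<open>When \<open>t \<le> a\<close> the increment vanishes identically, so that the weight need not be known at
  time \<open>min a t\<close>.\<close>

lemma stopped_term:
  fixes \<xi> :: "'w \<Rightarrow> real"
  assumes i: "i \<in> {0, 1}" and ab: "0 \<le> a" "a \<le> b" "0 \<le> t" and \<xi>: "\<xi> \<in> borel_measurable (F a)"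
     "\<And>\<omega>. \<omega> \<in> space M \<Longrightarrow> \<bar>\<xi> \<omega>\<bar> \<le> C"
  shows "L2 M (\<lambda>\<omega>. \<xi> \<omega> * (W i (min b t) \<omega> - W i (min a t) \<omega>))"
    and "(\<lambda>\<omega>. \<xi> \<omega> * (W i (min b t) \<omega> - W i (min a t) \<omega>)) \<in> borel_measurable (F t)"
proof -
  have "L2 M (\<lambda>\<omega>. \<xi> \<omega> * (W i (min b t) \<omega> - W i (min a t) \<omega>)) \<and>
    (\<lambda>\<omega>. \<xi> \<omega> * (W i (min b t) \<omega> - W i (min a t) \<omega>)) \<in> borel_measurable (F t)"
  proof (cases "t \<le> a")
    case True
    then show ?thesis using ab L2_const[of 0] by (simp add: min_absorb2)
  next
    case False
    then have ba: "a \<le> min b t" using ab by simp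
    show ?thesis
      using L2_weighted_increment[OF i ab(1) ba F_M[OF \<xi>(1)] \<xi>(2)] F_mono[OF \<xi>(1), of t]
        W_increment_F[OF i ab(1) ba, of t] False by (simp add: min_absorb1)
  qed
  then show "L2 M (\<lambda>\<omega>. \<xi> \<omega> * (W i (min b t) \<omega> - W i (min a t) \<omega>))"
    "(\<lambda>\<omega>. \<xi> \<omega> * (W i (min b t) \<omega> - W i (min a t) \<omega>)) \<in> borel_measurable (F t)" by blast+
qed

lemma
  assumes i: "i \<in> {0, 1}" and s: "0 \<le> s" "0 \<le> t" and S: "simple_integrand M F s T n p \<xi>"
  shows simple_integral_L2: "L2 M (simple_integral (W i) n p \<xi> t)"
    and simple_integral_F: "simple_integral (W i) n p \<xi> t \<in> borel_measurable (F t)"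
proof -
  obtain C where C: "\<And>l. l < n \<Longrightarrow> \<xi> l \<in> borel_measurable (F (p l))"
    "\<And>l \<omega>. l < n \<Longrightarrow> \<omega> \<in> space M \<Longrightarrow> \<bar>\<xi> l \<omega>\<bar> \<le> C" by (rule simple_integrand_weight[OF S]) blast
  have b: "0 \<le> p l" "p l \<le> p (Suc l)" if "l < n" for l
    using simple_integrand_bounds[OF S, of l "Suc l"] that s by auto
  show "L2 M (simple_integral (W i) n p \<xi> t)" "simple_integral (W i) n p \<xi> t \<in> borel_measurable (F t)"
    unfolding simple_integral_def[abs_def]
    by (intro L2_sum borel_measurable_sum stopped_term[OF i b s(2) C]; simp)+
qed

text \<open>Stopping both terms at \<open>t\<close> amounts to restricting the integrands to
  \<open>{..t}\<close>, and that is the form which survives the passage to limits.\<close>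

lemma stopped_terms_inner:
  fixes \<xi> \<xi>' :: "'w \<Rightarrow> real"
  assumes i: "i \<in> {0, 1}" "j \<in> {0, 1}" and ab: "0 \<le> s" "s \<le> a" "a \<le> b" "b \<le> T" "s \<le> c" "c \<le> d" "d \<le> T" "s \<le> t"
    and \<xi>: "\<xi> \<in> borel_measurable (F a)" "\<And>\<omega>. \<omega> \<in> space M \<Longrightarrow> \<bar>\<xi> \<omega>\<bar> \<le> C"
    and \<xi>': "\<xi>' \<in> borel_measurable (F c)" "\<And>\<omega>. \<omega> \<in> space M \<Longrightarrow> \<bar>\<xi>' \<omega>\<bar> \<le> C'"
  shows "(\<integral>\<omega>. (\<xi> \<omega> * (W i (min b t) \<omega> - W i (min a t) \<omega>)) * (\<xi>' \<omega> * (W j (min d t) \<omega> - W j (min c t) \<omega>)) \<partial>M)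
    = (if i = j then \<integral>z. (\<xi> (fst z) * \<xi>' (fst z)) * indicator ({a<..b} \<inter> {c<..d} \<inter> {..t}) (snd z) \<partial>Q s T else 0)"
proof -
  have C: "0 \<le> C" if "\<omega> \<in> space M" for \<omega> using \<xi>(2)[OF that] by linarith
  have i\<eta>: "integrable M (\<lambda>\<omega>. \<xi> \<omega> * \<xi>' \<omega>)"
    by (rule integrable_const_bound[of _ "C * C'"])
      (use F_M[OF \<xi>(1)] F_M[OF \<xi>'(1)] \<xi>(2) \<xi>'(2) C in \<open>auto simp: abs_mult intro!: AE_I2 mult_mono\<close>)
  have set: "{a<..b} \<inter> {c<..d} \<inter> {..t} \<inter> {s..T} = {max a c<..min (min b d) t}" using ab by auto
  have "measure lborel ({a<..b} \<inter> {c<..d} \<inter> {..t} \<inter> {s..T}) = max 0 (min (min b d) t - max a c)"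
    unfolding set by (rule measure_lborel_Ioc_max)
  then have R: "(\<integral>z. (\<xi> (fst z) * \<xi>' (fst z)) * indicator ({a<..b} \<inter> {c<..d} \<inter> {..t}) (snd z) \<partial>Q s T)
      = max 0 (min (min b d) t - max a c) * (\<integral>\<omega>. \<xi> \<omega> * \<xi>' \<omega> \<partial>M)"
    using integral_Q_rect[OF _ i\<eta>, of "{a<..b} \<inter> {c<..d} \<inter> {..t}"] by simp
  show ?thesis
  proof (cases "t \<le> a \<or> t \<le> c")
    case True
    then have "max 0 (min (min b d) t - max a c) = 0" by auto
    moreover have "(\<lambda>\<omega>. (\<xi> \<omega> * (W i (min b t) \<omega> - W i (min a t) \<omega>)) * (\<xi>' \<omega> * (W j (min d t) \<omega> - W j (min c t) \<omega>))) = (\<lambda>\<omega>. 0)"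
      using True ab by (auto simp: fun_eq_iff min_absorb2)
    ultimately show ?thesis unfolding R by simp
  next
    case False
    then have m: "min a t = a" "min c t = c" by auto
    have "(\<integral>\<omega>. (\<xi> \<omega> * (W i (min b t) \<omega> - W i a \<omega>)) * (\<xi>' \<omega> * (W j (min d t) \<omega> - W j c \<omega>)) \<partial>M)
       = (if i = j then max 0 (min (min b t) (min d t) - max a c) * (\<integral>\<omega>. \<xi> \<omega> * \<xi>' \<omega> \<partial>M) else 0)"
      by (rule weighted_increments_inner[OF i _ _ _ _ \<xi> \<xi>']) (use ab False in auto)
    moreover have "min (min b t) (min d t) = min (min b d) t" by auto
    ultimately show ?thesis unfolding R m by simp
  qed
qed

lemma simple_process_measurable:
  assumes "simple_integrand M F s T n p \<xi>"
  shows "(\<lambda>z. simple_process n p \<xi> (snd z) (fst z)) \<in> borel_measurable (Q s T)"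
proof -
  obtain C where C: "\<And>l. l < n \<Longrightarrow> \<xi> l \<in> borel_measurable (F (p l))"
    by (rule simple_integrand_weight[OF assms]) blast
  have m: "\<xi> l \<in> borel_measurable M" if "l < n" for l using F_M[OF C[OF that]] .
  show ?thesis unfolding simple_process_def
    by (intro borel_measurable_sum borel_measurable_times measurable_compose[OF measurable_fst m]
        measurable_compose[OF snd_Q]) auto
qed

lemma simple_process_L2:
  assumes S: "simple_integrand M F s T n p \<xi>"
  shows "L2 (Q s T) (\<lambda>z. simple_process n p \<xi> (snd z) (fst z))"
proof -
  obtain C where C: "\<And>l. l < n \<Longrightarrow> \<xi> l \<in> borel_measurable (F (p l))"
    "\<And>l \<omega>. l < n \<Longrightarrow> \<omega> \<in> space M \<Longrightarrow> \<bar>\<xi> l \<omega>\<bar> \<le> C" by (rule simple_integrand_weight[OF S]) blast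
  interpret R: finite_measure "Q s T" by (rule finite_measure_Q)
  show ?thesis
  proof (rule L2_bound[OF R.L2_const[of "\<Sum>l<n. \<bar>C\<bar>"] simple_process_measurable[OF S]], rule AE_I2)
    fix z assume z: "z \<in> space (Q s T)"
    have "\<bar>simple_process n p \<xi> (snd z) (fst z)\<bar> \<le> (\<Sum>l<n. \<bar>\<xi> l (fst z) * indicator {p l<..p (Suc l)} (snd z)\<bar>)"
      unfolding simple_process_def by (rule sum_abs)
    also have "\<dots> \<le> (\<Sum>l<n. \<bar>C\<bar>)"
    proof (rule sum_mono)
      fix l assume l: "l \<in> {..<n}"
      have "\<bar>\<xi> l (fst z)\<bar> \<le> \<bar>C\<bar>" using C(2)[of l "fst z"] z l by (auto simp: space_Q)
      then show "\<bar>\<xi> l (fst z) * indicator {p l<..p (Suc l)} (snd z)\<bar> \<le> \<bar>C\<bar>" by (auto simp: indicator_def)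
    qed
    finally show "\<bar>simple_process n p \<xi> (snd z) (fst z)\<bar> \<le> \<bar>\<Sum>l<n. \<bar>C\<bar>\<bar>" by linarith
  qed
qed

text \<open>The polarised Ito isometry for two unrelated partitions. No common refinement is formed,
  since the inner products of single terms already account for overlaps.\<close>

lemma simple_integrals_inner:
  assumes i: "i \<in> {0, 1}" "j \<in> {0, 1}" and s: "0 \<le> s" "s \<le> t"
    and S: "simple_integrand M F s T n p \<xi>" and S': "simple_integrand M F s T n' p' \<xi>'"
  shows "(\<integral>\<omega>. simple_integral (W i) n p \<xi> t \<omega> * simple_integral (W j) n' p' \<xi>' t \<omega> \<partial>M)
    = (if i = j then \<integral>z. (simple_process n p \<xi> (snd z) (fst z) * indicator {..t} (snd z))
         * (simple_process n' p' \<xi>' (snd z) (fst z) * indicator {..t} (snd z)) \<partial>Q s T else 0)"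
proof -
  obtain C where C: "\<And>l. l < n \<Longrightarrow> \<xi> l \<in> borel_measurable (F (p l))"
    "\<And>l \<omega>. l < n \<Longrightarrow> \<omega> \<in> space M \<Longrightarrow> \<bar>\<xi> l \<omega>\<bar> \<le> C" by (rule simple_integrand_weight[OF S]) blast
  obtain C' where C': "\<And>l. l < n' \<Longrightarrow> \<xi>' l \<in> borel_measurable (F (p' l))"
    "\<And>l \<omega>. l < n' \<Longrightarrow> \<omega> \<in> space M \<Longrightarrow> \<bar>\<xi>' l \<omega>\<bar> \<le> C'" by (rule simple_integrand_weight[OF S']) blast
  have b: "s \<le> p l" "p l \<le> p (Suc l)" "p (Suc l) \<le> T" if "l < n" for l
    using simple_integrand_bounds[OF S, of l "Suc l"] that by auto
  have b': "s \<le> p' l" "p' l \<le> p' (Suc l)" "p' (Suc l) \<le> T" if "l < n'" for l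
    using simple_integrand_bounds[OF S', of l "Suc l"] that by auto
  let ?J = "\<lambda>l \<omega>. \<xi> l \<omega> * (W i (min (p (Suc l)) t) \<omega> - W i (min (p l) t) \<omega>)"
  let ?J' = "\<lambda>l \<omega>. \<xi>' l \<omega> * (W j (min (p' (Suc l)) t) \<omega> - W j (min (p' l) t) \<omega>)"
  let ?R = "\<lambda>l m z. (\<xi> l (fst z) * \<xi>' m (fst z)) * indicator ({p l<..p (Suc l)} \<inter> {p' m<..p' (Suc m)} \<inter> {..t}) (snd z) :: real"
  have LJ: "L2 M (?J l)" if "l < n" for l
    by (rule stopped_term(1)[OF i(1) _ _ _ C]) (use b[OF that] s that in auto)
  have LJ': "L2 M (?J' l)" if "l < n'" for l
    by (rule stopped_term(1)[OF i(2) _ _ _ C']) (use b'[OF that] s that in auto)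
  have iR: "integrable (Q s T) (?R l m)" if "l < n" "m < n'" for l m
  proof (rule integrable_Q_rect)
    have "0 \<le> C" if "\<omega> \<in> space M" for \<omega> using C(2)[OF \<open>l < n\<close> that] by linarith
    then show "integrable M (\<lambda>\<omega>. \<xi> l \<omega> * \<xi>' m \<omega>)"
      using F_M[OF C(1)[OF that(1)]] F_M[OF C'(1)[OF that(2)]] C(2) C'(2) that
      by (intro integrable_const_bound[of _ "C * C'"]) (auto simp: abs_mult intro!: AE_I2 mult_mono)
  qed auto
  have "(\<integral>\<omega>. simple_integral (W i) n p \<xi> t \<omega> * simple_integral (W j) n' p' \<xi>' t \<omega> \<partial>M)
      = (\<Sum>l<n. \<Sum>m<n'. \<integral>\<omega>. ?J l \<omega> * ?J' m \<omega> \<partial>M)"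
  proof -
    have "(\<integral>\<omega>. simple_integral (W i) n p \<xi> t \<omega> * simple_integral (W j) n' p' \<xi>' t \<omega> \<partial>M)
        = (\<Sum>l<n. \<integral>\<omega>. (\<Sum>m<n'. ?J l \<omega> * ?J' m \<omega>) \<partial>M)"
      unfolding simple_integral_def sum_product
      by (rule Bochner_Integration.integral_sum) (auto intro!: Bochner_Integration.integrable_sum L2_mult[OF LJ LJ'])
    also have "\<dots> = (\<Sum>l<n. \<Sum>m<n'. \<integral>\<omega>. ?J l \<omega> * ?J' m \<omega> \<partial>M)"
      by (intro sum.cong refl Bochner_Integration.integral_sum L2_mult[OF LJ LJ']) auto
    finally show ?thesis .
  qed
  also have "\<dots> = (\<Sum>l<n. \<Sum>m<n'. if i = j then \<integral>z. ?R l m z \<partial>Q s T else 0)"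
    by (intro sum.cong refl stopped_terms_inner[OF i s(1) _ _ _ _ _ _ s(2) C C']) (use b b' in auto)
  also have "\<dots> = (if i = j then \<Sum>l<n. \<Sum>m<n'. \<integral>z. ?R l m z \<partial>Q s T else 0)" by simp
  also have "(\<Sum>l<n. \<Sum>m<n'. \<integral>z. ?R l m z \<partial>Q s T) = (\<integral>z. (\<Sum>l<n. \<Sum>m<n'. ?R l m z) \<partial>Q s T)"
  proof -
    have "(\<Sum>l<n. \<Sum>m<n'. \<integral>z. ?R l m z \<partial>Q s T) = (\<Sum>l<n. \<integral>z. (\<Sum>m<n'. ?R l m z) \<partial>Q s T)"
      by (intro sum.cong refl Bochner_Integration.integral_sum[symmetric] iR) auto
    also have "\<dots> = (\<integral>z. (\<Sum>l<n. \<Sum>m<n'. ?R l m z) \<partial>Q s T)"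
      by (intro Bochner_Integration.integral_sum[symmetric] Bochner_Integration.integrable_sum iR) auto
    finally show ?thesis .
  qed
  also have "(\<lambda>z. \<Sum>l<n. \<Sum>m<n'. ?R l m z) = (\<lambda>z. (simple_process n p \<xi> (snd z) (fst z) * indicator {..t} (snd z))
         * (simple_process n' p' \<xi>' (snd z) (fst z) * indicator {..t} (snd z)))"
    unfolding simple_process_def sum_distrib_right sum_product
    by (intro ext sum.cong refl) (auto simp: indicator_def sum_distrib_left)
  finally show ?thesis .
qed

text \<open>The times of the density and of the integral are independent of each other, because both
  orders occur later: the density at \<open>T\<close> tests integrals at earlier times, and
  densities at earlier times test an integral at \<open>t\<close>.\<close>

lemma simple_integral_dens:
  assumes i: "i \<in> {0, 1}" and s: "0 \<le> s" "s \<le> t" "s \<le> \<tau>"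
    and S: "simple_integrand M F s T n p \<xi>"
  shows "(\<integral>\<omega>. dens k0 k1 s \<tau> \<omega> * simple_integral (W i) n p \<xi> t \<omega> \<partial>M)
    = - (if i = 0 then k0 else k1) * (\<integral>z. (simple_process n p \<xi> (snd z) (fst z) * indicator {..t} (snd z))
         * (dens k0 k1 s \<tau> (fst z) * indicator {..\<tau>} (snd z)) \<partial>Q s T)"
proof -
  let ?k = "if i = 0 then k0 else k1"
  obtain C where C: "\<And>l. l < n \<Longrightarrow> \<xi> l \<in> borel_measurable (F (p l))"
    "\<And>l \<omega>. l < n \<Longrightarrow> \<omega> \<in> space M \<Longrightarrow> \<bar>\<xi> l \<omega>\<bar> \<le> C" by (rule simple_integrand_weight[OF S]) blast
  have b: "s \<le> p l" "p l \<le> p (Suc l)" "p (Suc l) \<le> T" if "l < n" for l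
    using simple_integrand_bounds[OF S, of l "Suc l"] that by auto
  let ?J = "\<lambda>l \<omega>. \<xi> l \<omega> * (W i (min (p (Suc l)) t) \<omega> - W i (min (p l) t) \<omega>)"
  let ?R = "\<lambda>l z. (dens k0 k1 s \<tau> (fst z) * \<xi> l (fst z)) * indicator ({p l<..p (Suc l)} \<inter> {..min t \<tau>}) (snd z) :: real"
  have LJ: "L2 M (?J l)" if "l < n" for l
    by (rule stopped_term(1)[OF i _ _ _ C]) (use b[OF that] s that in auto)
  have Ld: "L2 M (dens k0 k1 s \<tau>)" using s by (intro L2_dens)
  have id: "integrable M (\<lambda>\<omega>. dens k0 k1 s \<tau> \<omega> * \<xi> l \<omega>)" if "l < n" for l
    using L2_bounded_mult[OF Ld F_M[OF C(1)[OF that]] C(2)[OF that], THEN L2_integrable] by (simp add: mult.commute)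
  have iR: "integrable (Q s T) (?R l)" if "l < n" for l
    by (rule integrable_Q_rect[OF _ id[OF that]]) auto
  have tm: "(\<integral>\<omega>. dens k0 k1 s \<tau> \<omega> * ?J l \<omega> \<partial>M) = - ?k * (\<integral>z. ?R l z \<partial>Q s T)" if l: "l < n" for l
  proof -
    have set: "{p l<..p (Suc l)} \<inter> {..min t \<tau>} \<inter> {s..T} = {p l<..min (p (Suc l)) (min t \<tau>)}" using b[OF l] by auto
    have "measure lborel ({p l<..p (Suc l)} \<inter> {..min t \<tau>} \<inter> {s..T}) = max 0 (min (p (Suc l)) (min t \<tau>) - p l)"
      unfolding set by (rule measure_lborel_Ioc_max)
    then have R: "(\<integral>z. ?R l z \<partial>Q s T) = max 0 (min (p (Suc l)) (min t \<tau>) - p l) * (\<integral>\<omega>. dens k0 k1 s \<tau> \<omega> * \<xi> l \<omega> \<partial>M)"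
      using integral_Q_rect[OF _ id[OF l], of "{p l<..p (Suc l)} \<inter> {..min t \<tau>}"] by simp
    show ?thesis
    proof (cases "t \<le> p l")
      case True
      then have "max 0 (min (p (Suc l)) (min t \<tau>) - p l) = 0" by auto
      moreover have "min (p (Suc l)) t = t" "min (p l) t = t" using True b[OF l] by auto
      ultimately show ?thesis unfolding R by simp
    next
      case False
      then have m: "min (p l) t = p l" by simp
      have "(\<integral>\<omega>. dens k0 k1 s \<tau> \<omega> * (\<xi> l \<omega> * (W i (min (p (Suc l)) t) \<omega> - W i (p l) \<omega>)) \<partial>M)
        = - ?k * max 0 (min (min (p (Suc l)) t) \<tau> - p l) * (\<integral>\<omega>. dens k0 k1 s \<tau> \<omega> * \<xi> l \<omega> \<partial>M)"
        by (rule weighted_increment_dens[OF i s(1,3) _ _ C(1)[OF l] C(2)[OF l]]) (use b[OF l] False in auto)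
      then show ?thesis unfolding R m by (simp add: min.assoc)
    qed
  qed
  have "(\<integral>\<omega>. dens k0 k1 s \<tau> \<omega> * simple_integral (W i) n p \<xi> t \<omega> \<partial>M)
      = (\<Sum>l<n. \<integral>\<omega>. dens k0 k1 s \<tau> \<omega> * ?J l \<omega> \<partial>M)"
    unfolding simple_integral_def sum_distrib_left
    by (rule Bochner_Integration.integral_sum) (auto intro: L2_mult[OF Ld LJ])
  also have "\<dots> = (\<Sum>l<n. - ?k * (\<integral>z. ?R l z \<partial>Q s T))" by (intro sum.cong refl tm) simp
  also have "\<dots> = - ?k * (\<integral>z. (\<Sum>l<n. ?R l z) \<partial>Q s T)"
    unfolding sum_distrib_left[symmetric] by (subst Bochner_Integration.integral_sum) (auto intro: iR)
  also have "(\<lambda>z. \<Sum>l<n. ?R l z) = (\<lambda>z. (simple_process n p \<xi> (snd z) (fst z) * indicator {..t} (snd z))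
         * (dens k0 k1 s \<tau> (fst z) * indicator {..\<tau>} (snd z)))"
    unfolding simple_process_def sum_distrib_right
    by (intro ext sum.cong refl) (auto simp: indicator_def)
  finally show ?thesis .
qed

section \<open>Passage to general integrands\<close>

lemma progressive_Q:
  assumes "progressively_measurable F s T H" "s \<le> T"
  shows "(\<lambda>z. H (snd z) (fst z)) \<in> borel_measurable (Q s T)"
proof -
  have H: "(\<lambda>(\<tau>, \<omega>). H \<tau> \<omega>) \<in> borel_measurable (restrict_space borel {s..T} \<Otimes>\<^sub>M F T)"
    using assms by (auto simp: progressively_measurable_def)
  have "(\<lambda>z. (snd z, fst z)) \<in> Q s T \<rightarrow>\<^sub>M restrict_space borel {s..T} \<Otimes>\<^sub>M F T"
  proof (rule measurable_Pair)
    show "snd \<in> Q s T \<rightarrow>\<^sub>M restrict_space borel {s..T}"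
      by (rule measurable_restrict_space2) (auto simp: space_Q)
    have "(\<lambda>\<omega>. \<omega>) \<in> M \<rightarrow>\<^sub>M F T"
      by (rule F_M[of _ T]) simp
    then show "fst \<in> Q s T \<rightarrow>\<^sub>M F T" by (rule measurable_compose[OF measurable_fst])
  qed
  from measurable_compose[OF this H] show ?thesis by simp
qed

lemma square_integrable_L2:
  assumes "progressively_measurable F s T H" "square_integrable_process M s T H" "s \<le> T"
  shows "L2 (Q s T) (\<lambda>z. H (snd z) (fst z))"
  unfolding L2_iff_nn
  using progressive_Q[OF assms(1,3)] assms(2) nn_integral_Q[of "\<lambda>z. ennreal ((H (snd z) (fst z))\<^sup>2)" s T]
  by (simp add: square_integrable_process_def)

text \<open>One approximating sequence serves all times, and convergence of the integrands is
  rewritten as convergence in L2 over the product.\<close>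

lemma ito_approx:
  assumes I: "is_ito_integral M F (W i) s T H I" and i: "i \<in> {0, 1}" and s: "0 \<le> s" "s \<le> T"
  obtains n p \<xi> where "\<And>k. simple_integrand M F s T (n k) (p k) (\<xi> k)"
    "L2_lim (Q s T) (\<lambda>k z. simple_process (n k) (p k) (\<xi> k) (snd z) (fst z)) (\<lambda>z. H (snd z) (fst z))"
    "\<And>t. t \<in> {s..T} \<Longrightarrow> L2_lim M (\<lambda>k. simple_integral (W i) (n k) (p k) (\<xi> k) t) (I t)"
proof -
  obtain n p \<xi> where a: "\<And>k. simple_integrand M F s T (n k) (p k) (\<xi> k)"
    "(\<lambda>k. \<integral>\<^sup>+\<omega>. (\<integral>\<^sup>+\<tau>\<in>{s..T}.
            ennreal ((H \<tau> \<omega> - simple_process (n k) (p k) (\<xi> k) \<tau> \<omega>)\<^sup>2) \<partial>lborel) \<partial>M) \<longlonglongrightarrow> 0"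
    "\<And>t. t \<in> {s..T} \<Longrightarrow> (\<lambda>k. \<integral>\<^sup>+\<omega>. ennreal ((I t \<omega> - simple_integral (W i) (n k) (p k) (\<xi> k) t \<omega>)\<^sup>2) \<partial>M) \<longlonglongrightarrow> 0"
    using I unfolding is_ito_integral_def by blast
  have H: "(\<lambda>z. H (snd z) (fst z)) \<in> borel_measurable (Q s T)"
    using I s by (intro progressive_Q) (auto simp: is_ito_integral_def)
  have "(\<integral>\<^sup>+\<omega>. (\<integral>\<^sup>+\<tau>\<in>{s..T}. ennreal ((H \<tau> \<omega> - simple_process (n k) (p k) (\<xi> k) \<tau> \<omega>)\<^sup>2) \<partial>lborel) \<partial>M)
    = (\<integral>\<^sup>+z. ennreal ((H (snd z) (fst z) - simple_process (n k) (p k) (\<xi> k) (snd z) (fst z))\<^sup>2) \<partial>Q s T)" for k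
    using nn_integral_Q[of "\<lambda>z. ennreal ((H (snd z) (fst z) - simple_process (n k) (p k) (\<xi> k) (snd z) (fst z))\<^sup>2)" s T]
      H simple_process_measurable[OF a(1)] by simp
  then show ?thesis using that[OF a(1)] a(2,3) by (simp add: L2_lim_def)
qed

lemma
  assumes I: "is_ito_integral M F (W i) s T H I" and i: "i \<in> {0, 1}" and s: "0 \<le> s" "s \<le> T"
  shows ito_L2: "t \<in> {s..T} \<Longrightarrow> L2 M (I t)" and ito_integrand_L2: "L2 (Q s T) (\<lambda>z. H (snd z) (fst z))"
proof -
  show "L2 (Q s T) (\<lambda>z. H (snd z) (fst z))"
    using I s by (intro square_integrable_L2) (auto simp: is_ito_integral_def)
  assume t: "t \<in> {s..T}"
  obtain n p \<xi> where a: "\<And>k. simple_integrand M F s T (n k) (p k) (\<xi> k)"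
    "L2_lim M (\<lambda>k. simple_integral (W i) (n k) (p k) (\<xi> k) t) (I t)" by (rule ito_approx[OF assms]) (use t in blast)
  show "L2 M (I t)"
    by (rule L2_lim_L2[OF simple_integral_L2[OF i s(1) _ a(1)] _ a(2)])
      (use I t s in \<open>auto simp: is_ito_integral_def\<close>)
qed

lemma L2_indicator: "L2 (Q s T) f \<Longrightarrow> L2 (Q s T) (\<lambda>z. f z * indicator {..t} (snd z))"
proof -
  assume "L2 (Q s T) f"
  then have "L2 (Q s T) (\<lambda>z. indicator {..t} (snd z) * f z)"
    by (rule L2_bounded_mult[of _ _ _ 1]) (auto intro!: measurable_compose[OF snd_Q] simp: indicator_def)
  then show ?thesis by (simp add: mult.commute)
qed

lemma ito_inner:
  assumes I: "is_ito_integral M F (W i) s T H I" and I': "is_ito_integral M F (W j) s T H' I'"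
    and i: "i \<in> {0, 1}" "j \<in> {0, 1}" and s: "0 \<le> s" "s \<le> T" and t: "t \<in> {s..T}"
  shows "(\<integral>\<omega>. I t \<omega> * I' t \<omega> \<partial>M)
    = (if i = j then \<integral>z. (H (snd z) (fst z) * indicator {..t} (snd z)) * (H' (snd z) (fst z) * indicator {..t} (snd z)) \<partial>Q s T else 0)"
proof -
  obtain n p \<xi> where a: "\<And>k. simple_integrand M F s T (n k) (p k) (\<xi> k)"
    "L2_lim (Q s T) (\<lambda>k z. simple_process (n k) (p k) (\<xi> k) (snd z) (fst z)) (\<lambda>z. H (snd z) (fst z))"
    "L2_lim M (\<lambda>k. simple_integral (W i) (n k) (p k) (\<xi> k) t) (I t)" by (rule ito_approx[OF I i(1) s]) (use t in blast)
  obtain n' p' \<xi>' where a': "\<And>k. simple_integrand M F s T (n' k) (p' k) (\<xi>' k)"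
    "L2_lim (Q s T) (\<lambda>k z. simple_process (n' k) (p' k) (\<xi>' k) (snd z) (fst z)) (\<lambda>z. H' (snd z) (fst z))"
    "L2_lim M (\<lambda>k. simple_integral (W j) (n' k) (p' k) (\<xi>' k) t) (I' t)" by (rule ito_approx[OF I' i(2) s]) (use t in blast)
  have st: "0 \<le> t" "s \<le> t" using s t by auto
  have ind: "\<bar>indicator {..t} (snd z) :: real\<bar> \<le> 1" for z :: "'w \<times> real" by (simp add: indicator_def)
  note H = ito_integrand_L2[OF I i(1) s] and H' = ito_integrand_L2[OF I' i(2) s]
  have lim: "(\<lambda>k. \<integral>\<omega>. simple_integral (W i) (n k) (p k) (\<xi> k) t \<omega> * simple_integral (W j) (n' k) (p' k) (\<xi>' k) t \<omega> \<partial>M)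
      \<longlonglongrightarrow> (\<integral>\<omega>. I t \<omega> * I' t \<omega> \<partial>M)"
    by (rule L2_lim_inner[OF simple_integral_L2[OF i(1) s(1) st(1) a(1)] simple_integral_L2[OF i(2) s(1) st(1) a'(1)]
        ito_L2[OF I i(1) s t] ito_L2[OF I' i(2) s t] a(3) a'(3)])
  have limQ: "(\<lambda>k. \<integral>z. (simple_process (n k) (p k) (\<xi> k) (snd z) (fst z) * indicator {..t} (snd z))
         * (simple_process (n' k) (p' k) (\<xi>' k) (snd z) (fst z) * indicator {..t} (snd z)) \<partial>Q s T)
      \<longlonglongrightarrow> (\<integral>z. (H (snd z) (fst z) * indicator {..t} (snd z)) * (H' (snd z) (fst z) * indicator {..t} (snd z)) \<partial>Q s T)"
    by (rule L2_lim_inner[OF L2_indicator[OF simple_process_L2[OF a(1)]] L2_indicator[OF simple_process_L2[OF a'(1)]]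
        L2_indicator[OF H] L2_indicator[OF H']
        L2_lim_bounded_mult[OF a(2) simple_process_measurable[OF a(1)] L2_meas[OF H] ind]
        L2_lim_bounded_mult[OF a'(2) simple_process_measurable[OF a'(1)] L2_meas[OF H'] ind]])
  show ?thesis
  proof (cases "i = j")
    case True
    then show ?thesis using lim limQ unfolding simple_integrals_inner[OF i s(1) st(2) a(1) a'(1)]
      by (simp add: LIMSEQ_unique)
  next
    case False
    then have "(\<lambda>k::nat. 0) \<longlonglongrightarrow> (\<integral>\<omega>. I t \<omega> * I' t \<omega> \<partial>M)"
      using lim unfolding simple_integrals_inner[OF i s(1) st(2) a(1) a'(1)] by simp
    then have "(\<integral>\<omega>. I t \<omega> * I' t \<omega> \<partial>M) = 0" by (rule LIMSEQ_unique[OF _ tendsto_const])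
    then show ?thesis using False by simp
  qed
qed

lemma ito_dens:
  assumes I: "is_ito_integral M F (W i) s T H I"
    and i: "i \<in> {0, 1}" and s: "0 \<le> s" "s \<le> T" and t: "t \<in> {s..T}" "s \<le> \<tau>"
  shows "(\<integral>\<omega>. dens k0 k1 s \<tau> \<omega> * I t \<omega> \<partial>M)
    = - (if i = 0 then k0 else k1) * (\<integral>z. (H (snd z) (fst z) * indicator {..t} (snd z))
         * (dens k0 k1 s \<tau> (fst z) * indicator {..\<tau>} (snd z)) \<partial>Q s T)"
proof -
  let ?k = "if i = 0 then k0 else k1"
  obtain n p \<xi> where a: "\<And>k. simple_integrand M F s T (n k) (p k) (\<xi> k)"
    "L2_lim (Q s T) (\<lambda>k z. simple_process (n k) (p k) (\<xi> k) (snd z) (fst z)) (\<lambda>z. H (snd z) (fst z))"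
    "L2_lim M (\<lambda>k. simple_integral (W i) (n k) (p k) (\<xi> k) t) (I t)" by (rule ito_approx[OF I i s]) (use t in blast)
  have st: "0 \<le> t" "s \<le> t" using s t by auto
  have ind: "\<bar>indicator {..t} (snd z) :: real\<bar> \<le> 1" for z :: "'w \<times> real" by (simp add: indicator_def)
  note H = ito_integrand_L2[OF I i s]
  have Ld: "L2 M (dens k0 k1 s \<tau>)" using s t by (intro L2_dens)
  have LdQ: "L2 (Q s T) (\<lambda>z. dens k0 k1 s \<tau> (fst z))"
  proof -
    have "integrable (Q s T) (\<lambda>z. (dens k0 k1 s \<tau> (fst z))\<^sup>2 * indicator UNIV (snd z))"
      by (rule integrable_Q_rect) (use Ld in \<open>auto simp: L2_def\<close>)
    then show ?thesis using measurable_compose[OF measurable_fst L2_meas[OF Ld]] by (simp add: L2_def)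
  qed
  have lim: "(\<lambda>k. \<integral>\<omega>. dens k0 k1 s \<tau> \<omega> * simple_integral (W i) (n k) (p k) (\<xi> k) t \<omega> \<partial>M)
      \<longlonglongrightarrow> (\<integral>\<omega>. dens k0 k1 s \<tau> \<omega> * I t \<omega> \<partial>M)"
    by (rule L2_lim_inner[OF Ld simple_integral_L2[OF i s(1) st(1) a(1)] Ld ito_L2[OF I i s t(1)] L2_lim_const a(3)])
  have limQ: "(\<lambda>k. \<integral>z. (simple_process (n k) (p k) (\<xi> k) (snd z) (fst z) * indicator {..t} (snd z))
         * (dens k0 k1 s \<tau> (fst z) * indicator {..\<tau>} (snd z)) \<partial>Q s T)
      \<longlonglongrightarrow> (\<integral>z. (H (snd z) (fst z) * indicator {..t} (snd z)) * (dens k0 k1 s \<tau> (fst z) * indicator {..\<tau>} (snd z)) \<partial>Q s T)"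
    by (rule L2_lim_inner[OF L2_indicator[OF simple_process_L2[OF a(1)]] L2_indicator[OF LdQ]
        L2_indicator[OF H] L2_indicator[OF LdQ]
        L2_lim_bounded_mult[OF a(2) simple_process_measurable[OF a(1)] L2_meas[OF H] ind] L2_lim_const])
  show ?thesis
    using LIMSEQ_unique[OF lim[unfolded simple_integral_dens[OF i s(1) st(2) t(2) a(1)]] tendsto_mult_left[OF limQ]] .
qed

text \<open>The duality with \<open>k0 = k1 = 0\<close>, where the density is constantly 1.\<close>

lemma ito_mean:
  assumes "is_ito_integral M F (W i) s T H I" "i \<in> {0, 1}" "0 \<le> s" "s \<le> T" "t \<in> {s..T}"
  shows "(\<integral>\<omega>. I t \<omega> \<partial>M) = 0"
  using ito_dens[OF assms(1-5), of s 0 0] by simp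

text \<open>Linearity of the Ito integral is bypassed: the second moment of the difference is
  expanded into inner products, each of which is known.\<close>

lemma ito_diff_isometry:
  assumes I: "is_ito_integral M F (W i) s T H I" and I': "is_ito_integral M F (W i) s T H' I'"
    and i: "i \<in> {0, 1}" and s: "0 \<le> s" "s \<le> T" and t: "t \<in> {s..T}"
  shows "(\<integral>\<omega>. (I t \<omega> - I' t \<omega>)\<^sup>2 \<partial>M)
    = (\<integral>z. ((H (snd z) (fst z) - H' (snd z) (fst z)) * indicator {..t} (snd z))\<^sup>2 \<partial>Q s T)"
proof -
  note L = L2_indicator[OF ito_integrand_L2[OF I i s], of t] L2_indicator[OF ito_integrand_L2[OF I' i s], of t]
  show ?thesis
    unfolding left_diff_distrib L2_diff_square[OF ito_L2[OF I i s t] ito_L2[OF I' i s t]] L2_diff_square[OF L]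
    using ito_inner[OF I I i i s t] ito_inner[OF I I' i i s t] ito_inner[OF I' I' i i s t] by simp
qed

end

section \<open>Existence of the Ito integral\<close>

text \<open>Decomposition at the first index where the threshold is reached. Orthogonality is
  assumed against \<open>X j\<close> times indicators of events in \<open>\<F> j\<close>, which
  avoids conditional expectations.\<close>

lemma (in prob_space) kolmogorov_maximal:
  fixes X :: "nat \<Rightarrow> 'a \<Rightarrow> real" and \<F> :: "nat \<Rightarrow> 'a measure"
  assumes L: "\<And>j. j \<le> m \<Longrightarrow> L2 M (X j)" and e: "0 < e"
    and \<F>: "\<And>i j. i \<le> j \<Longrightarrow> j \<le> m \<Longrightarrow> X i \<in> borel_measurable (\<F> j)"
      "\<And>j. space (\<F> j) = space M" "\<And>j. sets (\<F> j) \<subseteq> events"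
    and orth: "\<And>j A. j \<le> m \<Longrightarrow> A \<in> sets (\<F> j) \<Longrightarrow> (\<integral>\<omega>. (indicator A \<omega> * X j \<omega>) * (X m \<omega> - X j \<omega>) \<partial>M) = 0"
  shows "prob {\<omega>\<in>space M. \<exists>j\<le>m. e \<le> \<bar>X j \<omega>\<bar>} \<le> (\<integral>\<omega>. (X m \<omega>)\<^sup>2 \<partial>M) / e\<^sup>2"
proof -
  define A where "A j = {\<omega>\<in>space M. e \<le> \<bar>X j \<omega>\<bar> \<and> (\<forall>i\<in>{..<j}. \<bar>X i \<omega>\<bar> < e)}" for j
  have AF: "A j \<in> sets (\<F> j)" if "j \<le> m" for j
  proof -
    have [measurable]: "X i \<in> borel_measurable (\<F> j)" if "i \<le> j" for i using \<F>(1)[OF that \<open>j \<le> m\<close>] .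
    have "{\<omega>\<in>space (\<F> j). e \<le> \<bar>X j \<omega>\<bar> \<and> (\<forall>i\<in>{..<j}. \<bar>X i \<omega>\<bar> < e)} \<in> sets (\<F> j)"
      by (intro sets.sets_Collect_conj sets.sets_Collect_finite_All) auto
    then show ?thesis by (simp add: A_def \<F>(2))
  qed
  then have Aev: "A j \<in> events" if "j \<le> m" for j using \<F>(3) that by blast
  have disj: "disjoint_family_on A {..m}"
    unfolding disjoint_family_on_def A_def by (auto simp: linorder_neq_iff dest!: bspec[where x = "_ :: nat"])
  have U: "{\<omega>\<in>space M. \<exists>j\<le>m. e \<le> \<bar>X j \<omega>\<bar>} = (\<Union>j\<in>{..m}. A j)"
  proof safe
    fix \<omega> j assume \<omega>: "\<omega> \<in> space M" "j \<le> m" "e \<le> \<bar>X j \<omega>\<bar>"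
    define k where "k = (LEAST k. e \<le> \<bar>X k \<omega>\<bar>)"
    have "e \<le> \<bar>X k \<omega>\<bar>" unfolding k_def using \<omega>(3) by (rule LeastI)
    moreover have "k \<le> m" unfolding k_def using Least_le[of "\<lambda>k. e \<le> \<bar>X k \<omega>\<bar>", OF \<omega>(3)] \<omega>(2) by simp
    moreover have "\<bar>X i \<omega>\<bar> < e" if "i < k" for i using not_less_Least that unfolding k_def by fastforce
    ultimately show "\<omega> \<in> (\<Union>j\<in>{..m}. A j)" using \<omega>(1) unfolding A_def by auto
  qed (auto simp: A_def)
  \<comment> \<open>On \<open>A j\<close> this is
    \<open>(X m)\<^sup>2 - (X m - X j)\<^sup>2\<close>: at most \<open>(X m)\<^sup>2\<close>, and
    with a second summand of integral zero.\<close>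
  let ?f = "\<lambda>j \<omega>. indicator (A j) \<omega> * X j \<omega> * X j \<omega> + 2 * ((indicator (A j) \<omega> * X j \<omega>) * (X m \<omega> - X j \<omega>))"
  have LA: "L2 M (\<lambda>\<omega>. indicator (A j) \<omega> * X j \<omega>)" if "j \<le> m" for j
    by (rule L2_bounded_mult[OF L[OF that], of _ 1]) (use Aev[OF that] in \<open>auto simp: indicator_def\<close>)
  have if1: "integrable M (\<lambda>\<omega>. indicator (A j) \<omega> * X j \<omega> * X j \<omega>)" if "j \<le> m" for j
    using L2_mult[OF LA[OF that] L[OF that]] by simp
  have if2: "integrable M (\<lambda>\<omega>. (indicator (A j) \<omega> * X j \<omega>) * (X m \<omega> - X j \<omega>))" if "j \<le> m" for j
    by (rule L2_mult[OF LA[OF that] L2_diff[OF L L]]) (use that in auto)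
  have "e\<^sup>2 * prob (\<Union>j\<in>{..m}. A j) = (\<Sum>j\<le>m. e\<^sup>2 * prob (A j))"
    by (subst finite_measure_finite_Union) (use Aev disj in \<open>auto simp: sum_distrib_left\<close>)
  also have "\<dots> \<le> (\<Sum>j\<le>m. \<integral>\<omega>. ?f j \<omega> \<partial>M)"
  proof (rule sum_mono)
    fix j assume "j \<in> {..m}"
    then have j: "j \<le> m" by simp
    have "e\<^sup>2 * prob (A j) = (\<integral>\<omega>. e\<^sup>2 * indicator (A j) \<omega> \<partial>M)" using Aev[OF j] by simp
    also have "\<dots> \<le> (\<integral>\<omega>. indicator (A j) \<omega> * X j \<omega> * X j \<omega> \<partial>M)"
    proof (rule integral_mono[OF _ if1[OF j]])
      show "integrable M (\<lambda>\<omega>. e\<^sup>2 * indicator (A j) \<omega>)"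
        using Aev[OF j] by (intro integrable_mult_right) (auto simp: emeasure_eq_measure)
      show "e\<^sup>2 * indicator (A j) \<omega> \<le> indicator (A j) \<omega> * X j \<omega> * X j \<omega>" if "\<omega> \<in> space M" for \<omega>
      proof (cases "\<omega> \<in> A j")
        case True
        then have "\<bar>e\<bar> \<le> \<bar>X j \<omega>\<bar>" using e by (simp add: A_def)
        then have "e\<^sup>2 \<le> (X j \<omega>)\<^sup>2" by (simp add: abs_le_square_iff)
        then show ?thesis using True by (simp add: power2_eq_square)
      qed simp
    qed
    also have "\<dots> = (\<integral>\<omega>. ?f j \<omega> \<partial>M)"
      using if1[OF j] if2[OF j] orth[OF j AF[OF j]] by simp
    finally show "e\<^sup>2 * prob (A j) \<le> (\<integral>\<omega>. ?f j \<omega> \<partial>M)" .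
  qed
  also have "\<dots> = (\<integral>\<omega>. (\<Sum>j\<le>m. ?f j \<omega>) \<partial>M)"
    by (rule Bochner_Integration.integral_sum[symmetric]) (auto intro!: Bochner_Integration.integrable_add if1 integrable_mult_right if2)
  also have "\<dots> \<le> (\<integral>\<omega>. (X m \<omega>)\<^sup>2 \<partial>M)"
  proof (rule integral_mono)
    show "integrable M (\<lambda>\<omega>. \<Sum>j\<le>m. ?f j \<omega>)"
      by (auto intro!: Bochner_Integration.integrable_sum Bochner_Integration.integrable_add if1 integrable_mult_right if2)
    show "integrable M (\<lambda>\<omega>. (X m \<omega>)\<^sup>2)" using L[of m] by (simp add: L2_def)
    fix \<omega> assume "\<omega> \<in> space M"
    have le: "?f j \<omega> \<le> indicator (A j) \<omega> * (X m \<omega>)\<^sup>2" for j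
    proof -
      have "?f j \<omega> = indicator (A j) \<omega> * ((X m \<omega>)\<^sup>2 - (X m \<omega> - X j \<omega>)\<^sup>2)"
        by (simp add: power2_eq_square algebra_simps)
      also have "\<dots> \<le> indicator (A j) \<omega> * (X m \<omega>)\<^sup>2" by (rule mult_left_mono) auto
      finally show ?thesis .
    qed
    have "(\<Sum>j\<le>m. ?f j \<omega>) \<le> (\<Sum>j\<le>m. indicator (A j) \<omega> * (X m \<omega>)\<^sup>2)" by (rule sum_mono[OF le])
    also have "\<dots> = indicator (\<Union>j\<in>{..m}. A j) \<omega> * (X m \<omega>)\<^sup>2"
      unfolding sum_distrib_right[symmetric] by (simp add: indicator_UN_disjoint disj)
    also have "\<dots> \<le> 1 * (X m \<omega>)\<^sup>2" by (rule mult_right_mono) (auto simp: indicator_def)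
    finally show "(\<Sum>j\<le>m. ?f j \<omega>) \<le> (X m \<omega>)\<^sup>2" by simp
  qed
  finally show ?thesis unfolding U using e by (simp add: field_simps)
qed

lemma dyadic_approx:
  fixes s T t :: real
  assumes "s \<le> t" "t \<le> T"
  shows "\<exists>j. (\<forall>m. j m \<le> (2::nat) ^ m) \<and> (\<lambda>m. s + (T - s) * real (j m) / 2 ^ m) \<longlonglongrightarrow> t"
proof (cases "s = T")
  case True
  then have "(\<lambda>m. s + (T - s) * real 0 / 2 ^ m) \<longlonglongrightarrow> t" using assms by simp
  then show ?thesis by (intro exI[of _ "\<lambda>_. 0"]) auto
next
  case False
  then have lt: "s < T" using assms by simp
  define x where "x = (t - s) / (T - s)"
  have x: "0 \<le> x" "x \<le> 1" using assms lt by (auto simp: x_def)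
  define j where "j m = nat \<lfloor>2 ^ m * x\<rfloor>" for m :: nat
  have rj: "real (j m) = real_of_int \<lfloor>2 ^ m * x\<rfloor>" for m using x by (simp add: j_def)
  have "j m \<le> 2 ^ m" for m
  proof -
    have "real (j m) \<le> 2 ^ m * x" using rj by simp
    also have "\<dots> \<le> 2 ^ m * 1" using x by (intro mult_left_mono) auto
    finally show ?thesis by (metis mult_1_right of_nat_le_iff of_nat_numeral of_nat_power)
  qed
  moreover have "(\<lambda>m. real (j m) / 2 ^ m) \<longlonglongrightarrow> x"
  proof (rule tendsto_sandwich[of "\<lambda>m. x - (1/2) ^ m" _ _ "\<lambda>m. x"])
    have "x - (1/2) ^ m \<le> real (j m) / 2 ^ m" for m
    proof -
      have "2 ^ m * x - 1 \<le> real (j m)" unfolding rj by linarith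
      then have "(2 ^ m * x - 1) / 2 ^ m \<le> real (j m) / 2 ^ m" by (rule divide_right_mono) simp
      then show ?thesis by (simp add: field_simps power_divide)
    qed
    then show "\<forall>\<^sub>F m in sequentially. x - (1/2) ^ m \<le> real (j m) / 2 ^ m" by simp
    have "real (j m) / 2 ^ m \<le> x" for m using rj[of m] by (simp add: field_simps)
    then show "\<forall>\<^sub>F m in sequentially. real (j m) / 2 ^ m \<le> x" by simp
    have "(\<lambda>m. x - (1/2) ^ m) \<longlonglongrightarrow> x - 0" by (intro tendsto_diff tendsto_const LIMSEQ_realpow_zero) auto
    then show "(\<lambda>m. x - (1/2) ^ m) \<longlonglongrightarrow> x" by simp
  qed simp
  then have "(\<lambda>m. s + (T - s) * (real (j m) / 2 ^ m)) \<longlonglongrightarrow> s + (T - s) * x" by (intro tendsto_intros)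
  moreover have "s + (T - s) * x = t" using lt by (simp add: x_def)
  ultimately show ?thesis by (intro exI[of _ j]) auto
qed

section \<open>Uniform convergence of simple integrals and construction of the Ito integral\<close>

context brownian_triple
begin

text \<open>The martingale property of simple integrals, tested against weights known at time
  \<open>t\<close>.\<close>

lemma simple_integral_orthogonal:
  assumes i: "i \<in> {0, 1}" and s: "0 \<le> s" "s \<le> t" "t \<le> t'" and S: "simple_integrand M F s T n p \<xi>"
    and \<eta>: "\<eta> \<in> borel_measurable (F t)" "L2 M \<eta>"
  shows "(\<integral>\<omega>. \<eta> \<omega> * (simple_integral (W i) n p \<xi> t' \<omega> - simple_integral (W i) n p \<xi> t \<omega>) \<partial>M) = 0"
proof -
  obtain C where C: "\<And>l. l < n \<Longrightarrow> \<xi> l \<in> borel_measurable (F (p l))"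
    "\<And>l \<omega>. l < n \<Longrightarrow> \<omega> \<in> space M \<Longrightarrow> \<bar>\<xi> l \<omega>\<bar> \<le> C" by (rule simple_integrand_weight[OF S]) blast
  \<comment> \<open>Partition points clamped to the interval from \<open>t\<close> to
    \<open>t'\<close>. The difference of the two integrals is then again a sum of weighted
    increments, none of which starts before \<open>t\<close>.\<close>
  define u where "u l = min (max (p l) t) t'" for l
  have t0: "0 \<le> t" using s by simp
  have p: "p l \<le> p (Suc l)" if "l < n" for l using simple_integrand_bounds[OF S, of l "Suc l"] that by auto
  have u: "t \<le> u l" for l using s by (auto simp: u_def)
  have uu: "u l \<le> u (Suc l)" if "l < n" for l using p[OF that] by (auto simp: u_def)
  have e: "W i (min c t') \<omega> - W i (min c t) \<omega> = W i (min (max c t) t') \<omega> - W i t \<omega>" for c \<omega>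
    using s by (cases "c \<le> t"; cases "c \<le> t'") (auto simp: min_def max_def)
  have J: "simple_integral (W i) n p \<xi> t' \<omega> - simple_integral (W i) n p \<xi> t \<omega>
      = (\<Sum>l<n. \<xi> l \<omega> * (W i (u (Suc l)) \<omega> - W i (u l) \<omega>))" for \<omega>
    unfolding simple_integral_def sum_subtractf[symmetric] right_diff_distrib[symmetric]
  proof (intro sum.cong refl arg_cong2[where f = "(*)"])
    fix l
    show "W i (min (p (Suc l)) t') \<omega> - W i (min (p l) t') \<omega> - (W i (min (p (Suc l)) t) \<omega> - W i (min (p l) t) \<omega>)
       = W i (u (Suc l)) \<omega> - W i (u l) \<omega>"
      using e[of "p (Suc l)" \<omega>] e[of "p l" \<omega>] unfolding u_def by linarith
  qed
  have tm: "(\<integral>\<omega>. (\<xi> l \<omega> * \<eta> \<omega>) * (W i (u (Suc l)) \<omega> - W i (u l) \<omega>) \<partial>M) = 0 \<and>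
       integrable M (\<lambda>\<omega>. (\<xi> l \<omega> * \<eta> \<omega>) * (W i (u (Suc l)) \<omega> - W i (u l) \<omega>))" if l: "l < n" for l
  proof (cases "p l \<le> t'")
    case True
    have L: "L2 M (\<lambda>\<omega>. \<xi> l \<omega> * \<eta> \<omega>)" by (rule L2_bounded_mult[OF \<eta>(2) F_M[OF C(1)[OF l]] C(2)[OF l]])
    have "p l \<le> u l" using True by (auto simp: u_def)
    then have "(\<lambda>\<omega>. \<xi> l \<omega> * \<eta> \<omega>) \<in> borel_measurable (F (u l))"
      using F_mono[OF C(1)[OF l]] F_mono[OF \<eta>(1) u] by (intro borel_measurable_times) auto
    then show ?thesis using orthogonal_increment[OF i _ uu[OF l] _ L] t0 u[of l] by simp
  next
    case False
    \<comment> \<open>A weight that becomes known only after \<open>t'\<close> multiplies a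
      vanishing increment.\<close>
    then have "u l = t'" "u (Suc l) = t'" using p[OF l] by (auto simp: u_def)
    then show ?thesis by simp
  qed
  have "(\<integral>\<omega>. \<eta> \<omega> * (simple_integral (W i) n p \<xi> t' \<omega> - simple_integral (W i) n p \<xi> t \<omega>) \<partial>M)
    = (\<integral>\<omega>. (\<Sum>l<n. (\<xi> l \<omega> * \<eta> \<omega>) * (W i (u (Suc l)) \<omega> - W i (u l) \<omega>)) \<partial>M)"
    unfolding J sum_distrib_left by (simp only: mult_ac)
  also have "\<dots> = (\<Sum>l<n. \<integral>\<omega>. (\<xi> l \<omega> * \<eta> \<omega>) * (W i (u (Suc l)) \<omega> - W i (u l) \<omega>) \<partial>M)"
    by (rule Bochner_Integration.integral_sum) (use tm in auto)
  also have "\<dots> = 0" using tm by simp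
  finally show ?thesis .
qed

lemma simple_integral_continuous:
  assumes i: "i \<in> {0, 1}" and s: "0 \<le> s" and S: "simple_integrand M F s T n p \<xi>"
    and W: "continuous_on {0..} (\<lambda>t. W i t \<omega>)"
  shows "continuous_on {s..T} (\<lambda>t. simple_integral (W i) n p \<xi> t \<omega>)"
proof -
  have c: "continuous_on {s..T} (\<lambda>t. W i (min c t) \<omega>)" if "0 \<le> c" for c
    by (rule continuous_on_compose2[OF W]) (use s that in \<open>auto intro!: continuous_intros\<close>)
  have p: "0 \<le> p l" "0 \<le> p (Suc l)" if "l < n" for l
    using simple_integrand_bounds[OF S, of l "Suc l"] that s by auto
  show ?thesis unfolding simple_integral_def
    by (intro continuous_on_sum continuous_on_mult continuous_on_const continuous_on_diff c) (use p in auto)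
qed

text \<open>Dropping the restriction of the integrands to times up to \<open>t\<close> makes the
  bound uniform in \<open>t\<close>.\<close>

lemma simple_integral_isometry:
  assumes i: "i \<in> {0, 1}" and s: "0 \<le> s" "s \<le> t"
    and S: "simple_integrand M F s T n p \<xi>" and S': "simple_integrand M F s T n' p' \<xi>'"
  shows "(\<integral>\<omega>. (simple_integral (W i) n p \<xi> t \<omega> - simple_integral (W i) n' p' \<xi>' t \<omega>)\<^sup>2 \<partial>M)
    \<le> (\<integral>z. (simple_process n p \<xi> (snd z) (fst z) - simple_process n' p' \<xi>' (snd z) (fst z))\<^sup>2 \<partial>Q s T)"
proof -
  have t0: "0 \<le> t" using s by simp
  note L = L2_indicator[OF simple_process_L2[OF S], of t] L2_indicator[OF simple_process_L2[OF S'], of t]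
  note LJ = simple_integral_L2[OF i s(1) t0 S] simple_integral_L2[OF i s(1) t0 S']
  let ?d = "\<lambda>z. simple_process n p \<xi> (snd z) (fst z) * indicator {..t} (snd z) - simple_process n' p' \<xi>' (snd z) (fst z) * indicator {..t} (snd z)"
  have "(\<integral>\<omega>. (simple_integral (W i) n p \<xi> t \<omega> - simple_integral (W i) n' p' \<xi>' t \<omega>)\<^sup>2 \<partial>M) = (\<integral>z. (?d z)\<^sup>2 \<partial>Q s T)"
    unfolding L2_diff_square[OF LJ] L2_diff_square[OF L] simple_integrals_inner[OF i i s S S]
      simple_integrals_inner[OF i i s S S'] simple_integrals_inner[OF i i s S' S'] by simp
  also have "\<dots> \<le> (\<integral>z. (simple_process n p \<xi> (snd z) (fst z) - simple_process n' p' \<xi>' (snd z) (fst z))\<^sup>2 \<partial>Q s T)"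
  proof (rule integral_mono[OF L2_sq[OF L2_diff[OF L]] L2_sq[OF L2_diff[OF simple_process_L2[OF S] simple_process_L2[OF S']]]])
    fix z show "(?d z)\<^sup>2 \<le> (simple_process n p \<xi> (snd z) (fst z) - simple_process n' p' \<xi>' (snd z) (fst z))\<^sup>2"
      by (auto simp: indicator_def)
  qed
  finally show ?thesis .
qed

text \<open>The supremum over a continuum is reached through dyadic grids: the bad events increase
  under refinement and share the bound of Kolmogorov's inequality, and outside their union
  continuity of the paths extends the estimate to all times. Since the continuity holds only almost
  surely, the conclusion keeps an \<open>AE\<close> beside the bad event.\<close>

lemma simple_integral_maximal:
  assumes i: "i \<in> {0, 1}" and s: "0 \<le> s" "s \<le> T" and e: "0 < e"
    and S: "simple_integrand M F s T n p \<xi>" and S': "simple_integrand M F s T n' p' \<xi>'"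
  shows "\<exists>B\<in>events. prob B \<le> (\<integral>z. (simple_process n p \<xi> (snd z) (fst z) - simple_process n' p' \<xi>' (snd z) (fst z))\<^sup>2 \<partial>Q s T) / e\<^sup>2 \<and>
    (AE \<omega> in M. \<omega> \<notin> B \<longrightarrow> (\<forall>t\<in>{s..T}. \<bar>simple_integral (W i) n p \<xi> t \<omega> - simple_integral (W i) n' p' \<xi>' t \<omega>\<bar> \<le> e))"
proof -
  have i': "i \<in> {0, 1, 2}" using i by auto
  let ?J = "simple_integral (W i) n p \<xi>" and ?J' = "simple_integral (W i) n' p' \<xi>'"
  let ?c = "(\<integral>z. (simple_process n p \<xi> (snd z) (fst z) - simple_process n' p' \<xi>' (snd z) (fst z))\<^sup>2 \<partial>Q s T) / e\<^sup>2"
  define D where "D t \<omega> = ?J t \<omega> - ?J' t \<omega>" for t \<omega>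
  define g where "g m j = s + (T - s) * real j / 2 ^ m" for m j :: nat
  have g: "s \<le> g m j" "g m j \<le> T" if "j \<le> 2 ^ m" for m j
  proof -
    have "real j \<le> 2 ^ m" using that by (metis of_nat_le_iff of_nat_numeral of_nat_power)
    then have "(T - s) * real j / 2 ^ m \<le> (T - s) * 1"
      using s by (simp add: divide_le_eq mult_left_mono)
    then show "s \<le> g m j" "g m j \<le> T" using s by (auto simp: g_def)
  qed
  have gmono: "g m j \<le> g m k" if "j \<le> k" for m j k
    using that s unfolding g_def by (intro add_left_mono divide_right_mono mult_left_mono) auto
  have gtop: "g m (2 ^ m) = T" for m by (simp add: g_def)
  have DF: "D t \<in> borel_measurable (F t)" if "s \<le> t" for t
    unfolding D_def[abs_def] using that s by (intro borel_measurable_diff simple_integral_F[OF i s(1) _ S] simple_integral_F[OF i s(1) _ S']) auto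
  have DL: "L2 M (D t)" if "s \<le> t" for t
    unfolding D_def[abs_def] using that s by (intro L2_diff simple_integral_L2[OF i s(1) _ S] simple_integral_L2[OF i s(1) _ S']) auto
  have orth: "(\<integral>\<omega>. \<eta> \<omega> * (D t' \<omega> - D t \<omega>) \<partial>M) = 0"
    if t: "s \<le> t" "t \<le> t'" and \<eta>: "\<eta> \<in> borel_measurable (F t)" "L2 M \<eta>" for t t' \<eta>
  proof -
    have t0: "0 \<le> t" "0 \<le> t'" using t s by auto
    have "integrable M (\<lambda>\<omega>. \<eta> \<omega> * (?J t' \<omega> - ?J t \<omega>))" "integrable M (\<lambda>\<omega>. \<eta> \<omega> * (?J' t' \<omega> - ?J' t \<omega>))"
      by (intro L2_mult[OF \<eta>(2)] L2_diff simple_integral_L2[OF i s(1) _ S] simple_integral_L2[OF i s(1) _ S'] t0)+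
    then have "(\<integral>\<omega>. \<eta> \<omega> * (?J t' \<omega> - ?J t \<omega>) - \<eta> \<omega> * (?J' t' \<omega> - ?J' t \<omega>) \<partial>M) = 0"
      using simple_integral_orthogonal[OF i s(1) t S \<eta>] simple_integral_orthogonal[OF i s(1) t S' \<eta>] by simp
    then show ?thesis by (simp add: D_def algebra_simps)
  qed
  define B where "B m = {\<omega>\<in>space M. \<exists>j\<le>2 ^ m. e \<le> \<bar>D (g m j) \<omega>\<bar>}" for m :: nat
  have Bev: "B m \<in> events" for m
  proof -
    have [measurable]: "D (g m j) \<in> borel_measurable M" if "j \<le> 2 ^ m" for j
      using F_M[OF DF] g[OF that] by blast
    have "{\<omega>\<in>space M. \<exists>j\<in>{..2 ^ m}. e \<le> \<bar>D (g m j) \<omega>\<bar>} \<in> events"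
      by (rule sets.sets_Collect_finite_Ex) auto
    moreover have "B m = {\<omega>\<in>space M. \<exists>j\<in>{..2 ^ m}. e \<le> \<bar>D (g m j) \<omega>\<bar>}" by (auto simp: B_def)
    ultimately show ?thesis by simp
  qed
  have Bb: "prob (B m) \<le> ?c" for m
  proof -
    have "prob {\<omega>\<in>space M. \<exists>j\<le>2 ^ m. e \<le> \<bar>D (g m j) \<omega>\<bar>} \<le> (\<integral>\<omega>. (D (g m (2 ^ m)) \<omega>)\<^sup>2 \<partial>M) / e\<^sup>2"
    proof (rule kolmogorov_maximal[where \<F> = "\<lambda>j. F (g m j)" and X = "\<lambda>j. D (g m j)", OF DL[OF g(1)] e])
      fix j A assume j: "j \<le> 2 ^ m" and A: "A \<in> sets (F (g m j))"
      have "A \<in> events" using A sets_F_events by blast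
      then show "(\<integral>\<omega>. (indicator A \<omega> * D (g m j) \<omega>) * (D (g m (2 ^ m)) \<omega> - D (g m j) \<omega>) \<partial>M) = 0"
        by (intro orth[OF g(1)[OF j] gmono[OF j]] L2_bounded_mult[OF DL[OF g(1)[OF j]], of _ 1])
          (use DF[OF g(1)[OF j]] A in \<open>auto simp: indicator_def intro!: borel_measurable_times borel_measurable_indicator\<close>)
    next
      fix k j :: nat assume "k \<le> j" "j \<le> 2 ^ m"
      then show "D (g m k) \<in> borel_measurable (F (g m j))"
        using F_mono[OF DF[OF g(1)] gmono] by simp
    qed (use sets_F_events in auto)
    also have "\<dots> \<le> ?c"
      unfolding gtop D_def by (intro divide_right_mono simple_integral_isometry[OF i s S S']) simp
    finally show ?thesis by (simp add: B_def)
  qed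
  have "incseq B"
  proof (rule incseq_SucI, rule subsetI)
    fix m \<omega> assume "\<omega> \<in> B m"
    then obtain j where j: "\<omega> \<in> space M" "j \<le> 2 ^ m" "e \<le> \<bar>D (g m j) \<omega>\<bar>" by (auto simp: B_def)
    \<comment> \<open>Point \<open>j\<close> of one dyadic grid is point \<open>2 * j\<close> of the
      next.\<close>
    moreover have "g (Suc m) (2 * j) = g m j" by (simp add: g_def)
    ultimately show "\<omega> \<in> B (Suc m)" unfolding B_def by (auto intro!: exI[of _ "2 * j"])
  qed
  then have "(\<lambda>m. prob (B m)) \<longlonglongrightarrow> prob (\<Union>m. B m)"
    by (rule finite_Lim_measure_incseq[rotated]) (use Bev in auto)
  then have "prob (\<Union>m. B m) \<le> ?c" by (rule LIMSEQ_le_const2) (use Bb in blast)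
  moreover have "AE \<omega> in M. \<omega> \<notin> (\<Union>m. B m) \<longrightarrow> (\<forall>t\<in>{s..T}. \<bar>D t \<omega>\<bar> \<le> e)"
    using W_continuous[OF i'] AE_space
  proof (eventually_elim, intro impI ballI)
    fix \<omega> t assume \<omega>: "continuous_on {0..} (\<lambda>t. W i t \<omega>)" "\<omega> \<in> space M" "\<omega> \<notin> (\<Union>m. B m)" and t: "t \<in> {s..T}"
    have c: "continuous_on {s..T} (\<lambda>t. D t \<omega>)"
      unfolding D_def by (intro continuous_on_diff simple_integral_continuous[OF i s(1)] S S' \<omega>)
    obtain j where j: "\<And>m. j m \<le> (2::nat) ^ m" "(\<lambda>m. g m (j m)) \<longlonglongrightarrow> t"
      using dyadic_approx[of s t T] t unfolding g_def by auto
    have "(\<lambda>m. D (g m (j m)) \<omega>) \<longlonglongrightarrow> D t \<omega>"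
      by (rule continuous_on_tendsto_compose[OF c j(2) t]) (use g j(1) in auto)
    then have "(\<lambda>m. \<bar>D (g m (j m)) \<omega>\<bar>) \<longlonglongrightarrow> \<bar>D t \<omega>\<bar>" by (rule tendsto_rabs)
    moreover have "\<bar>D (g m (j m)) \<omega>\<bar> \<le> e" for m
    proof -
      have "\<omega> \<notin> B m" using \<omega>(3) by blast
      then have "\<not> e \<le> \<bar>D (g m (j m)) \<omega>\<bar>" using \<omega>(2) j(1)[of m] unfolding B_def by blast
      then show ?thesis by linarith
    qed
    ultimately show "\<bar>D t \<omega>\<bar> \<le> e" by (intro LIMSEQ_le_const2) auto
  qed
  moreover have "(\<Union>m. B m) \<in> events" using Bev by auto
  ultimately show ?thesis unfolding D_def by blast
qed

text \<open>Along a fast subsequence the simple integrals converge uniformly in time, almost surely,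
  by the maximal inequality and the Borel-Cantelli lemma; this gives continuous paths. Fatou's lemma
  then identifies the limit in L2 at every time.\<close>

lemma ito_integral_exists:
  assumes i: "i \<in> {0, 1}" and s: "0 \<le> s" "s \<le> T"
    and H: "progressively_measurable F s T H" "square_integrable_process M s T H"
    and S: "\<And>k. simple_integrand M F s T (n k) (p k) (\<xi> k)"
    and lim: "L2_lim (Q s T) (\<lambda>k z. simple_process (n k) (p k) (\<xi> k) (snd z) (fst z)) (\<lambda>z. H (snd z) (fst z))"
  shows "\<exists>I. is_ito_integral M F (W i) s T H I"
proof -
  have i': "i \<in> {0, 1, 2}" using i by auto
  let ?H = "\<lambda>z. H (snd z) (fst z)" and ?S = "\<lambda>k z. simple_process (n k) (p k) (\<xi> k) (snd z) (fst z)"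
  have LH: "L2 (Q s T) ?H" by (rule square_integrable_L2[OF H s(2)])
  have LS: "L2 (Q s T) (?S k)" for k by (rule simple_process_L2[OF S])
  have lim0: "(\<lambda>k. \<integral>z. (?H z - ?S k z)\<^sup>2 \<partial>Q s T) \<longlonglongrightarrow> 0" using lim unfolding L2_lim_iff[OF LS LH] .
  \<comment> \<open>The rate is chosen for the maximal inequality: with threshold
    \<open>(1/2) ^ m\<close>, whose square is divided by, an error of order \<open>(1/8) ^ m\<close>
    leaves a summable bound of order \<open>(1/2) ^ m\<close>.\<close>
  have "\<exists>k. (\<integral>z. (?H z - ?S k z)\<^sup>2 \<partial>Q s T) < (1/8) ^ m" for m
  proof -
    from lim0 have "eventually (\<lambda>k. (\<integral>z. (?H z - ?S k z)\<^sup>2 \<partial>Q s T) < (1/8) ^ m) sequentially"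
      by (rule order_tendstoD) simp
    then show ?thesis by (auto simp: eventually_sequentially)
  qed
  then have "\<forall>m. \<exists>k. (\<integral>z. (?H z - ?S k z)\<^sup>2 \<partial>Q s T) < (1/8) ^ m" by blast
  from choice[OF this] obtain \<phi> where "\<forall>m. (\<integral>z. (?H z - ?S (\<phi> m) z)\<^sup>2 \<partial>Q s T) < (1/8) ^ m" ..
  then have \<phi>: "(\<integral>z. (?H z - ?S (\<phi> m) z)\<^sup>2 \<partial>Q s T) < (1/8) ^ m" for m by blast
  define S' where "S' m = ?S (\<phi> m)" for m
  define J where "J m = simple_integral (W i) (n (\<phi> m)) (p (\<phi> m)) (\<xi> (\<phi> m))" for m
  have LS': "L2 (Q s T) (S' m)" for m unfolding S'_def by (rule LS)
  have limS': "L2_lim (Q s T) S' ?H"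
    unfolding L2_lim_iff[OF LS' LH]
  proof (rule tendsto_sandwich[OF _ _ tendsto_const])
    show "\<forall>\<^sub>F m in sequentially. (\<integral>z. (?H z - S' m z)\<^sup>2 \<partial>Q s T) \<le> (1/8) ^ m"
      using \<phi> unfolding S'_def by (intro always_eventually allI less_imp_le)
    show "(\<lambda>m. (1/8 :: real) ^ m) \<longlonglongrightarrow> 0" by (rule LIMSEQ_realpow_zero) auto
  qed simp
  have SS: "(\<integral>z. (S' l z - S' m z)\<^sup>2 \<partial>Q s T) \<le> 4 * (1/8) ^ m" if "m \<le> l" for l m
  proof -
    have "(\<integral>z. (S' l z - S' m z)\<^sup>2 \<partial>Q s T) \<le> (\<integral>z. 2 * (?H z - S' l z)\<^sup>2 + 2 * (?H z - S' m z)\<^sup>2 \<partial>Q s T)"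
    proof (rule integral_mono)
      show "integrable (Q s T) (\<lambda>z. (S' l z - S' m z)\<^sup>2)" by (intro L2_sq L2_diff LS')
      show "integrable (Q s T) (\<lambda>z. 2 * (?H z - S' l z)\<^sup>2 + 2 * (?H z - S' m z)\<^sup>2)"
        by (intro Bochner_Integration.integrable_add integrable_mult_right L2_sq L2_diff LS' LH)
      fix z
      have "(x - y)\<^sup>2 \<le> 2 * (h - x)\<^sup>2 + 2 * (h - y)\<^sup>2" for x y h :: real
        using zero_le_power2[of "(h - x) + (h - y)"] by (simp add: power2_eq_square algebra_simps)
      then show "(S' l z - S' m z)\<^sup>2 \<le> 2 * (?H z - S' l z)\<^sup>2 + 2 * (?H z - S' m z)\<^sup>2" .
    qed
    also have "\<dots> = 2 * (\<integral>z. (?H z - S' l z)\<^sup>2 \<partial>Q s T) + 2 * (\<integral>z. (?H z - S' m z)\<^sup>2 \<partial>Q s T)"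
      using L2_sq[OF L2_diff[OF LH LS']] by simp
    also have "\<dots> \<le> 2 * (1/8) ^ l + 2 * (1/8) ^ m"
      using \<phi>[of l] \<phi>[of m] unfolding S'_def by linarith
    also have "\<dots> \<le> 2 * (1/8) ^ m + 2 * (1/8) ^ m"
      using that by (intro add_right_mono mult_left_mono power_decreasing) auto
    finally show ?thesis by simp
  qed
  have exB: "\<exists>B\<in>events. prob B \<le> 4 * (1/2) ^ m \<and> (AE \<omega> in M. \<omega> \<notin> B \<longrightarrow> (\<forall>t\<in>{s..T}. \<bar>J (Suc m) t \<omega> - J m t \<omega>\<bar> \<le> (1/2) ^ m))" for m
  proof -
    have "\<exists>B\<in>events. prob B \<le> (\<integral>z. (S' (Suc m) z - S' m z)\<^sup>2 \<partial>Q s T) / ((1/2) ^ m)\<^sup>2 \<and>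
      (AE \<omega> in M. \<omega> \<notin> B \<longrightarrow> (\<forall>t\<in>{s..T}. \<bar>J (Suc m) t \<omega> - J m t \<omega>\<bar> \<le> (1/2) ^ m))"
      unfolding J_def S'_def by (rule simple_integral_maximal[OF i s _ S S]) simp
    moreover have "(\<integral>z. (S' (Suc m) z - S' m z)\<^sup>2 \<partial>Q s T) / ((1/2) ^ m)\<^sup>2 \<le> 4 * (1/2) ^ m"
    proof -
      have "(1/8 :: real) ^ m = (1/2) ^ m * ((1/2) ^ m)\<^sup>2"
        by (simp add: power2_eq_square power_mult_distrib[symmetric])
      then show ?thesis using SS[of m "Suc m"] by (simp add: divide_le_eq)
    qed
    ultimately show ?thesis by (meson order_trans)
  qed
  define B where "B m = (SOME B. B \<in> events \<and> prob B \<le> 4 * (1/2) ^ m \<and>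
    (AE \<omega> in M. \<omega> \<notin> B \<longrightarrow> (\<forall>t\<in>{s..T}. \<bar>J (Suc m) t \<omega> - J m t \<omega>\<bar> \<le> (1/2) ^ m)))" for m
  have "B m \<in> events \<and> prob (B m) \<le> 4 * (1/2) ^ m \<and>
    (AE \<omega> in M. \<omega> \<notin> B m \<longrightarrow> (\<forall>t\<in>{s..T}. \<bar>J (Suc m) t \<omega> - J m t \<omega>\<bar> \<le> (1/2) ^ m))" for m
    unfolding B_def by (rule someI_ex) (use exB[of m] in blast)
  then have B: "B m \<in> events" "prob (B m) \<le> 4 * (1/2) ^ m"
    "AE \<omega> in M. \<omega> \<notin> B m \<longrightarrow> (\<forall>t\<in>{s..T}. \<bar>J (Suc m) t \<omega> - J m t \<omega>\<bar> \<le> (1/2) ^ m)" for m by blast+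
  have "summable (\<lambda>m. prob (B m))"
    by (rule summable_comparison_test'[of "\<lambda>m. 4 * (1/2) ^ m" 0]) (use B(2) in \<open>auto intro!: summable_mult summable_geometric\<close>)
  then have "AE \<omega> in M. eventually (\<lambda>m. \<omega> \<in> space M - B m) sequentially"
    by (intro borel_cantelli_AE1) (use B(1) in \<open>auto simp: emeasure_eq_measure\<close>)
  moreover have "AE \<omega> in M. \<forall>m. \<omega> \<notin> B m \<longrightarrow> (\<forall>t\<in>{s..T}. \<bar>J (Suc m) t \<omega> - J m t \<omega>\<bar> \<le> (1/2) ^ m)"
    unfolding AE_all_countable using B(3) by blast
  ultimately have AEb: "AE \<omega> in M. eventually (\<lambda>m. \<forall>t\<in>{s..T}. \<bar>J (Suc m) t \<omega> - J m t \<omega>\<bar> \<le> (1/2) ^ m) sequentially"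
    by eventually_elim (auto elim: eventually_mono)
  \<comment> \<open>A total definition: where the simple integrals fail to converge the value is
    arbitrary, yet measurability is kept.\<close>
  define I where "I t \<omega> = lim (\<lambda>m. J m t \<omega>)" for t \<omega>
  have unif: "uniform_limit {s..T} (\<lambda>m t. J m t \<omega>) (\<lambda>t. I t \<omega>) sequentially"
    if ev: "eventually (\<lambda>m. \<forall>t\<in>{s..T}. \<bar>J (Suc m) t \<omega> - J m t \<omega>\<bar> \<le> (1/2) ^ m) sequentially" for \<omega>
  proof -
    let ?d = "\<lambda>m t. J (Suc m) t \<omega> - J m t \<omega>"
    have "uniform_limit {s..T} (\<lambda>m t. \<Sum>k<m. ?d k t) (\<lambda>t. suminf (\<lambda>k. ?d k t)) sequentially"
      by (rule Weierstrass_m_test_ev[of _ _ "\<lambda>m. (1/2) ^ m"]) (use ev in \<open>auto intro!: summable_geometric\<close>)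
    then have "uniform_limit {s..T} (\<lambda>m t. J 0 t \<omega> + (\<Sum>k<m. ?d k t)) (\<lambda>t. J 0 t \<omega> + suminf (\<lambda>k. ?d k t)) sequentially"
      by (intro uniform_limit_add uniform_limit_const)
    moreover have "(\<Sum>k<m. ?d k t) = J m t \<omega> - J 0 t \<omega>" for m t by (rule sum_lessThan_telescope)
    ultimately have u: "uniform_limit {s..T} (\<lambda>m t. J m t \<omega>) (\<lambda>t. J 0 t \<omega> + suminf (\<lambda>k. ?d k t)) sequentially" by simp
    have "I t \<omega> = J 0 t \<omega> + suminf (\<lambda>k. ?d k t)" if "t \<in> {s..T}" for t
      unfolding I_def by (rule limI[OF tendsto_uniform_limitI[OF u that]])
    then show ?thesis by (intro uniform_limit_cong'[THEN iffD1, OF _ _ u]) auto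
  qed
  have AEu: "AE \<omega> in M. uniform_limit {s..T} (\<lambda>m t. J m t \<omega>) (\<lambda>t. I t \<omega>) sequentially"
    using AEb by eventually_elim (rule unif)
  have JM: "J m t \<in> borel_measurable M" if "t \<in> {s..T}" for m t
    unfolding J_def using that s by (intro F_M[OF simple_integral_F[OF i s(1) _ S]]) auto
  have IM: "I t \<in> borel_measurable M" if "t \<in> {s..T}" for t
    unfolding I_def[abs_def] by (rule borel_measurable_lim_metric) (rule JM[OF that])
  have Icont: "AE \<omega> in M. continuous_on {s..T} (\<lambda>t. I t \<omega>)"
    using AEu W_continuous[OF i']
  proof eventually_elim
    case (elim \<omega>)
    note u = elim(1) and c = elim(2)
    have "\<forall>\<^sub>F m in sequentially. continuous_on {s..T} (\<lambda>t. J m t \<omega>)"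
      unfolding J_def by (intro always_eventually allI simple_integral_continuous[OF i s(1) S c])
    then show ?case by (rule uniform_limit_theorem[OF _ u]) simp
  qed
  \<comment> \<open>By almost sure convergence the integrand is a lower limit of the distances
    between simple integrals, so Fatou's lemma transfers their uniform bound to the limit.\<close>
  have IL: "(\<integral>\<^sup>+\<omega>. ennreal ((I t \<omega> - J m t \<omega>)\<^sup>2) \<partial>M) \<le> ennreal (4 * (1/8) ^ m)" if t: "t \<in> {s..T}" for m t
  proof -
    note [measurable] = JM[OF t] IM[OF t]
    have "(\<integral>\<^sup>+\<omega>. ennreal ((I t \<omega> - J m t \<omega>)\<^sup>2) \<partial>M) = (\<integral>\<^sup>+\<omega>. liminf (\<lambda>l. ennreal ((J l t \<omega> - J m t \<omega>)\<^sup>2)) \<partial>M)"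
    proof (rule nn_integral_cong_AE, use AEu in eventually_elim)
      fix \<omega> assume u: "uniform_limit {s..T} (\<lambda>m t. J m t \<omega>) (\<lambda>t. I t \<omega>) sequentially"
      have "(\<lambda>l. J l t \<omega>) \<longlonglongrightarrow> I t \<omega>" by (rule tendsto_uniform_limitI[OF u t])
      then have "(\<lambda>l. ennreal ((J l t \<omega> - J m t \<omega>)\<^sup>2)) \<longlonglongrightarrow> ennreal ((I t \<omega> - J m t \<omega>)\<^sup>2)"
        by (intro tendsto_ennrealI tendsto_intros)
      then show "ennreal ((I t \<omega> - J m t \<omega>)\<^sup>2) = liminf (\<lambda>l. ennreal ((J l t \<omega> - J m t \<omega>)\<^sup>2))"
        by (intro lim_imp_Liminf[symmetric]) auto
    qed
    also have "\<dots> \<le> liminf (\<lambda>l. \<integral>\<^sup>+\<omega>. ennreal ((J l t \<omega> - J m t \<omega>)\<^sup>2) \<partial>M)"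
      by (rule nn_integral_liminf) auto
    also have "\<dots> \<le> ennreal (4 * (1/8) ^ m)"
    proof (rule Liminf_le)
      have "(\<integral>\<^sup>+\<omega>. ennreal ((J l t \<omega> - J m t \<omega>)\<^sup>2) \<partial>M) \<le> ennreal (4 * (1/8) ^ m)" if "m \<le> l" for l
      proof -
        have t0: "0 \<le> t" "s \<le> t" using t s by auto
        have "(\<integral>\<^sup>+\<omega>. ennreal ((J l t \<omega> - J m t \<omega>)\<^sup>2) \<partial>M) = ennreal (\<integral>\<omega>. (J l t \<omega> - J m t \<omega>)\<^sup>2 \<partial>M)"
          unfolding J_def by (intro L2_nn L2_diff simple_integral_L2[OF i s(1) t0(1) S])
        also have "\<dots> \<le> ennreal (4 * (1/8) ^ m)"
          using simple_integral_isometry[OF i s(1) t0(2) S S, of "\<phi> l" "\<phi> m"] SS[OF that]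
          unfolding J_def S'_def by (intro ennreal_leI) linarith
        finally show ?thesis .
      qed
      then show "\<forall>\<^sub>F l in sequentially. (\<integral>\<^sup>+\<omega>. ennreal ((J l t \<omega> - J m t \<omega>)\<^sup>2) \<partial>M) \<le> ennreal (4 * (1/8) ^ m)"
        using eventually_ge_at_top[of m] by (rule eventually_mono[rotated]) 
    qed simp
    finally show ?thesis .
  qed
  have limJ: "(\<lambda>m. \<integral>\<^sup>+\<omega>. ennreal ((I t \<omega> - J m t \<omega>)\<^sup>2) \<partial>M) \<longlonglongrightarrow> 0" if t: "t \<in> {s..T}" for t
  proof (rule tendsto_sandwich[OF _ _ tendsto_const])
    show "\<forall>\<^sub>F m in sequentially. (\<integral>\<^sup>+\<omega>. ennreal ((I t \<omega> - J m t \<omega>)\<^sup>2) \<partial>M) \<le> ennreal (4 * (1/8) ^ m)"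
      using IL[OF t] by simp
    have "(\<lambda>m. 4 * (1/8 :: real) ^ m) \<longlonglongrightarrow> 4 * 0" by (intro tendsto_mult tendsto_const LIMSEQ_realpow_zero) auto
    then have "(\<lambda>m. ennreal (4 * (1/8 :: real) ^ m)) \<longlonglongrightarrow> ennreal (4 * 0)" by (rule tendsto_ennrealI)
    then show "(\<lambda>m. ennreal (4 * (1/8 :: real) ^ m)) \<longlonglongrightarrow> 0" by simp
  qed simp
  have limQ: "(\<lambda>m. \<integral>\<^sup>+\<omega>. (\<integral>\<^sup>+\<tau>\<in>{s..T}. ennreal ((H \<tau> \<omega> - simple_process (n (\<phi> m)) (p (\<phi> m)) (\<xi> (\<phi> m)) \<tau> \<omega>)\<^sup>2) \<partial>lborel) \<partial>M) \<longlonglongrightarrow> 0"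
  proof -
    have "(\<integral>\<^sup>+\<omega>. (\<integral>\<^sup>+\<tau>\<in>{s..T}. ennreal ((H \<tau> \<omega> - simple_process (n (\<phi> m)) (p (\<phi> m)) (\<xi> (\<phi> m)) \<tau> \<omega>)\<^sup>2) \<partial>lborel) \<partial>M)
      = (\<integral>\<^sup>+z. ennreal ((?H z - S' m z)\<^sup>2) \<partial>Q s T)" for m
      using nn_integral_Q[of "\<lambda>z. ennreal ((?H z - S' m z)\<^sup>2)" s T] L2_meas[OF LH] L2_meas[OF LS'[of m]]
      by (simp add: S'_def)
    then show ?thesis using limS' by (simp add: L2_lim_def)
  qed
  have "is_ito_integral M F (W i) s T H I"
    unfolding is_ito_integral_def
  proof (intro conjI ballI exI allI)
    show "progressively_measurable F s T H" "square_integrable_process M s T H" by fact+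
    show "AE \<omega> in M. continuous_on {s..T} (\<lambda>t. I t \<omega>)" by (rule Icont)
    show "simple_integrand M F s T (n (\<phi> k)) (p (\<phi> k)) (\<xi> (\<phi> k))" for k by (rule S)
  qed (use IM limJ limQ in \<open>simp_all add: J_def\<close>)
  then show ?thesis by blast
qed

end

section \<open>Lower bounds for the cost\<close>

context brownian_triple
begin

text \<open>The upper limit enters through an indicator over the fixed interval, so that joint
  measurability in time and scenario comes from measurability of parameter integrals;
  \<open>time_integral_eq\<close> recovers the usual form.\<close>

definition time_integral :: "real \<Rightarrow> real \<Rightarrow> ('w \<times> real \<Rightarrow> real) \<Rightarrow> real \<Rightarrow> 'w \<Rightarrow> real" where
  "time_integral s T f t \<omega> = (\<integral>\<tau>. f (\<omega>, \<tau>) * indicator {..t} \<tau> \<partial>restrict_space lborel {s..T})"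

lemma time_integral_eq:
  assumes "t \<in> {s..T}"
  shows "time_integral s T f t \<omega> = (LINT \<tau>:{s..t}|lborel. f (\<omega>, \<tau>))"
proof -
  have "time_integral s T f t \<omega> = (\<integral>\<tau>. indicator {s..T} \<tau> *\<^sub>R (f (\<omega>, \<tau>) * indicator {..t} \<tau>) \<partial>lborel)"
    unfolding time_integral_def by (rule integral_restrict_space) auto
  also have "\<dots> = (LINT \<tau>:{s..t}|lborel. f (\<omega>, \<tau>))"
    unfolding set_lebesgue_integral_def using assms
    by (intro Bochner_Integration.integral_cong) (auto simp: indicator_def)
  finally show ?thesis .
qed

lemma time_integral_measurable:
  assumes "f \<in> borel_measurable (Q s T)"
  shows "time_integral s T f t \<in> borel_measurable M"
    and "(\<lambda>z. time_integral s T f (snd z) (fst z)) \<in> borel_measurable (Q s T)"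
proof -
  interpret R: finite_measure "restrict_space lborel {s..T}" by (rule finite_measure_interval)
  have id: "(\<lambda>\<tau>. \<tau>) \<in> borel_measurable (restrict_space lborel {s..T})" by (simp add: measurable_restrict_space1)
  have "(\<lambda>(\<omega>, \<tau>). f (\<omega>, \<tau>) * indicator {..t} \<tau>) \<in> borel_measurable (Q s T)"
    using assms snd_Q[of s T] by (simp add: case_prod_beta borel_measurable_times borel_measurable_indicator' measurable_compose[OF snd_Q])
  then show "time_integral s T f t \<in> borel_measurable M"
    unfolding time_integral_def[abs_def] by (rule R.borel_measurable_lebesgue_integral)
  have "(\<lambda>(z, \<tau>). f (fst z, \<tau>) * indicator {..snd z} \<tau>) \<in> borel_measurable (Q s T \<Otimes>\<^sub>M restrict_space lborel {s..T})"
  proof -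
    have 1: "(\<lambda>p. f (fst (fst p), snd p)) \<in> borel_measurable (Q s T \<Otimes>\<^sub>M restrict_space lborel {s..T})"
      by (rule measurable_compose[OF _ assms]) measurable
    have 2: "(\<lambda>p. snd (fst p)) \<in> borel_measurable (Q s T \<Otimes>\<^sub>M restrict_space lborel {s..T})"
      by (rule measurable_compose[OF measurable_fst snd_Q])
    have 3: "(\<lambda>p. snd p) \<in> borel_measurable (Q s T \<Otimes>\<^sub>M restrict_space lborel {s..T})"
      by (rule measurable_compose[OF measurable_snd id])
    have "(\<lambda>p. f (fst (fst p), snd p) * (if snd p \<le> snd (fst p) then 1 else 0)) \<in> borel_measurable (Q s T \<Otimes>\<^sub>M restrict_space lborel {s..T})"
      by (intro borel_measurable_times 1 measurable_If borel_measurable_const borel_measurable_le 2 3)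
    then show ?thesis by (simp add: case_prod_beta indicator_def of_bool_def)
  qed
  then show "(\<lambda>z. time_integral s T f (snd z) (fst z)) \<in> borel_measurable (Q s T)"
    unfolding time_integral_def[abs_def] by (rule R.borel_measurable_lebesgue_integral)
qed

lemma L2_Q_sections:
  assumes "L2 (Q s T) f"
  shows "AE \<omega> in M. L2 (restrict_space lborel {s..T}) (\<lambda>\<tau>. f (\<omega>, \<tau>))"
proof -
  interpret P: pair_sigma_finite M "restrict_space lborel {s..T}" by (rule pair_sigma_finite_Q)
  have "AE \<omega> in M. integrable (restrict_space lborel {s..T}) (\<lambda>\<tau>. (f (\<omega>, \<tau>))\<^sup>2)"
    by (rule P.AE_integrable_fst'[OF L2_sq[OF assms]])
  then show ?thesis using AE_space
    by eventually_elim (auto simp: L2_def intro!: measurable_compose[OF measurable_Pair1' L2_meas[OF assms]])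
qed

lemma measure_interval: "s \<le> T \<Longrightarrow> (\<integral>\<tau>. c \<partial>restrict_space lborel {s..T}) = c * (T - s :: real)"
  by (subst integral_restrict_space) (auto simp: measure_lborel_Icc)

lemma
  assumes f: "L2 (Q s T) f" and s: "s \<le> T"
  shows time_integral_bound: "(\<integral>\<omega>. (time_integral s T f t \<omega>)\<^sup>2 \<partial>M) \<le> (T - s) * (\<integral>z. (f z * indicator {..t} (snd z))\<^sup>2 \<partial>Q s T)"
    and time_integral_L2: "L2 M (time_integral s T f t)"
    and time_integral_L2_Q: "L2 (Q s T) (\<lambda>z. time_integral s T f (snd z) (fst z))"
proof -
  interpret P: pair_sigma_finite M "restrict_space lborel {s..T}" by (rule pair_sigma_finite_Q)
  interpret R: finite_measure "restrict_space lborel {s..T}" by (rule finite_measure_interval)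
  let ?R = "restrict_space lborel {s..T}"
  let ?g = "\<lambda>t z. f z * indicator {..t} (snd z)"
  have g: "L2 (Q s T) (?g t)" for t by (rule L2_indicator[OF f])
  have i: "integrable M (\<lambda>\<omega>. \<integral>\<tau>. (?g t (\<omega>, \<tau>))\<^sup>2 \<partial>?R)" for t
    using P.integrable_fst'[OF L2_sq[OF g[of t]]] by simp
  \<comment> \<open>One exceptional set for all \<open>t\<close> at once, so that the estimate can
    later be evaluated at the time coordinate of a point of \<open>Q s T\<close>.\<close>
  have ae: "AE \<omega> in M. \<forall>t. (time_integral s T f t \<omega>)\<^sup>2 \<le> (T - s) * (\<integral>\<tau>. (?g t (\<omega>, \<tau>))\<^sup>2 \<partial>?R)"
    using L2_Q_sections[OF f]
  proof (eventually_elim, intro allI)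
    fix \<omega> t assume L: "L2 ?R (\<lambda>\<tau>. f (\<omega>, \<tau>))"
    have "L2 ?R (\<lambda>\<tau>. indicator {..t} \<tau> * f (\<omega>, \<tau>))"
      by (rule L2_bounded_mult[OF L, of _ 1]) (auto intro!: measurable_restrict_space1 simp: indicator_def)
    then have L': "L2 ?R (\<lambda>\<tau>. ?g t (\<omega>, \<tau>))" by (simp add: mult.commute)
    have "(\<integral>\<tau>. ?g t (\<omega>, \<tau>) * 1 \<partial>?R)\<^sup>2 \<le> (\<integral>\<tau>. (?g t (\<omega>, \<tau>))\<^sup>2 \<partial>?R) * (\<integral>\<tau>. 1\<^sup>2 \<partial>?R)"
      by (rule L2_Cauchy_Schwarz[OF L' R.L2_const])
    then show "(time_integral s T f t \<omega>)\<^sup>2 \<le> (T - s) * (\<integral>\<tau>. (?g t (\<omega>, \<tau>))\<^sup>2 \<partial>?R)"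
      using measure_interval[OF s, of 1] by (simp add: time_integral_def mult.commute del: lebesgue_integral_const)
  qed
  have L: "L2 M (time_integral s T f t)" for t
  proof -
    have "integrable M (\<lambda>\<omega>. (time_integral s T f t \<omega>)\<^sup>2)"
      by (rule Bochner_Integration.integrable_bound[OF integrable_mult_right[OF i, of "T - s" t]])
        (use ae time_integral_measurable(1)[OF L2_meas[OF f]] in \<open>auto elim!: eventually_mono intro: order_trans[OF _ abs_ge_self]\<close>)
    then show ?thesis using time_integral_measurable(1)[OF L2_meas[OF f]] by (simp add: L2_def)
  qed
  then show "L2 M (time_integral s T f t)" .
  have "(\<integral>\<omega>. (time_integral s T f t \<omega>)\<^sup>2 \<partial>M) \<le> (\<integral>\<omega>. (T - s) * (\<integral>\<tau>. (?g t (\<omega>, \<tau>))\<^sup>2 \<partial>?R) \<partial>M)"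
    by (rule integral_mono_AE[OF L2_sq[OF L] integrable_mult_right[OF i]]) (use ae in \<open>auto elim: eventually_mono\<close>)
  also have "\<dots> = (T - s) * (\<integral>z. (?g t z)\<^sup>2 \<partial>Q s T)"
    using P.integral_fst'[OF L2_sq[OF g[of t]]] by simp
  finally show "(\<integral>\<omega>. (time_integral s T f t \<omega>)\<^sup>2 \<partial>M) \<le> (T - s) * (\<integral>z. (f z * indicator {..t} (snd z))\<^sup>2 \<partial>Q s T)" .
  show "L2 (Q s T) (\<lambda>z. time_integral s T f (snd z) (fst z))"
  proof -
    have iT: "integrable (Q s T) (\<lambda>z. (T - s) * (\<integral>\<tau>. (f (fst z, \<tau>))\<^sup>2 \<partial>?R) * indicator UNIV (snd z))"
      using P.integrable_fst'[OF L2_sq[OF f]] by (intro integrable_Q_rect integrable_mult_right) auto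
    have "AE z in Q s T. (time_integral s T f (snd z) (fst z))\<^sup>2 \<le> (T - s) * (\<integral>\<tau>. (f (fst z, \<tau>))\<^sup>2 \<partial>?R)"
    proof -
      have "AE \<omega> in M. \<forall>t. (time_integral s T f t \<omega>)\<^sup>2 \<le> (T - s) * (\<integral>\<tau>. (f (\<omega>, \<tau>))\<^sup>2 \<partial>?R)"
        using ae L2_Q_sections[OF f]
      proof (eventually_elim, intro allI)
        fix \<omega> t
        assume 1: "\<forall>t. (time_integral s T f t \<omega>)\<^sup>2 \<le> (T - s) * (\<integral>\<tau>. (?g t (\<omega>, \<tau>))\<^sup>2 \<partial>?R)"
          and 2: "L2 ?R (\<lambda>\<tau>. f (\<omega>, \<tau>))"
        have "(\<integral>\<tau>. (?g t (\<omega>, \<tau>))\<^sup>2 \<partial>?R) \<le> (\<integral>\<tau>. (f (\<omega>, \<tau>))\<^sup>2 \<partial>?R)"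
          by (rule integral_mono'[OF L2_sq[OF 2]]) (auto simp: indicator_def)
        then have "(T - s) * (\<integral>\<tau>. (?g t (\<omega>, \<tau>))\<^sup>2 \<partial>?R) \<le> (T - s) * (\<integral>\<tau>. (f (\<omega>, \<tau>))\<^sup>2 \<partial>?R)"
          using s by (intro mult_left_mono) auto
        then show "(time_integral s T f t \<omega>)\<^sup>2 \<le> (T - s) * (\<integral>\<tau>. (f (\<omega>, \<tau>))\<^sup>2 \<partial>?R)"
          using 1 by (meson order_trans)
      qed
      then obtain N where N: "N \<in> null_sets M" "{\<omega>\<in>space M. \<not> (\<forall>t. (time_integral s T f t \<omega>)\<^sup>2 \<le> (T - s) * (\<integral>\<tau>. (f (\<omega>, \<tau>))\<^sup>2 \<partial>?R))} \<subseteq> N"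
        unfolding eventually_ae_filter by blast
      \<comment> \<open>A null set of scenarios times the whole interval is null in the
        product.\<close>
      have "N \<times> space ?R \<in> null_sets (Q s T)"
        by (rule P.M2.times_in_null_sets1[OF N(1) sets.top])
      then show ?thesis
      proof (rule AE_I')
        show "{z \<in> space (Q s T). \<not> (time_integral s T f (snd z) (fst z))\<^sup>2 \<le> (T - s) * (\<integral>\<tau>. (f (fst z, \<tau>))\<^sup>2 \<partial>?R)}
          \<subseteq> N \<times> space ?R"
          unfolding space_pair_measure using N(2) by (intro subsetI) (clarsimp, blast)
      qed
    qed
    then have "integrable (Q s T) (\<lambda>z. (time_integral s T f (snd z) (fst z))\<^sup>2)"
      by (intro Bochner_Integration.integrable_bound[OF iT])
        (use time_integral_measurable(2)[OF L2_meas[OF f]] in \<open>auto elim!: eventually_mono intro: order_trans[OF _ abs_ge_self]\<close>)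
    then show ?thesis using time_integral_measurable(2)[OF L2_meas[OF f]] by (simp add: L2_def)
  qed
qed

lemma L2_fst: "L2 M g \<Longrightarrow> L2 (Q s T) (\<lambda>z. g (fst z))"
proof -
  assume g: "L2 M g"
  have "integrable (Q s T) (\<lambda>z. (g (fst z))\<^sup>2 * indicator UNIV (snd z))"
    by (rule integrable_Q_rect) (use g in \<open>auto simp: L2_def\<close>)
  then show ?thesis using measurable_compose[OF measurable_fst L2_meas[OF g]] by (simp add: L2_def)
qed

lemma time_integral_inner:
  assumes f: "L2 (Q s T) f" and g: "L2 M g"
  shows "(\<integral>\<omega>. g \<omega> * time_integral s T f t \<omega> \<partial>M) = (\<integral>z. g (fst z) * (f z * indicator {..t} (snd z)) \<partial>Q s T)"
proof -
  interpret P: pair_sigma_finite M "restrict_space lborel {s..T}" by (rule pair_sigma_finite_Q)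
  have "integrable (Q s T) (\<lambda>z. g (fst z) * (f z * indicator {..t} (snd z)))"
    by (rule L2_mult[OF L2_fst[OF g] L2_indicator[OF f]])
  from P.integral_fst'[OF this] show ?thesis
    unfolding time_integral_def by simp
qed

lemma integral_Q_snd:
  fixes f :: "'w \<times> real \<Rightarrow> real"
  assumes "integrable (Q s T) f"
  shows "(\<integral>z. f z \<partial>Q s T) = (LINT \<tau>:{s..T}|lborel. (\<integral>\<omega>. f (\<omega>, \<tau>) \<partial>M))"
proof -
  interpret P: pair_sigma_finite M "restrict_space lborel {s..T}" by (rule pair_sigma_finite_Q)
  have "(\<integral>z. f z \<partial>Q s T) = (\<integral>\<tau>. (\<integral>\<omega>. f (\<omega>, \<tau>) \<partial>M) \<partial>restrict_space lborel {s..T})"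
    using P.integral_snd[of "\<lambda>\<omega> \<tau>. f (\<omega>, \<tau>)"] assms by simp
  then show ?thesis unfolding set_lebesgue_integral_def by (subst (asm) integral_restrict_space) auto
qed

lemma nn_integral_Q_snd:
  assumes "f \<in> borel_measurable (Q s T)"
  shows "(\<integral>\<^sup>+z. f z \<partial>Q s T) = (\<integral>\<^sup>+\<tau>\<in>{s..T}. (\<integral>\<^sup>+\<omega>. f (\<omega>, \<tau>) \<partial>M) \<partial>lborel)"
proof -
  interpret P: pair_sigma_finite M "restrict_space lborel {s..T}" by (rule pair_sigma_finite_Q)
  show ?thesis using P.nn_integral_snd[OF assms] by (simp add: nn_integral_restrict_space)
qed

text \<open>By definition an Ito integral is measurable only at each fixed time. The grid limit is a
  jointly measurable version, and the isometry bounds its second moments uniformly in time.\<close>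

lemma ito_joint_version:
  assumes I: "is_ito_integral M F (W i) s T H I" and i: "i \<in> {0, 1}" and s: "0 \<le> s" "s \<le> T"
  shows "L2 (Q s T) (\<lambda>z. grid_limit s I (snd z) (fst z))"
    and "AE \<omega> in M. \<forall>t\<in>{s..T}. grid_limit s I t \<omega> = I t \<omega>"
proof -
  have "AE \<omega> in M. continuous_on {s..T} (\<lambda>t. I t \<omega>)" using I by (simp add: is_ito_integral_def)
  then show ae: "AE \<omega> in M. \<forall>t\<in>{s..T}. grid_limit s I t \<omega> = I t \<omega>"
    by eventually_elim (auto intro: grid_limit_eq)
  have "(\<lambda>(\<tau>, \<omega>). grid_limit s I \<tau> \<omega>) \<in> borel_measurable (restrict_space borel {s..T} \<Otimes>\<^sub>M M)"
    using I by (intro grid_limit_measurable) (auto simp: is_ito_integral_def)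
  moreover have "(\<lambda>z. (snd z, fst z)) \<in> Q s T \<rightarrow>\<^sub>M restrict_space borel {s..T} \<Otimes>\<^sub>M M"
    by (intro measurable_Pair measurable_fst measurable_restrict_space2) (auto simp: space_Q)
  ultimately have m: "(\<lambda>z. grid_limit s I (snd z) (fst z)) \<in> borel_measurable (Q s T)"
    using measurable_compose by fastforce
  let ?K = "\<integral>z. (H (snd z) (fst z))\<^sup>2 \<partial>Q s T"
  have bound: "(\<integral>\<^sup>+\<omega>. ennreal ((grid_limit s I t \<omega>)\<^sup>2) \<partial>M) \<le> ennreal ?K" if t: "t \<in> {s..T}" for t
  proof -
    have "(\<integral>\<^sup>+\<omega>. ennreal ((grid_limit s I t \<omega>)\<^sup>2) \<partial>M) = (\<integral>\<^sup>+\<omega>. ennreal ((I t \<omega>)\<^sup>2) \<partial>M)"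
      by (rule nn_integral_cong_AE) (use ae t in \<open>auto elim: eventually_mono\<close>)
    also have "\<dots> = ennreal (\<integral>\<omega>. I t \<omega> * I t \<omega> \<partial>M)"
      using L2_nn[OF ito_L2[OF I i s t]] by (simp add: power2_eq_square)
    also have "\<dots> \<le> ennreal ?K"
      unfolding ito_inner[OF I I i i s t]
      by (intro ennreal_leI, simp, intro integral_mono' L2_sq[OF ito_integrand_L2[OF I i s]])
        (auto simp: indicator_def power2_eq_square)
    finally show ?thesis .
  qed
  have "(\<integral>\<^sup>+z. ennreal ((grid_limit s I (snd z) (fst z))\<^sup>2) \<partial>Q s T) \<le> (\<integral>\<^sup>+\<tau>\<in>{s..T}. ennreal ?K \<partial>lborel)"
    using m by (subst nn_integral_Q_snd) (auto intro!: nn_integral_mono bound simp: indicator_def)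
  also have "\<dots> < \<infinity>" using s by (simp add: nn_integral_cmult_indicator ennreal_mult_less_top)
  finally show "L2 (Q s T) (\<lambda>z. grid_limit s I (snd z) (fst z))" unfolding L2_iff_nn using m by simp
qed

lemma volterra_L2:
  assumes s: "s \<le> t" "t \<le> T"
    and c: "AE \<omega> in M. continuous_on {s..T} (\<lambda>\<tau>. X \<tau> \<omega>)"
    and eq: "AE \<omega> in M. \<forall>\<tau>\<in>{s..T}. X \<tau> \<omega> = h \<tau> \<omega> + r * (LINT \<tau>':{s..\<tau>}|lborel. X \<tau>' \<omega>)"
  shows "AE \<omega> in M. X t \<omega> = h t \<omega> + time_integral s T (\<lambda>z. r * exp (r * (t - snd z)) * h (snd z) (fst z)) t \<omega>"
  using c eq
proof eventually_elim
  case (elim \<omega>)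
  have "X t \<omega> = h t \<omega> + r * (LINT \<tau>:{s..t}|lborel. exp (r * (t - \<tau>)) * h \<tau> \<omega>)"
    by (rule volterra_resolvent[OF s(1) continuous_on_subset[OF elim(1)]]) (use s elim(2) in auto)
  also have "r * (LINT \<tau>:{s..t}|lborel. exp (r * (t - \<tau>)) * h \<tau> \<omega>) = (LINT \<tau>:{s..t}|lborel. r * exp (r * (t - \<tau>)) * h \<tau> \<omega>)"
    by (simp add: mult.assoc)
  finally show ?case using s by (subst time_integral_eq) auto
qed

end

text \<open>In the application \<open>\<alpha> = a * \<eta>\<close>,
  \<open>\<rho> = \<mu> - r\<close>, and \<open>c\<close> collects the constant drift terms. The
  signs of \<open>\<alpha>\<close> and \<open>\<rho>\<close> make the drift added by a nonnegative
  control nonnegative.\<close>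

locale linear_control = brownian_triple M W F
  for M :: "'w measure" and W :: "nat \<Rightarrow> real \<Rightarrow> 'w \<Rightarrow> real" and F :: "real \<Rightarrow> 'w measure" +
  fixes \<alpha> \<rho> b \<sigma> r c T :: real
  assumes pos: "\<alpha> > 0" "\<rho> \<ge> 0" "b > 0" "\<sigma> \<noteq> 0" "r > 0" "T > 0"
begin

definition drift :: "real \<Rightarrow> real \<times> real \<Rightarrow> real" where
  "drift x u = r * x + \<alpha> * snd u + \<rho> * fst u + c"

definition vol0 :: "real \<times> real \<Rightarrow> real" where "vol0 u = b * snd u"

definition vol1 :: "real \<times> real \<Rightarrow> real" where "vol1 u = \<sigma> * fst u"

text \<open>\<open>lam0\<close> and \<open>lam1\<close> are market prices of risk, that is, excess
  drift per unit of volatility. Since \<open>\<sigma>\<close> may be negative, so may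
  \<open>lam1\<close>.\<close>

definition lam0 :: real where "lam0 = \<alpha> / b"

definition lam1 :: real where "lam1 = \<rho> / \<sigma>"

definition gain :: "real \<times> real \<Rightarrow> real" where "gain u = \<alpha> * snd u + \<rho> * fst u"

text \<open>The squared length of the market price of risk; it will turn out to be
  \<open>- 2 * A1\<close>. The two sources of risk influence the value function only through
  it.\<close>

definition kap :: real where "kap = lam0\<^sup>2 + lam1\<^sup>2"

text \<open>The terminal wealth reached from \<open>y\<close> at time \<open>s\<close> with the zero control.\<close>

definition endpoint :: "real \<Rightarrow> real \<Rightarrow> real" where
  "endpoint s y = exp (r * (T - s)) * y + c * (exp (r * (T - s)) - 1) / r"

text \<open>The identity behind the risk-neutral argument: the drift gained by a control is its
  exposure to the two motions, priced by \<open>lam0\<close> and \<open>lam1\<close>, and that is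
  exactly what the change of measure takes away.\<close>

lemma gain_vol: "gain u = lam0 * vol0 u + lam1 * vol1 u"
  using pos by (simp add: gain_def vol0_def vol1_def lam0_def lam1_def)

lemma admissible_L2:
  assumes u: "u \<in> admissible_controls M F s T" and s: "s \<le> T"
  shows "L2 (Q s T) (\<lambda>z. fst (u (snd z) (fst z)))" "L2 (Q s T) (\<lambda>z. snd (u (snd z) (fst z)))"
    and "L2 (Q s T) (\<lambda>z. gain (u (snd z) (fst z)))"
proof -
  have u': "progressively_measurable F s T u" "square_integrable_process M s T (\<lambda>t \<omega>. fst (u t \<omega>))"
    "square_integrable_process M s T (\<lambda>t \<omega>. snd (u t \<omega>))" using u by (auto simp: admissible_controls_def)
  have "progressively_measurable F s T (\<lambda>t \<omega>. fst (u t \<omega>))" "progressively_measurable F s T (\<lambda>t \<omega>. snd (u t \<omega>))"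
    unfolding progressively_measurable_def case_prod_beta
    by (intro ballI measurable_compose[OF u'(1)[unfolded progressively_measurable_def case_prod_beta, rule_format]]; simp add: borel_prod[symmetric])+
  from square_integrable_L2[OF this(1) u'(2) s] square_integrable_L2[OF this(2) u'(3) s]
  show L: "L2 (Q s T) (\<lambda>z. fst (u (snd z) (fst z)))" "L2 (Q s T) (\<lambda>z. snd (u (snd z) (fst z)))" .
  show "L2 (Q s T) (\<lambda>z. gain (u (snd z) (fst z)))"
    unfolding gain_def by (intro L2_add L2_cmult L)
qed

text \<open>Only \<open>r * x\<close> is kept as unknown, in the form required by the resolvent; the
  remaining terms depend on control and noise alone. The integral of the state is split off path by
  path, by continuity, so that no moments of the state are involved.\<close>

lemma state_representation:
  assumes s: "s \<le> T" and u: "u \<in> admissible_controls M F s T"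
    and x: "state_process M F W s T drift vol0 vol1 y u x"
  obtains I0 I1 where "is_ito_integral M F (W 0) s T (\<lambda>t \<omega>. vol0 (u t \<omega>)) I0"
    "is_ito_integral M F (W 1) s T (\<lambda>t \<omega>. vol1 (u t \<omega>)) I1"
    "AE \<omega> in M. \<forall>t\<in>{s..T}. x t \<omega> = (y + c * (t - s)
       + time_integral s T (\<lambda>z. gain (u (snd z) (fst z))) t \<omega> + I0 t \<omega> + I1 t \<omega>) + r * (LINT \<tau>:{s..t}|lborel. x \<tau> \<omega>)"
proof -
  obtain I0 I1 where I: "is_ito_integral M F (W 0) s T (\<lambda>t \<omega>. vol0 (u t \<omega>)) I0"
    "is_ito_integral M F (W 1) s T (\<lambda>t \<omega>. vol1 (u t \<omega>)) I1"
    and eq: "AE \<omega> in M. set_integrable lborel {s..T} (\<lambda>\<tau>. drift (x \<tau> \<omega>) (u \<tau> \<omega>)) \<and>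
           (\<forall>t\<in>{s..T}. x t \<omega> = y + (LINT \<tau>:{s..t}|lborel. drift (x \<tau> \<omega>) (u \<tau> \<omega>)) + I0 t \<omega> + I1 t \<omega>)"
    and c: "AE \<omega> in M. continuous_on {s..T} (\<lambda>t. x t \<omega>)"
    using x unfolding state_process_def by blast
  have "AE \<omega> in M. \<forall>t\<in>{s..T}. x t \<omega> = (y + c * (t - s)
       + time_integral s T (\<lambda>z. gain (u (snd z) (fst z))) t \<omega> + I0 t \<omega> + I1 t \<omega>) + r * (LINT \<tau>:{s..t}|lborel. x \<tau> \<omega>)"
    using eq c
  proof (eventually_elim, intro ballI, elim conjE)
    fix \<omega> t assume i: "set_integrable lborel {s..T} (\<lambda>\<tau>. drift (x \<tau> \<omega>) (u \<tau> \<omega>))"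
      and e: "\<forall>t\<in>{s..T}. x t \<omega> = y + (LINT \<tau>:{s..t}|lborel. drift (x \<tau> \<omega>) (u \<tau> \<omega>)) + I0 t \<omega> + I1 t \<omega>"
      and c: "continuous_on {s..T} (\<lambda>t. x t \<omega>)" and t: "t \<in> {s..T}"
    have sub: "{s..t} \<subseteq> {s..T}" using t by auto
    have ix: "set_integrable lborel {s..t} (\<lambda>\<tau>. x \<tau> \<omega>)"
      by (rule borel_integrable_atLeastAtMost') (rule continuous_on_subset[OF c sub])
    have ic: "set_integrable lborel {s..t} (\<lambda>\<tau>. c)" by (rule borel_integrable_atLeastAtMost') simp
    have id: "set_integrable lborel {s..t} (\<lambda>\<tau>. drift (x \<tau> \<omega>) (u \<tau> \<omega>))"
      by (rule set_integrable_subset[OF i]) (use sub in auto)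
    have irx: "set_integrable lborel {s..t} (\<lambda>\<tau>. r * x \<tau> \<omega>)" using ix by simp
    have "(LINT \<tau>:{s..t}|lborel. gain (u \<tau> \<omega>)) = (LINT \<tau>:{s..t}|lborel. drift (x \<tau> \<omega>) (u \<tau> \<omega>) - r * x \<tau> \<omega> - c)"
      by (simp add: drift_def gain_def)
    also have "\<dots> = (LINT \<tau>:{s..t}|lborel. drift (x \<tau> \<omega>) (u \<tau> \<omega>)) - r * (LINT \<tau>:{s..t}|lborel. x \<tau> \<omega>) - (LINT \<tau>:{s..t}|lborel. c)"
      using set_integral_diff[OF set_integral_diff(1)[OF id irx] ic] set_integral_diff[OF id irx] by simp
    also have "(LINT \<tau>:{s..t}|lborel. c) = c * (t - s)"
      using t unfolding set_lebesgue_integral_def by simp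
    finally show "x t \<omega> = (y + c * (t - s)
       + time_integral s T (\<lambda>z. gain (u (snd z) (fst z))) t \<omega> + I0 t \<omega> + I1 t \<omega>) + r * (LINT \<tau>:{s..t}|lborel. x \<tau> \<omega>)"
      unfolding time_integral_eq[OF t] using e t by simp
  qed
  then show ?thesis using I that by blast
qed

text \<open>The resolvent formula at time \<open>T\<close> with the inhomogeneity
  \<open>y + c * (t - s)\<close>, which belongs to the zero control.\<close>

lemma discount_integral:
  assumes "s \<le> T"
  shows "(y + c * (T - s)) + (LINT \<tau>:{s..T}|lborel. r * exp (r * (T - \<tau>)) * (y + c * (\<tau> - s))) = endpoint s y"
proof -
  let ?G = "\<lambda>\<tau>. - exp (r * (T - \<tau>)) * (y + c * (\<tau> - s)) - c / r * exp (r * (T - \<tau>))"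
  have "(LBINT \<tau>=s..T. r * exp (r * (T - \<tau>)) * (y + c * (\<tau> - s))) = ?G T - ?G s"
  proof (rule interval_integral_FTC_finite)
    show "continuous_on {min s T..max s T} (\<lambda>\<tau>. r * exp (r * (T - \<tau>)) * (y + c * (\<tau> - s)))"
      by (intro continuous_intros)
    fix \<tau>
    have "(?G has_real_derivative r * exp (r * (T - \<tau>)) * (y + c * (\<tau> - s))) (at \<tau> within {min s T..max s T})"
      using pos by (auto intro!: derivative_eq_intros simp: field_simps)
    then show "(?G has_vector_derivative r * exp (r * (T - \<tau>)) * (y + c * (\<tau> - s))) (at \<tau> within {min s T..max s T})"
      by (simp add: has_real_derivative_iff_has_vector_derivative)
  qed
  then have e: "(LINT \<tau>:{s..T}|lborel. r * exp (r * (T - \<tau>)) * (y + c * (\<tau> - s))) = ?G T - ?G s"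
    by (subst (asm) interval_integral_Icc[OF assms])
  show ?thesis unfolding e endpoint_def using pos by (simp add: field_simps)
qed

text \<open>With respect to the density for \<open>lam0\<close>, \<open>lam1\<close> (the risk-neutral measure) the gain from the
  control and the drift of the Ito integrals cancel, so the mean does not depend on the control.\<close>

lemma state_terminal:
  assumes s: "0 \<le> s" "s \<le> T" and u: "u \<in> admissible_controls M F s T"
    and x: "state_process M F W s T drift vol0 vol1 y u x"
  shows "L2 M (x T)"
    and "(\<integral>\<omega>. dens lam0 lam1 s T \<omega> * x T \<omega> \<partial>M) = endpoint s y"
    and "endpoint s y \<le> (\<integral>\<omega>. x T \<omega> \<partial>M)"
proof -
  obtain I0 I1 where I0: "is_ito_integral M F (W 0) s T (\<lambda>t \<omega>. vol0 (u t \<omega>)) I0"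
    and I1: "is_ito_integral M F (W 1) s T (\<lambda>t \<omega>. vol1 (u t \<omega>)) I1"
    and eq: "AE \<omega> in M. \<forall>t\<in>{s..T}. x t \<omega> = (y + c * (t - s)
       + time_integral s T (\<lambda>z. gain (u (snd z) (fst z))) t \<omega> + I0 t \<omega> + I1 t \<omega>) + r * (LINT \<tau>:{s..t}|lborel. x \<tau> \<omega>)"
    by (rule state_representation[OF s(2) u x])
  let ?v = "\<lambda>z. gain (u (snd z) (fst z))"
  let ?J0 = "grid_limit s I0" and ?J1 = "grid_limit s I1"
  \<comment> \<open>The inhomogeneity, built from the joint versions so that it lies in L2 over
    \<open>Q s T\<close>; almost surely it agrees at all times with the expression in
    \<open>I0\<close> and \<open>I1\<close>.\<close>
  define h where "h t \<omega> = y + c * (t - s) + time_integral s T ?v t \<omega> + ?J0 t \<omega> + ?J1 t \<omega>" for t \<omega>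
  interpret R: finite_measure "Q s T" by (rule finite_measure_Q)
  have v: "L2 (Q s T) ?v" by (rule admissible_L2(3)[OF u s(2)])
  have i01: "0 \<in> {0, 1 :: nat}" "1 \<in> {0, 1 :: nat}" by auto
  note J0 = ito_joint_version[OF I0 i01(1) s] and J1 = ito_joint_version[OF I1 i01(2) s]
  have lin: "L2 (Q s T) (\<lambda>z. y + c * (snd z - s))"
    by (rule L2_bound[OF R.L2_const[of "\<bar>y\<bar> + \<bar>c\<bar> * (T - s)"]])
      (use s in \<open>auto simp: space_Q abs_mult intro!: AE_I2 order_trans[OF abs_triangle_ineq] mult_mono add_mono\<close>)
  have hQ: "L2 (Q s T) (\<lambda>z. h (snd z) (fst z))"
    unfolding h_def by (intro L2_add lin time_integral_L2_Q[OF v s(2)] J0(1) J1(1))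
  have hI: "AE \<omega> in M. \<forall>t\<in>{s..T}. h t \<omega> = y + c * (t - s) + time_integral s T ?v t \<omega> + I0 t \<omega> + I1 t \<omega>"
    using J0(2) J1(2) by eventually_elim (auto simp: h_def)
  define g where "g z = r * exp (r * (T - snd z)) * h (snd z) (fst z)" for z :: "'w \<times> real"
  have "AE \<omega> in M. \<forall>t\<in>{s..T}. x t \<omega> = h t \<omega> + r * (LINT \<tau>:{s..t}|lborel. x \<tau> \<omega>)"
    using eq hI by eventually_elim simp
  moreover have "AE \<omega> in M. continuous_on {s..T} (\<lambda>t. x t \<omega>)" using x by (simp add: state_process_def)
  ultimately have xT: "AE \<omega> in M. x T \<omega> = h T \<omega> + time_integral s T g T \<omega>"
    unfolding g_def[abs_def] by (intro volterra_L2) (use s in auto)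
  have gQ: "L2 (Q s T) g"
    unfolding g_def
  proof (rule L2_bounded_mult[OF hQ, of _ "r * exp (r * (T - s))"])
    show "(\<lambda>z. r * exp (r * (T - snd z))) \<in> borel_measurable (Q s T)"
      using snd_Q[of s T] by measurable
    show "\<bar>r * exp (r * (T - snd z))\<bar> \<le> r * exp (r * (T - s))" if "z \<in> space (Q s T)" for z
      using that pos by (auto simp: space_Q)
  qed
  have LI: "L2 M (I0 t)" "L2 M (I1 t)" if "t \<in> {s..T}" for t
    using ito_L2[OF I0 i01(1) s that] ito_L2[OF I1 i01(2) s that] by blast+
  have hL: "L2 M (\<lambda>\<omega>. y + c * (t - s) + time_integral s T ?v t \<omega> + I0 t \<omega> + I1 t \<omega>)" if "t \<in> {s..T}" for t
    by (intro L2_add L2_const time_integral_L2[OF v s(2)] LI that)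
  have T: "T \<in> {s..T}" using s by auto
  let ?x = "\<lambda>\<omega>. (y + c * (T - s) + time_integral s T ?v T \<omega> + I0 T \<omega> + I1 T \<omega>) + time_integral s T g T \<omega>"
  have xL: "L2 M ?x" by (rule L2_add[OF hL[OF T] time_integral_L2[OF gQ s(2)]])
  have xae: "AE \<omega> in M. x T \<omega> = ?x \<omega>"
    using xT hI by eventually_elim (use T in simp)
  have xM: "x T \<in> borel_measurable M"
    using x T by (intro F_M[of _ T]) (auto simp: state_process_def)
  show "L2 M (x T)"
    by (rule L2_cong_AE[OF xL _ xM]) (use xae in eventually_elim, simp)
  \<comment> \<open>By Fubini's theorem the weighted mean of the terminal state is a functional of
    the weighted means \<open>m\<close> of \<open>h\<close>. This is used twice, with the
    risk-neutral parameters and with both parameters zero.\<close>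
  have key: "(\<integral>\<omega>. dens k0 k1 s T \<omega> * x T \<omega> \<partial>M) = (m T + (LINT \<tau>:{s..T}|lborel. r * exp (r * (T - \<tau>)) * m \<tau>)) \<and>
      (set_integrable lborel {s..T} (\<lambda>\<tau>. r * exp (r * (T - \<tau>)) * m \<tau>))"
    if m: "\<And>t. m t = (\<integral>\<omega>. dens k0 k1 s T \<omega> * h t \<omega> \<partial>M)" for k0 k1 m
  proof -
    let ?Z = "dens k0 k1 s T"
    have Z: "L2 M ?Z" using s by (intro L2_dens)
    have "(\<integral>\<omega>. ?Z \<omega> * x T \<omega> \<partial>M) = (\<integral>\<omega>. ?Z \<omega> * h T \<omega> + ?Z \<omega> * time_integral s T g T \<omega> \<partial>M)"
    proof (rule integral_cong_AE)
      show "AE \<omega> in M. ?Z \<omega> * x T \<omega> = ?Z \<omega> * h T \<omega> + ?Z \<omega> * time_integral s T g T \<omega>"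
        using xT by eventually_elim (simp add: distrib_left)
    next
      have "?Z \<in> borel_measurable M" "h T \<in> borel_measurable M"
        "time_integral s T g T \<in> borel_measurable M"
        using L2_meas[OF Z] measurable_compose[OF measurable_Pair1'] L2_meas[OF time_integral_L2[OF gQ s(2)]]
        measurable_compose[OF measurable_Pair2' L2_meas[OF hQ], of T] T by (auto simp: space_restrict_space)
      then show "(\<lambda>\<omega>. ?Z \<omega> * h T \<omega> + ?Z \<omega> * time_integral s T g T \<omega>) \<in> borel_measurable M" by auto
    qed (use xM L2_meas[OF Z] in auto)
    also have "\<dots> = m T + (\<integral>\<omega>. ?Z \<omega> * time_integral s T g T \<omega> \<partial>M)"
    proof -
      have "L2 M (h T)"
        by (rule L2_cong_AE[OF hL[OF T]])
          (use hI T measurable_compose[OF measurable_Pair2' L2_meas[OF hQ], of T] in \<open>auto elim!: eventually_mono simp: space_restrict_space\<close>)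
      then show ?thesis unfolding m
        by (intro Bochner_Integration.integral_add L2_mult Z time_integral_L2[OF gQ s(2)])
    qed
    also have "(\<integral>\<omega>. ?Z \<omega> * time_integral s T g T \<omega> \<partial>M) = (\<integral>z. ?Z (fst z) * (g z * indicator {..T} (snd z)) \<partial>Q s T)"
      by (rule time_integral_inner[OF gQ Z])
    also have "\<dots> = (\<integral>z. ?Z (fst z) * g z \<partial>Q s T)"
      by (rule Bochner_Integration.integral_cong) (auto simp: space_Q)
    also have "\<dots> = (LINT \<tau>:{s..T}|lborel. (\<integral>\<omega>. ?Z \<omega> * g (\<omega>, \<tau>) \<partial>M))"
      by (subst integral_Q_snd[OF L2_mult[OF L2_fst[OF Z] gQ]]) simp
    also have "\<dots> = (LINT \<tau>:{s..T}|lborel. r * exp (r * (T - \<tau>)) * m \<tau>)"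
    proof -
      have "(\<integral>\<omega>. ?Z \<omega> * g (\<omega>, \<tau>) \<partial>M) = r * exp (r * (T - \<tau>)) * m \<tau>" for \<tau>
        unfolding m g_def Bochner_Integration.integral_mult_right_zero[symmetric] by (simp add: mult_ac)
      then show ?thesis by simp
    qed
    finally have 1: "(\<integral>\<omega>. ?Z \<omega> * x T \<omega> \<partial>M) = m T + (LINT \<tau>:{s..T}|lborel. r * exp (r * (T - \<tau>)) * m \<tau>)" .
    have "set_integrable lborel {s..T} (\<lambda>\<tau>. (\<integral>\<omega>. ?Z \<omega> * g (\<omega>, \<tau>) \<partial>M))"
    proof -
      interpret P: pair_sigma_finite M "restrict_space lborel {s..T}" by (rule pair_sigma_finite_Q)
      have "integrable (restrict_space lborel {s..T}) (\<lambda>\<tau>. (\<integral>\<omega>. ?Z \<omega> * g (\<omega>, \<tau>) \<partial>M))"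
      proof (rule P.integrable_snd)
        have "(\<lambda>(\<omega>, \<tau>). ?Z \<omega> * g (\<omega>, \<tau>)) = (\<lambda>z. ?Z (fst z) * g z)" by auto
        then show "integrable (Q s T) (\<lambda>(\<omega>, \<tau>). ?Z \<omega> * g (\<omega>, \<tau>))"
          using L2_mult[OF L2_fst[OF Z] gQ] by simp
      qed
      then show ?thesis unfolding set_integrable_def by (subst (asm) integrable_restrict_space) auto
    qed
    moreover have "(\<integral>\<omega>. ?Z \<omega> * g (\<omega>, \<tau>) \<partial>M) = r * exp (r * (T - \<tau>)) * m \<tau>" for \<tau>
      unfolding m g_def Bochner_Integration.integral_mult_right_zero[symmetric] by (simp add: mult_ac)
    ultimately show ?thesis using 1 by simp
  qed
  \<comment> \<open>Duality turns the Ito integrals into time integrals, so that only gain minus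
    \<open>k0 * vol0\<close> minus \<open>k1 * vol1\<close> matters. This vanishes for
    \<open>lam0\<close> and \<open>lam1\<close> and is the nonnegative gain for
    \<open>k0 = k1 = 0\<close>.\<close>
  have m_val: "(\<integral>\<omega>. dens k0 k1 s T \<omega> * h t \<omega> \<partial>M) = y + c * (t - s)
      + (\<integral>z. dens k0 k1 s T (fst z) * ((?v z - k0 * vol0 (u (snd z) (fst z)) - k1 * vol1 (u (snd z) (fst z))) * indicator {..t} (snd z)) \<partial>Q s T)"
    if t: "t \<in> {s..T}" for t k0 k1
  proof -
    let ?Z = "dens k0 k1 s T"

    have Z: "L2 M ?Z" using s by (intro L2_dens)
    note L0 = ito_integrand_L2[OF I0 i01(1) s] and L1 = ito_integrand_L2[OF I1 i01(2) s]
    have hT: "h t \<in> borel_measurable M"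
      using measurable_compose[OF measurable_Pair2' L2_meas[OF hQ], of t] t by (auto simp: space_restrict_space)
    have "(\<integral>\<omega>. ?Z \<omega> * h t \<omega> \<partial>M) = (\<integral>\<omega>. (y + c * (t - s)) * ?Z \<omega> + ?Z \<omega> * time_integral s T ?v t \<omega> + ?Z \<omega> * I0 t \<omega> + ?Z \<omega> * I1 t \<omega> \<partial>M)"
    proof (rule integral_cong_AE)
      show "AE \<omega> in M. ?Z \<omega> * h t \<omega> = (y + c * (t - s)) * ?Z \<omega> + ?Z \<omega> * time_integral s T ?v t \<omega> + ?Z \<omega> * I0 t \<omega> + ?Z \<omega> * I1 t \<omega>"
        using hI
      proof eventually_elim
        case (elim \<omega>)
        have e: "h t \<omega> = y + c * (t - s) + time_integral s T ?v t \<omega> + I0 t \<omega> + I1 t \<omega>" using elim t by blast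
        show ?case unfolding e by (simp add: algebra_simps)
      qed
    qed (use hT L2_meas[OF Z] L2_meas[OF LI(1)[OF t]] L2_meas[OF LI(2)[OF t]] L2_meas[OF time_integral_L2[OF v s(2)]] in auto)
    also have "\<dots> = (y + c * (t - s)) * (\<integral>\<omega>. ?Z \<omega> \<partial>M) + (\<integral>\<omega>. ?Z \<omega> * time_integral s T ?v t \<omega> \<partial>M)
        + (\<integral>\<omega>. ?Z \<omega> * I0 t \<omega> \<partial>M) + (\<integral>\<omega>. ?Z \<omega> * I1 t \<omega> \<partial>M)"
      using L2_integrable[OF Z] L2_mult[OF Z LI(1)[OF t]] L2_mult[OF Z LI(2)[OF t]] L2_mult[OF Z time_integral_L2[OF v s(2), of t]]
      by simp
    also have "(\<integral>\<omega>. ?Z \<omega> \<partial>M) = 1"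
      using dens_power[of s T k0 k1 1] s by simp
    also have "(\<integral>\<omega>. ?Z \<omega> * time_integral s T ?v t \<omega> \<partial>M) = (\<integral>z. ?Z (fst z) * (?v z * indicator {..t} (snd z)) \<partial>Q s T)"
      by (rule time_integral_inner[OF v Z])
    also have "(\<integral>\<omega>. ?Z \<omega> * I0 t \<omega> \<partial>M) = - k0 * (\<integral>z. ?Z (fst z) * (vol0 (u (snd z) (fst z)) * indicator {..t} (snd z)) \<partial>Q s T)"
      unfolding ito_dens[OF I0 i01(1) s t s(2)]
      by (auto intro!: Bochner_Integration.integral_cong simp: space_Q mult_ac)
    also have "(\<integral>\<omega>. ?Z \<omega> * I1 t \<omega> \<partial>M) = - k1 * (\<integral>z. ?Z (fst z) * (vol1 (u (snd z) (fst z)) * indicator {..t} (snd z)) \<partial>Q s T)"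
      unfolding ito_dens[OF I1 i01(2) s t s(2)]
      by (auto intro!: Bochner_Integration.integral_cong simp: space_Q mult_ac)
    finally have e: "(\<integral>\<omega>. ?Z \<omega> * h t \<omega> \<partial>M) = (y + c * (t - s)) * 1 + (\<integral>z. ?Z (fst z) * (?v z * indicator {..t} (snd z)) \<partial>Q s T)
        + - k0 * (\<integral>z. ?Z (fst z) * (vol0 (u (snd z) (fst z)) * indicator {..t} (snd z)) \<partial>Q s T)
        + - k1 * (\<integral>z. ?Z (fst z) * (vol1 (u (snd z) (fst z)) * indicator {..t} (snd z)) \<partial>Q s T)" .
    note i = L2_mult[OF L2_fst[OF Z] L2_indicator[OF v, of t]] L2_mult[OF L2_fst[OF Z] L2_indicator[OF L0, of t]]
      L2_mult[OF L2_fst[OF Z] L2_indicator[OF L1, of t]]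
    have "(\<integral>z. ?Z (fst z) * ((?v z - k0 * vol0 (u (snd z) (fst z)) - k1 * vol1 (u (snd z) (fst z))) * indicator {..t} (snd z)) \<partial>Q s T)
       = (\<integral>z. ?Z (fst z) * (?v z * indicator {..t} (snd z)) - k0 * (?Z (fst z) * (vol0 (u (snd z) (fst z)) * indicator {..t} (snd z)))
           - k1 * (?Z (fst z) * (vol1 (u (snd z) (fst z)) * indicator {..t} (snd z))) \<partial>Q s T)"
      by (simp add: algebra_simps)
    also have "\<dots> = (\<integral>z. ?Z (fst z) * (?v z * indicator {..t} (snd z)) \<partial>Q s T)
        - k0 * (\<integral>z. ?Z (fst z) * (vol0 (u (snd z) (fst z)) * indicator {..t} (snd z)) \<partial>Q s T)
        - k1 * (\<integral>z. ?Z (fst z) * (vol1 (u (snd z) (fst z)) * indicator {..t} (snd z)) \<partial>Q s T)"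
      using i by simp
    finally show ?thesis using e by simp
  qed
  show "(\<integral>\<omega>. dens lam0 lam1 s T \<omega> * x T \<omega> \<partial>M) = endpoint s y"
  proof -
    have m: "(\<integral>\<omega>. dens lam0 lam1 s T \<omega> * h t \<omega> \<partial>M) = y + c * (t - s)" if "t \<in> {s..T}" for t
      unfolding m_val[OF that] gain_vol by simp
    have "(LINT \<tau>:{s..T}|lborel. r * exp (r * (T - \<tau>)) * (\<integral>\<omega>. dens lam0 lam1 s T \<omega> * h \<tau> \<omega> \<partial>M))
      = (LINT \<tau>:{s..T}|lborel. r * exp (r * (T - \<tau>)) * (y + c * (\<tau> - s)))"
      by (rule set_lebesgue_integral_cong) (auto simp: m)
    then show ?thesis using key[OF refl, of lam0 lam1] m[OF T] discount_integral[OF s(2), of y] by simp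
  qed
  show "endpoint s y \<le> (\<integral>\<omega>. x T \<omega> \<partial>M)"
  proof -
    let ?m = "\<lambda>t. \<integral>\<omega>. dens 0 0 s T \<omega> * h t \<omega> \<partial>M"
    \<comment> \<open>Here the sign constraint on the controls enters the lower bounds.\<close>
    have nn: "gain (u t \<omega>) \<ge> 0" if "t \<in> {s..T}" "\<omega> \<in> space M" for t \<omega>
    proof -
      have "u t \<omega> \<in> {0..} \<times> {0..}" using u that by (auto simp: admissible_controls_def)
      then show ?thesis using pos unfolding gain_def by (auto simp: mem_Times_iff)
    qed
    have m: "y + c * (t - s) \<le> ?m t" if "t \<in> {s..T}" for t
      unfolding m_val[OF that] using nn by (auto intro!: integral_nonneg_AE AE_I2 simp: space_Q)
    have "(LINT \<tau>:{s..T}|lborel. r * exp (r * (T - \<tau>)) * (y + c * (\<tau> - s)))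
      \<le> (LINT \<tau>:{s..T}|lborel. r * exp (r * (T - \<tau>)) * ?m \<tau>)"
    proof (rule set_integral_mono)
      show "set_integrable lborel {s..T} (\<lambda>\<tau>. r * exp (r * (T - \<tau>)) * (y + c * (\<tau> - s)))"
        by (rule borel_integrable_atLeastAtMost') (intro continuous_intros)
      show "set_integrable lborel {s..T} (\<lambda>\<tau>. r * exp (r * (T - \<tau>)) * ?m \<tau>)"
        using key[OF refl, of 0 0] by blast
      show "r * exp (r * (T - \<tau>)) * (y + c * (\<tau> - s)) \<le> r * exp (r * (T - \<tau>)) * ?m \<tau>" if "\<tau> \<in> {s..T}" for \<tau>
        using pos by (intro mult_left_mono m that) auto
    qed
    then show ?thesis using key[OF refl, of 0 0] m[OF T] discount_integral[OF s(2), of y] by simp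
  qed
qed

lemma cost_lower_bound:
  assumes s: "0 \<le> s" "s \<le> T" and u: "u \<in> admissible_controls M F s T"
    and x: "state_process M F W s T drift vol0 vol1 y u x"
  shows "(if endpoint s y \<ge> 0 then 1 else exp (- kap * (T - s))) * (endpoint s y)\<^sup>2 \<le> (\<integral>\<omega>. (x T \<omega>)\<^sup>2 \<partial>M)"
proof -
  note st = state_terminal[OF s u x]
  show ?thesis
  proof (cases "endpoint s y \<ge> 0")
    case True
    have "(endpoint s y)\<^sup>2 \<le> (\<integral>\<omega>. x T \<omega> * 1 \<partial>M)\<^sup>2"
      using st(3) True by (intro power_mono) auto
    also have "\<dots> \<le> (\<integral>\<omega>. (x T \<omega>)\<^sup>2 \<partial>M) * (\<integral>\<omega>. 1\<^sup>2 \<partial>M)"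
      by (rule L2_Cauchy_Schwarz[OF st(1) L2_const])
    finally show ?thesis using True by (simp add: prob_space)
  next
    case False
    have "(endpoint s y)\<^sup>2 \<le> (\<integral>\<omega>. (dens lam0 lam1 s T \<omega>)\<^sup>2 \<partial>M) * (\<integral>\<omega>. (x T \<omega>)\<^sup>2 \<partial>M)"
      unfolding st(2)[symmetric] using s by (intro L2_Cauchy_Schwarz L2_dens st(1))
    also have "(\<integral>\<omega>. (dens lam0 lam1 s T \<omega>)\<^sup>2 \<partial>M) = exp (kap * (T - s))"
      using s by (subst dens_power) (auto simp: kap_def field_simps)
    finally have "exp (- kap * (T - s)) * (endpoint s y)\<^sup>2 \<le> exp (- kap * (T - s)) * (exp (kap * (T - s)) * (\<integral>\<omega>. (x T \<omega>)\<^sup>2 \<partial>M))"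
      by (rule mult_left_mono) simp
    also have "\<dots> = (\<integral>\<omega>. (x T \<omega>)\<^sup>2 \<partial>M)" by (simp add: mult.assoc[symmetric] exp_add[symmetric])
    finally show ?thesis using False by simp
  qed
qed

end

section \<open>Geometric Brownian motion\<close>

lemma LINT_FTC:
  fixes G g :: "real \<Rightarrow> real"
  assumes "s \<le> t" "\<And>v. (G has_real_derivative g v) (at v)" "continuous_on UNIV g"
  shows "(LINT v:{s..t}|lborel. g v) = G t - G s"
proof -
  have "(LBINT v=s..t. g v) = G t - G s"
  proof (rule interval_integral_FTC_finite)
    show "continuous_on {min s t..max s t} g" using assms(3) by (rule continuous_on_subset) simp
    fix v show "(G has_vector_derivative g v) (at v within {min s t..max s t})"
      using assms(2)[of v] by (simp add: has_real_derivative_iff_has_vector_derivative[symmetric] has_field_derivative_at_within)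
  qed
  then show ?thesis by (subst (asm) interval_integral_Icc[OF assms(1)])
qed

lemma LINT_indicator:
  fixes g :: "real \<Rightarrow> real"
  assumes "t \<le> T"
  shows "(LINT v:{s..T}|lborel. g v * indicator {..t} v) = (LINT v:{s..t}|lborel. g v)"
  unfolding set_lebesgue_integral_def using assms
  by (intro Bochner_Integration.integral_cong) (auto simp: indicator_def)

context linear_control
begin

text \<open>Geometric Brownian motion started from \<open>C\<close> at time \<open>s\<close>, in a version that is progressively
  measurable for the filtration without null sets.\<close>

definition gbm :: "real \<Rightarrow> real \<Rightarrow> real \<Rightarrow> 'w \<Rightarrow> real" where
  "gbm s C t \<omega> = C * exp ((r - kap) * (t - s)) * (exp (- lam0 * (grid_limit s (W 0) t \<omega> - W 0 s \<omega>))
     * exp (- lam1 * (grid_limit s (W 1) t \<omega> - W 1 s \<omega>)) * exp (- (kap / 2 * (t - s))))"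

abbreviation Z :: "real \<Rightarrow> real \<Rightarrow> 'w \<Rightarrow> real" where "Z \<equiv> dens lam0 lam1"

lemma W01_continuous:
  "AE \<omega> in M. continuous_on {0..} (\<lambda>t. W 0 t \<omega>)" "AE \<omega> in M. continuous_on {0..} (\<lambda>t. W 1 t \<omega>)"
  by (rule W_continuous, simp)+

text \<open>One null set serves all \<open>t\<close>: off it both paths are continuous and the grid
  limits in \<open>gbm\<close> return the actual values. Moments of \<open>gbm\<close> thereby
  reduce to moments of the density.\<close>

lemma gbm_dens:
  assumes "0 \<le> s"
  shows "AE \<omega> in M. \<forall>t\<ge>s. gbm s C t \<omega> = C * exp ((r - kap) * (t - s)) * Z s t \<omega>"
  using W01_continuous
proof (eventually_elim, intro allI impI)
  fix \<omega> t assume c: "continuous_on {0..} (\<lambda>t. W 0 t \<omega>)" "continuous_on {0..} (\<lambda>t. W 1 t \<omega>)" and t: "s \<le> t"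
  have sub: "{s..t} \<subseteq> {0..}" using assms by auto
  have "grid_limit s (W 0) t \<omega> = W 0 t \<omega>" "grid_limit s (W 1) t \<omega> = W 1 t \<omega>"
    using grid_limit_eq[of s t "W 0" \<omega> t, OF continuous_on_subset[OF c(1) sub]]
      grid_limit_eq[of s t "W 1" \<omega> t, OF continuous_on_subset[OF c(2) sub]] t by auto
  then show "gbm s C t \<omega> = C * exp ((r - kap) * (t - s)) * Z s t \<omega>" by (simp add: gbm_def dens_def kap_def)
qed

lemma gbm_continuous:
  assumes "0 \<le> s"
  shows "AE \<omega> in M. continuous_on {s..T} (\<lambda>t. gbm s C t \<omega>)"
  using gbm_dens[OF assms, of C] W01_continuous
proof eventually_elim
  case (elim \<omega>)
  have "continuous_on {s..T} (\<lambda>t. W 0 t \<omega>)" "continuous_on {s..T} (\<lambda>t. W 1 t \<omega>)"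
    using elim assms by (auto elim: continuous_on_subset)
  then have "continuous_on {s..T} (\<lambda>t. C * exp ((r - kap) * (t - s)) * Z s t \<omega>)"
    unfolding dens_def by (intro continuous_intros)
  then show ?case by (rule continuous_on_eq) (use elim in auto)
qed

lemma gbm_progressive:
  assumes s: "0 \<le> s"
  shows "progressively_measurable F s T (gbm s C)"
  unfolding progressively_measurable_def
proof
  fix t assume t: "t \<in> {s..T}"
  have g: "(\<lambda>z. grid_limit s (W i) (fst z) (snd z)) \<in> borel_measurable (restrict_space borel {s..t} \<Otimes>\<^sub>M F t)" if "i \<in> {0, 1}" for i
    using grid_limit_measurable[of s t "W i" "F t"] W_F[of i _ t] that s by (auto simp: case_prod_beta)
  have w: "(\<lambda>z. W i s (snd z)) \<in> borel_measurable (restrict_space borel {s..t} \<Otimes>\<^sub>M F t)" if "i \<in> {0, 1}" for i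
    by (rule measurable_compose[OF measurable_snd W_F]) (use that s t in auto)
  have f: "fst \<in> borel_measurable (restrict_space borel {s..t} \<Otimes>\<^sub>M F t)"
    by (rule measurable_compose[OF measurable_fst]) (rule measurable_restrict_space1, simp)
  show "(\<lambda>(\<tau>, \<omega>). gbm s C \<tau> \<omega>) \<in> borel_measurable (restrict_space borel {s..t} \<Otimes>\<^sub>M F t)"
    unfolding gbm_def case_prod_beta
    using g[of 0] g[of 1] w[of 0] w[of 1] f by simp
qed

lemma progressive_section:
  assumes "progressively_measurable F s T X" "t \<in> {s..T}"
  shows "X t \<in> borel_measurable (F t)"
proof -
  have "(\<lambda>(\<tau>, \<omega>). X \<tau> \<omega>) \<in> borel_measurable (restrict_space borel {s..t} \<Otimes>\<^sub>M F t)"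
    using assms by (simp add: progressively_measurable_def)
  from measurable_compose[OF measurable_Pair1' this, of t] assms(2) show ?thesis
    by (simp add: space_restrict_space)
qed

lemma gbm_F: "0 \<le> s \<Longrightarrow> t \<in> {s..T} \<Longrightarrow> gbm s C t \<in> borel_measurable (F t)"
  by (rule progressive_section[OF gbm_progressive])

lemma gbm_M: "0 \<le> s \<Longrightarrow> t \<in> {s..T} \<Longrightarrow> gbm s C t \<in> borel_measurable M"
  by (rule F_M[OF gbm_F])

lemma gbm_L2: assumes "0 \<le> s" "t \<in> {s..T}" shows "L2 M (gbm s C t)"
proof (rule L2_cong_AE[OF L2_cmult[OF L2_dens[of s t lam0 lam1]] _ gbm_M[OF assms]])
  show "AE \<omega> in M. C * exp ((r - kap) * (t - s)) * Z s t \<omega> = gbm s C t \<omega>"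
    using gbm_dens[OF assms(1), of C] by eventually_elim (use assms in auto)
qed (use assms in auto)

lemma dens_inner:
  assumes "0 \<le> s" "s \<le> t" "s \<le> \<tau>"
  shows "(\<integral>\<omega>. Z s \<tau> \<omega> * Z s t \<omega> \<partial>M) = exp (kap * (min t \<tau> - s))"
proof (cases "\<tau> \<le> t")
  case True
  then show ?thesis using dens_covariance[of s \<tau> t lam0 lam1] assms by (simp add: kap_def min_def)
next
  case False
  then show ?thesis using dens_covariance[of s t \<tau> lam0 lam1] assms by (simp add: kap_def min_def mult.commute)
qed

lemma gbm_inner:
  assumes "0 \<le> s" "t \<in> {s..T}" "s \<le> \<tau>"
  shows "(\<integral>\<omega>. Z s \<tau> \<omega> * gbm s C t \<omega> \<partial>M) = C * exp ((r - kap) * (t - s)) * exp (kap * (min t \<tau> - s))"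
proof -
  have "(\<integral>\<omega>. Z s \<tau> \<omega> * gbm s C t \<omega> \<partial>M) = (\<integral>\<omega>. C * exp ((r - kap) * (t - s)) * (Z s \<tau> \<omega> * Z s t \<omega>) \<partial>M)"
  proof (rule integral_cong_AE)
    show "AE \<omega> in M. Z s \<tau> \<omega> * gbm s C t \<omega> = C * exp ((r - kap) * (t - s)) * (Z s \<tau> \<omega> * Z s t \<omega>)"
      using gbm_dens[OF assms(1), of C] by eventually_elim (use assms in auto)
  qed (use gbm_M[OF assms(1,2)] L2_meas[OF L2_dens[of s t]] L2_meas[OF L2_dens[of s \<tau>]] assms in auto)
  then show ?thesis using dens_inner[of s t \<tau>] assms by simp
qed

lemma gbm_square:
  assumes "0 \<le> s" "t \<in> {s..T}"
  shows "(\<integral>\<omega>. gbm s C t \<omega> * gbm s C t \<omega> \<partial>M) = C\<^sup>2 * exp ((2 * (r - kap) + kap) * (t - s))"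
proof -
  have "(\<integral>\<omega>. gbm s C t \<omega> * gbm s C t \<omega> \<partial>M) = (\<integral>\<omega>. C * exp ((r - kap) * (t - s)) * (Z s t \<omega> * gbm s C t \<omega>) \<partial>M)"
  proof (rule integral_cong_AE)
    show "AE \<omega> in M. gbm s C t \<omega> * gbm s C t \<omega> = C * exp ((r - kap) * (t - s)) * (Z s t \<omega> * gbm s C t \<omega>)"
      using gbm_dens[OF assms(1), of C] by eventually_elim (use assms in auto)
  qed (use gbm_M[OF assms] L2_meas[OF L2_dens[of s t]] assms in auto)
  also have "\<dots> = C * exp ((r - kap) * (t - s)) * (C * exp ((r - kap) * (t - s)) * exp (kap * (t - s)))"
    using gbm_inner[OF assms, of t C] assms by simp
  also have "\<dots> = C\<^sup>2 * (exp ((r - kap) * (t - s)) * exp ((r - kap) * (t - s)) * exp (kap * (t - s)))"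
    by (simp add: power2_eq_square)
  also have "exp ((r - kap) * (t - s)) * exp ((r - kap) * (t - s)) * exp (kap * (t - s)) = exp ((2 * (r - kap) + kap) * (t - s))"
    unfolding exp_add[symmetric] by (simp add: algebra_simps)
  finally show ?thesis .
qed

lemma gbm_L2_Q:
  assumes s: "0 \<le> s" "s \<le> T"
  shows "L2 (Q s T) (\<lambda>z. gbm s C (snd z) (fst z))"
proof -
  have m: "(\<lambda>z. gbm s C (snd z) (fst z)) \<in> borel_measurable (Q s T)"
    by (rule progressive_Q[OF gbm_progressive[OF s(1)] s(2)])
  let ?K = "C\<^sup>2 * exp (\<bar>2 * (r - kap) + kap\<bar> * (T - s))"
  have "(\<integral>\<^sup>+z. ennreal ((gbm s C (snd z) (fst z))\<^sup>2) \<partial>Q s T) \<le> (\<integral>\<^sup>+\<tau>\<in>{s..T}. ennreal ?K \<partial>lborel)"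
  proof (subst nn_integral_Q_snd)
    show "(\<integral>\<^sup>+\<tau>\<in>{s..T}. (\<integral>\<^sup>+\<omega>. ennreal ((gbm s C (snd (\<omega>, \<tau>)) (fst (\<omega>, \<tau>)))\<^sup>2) \<partial>M) \<partial>lborel) \<le> (\<integral>\<^sup>+\<tau>\<in>{s..T}. ennreal ?K \<partial>lborel)"
    proof (rule nn_integral_mono)
      fix \<tau> :: real
      have "(\<integral>\<^sup>+\<omega>. ennreal ((gbm s C \<tau> \<omega>)\<^sup>2) \<partial>M) \<le> ennreal ?K" if \<tau>: "\<tau> \<in> {s..T}"
      proof -
        have "(\<integral>\<^sup>+\<omega>. ennreal ((gbm s C \<tau> \<omega>)\<^sup>2) \<partial>M) = ennreal (C\<^sup>2 * exp ((2 * (r - kap) + kap) * (\<tau> - s)))"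
          using L2_nn[OF gbm_L2[OF s(1) \<tau>, of C]] gbm_square[OF s(1) \<tau>, of C] by (simp add: power2_eq_square)
        also have "\<dots> \<le> ennreal ?K"
          using \<tau> by (intro ennreal_leI mult_left_mono) (auto intro!: mult_mono)
        finally show ?thesis .
      qed
      then show "(\<integral>\<^sup>+\<omega>. ennreal ((gbm s C (snd (\<omega>, \<tau>)) (fst (\<omega>, \<tau>)))\<^sup>2) \<partial>M) * indicator {s..T} \<tau> \<le> ennreal ?K * indicator {s..T} \<tau>"
        by (auto simp: indicator_def)
    qed
  qed (use m in auto)
  also have "\<dots> < \<infinity>" using s by (simp add: nn_integral_cmult_indicator ennreal_mult_less_top)
  finally show ?thesis unfolding L2_iff_nn using m by simp
qed

lemma gbm_square_integrable:
  assumes s: "0 \<le> s" "s \<le> T"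
  shows "square_integrable_process M s T (gbm s C)"
  using gbm_L2_Q[OF s, of C] nn_integral_Q[of "\<lambda>z. ennreal ((gbm s C (snd z) (fst z))\<^sup>2)" s T]
  unfolding square_integrable_process_def L2_iff_nn by auto

text \<open>The error on one cell when the process is frozen at the left end \<open>p\<close> and
  the density is cut off at \<open>K\<close>. The cut is made because weights of simple integrands
  are bounded. The bound depends on the cell only through an upper bound \<open>e\<close> for its
  length.\<close>

lemma gbm_step_bound:
  assumes s: "0 \<le> s" "s \<le> p" "p \<le> \<tau>" "\<tau> \<le> T" "\<tau> - p \<le> e" and K: "0 < K"
  shows "(\<integral>\<^sup>+\<omega>. ennreal ((gbm s C \<tau> \<omega> - C * exp ((r - kap) * (p - s)) * min (Z s p \<omega>) K)\<^sup>2) \<partial>M)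
    \<le> ennreal (2 * C\<^sup>2 * exp ((2 * \<bar>r - kap\<bar> + kap) * (T - s)) *
       ((exp ((2 * \<bar>r - kap\<bar> + kap) * e) - 1 + 2 * (1 - exp (- \<bar>r - kap\<bar> * e))) + exp (6 * kap * (T - s)) / K\<^sup>2))"
proof -
  let ?\<beta> = "r - kap"
  let ?A = "2 * \<bar>?\<beta>\<bar> + kap"
  have kap: "0 \<le> kap" by (simp add: kap_def)
  define \<delta> where "\<delta> = \<tau> - p"
  define q where "q = p - s"
  have \<delta>: "0 \<le> \<delta>" "\<delta> \<le> e" "0 \<le> q" "q \<le> T - s" "\<tau> - s = q + \<delta>" using s by (auto simp: \<delta>_def q_def)
  have \<tau>: "\<tau> \<in> {s..T}" using s by auto
  note Lp = L2_dens[OF s(1,2), of lam0 lam1]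
  have L\<tau>: "L2 M (Z s \<tau>)" using s by (intro L2_dens) auto
  \<comment> \<open>\<open>?f\<close> is the error of freezing time, \<open>?g\<close> the error of
    the cut.\<close>
  let ?f = "\<lambda>\<omega>. exp (?\<beta> * (q + \<delta>)) * Z s \<tau> \<omega> - exp (?\<beta> * q) * Z s p \<omega>"
  let ?g = "\<lambda>\<omega>. exp (?\<beta> * q) * (Z s p \<omega> - min (Z s p \<omega>) K)"
  have Lf: "L2 M ?f" by (intro L2_diff L2_cmult Lp L\<tau>)
  have Lm: "L2 M (\<lambda>\<omega>. min (Z s p \<omega>) K)"
    by (rule L2_bound[OF Lp]) (use L2_meas[OF Lp] K dens_pos[of lam0 lam1 s p] in \<open>auto simp: less_imp_le\<close>)
  have Lg: "L2 M ?g" by (intro L2_cmult L2_diff Lp Lm)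
  have ef: "(\<integral>\<omega>. (?f \<omega>)\<^sup>2 \<partial>M) = exp ((2 * ?\<beta> + kap) * q) * (exp ((2 * ?\<beta> + kap) * \<delta>) - 2 * exp (?\<beta> * \<delta>) + 1)"
  proof -
    have "(\<integral>\<omega>. (?f \<omega>)\<^sup>2 \<partial>M) = (exp (?\<beta> * (q + \<delta>)))\<^sup>2 * exp (kap * (q + \<delta>)) - 2 * (exp (?\<beta> * (q + \<delta>)) * exp (?\<beta> * q) * exp (kap * q)) + (exp (?\<beta> * q))\<^sup>2 * exp (kap * q)"
    proof -
      have d: "(\<integral>\<omega>. Z s \<tau> \<omega> * Z s \<tau> \<omega> \<partial>M) = exp (kap * (q + \<delta>))" "(\<integral>\<omega>. Z s \<tau> \<omega> * Z s p \<omega> \<partial>M) = exp (kap * q)" "(\<integral>\<omega>. Z s p \<omega> * Z s p \<omega> \<partial>M) = exp (kap * q)"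
        using dens_inner[of s \<tau> \<tau>] dens_inner[of s p \<tau>] dens_inner[of s p p] s by (auto simp: q_def \<delta>_def)
      have "(\<integral>\<omega>. (?f \<omega>)\<^sup>2 \<partial>M) = (\<integral>\<omega>. (exp (?\<beta> * (q + \<delta>)) * Z s \<tau> \<omega>) * (exp (?\<beta> * (q + \<delta>)) * Z s \<tau> \<omega>) \<partial>M)
         - 2 * (\<integral>\<omega>. (exp (?\<beta> * (q + \<delta>)) * Z s \<tau> \<omega>) * (exp (?\<beta> * q) * Z s p \<omega>) \<partial>M) + (\<integral>\<omega>. (exp (?\<beta> * q) * Z s p \<omega>) * (exp (?\<beta> * q) * Z s p \<omega>) \<partial>M)"
        by (rule L2_diff_square[OF L2_cmult[OF L\<tau>] L2_cmult[OF Lp]])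
      also have "(\<lambda>\<omega>. (exp (?\<beta> * (q + \<delta>)) * Z s \<tau> \<omega>) * (exp (?\<beta> * (q + \<delta>)) * Z s \<tau> \<omega>)) = (\<lambda>\<omega>. (exp (?\<beta> * (q + \<delta>)))\<^sup>2 * (Z s \<tau> \<omega> * Z s \<tau> \<omega>))"
        by (simp add: fun_eq_iff power2_eq_square mult_ac)
      also have "(\<lambda>\<omega>. (exp (?\<beta> * (q + \<delta>)) * Z s \<tau> \<omega>) * (exp (?\<beta> * q) * Z s p \<omega>)) = (\<lambda>\<omega>. (exp (?\<beta> * (q + \<delta>)) * exp (?\<beta> * q)) * (Z s \<tau> \<omega> * Z s p \<omega>))"
        by (simp add: fun_eq_iff mult_ac)
      also have "(\<lambda>\<omega>. (exp (?\<beta> * q) * Z s p \<omega>) * (exp (?\<beta> * q) * Z s p \<omega>)) = (\<lambda>\<omega>. (exp (?\<beta> * q))\<^sup>2 * (Z s p \<omega> * Z s p \<omega>))"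
        by (simp add: fun_eq_iff power2_eq_square mult_ac)
      finally show ?thesis unfolding Bochner_Integration.integral_mult_right_zero d .
    qed
    also have "(exp (?\<beta> * (q + \<delta>)))\<^sup>2 * exp (kap * (q + \<delta>)) = exp ((2 * ?\<beta> + kap) * q) * exp ((2 * ?\<beta> + kap) * \<delta>)"
      unfolding exp_double[symmetric] exp_add[symmetric] by (simp add: algebra_simps)
    also have "exp (?\<beta> * (q + \<delta>)) * exp (?\<beta> * q) * exp (kap * q) = exp ((2 * ?\<beta> + kap) * q) * exp (?\<beta> * \<delta>)"
      unfolding exp_add[symmetric] by (simp add: algebra_simps)
    also have "(exp (?\<beta> * q))\<^sup>2 * exp (kap * q) = exp ((2 * ?\<beta> + kap) * q)"
      unfolding exp_double[symmetric] exp_add[symmetric] by (simp add: algebra_simps)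
    finally show ?thesis by (simp add: algebra_simps)
  qed
  \<comment> \<open>The sign of \<open>r - kap\<close> is open, hence the absolute values; the last
    factor tends to zero with \<open>e\<close>.\<close>
  have b1: "(\<integral>\<omega>. (?f \<omega>)\<^sup>2 \<partial>M) \<le> exp (?A * (T - s)) * (exp (?A * e) - 1 + 2 * (1 - exp (- \<bar>?\<beta>\<bar> * e)))"
  proof -
    have le: "exp ((2 * ?\<beta> + kap) * x) \<le> exp (?A * y)" if "0 \<le> x" "x \<le> y" for x y
    proof -
      have "2 * ?\<beta> + kap \<le> ?A" by (intro add_right_mono mult_left_mono abs_ge_self) simp
      then have "(2 * ?\<beta> + kap) * x \<le> ?A * x" using that(1) by (rule mult_right_mono)
      also have "\<dots> \<le> ?A * y" using that kap by (intro mult_left_mono) auto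
      finally show ?thesis by simp
    qed
    note 1 = le[OF \<delta>(3,4)] and 2 = le[OF \<delta>(1,2)]
    have "- (\<bar>?\<beta>\<bar> * e) \<le> - (\<bar>?\<beta>\<bar> * \<delta>)" using \<delta> by (simp add: mult_left_mono)
    also have "\<dots> \<le> ?\<beta> * \<delta>" using \<delta> by (metis abs_ge_minus_self minus_le_iff minus_mult_left mult_right_mono)
    finally have 3: "exp (- \<bar>?\<beta>\<bar> * e) \<le> exp (?\<beta> * \<delta>)" by simp
    have "0 \<le> exp ((2 * ?\<beta> + kap) * q) * (exp ((2 * ?\<beta> + kap) * \<delta>) - 2 * exp (?\<beta> * \<delta>) + 1)"
      unfolding ef[symmetric] by simp
    then have 4: "0 \<le> exp ((2 * ?\<beta> + kap) * \<delta>) - 2 * exp (?\<beta> * \<delta>) + 1"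
      by (simp add: zero_le_mult_iff)
    have 5: "exp ((2 * ?\<beta> + kap) * \<delta>) - 2 * exp (?\<beta> * \<delta>) + 1 \<le> exp (?A * e) - 1 + 2 * (1 - exp (- \<bar>?\<beta>\<bar> * e))"
      using 2 3 by argo
    show ?thesis unfolding ef by (intro mult_mono 1 5 4) simp
  qed
  have b2: "(\<integral>\<omega>. (?g \<omega>)\<^sup>2 \<partial>M) \<le> exp (?A * (T - s)) * (exp (6 * kap * (T - s)) / K\<^sup>2)"
  proof -
    \<comment> \<open>Where the cut is active the density is at least \<open>K\<close>, so the
      squared error is at most its fourth power divided by the square of \<open>K\<close>. The
      exponent 6 is (16 - 4) / 2, from \<open>dens_power\<close> with \<open>m = 4\<close>.\<close>
    have i4: "integrable M (\<lambda>\<omega>. Z s p \<omega> ^ 4)" and v4: "(\<integral>\<omega>. Z s p \<omega> ^ 4 \<partial>M) = exp (6 * kap * q)"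
      using dens_power_integrable[of s p lam0 lam1 4] dens_power[of s p lam0 lam1 4] s by (auto simp: kap_def q_def field_simps)
    have "(\<integral>\<omega>. (?g \<omega>)\<^sup>2 \<partial>M) \<le> (\<integral>\<omega>. (exp (?\<beta> * q))\<^sup>2 / K\<^sup>2 * Z s p \<omega> ^ 4 \<partial>M)"
    proof (rule integral_mono[OF L2_sq[OF Lg] integrable_mult_right[OF i4]])
      fix \<omega>
      have "(Z s p \<omega> - min (Z s p \<omega>) K)\<^sup>2 \<le> Z s p \<omega> ^ 4 / K\<^sup>2"
      proof (cases "Z s p \<omega> \<le> K")
        case False
        then have z: "K \<le> Z s p \<omega>" by simp
        have "(Z s p \<omega> - min (Z s p \<omega>) K)\<^sup>2 \<le> (Z s p \<omega>)\<^sup>2" using z K by (intro power_mono) auto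
        moreover have "(Z s p \<omega>)\<^sup>2 * K\<^sup>2 \<le> (Z s p \<omega>)\<^sup>2 * (Z s p \<omega>)\<^sup>2"
          using z K by (intro mult_left_mono power_mono) auto
        ultimately have "(Z s p \<omega> - min (Z s p \<omega>) K)\<^sup>2 * K\<^sup>2 \<le> Z s p \<omega> ^ 4"
          using mult_right_mono[of "(Z s p \<omega> - min (Z s p \<omega>) K)\<^sup>2" "(Z s p \<omega>)\<^sup>2" "K\<^sup>2"]
          by (simp add: power4_eq_xxxx power2_eq_square mult.assoc)
        then show ?thesis using K by (simp add: field_simps)
      qed (use K in simp)
      then have "(exp (?\<beta> * q))\<^sup>2 * (Z s p \<omega> - min (Z s p \<omega>) K)\<^sup>2 \<le> (exp (?\<beta> * q))\<^sup>2 * (Z s p \<omega> ^ 4 / K\<^sup>2)"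
        by (rule mult_left_mono) simp
      then show "(?g \<omega>)\<^sup>2 \<le> (exp (?\<beta> * q))\<^sup>2 / K\<^sup>2 * Z s p \<omega> ^ 4" by (simp add: power_mult_distrib)
    qed
    also have "\<dots> = (exp (?\<beta> * q))\<^sup>2 * (exp (6 * kap * q) / K\<^sup>2)" using v4 by simp
    also have "\<dots> \<le> exp (?A * (T - s)) * (exp (6 * kap * (T - s)) / K\<^sup>2)"
    proof (rule mult_mono)
      have "2 * (?\<beta> * q) = (2 * ?\<beta>) * q" by simp
      also have "\<dots> \<le> ?A * (T - s)"
      proof (rule mult_mono)
        show "2 * ?\<beta> \<le> ?A" by (rule order_trans[OF mult_left_mono[OF abs_ge_self]]) (use kap in auto)
      qed (use \<delta> kap in auto)
      finally show "(exp (?\<beta> * q))\<^sup>2 \<le> exp (?A * (T - s))" unfolding exp_double[symmetric] by simp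
      show "exp (6 * kap * q) / K\<^sup>2 \<le> exp (6 * kap * (T - s)) / K\<^sup>2"
        using \<delta> kap by (intro divide_right_mono) (auto intro!: mult_mono)
    qed auto
    finally show ?thesis .
  qed
  have "(\<integral>\<^sup>+\<omega>. ennreal ((gbm s C \<tau> \<omega> - C * exp (?\<beta> * (p - s)) * min (Z s p \<omega>) K)\<^sup>2) \<partial>M)
     = (\<integral>\<^sup>+\<omega>. ennreal ((C * (?f \<omega> + ?g \<omega>))\<^sup>2) \<partial>M)"
  proof (rule nn_integral_cong_AE)
    show "AE \<omega> in M. ennreal ((gbm s C \<tau> \<omega> - C * exp (?\<beta> * (p - s)) * min (Z s p \<omega>) K)\<^sup>2) = ennreal ((C * (?f \<omega> + ?g \<omega>))\<^sup>2)"
      using gbm_dens[OF s(1), of C]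
    proof eventually_elim
      case (elim \<omega>)
      have "gbm s C \<tau> \<omega> = C * exp (?\<beta> * (q + \<delta>)) * Z s \<tau> \<omega>" using elim s \<delta>(5) by auto
      then show ?case by (simp add: algebra_simps q_def)
    qed
  qed
  also have "\<dots> = ennreal (\<integral>\<omega>. (C * (?f \<omega> + ?g \<omega>))\<^sup>2 \<partial>M)"
    by (intro L2_nn L2_cmult L2_add Lf Lg)
  also have "\<dots> \<le> ennreal (2 * C\<^sup>2 * ((\<integral>\<omega>. (?f \<omega>)\<^sup>2 \<partial>M) + (\<integral>\<omega>. (?g \<omega>)\<^sup>2 \<partial>M)))"
  proof (rule ennreal_leI)
    have "(\<integral>\<omega>. (C * (?f \<omega> + ?g \<omega>))\<^sup>2 \<partial>M) \<le> (\<integral>\<omega>. 2 * C\<^sup>2 * ((?f \<omega>)\<^sup>2 + (?g \<omega>)\<^sup>2) \<partial>M)"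
    proof (rule integral_mono)
      show "integrable M (\<lambda>\<omega>. (C * (?f \<omega> + ?g \<omega>))\<^sup>2)" by (intro L2_sq L2_cmult L2_add Lf Lg)
      show "integrable M (\<lambda>\<omega>. 2 * C\<^sup>2 * ((?f \<omega>)\<^sup>2 + (?g \<omega>)\<^sup>2))"
        by (intro integrable_mult_right Bochner_Integration.integrable_add L2_sq Lf Lg)
      fix \<omega>
      have "(x + y)\<^sup>2 \<le> 2 * (x\<^sup>2 + y\<^sup>2)" for x y :: real
        using zero_le_power2[of "x - y"] by (simp add: power2_eq_square algebra_simps)
      then have "C\<^sup>2 * (x + y)\<^sup>2 \<le> C\<^sup>2 * (2 * (x\<^sup>2 + y\<^sup>2))" for x y :: real
        by (intro mult_left_mono) auto
      then have "(C * (x + y))\<^sup>2 \<le> 2 * C\<^sup>2 * (x\<^sup>2 + y\<^sup>2)" for x y :: real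
        by (simp only: power_mult_distrib mult_ac)
      then show "(C * (?f \<omega> + ?g \<omega>))\<^sup>2 \<le> 2 * C\<^sup>2 * ((?f \<omega>)\<^sup>2 + (?g \<omega>)\<^sup>2)" .
    qed
    also have "\<dots> = 2 * C\<^sup>2 * ((\<integral>\<omega>. (?f \<omega>)\<^sup>2 \<partial>M) + (\<integral>\<omega>. (?g \<omega>)\<^sup>2 \<partial>M))"
      using L2_sq[OF Lf] L2_sq[OF Lg] by simp
    finally show "(\<integral>\<omega>. (C * (?f \<omega> + ?g \<omega>))\<^sup>2 \<partial>M) \<le> 2 * C\<^sup>2 * ((\<integral>\<omega>. (?f \<omega>)\<^sup>2 \<partial>M) + (\<integral>\<omega>. (?g \<omega>)\<^sup>2 \<partial>M))" .
  qed
  also have "\<dots> \<le> ennreal (2 * C\<^sup>2 * (exp (?A * (T - s)) * (exp (?A * e) - 1 + 2 * (1 - exp (- \<bar>?\<beta>\<bar> * e)))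
       + exp (?A * (T - s)) * (exp (6 * kap * (T - s)) / K\<^sup>2)))"
    by (intro ennreal_leI mult_left_mono add_mono b1 b2) auto
  finally show ?thesis by (simp add: distrib_left mult.assoc)
qed

text \<open>Apart from zero, the only integrands for which existence is needed are these. They are
  approximated on \<open>Suc k\<close> equal cells with cut-off level \<open>Suc k\<close>, so that
  a single index refines the grid and releases the cut.\<close>

lemma gbm_ito_exists:
  assumes s: "0 \<le> s" "s \<le> T" and i: "i \<in> {0, 1}"
  shows "\<exists>I. is_ito_integral M F (W i) s T (gbm s C) I"
proof -
  define n :: "nat \<Rightarrow> nat" where "n = Suc"
  define p where "p k l = s + (T - s) * real l / real (Suc k)" for k l :: nat
  define \<xi> where "\<xi> k l \<omega> = C * exp ((r - kap) * (p k l - s)) * min (Z s (p k l) \<omega>) (real (Suc k))" for k l :: nat and \<omega>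
  let ?A = "2 * \<bar>r - kap\<bar> + kap"
  define e where "e k = 2 * C\<^sup>2 * exp (?A * (T - s)) *
       ((exp (?A * ((T - s) / real (Suc k))) - 1 + 2 * (1 - exp (- \<bar>r - kap\<bar> * ((T - s) / real (Suc k))))) + exp (6 * kap * (T - s)) / (real (Suc k))\<^sup>2)" for k
  have step: "p k (Suc l) - p k l = (T - s) / real (Suc k)" for k l
    by (simp add: p_def distrib_left add_divide_distrib)
  have pmono: "p k l \<le> p k (Suc l)" for k l using step[of k l] s
    by (metis diff_ge_0_iff_ge divide_nonneg_nonneg of_nat_0_le_iff)
  have ps: "s \<le> p k l" for k l using s by (simp add: p_def)
  have pT: "p k l \<le> T" if "l \<le> Suc k" for k l
  proof -
    have "(T - s) * real l / real (Suc k) \<le> (T - s) * 1"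
      using that s by (simp add: divide_le_eq mult_left_mono del: of_nat_Suc)
    then show ?thesis by (simp add: p_def)
  qed
  have S: "simple_integrand M F s T (n k) (p k) (\<xi> k)" for k
    unfolding simple_integrand_def
  proof (intro conjI allI impI)
    show "p k 0 = s" by (simp add: p_def)
    show "p k (n k) = T" unfolding p_def n_def by (subst nonzero_mult_div_cancel_right) auto
    show "p k l \<le> p k (Suc l)" for l by (rule pmono)
    show "\<xi> k l \<in> borel_measurable (F (p k l))" for l
      unfolding \<xi>_def[abs_def] using dens_F[of s "p k l" "p k l" lam0 lam1] s ps[of k l] by simp
    show "\<exists>C. \<forall>l<n k. \<forall>\<omega>\<in>space M. \<bar>\<xi> k l \<omega>\<bar> \<le> C"
    proof (intro exI allI impI ballI)
      fix l \<omega> assume l: "l < n k"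
      have "\<bar>\<xi> k l \<omega>\<bar> = \<bar>C\<bar> * exp ((r - kap) * (p k l - s)) * min (Z s (p k l) \<omega>) (real (Suc k))"
        using dens_pos[of lam0 lam1 s "p k l" \<omega>] by (simp add: \<xi>_def abs_mult less_imp_le)
      also have "\<dots> \<le> \<bar>C\<bar> * exp (\<bar>r - kap\<bar> * (T - s)) * real (Suc k)"
        using ps[of k l] pT[of l k] l dens_pos[of lam0 lam1 s "p k l" \<omega>]
        by (intro mult_mono) (auto simp: n_def less_imp_le intro!: mult_mono)
      finally show "\<bar>\<xi> k l \<omega>\<bar> \<le> \<bar>C\<bar> * exp (\<bar>r - kap\<bar> * (T - s)) * real (Suc k)" .
    qed
  qed
  have SL: "L2 (Q s T) (\<lambda>z. simple_process (n k) (p k) (\<xi> k) (snd z) (fst z))" for k by (rule simple_process_L2[OF S])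
  note GL = gbm_L2_Q[OF s, of C]
  have bound: "(\<integral>\<^sup>+z. ennreal ((gbm s C (snd z) (fst z) - simple_process (n k) (p k) (\<xi> k) (snd z) (fst z))\<^sup>2) \<partial>Q s T)
      \<le> ennreal (e k * (T - s))" for k
  proof -
    have e0: "0 \<le> e k"
    proof -
      have "1 \<le> exp (?A * ((T - s) / real (Suc k)))" using s by (simp add: kap_def)
      moreover have "exp (- \<bar>r - kap\<bar> * ((T - s) / real (Suc k))) \<le> 1" using s by simp
      ultimately show ?thesis unfolding e_def by (intro mult_nonneg_nonneg add_nonneg_nonneg) auto
    qed
    have sp: "(\<integral>\<^sup>+\<omega>. ennreal ((gbm s C \<tau> \<omega> - simple_process (n k) (p k) (\<xi> k) \<tau> \<omega>)\<^sup>2) \<partial>M) \<le> ennreal (e k)"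
      if \<tau>: "s < \<tau>" "\<tau> \<le> T" for \<tau>
    proof -
      \<comment> \<open>The cell containing \<open>\<tau>\<close>, open on the left and closed on
        the right as in \<open>simple_process\<close>.\<close>
      define l where "l = (LEAST l. \<tau> \<le> p k (Suc l))"
      have ex: "\<tau> \<le> p k (Suc k)" using \<tau> unfolding p_def by (subst nonzero_mult_div_cancel_right) auto
      have l1: "\<tau> \<le> p k (Suc l)" unfolding l_def by (rule LeastI[of _ k]) (rule ex)
      have lk: "l \<le> k" unfolding l_def by (rule Least_le) (rule ex)
      have l0: "p k l < \<tau>"
      proof (cases l)
        case 0 then show ?thesis using \<tau> by (simp add: p_def)
      next
        case (Suc m)
        then have "\<not> \<tau> \<le> p k (Suc m)" using not_less_Least[of m "\<lambda>l. \<tau> \<le> p k (Suc l)"] unfolding l_def by simp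
        then show ?thesis using Suc by simp
      qed
      have mono: "p k i \<le> p k j" if "i \<le> j" for i j
        using that s unfolding p_def by (intro add_left_mono divide_right_mono mult_left_mono) auto
      have "simple_process (n k) (p k) (\<xi> k) \<tau> \<omega> = \<xi> k l \<omega>" for \<omega>
      proof -
        have ind: "indicator {p k m<..p k (Suc m)} \<tau> = (if m = l then 1 else 0 :: real)" for m
        proof (cases m l rule: linorder_cases)
          case less
          then have "p k (Suc m) \<le> p k l" by (intro mono) simp
          then show ?thesis using less l0 by simp
        next
          case greater
          then have "p k (Suc l) \<le> p k m" by (intro mono) simp
          then show ?thesis using greater l1 by simp
        qed (use l0 l1 in simp)
        show ?thesis unfolding simple_process_def ind using lk by (simp add: n_def if_distrib cong: if_cong)
      qed
      then have "(\<integral>\<^sup>+\<omega>. ennreal ((gbm s C \<tau> \<omega> - simple_process (n k) (p k) (\<xi> k) \<tau> \<omega>)\<^sup>2) \<partial>M)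
        = (\<integral>\<^sup>+\<omega>. ennreal ((gbm s C \<tau> \<omega> - C * exp ((r - kap) * (p k l - s)) * min (Z s (p k l) \<omega>) (real (Suc k)))\<^sup>2) \<partial>M)"
        by (simp add: \<xi>_def)
      also have "\<dots> \<le> ennreal (e k)"
        unfolding e_def
        by (rule gbm_step_bound) (use s ps[of k l] l0 l1 \<tau> step[of k l] in auto)
      finally show ?thesis .
    qed
    have "(\<integral>\<^sup>+z. ennreal ((gbm s C (snd z) (fst z) - simple_process (n k) (p k) (\<xi> k) (snd z) (fst z))\<^sup>2) \<partial>Q s T)
      = (\<integral>\<^sup>+\<tau>\<in>{s..T}. (\<integral>\<^sup>+\<omega>. ennreal ((gbm s C \<tau> \<omega> - simple_process (n k) (p k) (\<xi> k) \<tau> \<omega>)\<^sup>2) \<partial>M) \<partial>lborel)"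
      by (subst nn_integral_Q_snd) (use L2_meas[OF GL] L2_meas[OF SL[of k]] in auto)
    also have "\<dots> \<le> (\<integral>\<^sup>+\<tau>\<in>{s..T}. ennreal (e k) \<partial>lborel)"
    proof (rule nn_integral_mono_AE)
      \<comment> \<open>At \<open>s\<close> itself no cell applies and the simple process vanishes;
        a single time is negligible.\<close>
      have "AE \<tau> in lborel. \<tau> \<noteq> s" by (rule AE_lborel_singleton)
      then show "AE \<tau> in lborel. (\<integral>\<^sup>+\<omega>. ennreal ((gbm s C \<tau> \<omega> - simple_process (n k) (p k) (\<xi> k) \<tau> \<omega>)\<^sup>2) \<partial>M) * indicator {s..T} \<tau>
          \<le> ennreal (e k) * indicator {s..T} \<tau>"
        by eventually_elim (use sp in \<open>auto simp: indicator_def\<close>)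
    qed
    also have "\<dots> = ennreal (e k * (T - s))"
      using s e0 by (simp add: nn_integral_cmult_indicator ennreal_mult)
    finally show ?thesis .
  qed
  have inv: "(\<lambda>k. 1 / real (Suc k)) \<longlonglongrightarrow> 0" by (rule LIMSEQ_Suc[OF lim_1_over_n])
  have "(\<lambda>k. e k * (T - s)) \<longlonglongrightarrow> (2 * C\<^sup>2 * exp (?A * (T - s)) *
       ((exp (?A * ((T - s) * 0)) - 1 + 2 * (1 - exp (- \<bar>r - kap\<bar> * ((T - s) * 0)))) + exp (6 * kap * (T - s)) * 0\<^sup>2)) * (T - s)"
  proof -
    have "e k = 2 * C\<^sup>2 * exp (?A * (T - s)) *
       ((exp (?A * ((T - s) * (1 / real (Suc k)))) - 1 + 2 * (1 - exp (- \<bar>r - kap\<bar> * ((T - s) * (1 / real (Suc k)))))) + exp (6 * kap * (T - s)) * (1 / real (Suc k))\<^sup>2)" for k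
      by (simp add: e_def power_divide)
    then show ?thesis by (simp only:) (intro tendsto_intros inv)
  qed
  then have e: "(\<lambda>k. e k * (T - s)) \<longlonglongrightarrow> 0" by simp
  have "L2_lim (Q s T) (\<lambda>k z. simple_process (n k) (p k) (\<xi> k) (snd z) (fst z)) (\<lambda>z. gbm s C (snd z) (fst z))"
    unfolding L2_lim_def
  proof (rule tendsto_sandwich[OF _ _ tendsto_const])
    show "\<forall>\<^sub>F k in sequentially. (\<integral>\<^sup>+z. ennreal ((gbm s C (snd z) (fst z) - simple_process (n k) (p k) (\<xi> k) (snd z) (fst z))\<^sup>2) \<partial>Q s T)
        \<le> ennreal (e k * (T - s))" using bound by simp
    show "(\<lambda>k. ennreal (e k * (T - s))) \<longlonglongrightarrow> 0" using tendsto_ennrealI[OF e] by simp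
  qed simp
  then show ?thesis
    by (rule ito_integral_exists[OF i s gbm_progressive[OF s(1)] gbm_square_integrable[OF s] S])
qed

end

section \<open>The closed loop\<close>

lemma LINT_split:
  fixes g :: "real \<Rightarrow> real"
  assumes "s \<le> \<tau>" "\<tau> \<le> t" "continuous_on {s..t} g"
  shows "(LINT v:{s..t}|lborel. g v) = (LINT v:{s..\<tau>}|lborel. g v) + (LINT v:{\<tau>..t}|lborel. g v)"
proof -
  have c: "continuous_on {s..\<tau>} g" "continuous_on {\<tau>..t} g"
    using assms by (auto elim: continuous_on_subset)
  have "integral {s..\<tau>} g + integral {\<tau>..t} g = integral {s..t} g"
    using assms by (intro Henstock_Kurzweil_Integration.integral_combine integrable_continuous_interval)
  then show ?thesis
    using set_borel_integral_eq_integral(2)[OF borel_integrable_atLeastAtMost'[OF assms(3)]]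
      set_borel_integral_eq_integral(2)[OF borel_integrable_atLeastAtMost'[OF c(1)]]
      set_borel_integral_eq_integral(2)[OF borel_integrable_atLeastAtMost'[OF c(2)]] by simp
qed

context linear_control
begin

lemma gbm_scale: "gbm s (l * C) t \<omega> = l * gbm s C t \<omega>"
  by (simp add: gbm_def)

text \<open>Closed form of the integral of \<open>exp (r * (v - s))\<close> for \<open>v\<close>
  from \<open>s\<close> to \<open>t\<close>, kept explicit so that it can be differentiated.\<close>

definition growth :: "real \<Rightarrow> real \<Rightarrow> real" where
  "growth s t = (exp (r * (t - s)) - 1) / r"

lemma LINT_growth: "s \<le> t \<Longrightarrow> (LINT v:{s..t}|lborel. exp (r * (v - s))) = growth s t"
proof -
  assume "s \<le> t"
  then have "(LINT v:{s..t}|lborel. exp (r * (v - s))) = exp (r * (t - s)) / r - exp (r * (s - s)) / r"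
    by (rule LINT_FTC) (use pos in \<open>auto intro!: derivative_eq_intros continuous_intros\<close>)
  then show ?thesis by (simp add: growth_def diff_divide_distrib)
qed

lemma dens_M: "0 \<le> s \<Longrightarrow> s \<le> t \<Longrightarrow> Z s t \<in> borel_measurable M"
  by (rule L2_meas[OF L2_dens])

text \<open>Testing with the process is testing with the density, for which the duality is
  available.\<close>

lemma gbm_test:
  assumes "0 \<le> s" "t \<in> {s..T}" "Y \<in> borel_measurable M"
  shows "(\<integral>\<omega>. Y \<omega> * gbm s C t \<omega> \<partial>M) = C * exp ((r - kap) * (t - s)) * (\<integral>\<omega>. Z s t \<omega> * Y \<omega> \<partial>M)"
proof -
  have "(\<integral>\<omega>. Y \<omega> * gbm s C t \<omega> \<partial>M) = (\<integral>\<omega>. C * exp ((r - kap) * (t - s)) * (Z s t \<omega> * Y \<omega>) \<partial>M)"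
  proof (rule integral_cong_AE)
    show "AE \<omega> in M. Y \<omega> * gbm s C t \<omega> = C * exp ((r - kap) * (t - s)) * (Z s t \<omega> * Y \<omega>)"
      using gbm_dens[OF assms(1), of C] by eventually_elim (use assms in auto)
  qed (use gbm_M[OF assms(1,2)] dens_M[of s t] assms in auto)
  then show ?thesis by simp
qed

text \<open>Duality turns the Ito integral into a time integral of covariances; the signs of the
  integrand and of the duality cancel and leave \<open>l\<^sup>2\<close>. The covariance of the
  density contributes \<open>exp (kap * (v - s))\<close>, which compensates the \<open>- kap\<close>
  in the exponent of the process, so that \<open>growth\<close> appears.\<close>

lemma dens_ito_gbm:
  assumes s: "0 \<le> s" "s \<le> T" and t: "t \<in> {s..T}" "\<tau> \<in> {s..T}" and i: "i \<in> {0, 1}"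
    and l: "l = (if i = 0 then lam0 else lam1)"
    and I: "is_ito_integral M F (W i) s T (gbm s (- l * C)) I"
  shows "(\<integral>\<omega>. Z s \<tau> \<omega> * I t \<omega> \<partial>M) = l\<^sup>2 * C * growth s (min t \<tau>)"
proof -
  have s\<tau>: "s \<le> \<tau>" using t by simp
  have Zi: "L2 M (Z s \<tau>)" using s t by (intro L2_dens) auto
  have int: "integrable (Q s T) (\<lambda>z. (gbm s (- l * C) (snd z) (fst z) * indicator {..t} (snd z)) * (Z s \<tau> (fst z) * indicator {..\<tau>} (snd z)))"
    by (intro L2_mult L2_indicator gbm_L2_Q s L2_fst Zi)
  have m: "min t \<tau> \<in> {s..T}" using t by auto
  have "(\<integral>z. (gbm s (- l * C) (snd z) (fst z) * indicator {..t} (snd z)) * (Z s \<tau> (fst z) * indicator {..\<tau>} (snd z)) \<partial>Q s T)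
    = (LINT v:{s..T}|lborel. (\<integral>\<omega>. Z s \<tau> \<omega> * gbm s (- l * C) v \<omega> \<partial>M) * indicator {..min t \<tau>} v)"
    unfolding integral_Q_snd[OF int] Bochner_Integration.integral_mult_left_zero[symmetric]
    by (intro set_lebesgue_integral_cong) (auto intro!: Bochner_Integration.integral_cong simp: indicator_def)
  also have "\<dots> = (LINT v:{s..min t \<tau>}|lborel. (\<integral>\<omega>. Z s \<tau> \<omega> * gbm s (- l * C) v \<omega> \<partial>M))"
    using t by (intro LINT_indicator) auto
  also have "\<dots> = (LINT v:{s..min t \<tau>}|lborel. (- l * C) * exp (r * (v - s)))"
  proof (intro set_lebesgue_integral_cong, simp, intro allI impI)
    fix v assume v: "v \<in> {s..min t \<tau>}"
    have "(\<integral>\<omega>. Z s \<tau> \<omega> * gbm s (- l * C) v \<omega> \<partial>M) = (- l * C) * (exp ((r - kap) * (v - s)) * exp (kap * (min v \<tau> - s)))"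
      using gbm_inner[OF s(1) _ s\<tau>, of v "- l * C"] v t by simp
    also have "exp ((r - kap) * (v - s)) * exp (kap * (min v \<tau> - s)) = exp (r * (v - s))"
      using v unfolding exp_add[symmetric] by (simp add: algebra_simps)
    finally show "(\<integral>\<omega>. Z s \<tau> \<omega> * gbm s (- l * C) v \<omega> \<partial>M) = (- l * C) * exp (r * (v - s))" .
  qed
  also have "\<dots> = (- l * C) * growth s (min t \<tau>)"
    unfolding set_integral_mult_right using LINT_growth[of s "min t \<tau>"] m by simp
  finally show ?thesis
    unfolding ito_dens[OF I i s t(1) s\<tau>] l[symmetric] by (simp add: power2_eq_square)
qed

text \<open>The Ito formula for this exponential without second-order expansions: the residual \<open>X\<close> of the
  equation is orthogonal to every term it consists of, because all inner products involved are known
  from the isometry and from the duality with the density process.\<close>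

lemma gbm_sde:
  assumes s: "0 \<le> s" "s \<le> T" and t: "t \<in> {s..T}"
    and I0: "is_ito_integral M F (W 0) s T (gbm s (- lam0 * C)) I0"
    and I1: "is_ito_integral M F (W 1) s T (gbm s (- lam1 * C)) I1"
  shows "AE \<omega> in M. gbm s C t \<omega> = C + (r - kap) * time_integral s T (\<lambda>z. gbm s C (snd z) (fst z)) t \<omega> + I0 t \<omega> + I1 t \<omega>"
proof -
  let ?\<beta> = "r - kap"
  let ?z = "gbm s C" and ?U = "time_integral s T (\<lambda>z. gbm s C (snd z) (fst z)) t"
  have st: "s \<le> t" "t \<le> T" using t by auto
  note zL = gbm_L2[OF s(1) t, of C] and zQ = gbm_L2_Q[OF s, of C]
  note UL = time_integral_L2[OF zQ s(2), of t]
  note I0L = ito_L2[OF I0 _ s t, simplified] and I1L = ito_L2[OF I1 _ s t, simplified]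
  define X where "X \<omega> = ?z t \<omega> - C - ?\<beta> * ?U \<omega> - I0 t \<omega> - I1 t \<omega>" for \<omega>
  have XL: "L2 M X" unfolding X_def by (intro L2_diff L2_cmult zL L2_const UL I0L I1L)
  have expand: "(\<integral>\<omega>. Y \<omega> * X \<omega> \<partial>M) = (\<integral>\<omega>. Y \<omega> * ?z t \<omega> \<partial>M) - C * (\<integral>\<omega>. Y \<omega> \<partial>M) - ?\<beta> * (\<integral>\<omega>. Y \<omega> * ?U \<omega> \<partial>M)
      - (\<integral>\<omega>. Y \<omega> * I0 t \<omega> \<partial>M) - (\<integral>\<omega>. Y \<omega> * I1 t \<omega> \<partial>M)" if Y: "L2 M Y" for Y
  proof -
    have "(\<integral>\<omega>. Y \<omega> * X \<omega> \<partial>M) = (\<integral>\<omega>. Y \<omega> * ?z t \<omega> - C * Y \<omega> - ?\<beta> * (Y \<omega> * ?U \<omega>) - Y \<omega> * I0 t \<omega> - Y \<omega> * I1 t \<omega> \<partial>M)"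
      by (simp add: X_def algebra_simps)
    then show ?thesis
      using L2_mult[OF Y zL] L2_integrable[OF Y] L2_mult[OF Y UL] L2_mult[OF Y I0L] L2_mult[OF Y I1L] by simp
  qed
  have U_inner: "(\<integral>\<omega>. Y \<omega> * ?U \<omega> \<partial>M) = (LINT v:{s..t}|lborel. (\<integral>\<omega>. Y \<omega> * ?z v \<omega> \<partial>M))" if Y: "L2 M Y" for Y
  proof -
    have "(\<integral>\<omega>. Y \<omega> * ?U \<omega> \<partial>M) = (\<integral>z. Y (fst z) * (?z (snd z) (fst z) * indicator {..t} (snd z)) \<partial>Q s T)"
      by (rule time_integral_inner[OF zQ Y])
    also have "\<dots> = (LINT v:{s..T}|lborel. (\<integral>\<omega>. Y \<omega> * ?z v \<omega> \<partial>M) * indicator {..t} v)"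
      unfolding integral_Q_snd[OF L2_mult[OF L2_fst[OF Y] L2_indicator[OF zQ]]] Bochner_Integration.integral_mult_left_zero[symmetric]
      by (simp add: mult.assoc)
    finally show ?thesis using LINT_indicator[OF st(2)] by simp
  qed
  \<comment> \<open>The process at time \<open>\<tau>\<close> is a multiple of
    \<open>Z s \<tau>\<close>, so this prepares orthogonality to the process. All terms are
    explicit, and they cancel since
    \<open>r * growth s \<tau> = exp (r * (\<tau> - s)) - 1\<close>.\<close>
  have XZ: "(\<integral>\<omega>. Z s \<tau> \<omega> * X \<omega> \<partial>M) = 0" if \<tau>: "\<tau> \<in> {s..t}" for \<tau>
  proof -
    have \<tau>': "s \<le> \<tau>" "\<tau> \<in> {s..T}" "min t \<tau> = \<tau>" "\<tau> \<le> t" using \<tau> t by auto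
    have Y: "L2 M (Z s \<tau>)" using s \<tau> by (intro L2_dens) auto
    have Z1: "(\<integral>\<omega>. Z s \<tau> \<omega> \<partial>M) = 1" using dens_power[of s \<tau> lam0 lam1 1] s \<tau>' by simp
    have "(LINT v:{s..t}|lborel. (\<integral>\<omega>. Z s \<tau> \<omega> * ?z v \<omega> \<partial>M)) = (LINT v:{s..t}|lborel. C * (exp (?\<beta> * (v - s)) * exp (kap * (min v \<tau> - s))))"
      by (intro set_lebesgue_integral_cong) (use gbm_inner[OF s(1) _ \<tau>'(1), of _ C] st in auto)
    also have "\<dots> = C * (LINT v:{s..t}|lborel. exp (?\<beta> * (v - s)) * exp (kap * (min v \<tau> - s)))" by simp
    \<comment> \<open>Split at \<open>\<tau>\<close>, where \<open>min v \<tau>\<close> changes its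
      form.\<close>
    also have "(LINT v:{s..t}|lborel. exp (?\<beta> * (v - s)) * exp (kap * (min v \<tau> - s)))
      = (LINT v:{s..\<tau>}|lborel. exp (?\<beta> * (v - s)) * exp (kap * (min v \<tau> - s))) + (LINT v:{\<tau>..t}|lborel. exp (?\<beta> * (v - s)) * exp (kap * (min v \<tau> - s)))"
      by (intro LINT_split \<tau>' continuous_intros)
    also have "(LINT v:{s..\<tau>}|lborel. exp (?\<beta> * (v - s)) * exp (kap * (min v \<tau> - s))) = (LINT v:{s..\<tau>}|lborel. exp (r * (v - s)))"
      unfolding exp_add[symmetric] by (intro set_lebesgue_integral_cong) (auto simp: algebra_simps)
    also have "\<dots> = growth s \<tau>" by (rule LINT_growth[OF \<tau>'(1)])
    also have "(LINT v:{\<tau>..t}|lborel. exp (?\<beta> * (v - s)) * exp (kap * (min v \<tau> - s))) = (LINT v:{\<tau>..t}|lborel. exp (?\<beta> * (v - s)) * exp (kap * (\<tau> - s)))"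
      by (intro set_lebesgue_integral_cong) (auto simp: min_def)
    finally have U: "?\<beta> * (LINT v:{s..t}|lborel. (\<integral>\<omega>. Z s \<tau> \<omega> * ?z v \<omega> \<partial>M))
       = C * (?\<beta> * growth s \<tau> + (LINT v:{\<tau>..t}|lborel. ?\<beta> * (exp (?\<beta> * (v - s)) * exp (kap * (\<tau> - s)))))"
      unfolding set_integral_mult_right by (simp only: distrib_left mult.left_commute)
    have "(LINT v:{\<tau>..t}|lborel. ?\<beta> * (exp (?\<beta> * (v - s)) * exp (kap * (\<tau> - s))))
       = exp (?\<beta> * (t - s)) * exp (kap * (\<tau> - s)) - exp (?\<beta> * (\<tau> - s)) * exp (kap * (\<tau> - s))"
      by (rule LINT_FTC[OF \<tau>'(4)]) (auto intro!: derivative_eq_intros continuous_intros)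
    also have "exp (?\<beta> * (\<tau> - s)) * exp (kap * (\<tau> - s)) = exp (r * (\<tau> - s))"
      unfolding exp_add[symmetric] by (simp add: algebra_simps)
    finally have U': "?\<beta> * (LINT v:{s..t}|lborel. (\<integral>\<omega>. Z s \<tau> \<omega> * ?z v \<omega> \<partial>M))
       = C * (?\<beta> * growth s \<tau> + (exp (?\<beta> * (t - s)) * exp (kap * (\<tau> - s)) - exp (r * (\<tau> - s))))" using U by simp
    have I: "(\<integral>\<omega>. Z s \<tau> \<omega> * I0 t \<omega> \<partial>M) = lam0\<^sup>2 * C * growth s \<tau>" "(\<integral>\<omega>. Z s \<tau> \<omega> * I1 t \<omega> \<partial>M) = lam1\<^sup>2 * C * growth s \<tau>"
      using dens_ito_gbm[OF s t \<tau>'(2) _ _ I0] dens_ito_gbm[OF s t \<tau>'(2) _ _ I1] \<tau>'(3) by simp_all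
    have "(\<integral>\<omega>. Z s \<tau> \<omega> * X \<omega> \<partial>M) = C * (exp (?\<beta> * (t - s)) * exp (kap * (\<tau> - s))) - C * 1
        - C * (?\<beta> * growth s \<tau> + (exp (?\<beta> * (t - s)) * exp (kap * (\<tau> - s)) - exp (r * (\<tau> - s))))
        - lam0\<^sup>2 * C * growth s \<tau> - lam1\<^sup>2 * C * growth s \<tau>"
      unfolding expand[OF Y] Z1 U_inner[OF Y] U' I using gbm_inner[OF s(1) t \<tau>'(1), of C] \<tau>'(3) by simp
    also have "\<dots> = C * (exp (r * (\<tau> - s)) - 1 - (?\<beta> + kap) * growth s \<tau>)"
      by (simp add: kap_def algebra_simps)
    also have "\<dots> = 0" using pos by (simp add: growth_def)
    finally show ?thesis .
  qed
  \<comment> \<open>\<open>cross\<close> says that only the product of the integral with itself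
    remains; it holds because integrals with respect to different motions are orthogonal.\<close>
  have XI: "(\<integral>\<omega>. I t \<omega> * X \<omega> \<partial>M) = 0"
    if i: "i \<in> {0, 1}" and l: "l = (if i = 0 then lam0 else lam1)" and I: "is_ito_integral M F (W i) s T (gbm s (- l * C)) I"
      and cross: "(\<integral>\<omega>. I t \<omega> * I0 t \<omega> \<partial>M) + (\<integral>\<omega>. I t \<omega> * I1 t \<omega> \<partial>M) = (\<integral>\<omega>. I t \<omega> * I t \<omega> \<partial>M)" for i l I
  proof -
    note IL = ito_L2[OF I i s t]
    have test: "(\<integral>\<omega>. I t \<omega> * ?z v \<omega> \<partial>M) = l\<^sup>2 * C\<^sup>2 * (exp (?\<beta> * (v - s)) * growth s v)" if v: "v \<in> {s..t}" for v
    proof -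
      have v': "v \<in> {s..T}" "min t v = v" using v t by auto
      show ?thesis using gbm_test[OF s(1) v'(1) L2_meas[OF IL], of C] dens_ito_gbm[OF s t v'(1) i l I] v'(2)
        by (simp add: power2_eq_square)
    qed
    have II: "(\<integral>\<omega>. I t \<omega> * I t \<omega> \<partial>M) = (LINT v:{s..t}|lborel. l\<^sup>2 * C\<^sup>2 * exp ((2 * ?\<beta> + kap) * (v - s)))"
    proof -
      note gL = gbm_L2_Q[OF s, of "- l * C"]
      have "(\<integral>\<omega>. I t \<omega> * I t \<omega> \<partial>M) = (\<integral>z. (gbm s (- l * C) (snd z) (fst z) * indicator {..t} (snd z)) * (gbm s (- l * C) (snd z) (fst z) * indicator {..t} (snd z)) \<partial>Q s T)"
        using ito_inner[OF I I i i s t] by simp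
      also have "\<dots> = (LINT v:{s..T}|lborel. (\<integral>\<omega>. gbm s (- l * C) v \<omega> * gbm s (- l * C) v \<omega> \<partial>M) * indicator {..t} v)"
        unfolding integral_Q_snd[OF L2_mult[OF L2_indicator[OF gL] L2_indicator[OF gL]]] Bochner_Integration.integral_mult_left_zero[symmetric]
        by (intro set_lebesgue_integral_cong) (auto intro!: Bochner_Integration.integral_cong simp: indicator_def)
      also have "\<dots> = (LINT v:{s..t}|lborel. (\<integral>\<omega>. gbm s (- l * C) v \<omega> * gbm s (- l * C) v \<omega> \<partial>M))"
        by (rule LINT_indicator[OF st(2)])
      also have "\<dots> = (LINT v:{s..t}|lborel. l\<^sup>2 * C\<^sup>2 * exp ((2 * ?\<beta> + kap) * (v - s)))"
        by (intro set_lebesgue_integral_cong) (use gbm_square[OF s(1), of _ "- l * C"] st in \<open>auto simp: power_mult_distrib\<close>)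
      finally show ?thesis .
    qed
    \<comment> \<open>The product rule for the inner product of the Ito integral with the process;
      the second summand is the integrand that the isometry produces.\<close>
    have ftc: "(LINT v:{s..t}|lborel. ?\<beta> * (exp (?\<beta> * (v - s)) * growth s v) + exp ((2 * ?\<beta> + kap) * (v - s))) = exp (?\<beta> * (t - s)) * growth s t"
    proof -
      have "((\<lambda>v. exp (?\<beta> * (v - s)) * growth s v) has_real_derivative
          ?\<beta> * (exp (?\<beta> * (v - s)) * growth s v) + exp ((2 * ?\<beta> + kap) * (v - s))) (at v)" for v
      proof -
        have g: "((\<lambda>v. growth s v) has_real_derivative exp (r * (v - s))) (at v)"
          unfolding growth_def using pos by (auto intro!: derivative_eq_intros)
        have "((\<lambda>v. exp (?\<beta> * (v - s)) * growth s v) has_real_derivative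
            exp (?\<beta> * (v - s)) * ?\<beta> * growth s v + exp (r * (v - s)) * exp (?\<beta> * (v - s))) (at v)"
          by (auto intro!: derivative_eq_intros g)
        moreover have "exp (r * (v - s)) * exp (?\<beta> * (v - s)) = exp ((2 * ?\<beta> + kap) * (v - s))"
          unfolding exp_add[symmetric] by (simp add: algebra_simps)
        ultimately show ?thesis by (simp add: mult_ac)
      qed
      then have "(LINT v:{s..t}|lborel. ?\<beta> * (exp (?\<beta> * (v - s)) * growth s v) + exp ((2 * ?\<beta> + kap) * (v - s)))
         = exp (?\<beta> * (t - s)) * growth s t - exp (?\<beta> * (s - s)) * growth s s"
        unfolding growth_def using pos by (intro LINT_FTC[OF st(1)]) (auto intro!: continuous_intros)
      then show ?thesis by (simp add: growth_def)
    qed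
    have c: "set_integrable lborel {s..t} (\<lambda>v. ?\<beta> * (exp (?\<beta> * (v - s)) * growth s v))"
      "set_integrable lborel {s..t} (\<lambda>v. exp ((2 * ?\<beta> + kap) * (v - s)))"
      unfolding growth_def using pos by (auto intro!: borel_integrable_atLeastAtMost' continuous_intros)
    have "(\<integral>\<omega>. I t \<omega> * X \<omega> \<partial>M) = l\<^sup>2 * C\<^sup>2 * (exp (?\<beta> * (t - s)) * growth s t)
        - ?\<beta> * (LINT v:{s..t}|lborel. (\<integral>\<omega>. I t \<omega> * ?z v \<omega> \<partial>M)) - (\<integral>\<omega>. I t \<omega> * I t \<omega> \<partial>M)"
      unfolding expand[OF IL] U_inner[OF IL] ito_mean[OF I i s t] using test[of t] st cross by simp
    also have "(LINT v:{s..t}|lborel. (\<integral>\<omega>. I t \<omega> * ?z v \<omega> \<partial>M)) = (LINT v:{s..t}|lborel. l\<^sup>2 * C\<^sup>2 * (exp (?\<beta> * (v - s)) * growth s v))"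
      by (intro set_lebesgue_integral_cong) (use test in auto)
    also have "l\<^sup>2 * C\<^sup>2 * (exp (?\<beta> * (t - s)) * growth s t) - ?\<beta> * (LINT v:{s..t}|lborel. l\<^sup>2 * C\<^sup>2 * (exp (?\<beta> * (v - s)) * growth s v)) - (\<integral>\<omega>. I t \<omega> * I t \<omega> \<partial>M)
      = l\<^sup>2 * C\<^sup>2 * (exp (?\<beta> * (t - s)) * growth s t
         - ((LINT v:{s..t}|lborel. ?\<beta> * (exp (?\<beta> * (v - s)) * growth s v)) + (LINT v:{s..t}|lborel. exp ((2 * ?\<beta> + kap) * (v - s)))))"
    proof -
      have "K * x - B * (K * A) - K * G = K * (x - (B * A + G))" for K x B A G :: real
        by (simp add: algebra_simps)
      then show ?thesis unfolding II set_integral_mult_right .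
    qed
    also have "\<dots> = 0" unfolding set_integral_add(2)[OF c, symmetric] ftc by simp
    finally show ?thesis .
  qed
  have c01: "(\<integral>\<omega>. I0 t \<omega> * I1 t \<omega> \<partial>M) = 0" "(\<integral>\<omega>. I1 t \<omega> * I0 t \<omega> \<partial>M) = 0"
    using ito_inner[OF I0 I1 _ _ s t] ito_inner[OF I1 I0 _ _ s t] by simp_all
  have X0: "(\<integral>\<omega>. I0 t \<omega> * X \<omega> \<partial>M) = 0" by (rule XI[OF _ _ I0]) (use c01 in auto)
  have X1: "(\<integral>\<omega>. I1 t \<omega> * X \<omega> \<partial>M) = 0" by (rule XI[OF _ _ I1]) (use c01 in auto)
  have Xz: "(\<integral>\<omega>. X \<omega> * ?z v \<omega> \<partial>M) = 0" if "v \<in> {s..t}" for v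
    using gbm_test[OF s(1) _ L2_meas[OF XL], of v C] XZ[OF that] that t by simp
  have XU: "(\<integral>\<omega>. X \<omega> * ?U \<omega> \<partial>M) = 0"
  proof -
    have "(LINT v:{s..t}|lborel. (\<integral>\<omega>. X \<omega> * ?z v \<omega> \<partial>M)) = (LINT v:{s..t}|lborel. 0)"
      by (intro set_lebesgue_integral_cong) (use Xz in auto)
    then show ?thesis unfolding U_inner[OF XL] by simp
  qed
  have X_mean: "(\<integral>\<omega>. X \<omega> \<partial>M) = 0" using XZ[of s] st by simp
  \<comment> \<open>The residual itself is taken as test variable: every summand of its expansion is
    one of the inner products just shown to vanish.\<close>
  have "(\<integral>\<omega>. X \<omega> * X \<omega> \<partial>M) = 0"
    unfolding expand[OF XL] XU X_mean Xz[of t, OF atLeastAtMost_iff[THEN iffD2, OF conjI[OF st(1) order_refl]]]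
    using X0 X1 by (simp add: mult.commute)
  then have "(\<integral>\<omega>. (X \<omega>)\<^sup>2 \<partial>M) = 0" by (simp add: power2_eq_square)
  then have "AE \<omega> in M. (X \<omega>)\<^sup>2 = 0"
    using integral_nonneg_eq_0_iff_AE[OF L2_sq[OF XL]] by simp
  then show ?thesis by eventually_elim (auto simp: X_def)
qed

text \<open>The value at time \<open>t\<close> of the constant drift still to come, discounted at
  rate \<open>r\<close>; it equals \<open>g1 t * exp (- r * (T - t))\<close>. The value function
  changes its form where the state is minus this amount.\<close>

definition shift :: "real \<Rightarrow> real" where "shift t = c * (1 - exp (- r * (T - t))) / r"

definition feedback :: "real \<Rightarrow> real \<Rightarrow> real \<times> real" where
  "feedback t x = (if x + shift t < 0 then (- (\<rho> / \<sigma>\<^sup>2) * (x + shift t), - (\<alpha> / b\<^sup>2) * (x + shift t)) else (0, 0))"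

text \<open>Hence the sign of the terminal wealth under the zero control decides on which side of
  the boundary the state lies.\<close>

lemma endpoint_shift: "endpoint s y = exp (r * (T - s)) * (y + shift s)"
proof -
  have "E * y + c * (E - 1) / r = E * (y + c * (1 - E') / r)" if "E * E' = 1" for E E'
  proof -
    have "E * (c * (1 - E') / r) = c * (E - E * E') / r" by (simp add: algebra_simps)
    also have "\<dots> = c * (E - 1) / r" unfolding that ..
    finally show ?thesis by (simp only: distrib_left)
  qed
  moreover have "exp (r * (T - s)) * exp (- r * (T - s)) = 1" by (simp add: exp_add[symmetric])
  ultimately show ?thesis unfolding endpoint_def shift_def by blast
qed

lemma shift_derivative: "(shift has_real_derivative - c * exp (- r * (T - t))) (at t)"
  unfolding shift_def[abs_def] using pos by (auto intro!: derivative_eq_intros)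

lemma shift_integral: assumes "s \<le> t" shows "(LINT v:{s..t}|lborel. c - r * shift v) = shift s - shift t"
proof -
  have e: "(\<lambda>v. c - r * shift v) = (\<lambda>v. c * exp (- r * (T - v)))" using pos by (auto simp: shift_def field_simps)
  have "(LINT v:{s..t}|lborel. c * exp (- r * (T - v))) = (- shift t) - (- shift s)"
    by (rule LINT_FTC[OF assms]) (use DERIV_minus[OF shift_derivative] in \<open>auto intro!: continuous_intros\<close>)
  then show ?thesis unfolding e by simp
qed

section \<open>Closed-loop states on both sides of the boundary\<close>

lemma zero_ito:
  assumes s: "0 \<le> s" "s \<le> T" and i: "i \<in> {0, 1}"
  shows "is_ito_integral M F (W i) s T (\<lambda>t \<omega>. 0) (\<lambda>t \<omega>. 0)"
  unfolding is_ito_integral_def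
proof (intro conjI exI allI)
  show "progressively_measurable F s T (\<lambda>t \<omega>. 0 :: real)" by (simp add: progressively_measurable_def)
  show "square_integrable_process M s T (\<lambda>t \<omega>. 0)" by (simp add: square_integrable_process_def)
  show "simple_integrand M F s T 1 (\<lambda>l. if l = 0 then s else T) (\<lambda>l \<omega>. 0)" for k :: nat
    using s by (auto simp: simple_integrand_def intro!: exI[of _ 0])
qed (auto simp: simple_process_def simple_integral_def)

text \<open>On this side the shifted state is multiplied by \<open>exp (r * (t - s))\<close> and
  never changes sign, so the feedback stays zero and the state is deterministic.\<close>

lemma closed_loop_nonneg:
  assumes s: "0 \<le> s" "s \<le> T" and y: "0 \<le> y + shift s"
  shows "\<exists>x. closed_loop_state M F W s T drift vol0 vol1 y feedback x \<and>
    (\<integral>\<omega>. (x T \<omega>)\<^sup>2 \<partial>M) = (endpoint s y)\<^sup>2"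
proof -
  define x where "x t = exp (r * (t - s)) * (y + shift s) - shift t" for t
  have fb: "feedback t (x t) = (0, 0)" for t
  proof -
    have "0 \<le> exp (r * (t - s)) * (y + shift s)" using y by simp
    then have "\<not> x t + shift t < 0" unfolding x_def by linarith
    then show ?thesis by (simp add: feedback_def)
  qed
  have xc: "continuous_on A x" for A
    unfolding x_def shift_def using pos by (auto intro!: continuous_intros)
  have dx: "(x has_real_derivative drift (x t) (0, 0)) (at t)" for t
  proof -
    have "(x has_real_derivative r * exp (r * (t - s)) * (y + shift s) - (- c * exp (- r * (T - t)))) (at t)"
      unfolding x_def[abs_def] by (auto intro!: derivative_eq_intros shift_derivative[THEN DERIV_cong] simp: x_def)
    moreover have "drift (x t) (0, 0) = r * exp (r * (t - s)) * (y + shift s) - (- c * exp (- r * (T - t)))"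
      using pos by (simp add: drift_def x_def shift_def field_simps)
    ultimately show ?thesis by simp
  qed
  have dc: "continuous_on A (\<lambda>t. drift (x t) (0, 0))" for A
    unfolding drift_def by (intro continuous_intros xc)
  have eq: "x t = y + (LINT v:{s..t}|lborel. drift (x v) (0, 0))" if "t \<in> {s..T}" for t
    using LINT_FTC[of s t x, OF _ dx dc] that by (simp add: x_def)
  have "closed_loop_state M F W s T drift vol0 vol1 y feedback (\<lambda>t \<omega>. x t)"
    unfolding closed_loop_state_def fb
  proof
    show "(\<lambda>t \<omega>. (0, 0)) \<in> admissible_controls M F s T"
      by (auto simp: admissible_controls_def progressively_measurable_def square_integrable_process_def)
    show "state_process M F W s T drift vol0 vol1 y (\<lambda>t \<omega>. (0, 0)) (\<lambda>t \<omega>. x t)"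
      unfolding state_process_def
    proof (intro conjI exI)
      show "is_ito_integral M F (W 0) s T (\<lambda>t \<omega>. vol0 (0, 0)) (\<lambda>t \<omega>. 0)"
        "is_ito_integral M F (W 1) s T (\<lambda>t \<omega>. vol1 (0, 0)) (\<lambda>t \<omega>. 0)"
        using zero_ito[OF s, of 0] zero_ito[OF s, of 1] by (simp_all add: vol0_def vol1_def)
      show "AE \<omega> in M. set_integrable lborel {s..T} (\<lambda>\<tau>. drift (x \<tau>) (0, 0)) \<and>
           (\<forall>t\<in>{s..T}. x t = y + (LINT \<tau>:{s..t}|lborel. drift (x \<tau>) (0, 0)) + 0 + 0)"
        using eq borel_integrable_atLeastAtMost'[OF dc] by simp
    qed (auto simp: xc)
  qed
  moreover have "x T = endpoint s y" by (simp add: x_def endpoint_shift) (simp add: shift_def)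
  ultimately show ?thesis by (intro exI[of _ "\<lambda>t \<omega>. x t"]) (simp add: prob_space)
qed

text \<open>The geometric Brownian motion started from a negative value stays negative in every
  scenario, so the feedback acts through its linear branch at all times. Its sign and its
  progressive measurability hold without an exceptional set, as admissibility demands.\<close>

lemma closed_loop_neg:
  assumes s: "0 \<le> s" "s \<le> T" and y: "y + shift s < 0"
  shows "\<exists>x. closed_loop_state M F W s T drift vol0 vol1 y feedback x \<and>
    (\<integral>\<omega>. (x T \<omega>)\<^sup>2 \<partial>M) = exp (- kap * (T - s)) * (endpoint s y)\<^sup>2"
proof -
  define C where "C = y + shift s"
  define z where "z = gbm s C"
  define x where "x t \<omega> = z t \<omega> - shift t" for t \<omega>
  have z_neg: "z t \<omega> < 0" for t \<omega>
    using y by (simp add: z_def C_def gbm_def mult_less_0_iff)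
  have fb: "feedback t (x t \<omega>) = (- (\<rho> / \<sigma>\<^sup>2) * z t \<omega>, - (\<alpha> / b\<^sup>2) * z t \<omega>)" for t \<omega>
    using z_neg by (simp add: feedback_def x_def)
  have v0: "(\<lambda>t \<omega>. vol0 (feedback t (x t \<omega>))) = gbm s (- lam0 * C)"
    unfolding fb vol0_def lam0_def gbm_scale z_def using pos by (simp add: fun_eq_iff power2_eq_square)
  have v1: "(\<lambda>t \<omega>. vol1 (feedback t (x t \<omega>))) = gbm s (- lam1 * C)"
    unfolding fb vol1_def lam1_def gbm_scale z_def using pos by (simp add: fun_eq_iff power2_eq_square)
  \<comment> \<open>The feedback lowers the growth rate of the shifted state from \<open>r\<close>
    to \<open>r - kap\<close>; the term left over is minus the derivative of
    \<open>shift\<close>.\<close>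
  have dr: "drift (x t \<omega>) (feedback t (x t \<omega>)) = (r - kap) * z t \<omega> + (c - r * shift t)" for t \<omega>
  proof -
    have "drift (x t \<omega>) (feedback t (x t \<omega>)) = r * x t \<omega> + gain (feedback t (x t \<omega>)) + c"
      by (simp add: drift_def gain_def)
    also have "gain (feedback t (x t \<omega>)) = - kap * z t \<omega>"
      unfolding gain_vol fun_cong[OF fun_cong[OF v0]] fun_cong[OF fun_cong[OF v1]] gbm_scale z_def
      by (simp add: kap_def power2_eq_square algebra_simps)
    finally show ?thesis by (simp add: x_def algebra_simps)
  qed
  obtain I0 where I0: "is_ito_integral M F (W 0) s T (gbm s (- lam0 * C)) I0"
    using gbm_ito_exists[OF s, of 0] by auto
  obtain J1 where J1: "is_ito_integral M F (W 1) s T (gbm s (- lam1 * C)) J1"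
    using gbm_ito_exists[OF s, of 1] by auto
  define U where "U = time_integral s T (\<lambda>w. z (snd w) (fst w))"
  \<comment> \<open>Taking this version of the second integral makes the state equation hold identically in \<open>t\<close>.\<close>
  define I1 where "I1 t \<omega> = z t \<omega> - C - (r - kap) * U t \<omega> - I0 t \<omega>" for t \<omega>
  have zc: "AE \<omega> in M. continuous_on {s..T} (\<lambda>t. z t \<omega>)" unfolding z_def by (rule gbm_continuous[OF s(1)])
  have UM: "U t \<in> borel_measurable M" for t
    unfolding U_def z_def by (rule time_integral_measurable(1)[OF L2_meas[OF gbm_L2_Q[OF s]]])
  have I1M: "I1 t \<in> borel_measurable M" if "t \<in> {s..T}" for t
  proof -
    have "I0 t \<in> borel_measurable M" using I0 that by (simp add: is_ito_integral_def)
    then show ?thesis unfolding I1_def[abs_def] z_def using gbm_M[OF s(1) that, of C] UM[of t] by simp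
  qed
  have I1J1: "AE \<omega> in M. I1 t \<omega> = J1 t \<omega>" if "t \<in> {s..T}" for t
    using gbm_sde[OF s that I0 J1] by eventually_elim (simp add: I1_def z_def U_def)
  have Uc: "continuous_on {s..T} (\<lambda>t. U t \<omega>)" if "continuous_on {s..T} (\<lambda>t. z t \<omega>)" for \<omega>
  proof -
    have "continuous_on {s..T} (\<lambda>t. integral {s..t} (\<lambda>t. z t \<omega>))"
      by (intro indefinite_integral_continuous_1 integrable_continuous_interval that)
    then show ?thesis
    proof (rule continuous_on_eq)
      fix t assume t: "t \<in> {s..T}"
      have "continuous_on {s..t} (\<lambda>t. z t \<omega>)" using that by (rule continuous_on_subset) (use t in auto)
      then show "integral {s..t} (\<lambda>t. z t \<omega>) = U t \<omega>"
        unfolding U_def time_integral_eq[OF t] by (simp add: set_borel_integral_eq_integral(2) borel_integrable_atLeastAtMost')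
    qed
  qed
  \<comment> \<open>\<open>I1\<close> agrees with \<open>J1\<close> almost surely at each time, so
    it inherits the approximating sequence; continuity comes from its explicit form.\<close>
  have I1: "is_ito_integral M F (W 1) s T (gbm s (- lam1 * C)) I1"
  proof -
    obtain n p \<xi> where a: "\<forall>k::nat. simple_integrand M F s T (n k) (p k) (\<xi> k)"
      "(\<lambda>k. \<integral>\<^sup>+\<omega>. (\<integral>\<^sup>+\<tau>\<in>{s..T}. ennreal ((gbm s (- lam1 * C) \<tau> \<omega> - simple_process (n k) (p k) (\<xi> k) \<tau> \<omega>)\<^sup>2) \<partial>lborel) \<partial>M) \<longlonglongrightarrow> 0"
      "\<forall>t\<in>{s..T}. (\<lambda>k. \<integral>\<^sup>+\<omega>. ennreal ((J1 t \<omega> - simple_integral (W 1) (n k) (p k) (\<xi> k) t \<omega>)\<^sup>2) \<partial>M) \<longlonglongrightarrow> 0"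
      using J1 unfolding is_ito_integral_def by blast
    have "(\<integral>\<^sup>+\<omega>. ennreal ((I1 t \<omega> - simple_integral (W 1) (n k) (p k) (\<xi> k) t \<omega>)\<^sup>2) \<partial>M)
       = (\<integral>\<^sup>+\<omega>. ennreal ((J1 t \<omega> - simple_integral (W 1) (n k) (p k) (\<xi> k) t \<omega>)\<^sup>2) \<partial>M)" if "t \<in> {s..T}" for t k
      by (rule nn_integral_cong_AE) (use I1J1[OF that] in \<open>auto elim: eventually_mono\<close>)
    then have "\<forall>t\<in>{s..T}. (\<lambda>k. \<integral>\<^sup>+\<omega>. ennreal ((I1 t \<omega> - simple_integral (W 1) (n k) (p k) (\<xi> k) t \<omega>)\<^sup>2) \<partial>M) \<longlonglongrightarrow> 0"
      using a(3) by simp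
    moreover have "AE \<omega> in M. continuous_on {s..T} (\<lambda>t. I0 t \<omega>)" using I0 by (simp add: is_ito_integral_def)
    then have "AE \<omega> in M. continuous_on {s..T} (\<lambda>t. I1 t \<omega>)"
      using zc by eventually_elim (auto simp: I1_def intro!: continuous_intros Uc)
    moreover have "progressively_measurable F s T (gbm s (- lam1 * C))" "square_integrable_process M s T (gbm s (- lam1 * C))"
      using J1 by (simp_all add: is_ito_integral_def)
    ultimately show ?thesis unfolding is_ito_integral_def using a(1,2) I1M by blast
  qed
  have eq: "AE \<omega> in M. set_integrable lborel {s..T} (\<lambda>\<tau>. drift (x \<tau> \<omega>) (feedback \<tau> (x \<tau> \<omega>))) \<and>
      (\<forall>t\<in>{s..T}. x t \<omega> = y + (LINT \<tau>:{s..t}|lborel. drift (x \<tau> \<omega>) (feedback \<tau> (x \<tau> \<omega>))) + I0 t \<omega> + I1 t \<omega>)"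
    using zc
  proof eventually_elim
    case (elim \<omega>)
    have sc: "continuous_on A (\<lambda>v. c - r * shift v)" for A
      unfolding shift_def using pos by (auto intro!: continuous_intros)
    have i1: "set_integrable lborel {s..t} (\<lambda>v. (r - kap) * z v \<omega>)" and i2: "set_integrable lborel {s..t} (\<lambda>v. c - r * shift v)"
      if "t \<in> {s..T}" for t
      using that by (auto intro!: borel_integrable_atLeastAtMost' continuous_intros sc continuous_on_subset[OF elim])
    have "x t \<omega> = y + (LINT \<tau>:{s..t}|lborel. drift (x \<tau> \<omega>) (feedback \<tau> (x \<tau> \<omega>))) + I0 t \<omega> + I1 t \<omega>" if t: "t \<in> {s..T}" for t
    proof -
      have "(LINT \<tau>:{s..t}|lborel. drift (x \<tau> \<omega>) (feedback \<tau> (x \<tau> \<omega>)))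
        = (LINT \<tau>:{s..t}|lborel. (r - kap) * z \<tau> \<omega>) + (LINT \<tau>:{s..t}|lborel. c - r * shift \<tau>)"
        unfolding dr by (rule set_integral_add(2)[OF i1[OF t] i2[OF t]])
      also have "\<dots> = (r - kap) * U t \<omega> + (shift s - shift t)"
        using shift_integral[of s t] t by (simp add: U_def time_integral_eq[OF t])
      finally show ?thesis by (simp add: I1_def x_def C_def)
    qed
    moreover have "set_integrable lborel {s..T} (\<lambda>\<tau>. drift (x \<tau> \<omega>) (feedback \<tau> (x \<tau> \<omega>)))"
      unfolding dr using set_integral_add(1)[OF i1 i2, of T] s by auto
    ultimately show ?case by blast
  qed
  have zprog: "progressively_measurable F s T (gbm s C')" for C' by (rule gbm_progressive[OF s(1)])
  have scale: "(\<lambda>t \<omega>. k * z t \<omega>) = gbm s (k * C)" for k by (simp add: fun_eq_iff gbm_scale z_def)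
  have "closed_loop_state M F W s T drift vol0 vol1 y feedback x"
    unfolding closed_loop_state_def
  proof
    show "(\<lambda>t \<omega>. feedback t (x t \<omega>)) \<in> admissible_controls M F s T"
      unfolding admissible_controls_def
    proof (intro CollectI conjI ballI)
      show "progressively_measurable F s T (\<lambda>t \<omega>. feedback t (x t \<omega>))"
        unfolding fb progressively_measurable_def
      proof
        fix t assume "t \<in> {s..T}"
        then have "(\<lambda>(\<tau>, \<omega>). z \<tau> \<omega>) \<in> borel_measurable (restrict_space borel {s..t} \<Otimes>\<^sub>M F t)"
          using zprog[of C] by (simp add: progressively_measurable_def z_def)
        then show "(\<lambda>(\<tau>, \<omega>). (- (\<rho> / \<sigma>\<^sup>2) * z \<tau> \<omega>, - (\<alpha> / b\<^sup>2) * z \<tau> \<omega>)) \<in> borel_measurable (restrict_space borel {s..t} \<Otimes>\<^sub>M F t)"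
          unfolding case_prod_beta by (intro borel_measurable_Pair borel_measurable_times borel_measurable_const)
      qed
      show "feedback t (x t \<omega>) \<in> {0..} \<times> {0..}" for t \<omega>
      proof -
        have "0 \<le> - (\<rho> / \<sigma>\<^sup>2) * z t \<omega>" "0 \<le> - (\<alpha> / b\<^sup>2) * z t \<omega>"
          by (rule mult_nonpos_nonpos; use z_neg[of t \<omega>] pos in simp)+
        then show ?thesis unfolding fb by simp
      qed
      show "square_integrable_process M s T (\<lambda>t \<omega>. fst (feedback t (x t \<omega>)))"
        unfolding fb fst_conv scale by (rule gbm_square_integrable[OF s])
      show "square_integrable_process M s T (\<lambda>t \<omega>. snd (feedback t (x t \<omega>)))"
        unfolding fb snd_conv scale by (rule gbm_square_integrable[OF s])
    qed
    show "state_process M F W s T drift vol0 vol1 y (\<lambda>t \<omega>. feedback t (x t \<omega>)) x"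
      unfolding state_process_def
    proof (intro conjI ballI exI)
      show "x t \<in> borel_measurable (F t)" if "t \<in> {s..T}" for t
        unfolding x_def[abs_def] z_def using gbm_F[OF s(1) that, of C] by simp
      show "AE \<omega> in M. continuous_on {s..T} (\<lambda>t. x t \<omega>)"
        using zc by eventually_elim (use pos in \<open>auto simp: x_def shift_def intro!: continuous_intros\<close>)
      show "is_ito_integral M F (W 0) s T (\<lambda>t \<omega>. vol0 (feedback t (x t \<omega>))) I0" unfolding v0 by (rule I0)
      show "is_ito_integral M F (W 1) s T (\<lambda>t \<omega>. vol1 (feedback t (x t \<omega>))) I1" unfolding v1 by (rule I1)
      show "AE \<omega> in M. set_integrable lborel {s..T} (\<lambda>\<tau>. drift (x \<tau> \<omega>) (feedback \<tau> (x \<tau> \<omega>))) \<and>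
        (\<forall>t\<in>{s..T}. x t \<omega> = y + (LINT \<tau>:{s..t}|lborel. drift (x \<tau> \<omega>) (feedback \<tau> (x \<tau> \<omega>))) + I0 t \<omega> + I1 t \<omega>)"
        by (rule eq)
    qed
  qed
  moreover have "(\<integral>\<omega>. (x T \<omega>)\<^sup>2 \<partial>M) = exp (- kap * (T - s)) * (endpoint s y)\<^sup>2"
  proof -
    have "(\<integral>\<omega>. (x T \<omega>)\<^sup>2 \<partial>M) = C\<^sup>2 * exp ((2 * (r - kap) + kap) * (T - s))"
      using gbm_square[OF s(1), of T C] s by (simp add: x_def z_def shift_def power2_eq_square)
    also have "exp ((2 * (r - kap) + kap) * (T - s)) = exp (- kap * (T - s)) * (exp (r * (T - s)))\<^sup>2"
      unfolding exp_double[symmetric] exp_add[symmetric] by (simp add: algebra_simps)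
    finally show ?thesis by (simp add: endpoint_shift C_def power_mult_distrib mult_ac)
  qed
  ultimately show ?thesis by blast
qed

end

section \<open>Uniqueness of the closed loop\<close>

text \<open>Gronwall's lemma by iteration: inserting the bound into itself \<open>n\<close> times
  produces the factor \<open>(K * (T - s)) ^ n / fact n\<close>, which tends to zero. It is stated
  for integrable \<open>\<psi>\<close>, because the mean square distance to which it is applied
  comes from Fubini's theorem.\<close>

lemma gronwall_null:
  fixes \<psi> :: "real \<Rightarrow> real"
  assumes s: "s \<le> T" and K: "0 \<le> K" and i: "set_integrable lborel {s..T} \<psi>" and nn: "\<And>t. 0 \<le> \<psi> t"
    and le: "\<And>t. t \<in> {s..T} \<Longrightarrow> \<psi> t \<le> K * (LINT v:{s..t}|lborel. \<psi> v)"
  shows "(LINT v:{s..T}|lborel. \<psi> v) = 0"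
proof -
  define \<Psi> where "\<Psi> t = (LINT v:{s..t}|lborel. \<psi> v)" for t
  have sub: "set_integrable lborel {s..t} \<psi>" if "t \<le> T" for t
    by (rule set_integrable_subset[OF i]) (use that in auto)
  have \<Psi>0: "0 \<le> \<Psi> t" for t
    unfolding \<Psi>_def set_lebesgue_integral_def using nn by (intro integral_nonneg_AE AE_I2) auto
  have \<Psi>m: "\<Psi> t \<le> \<Psi> T" if "t \<le> T" for t
    unfolding \<Psi>_def set_lebesgue_integral_def
    by (rule integral_mono) (use sub[OF that] i nn that in \<open>auto simp: set_integrable_def indicator_def\<close>)
  have step: "\<Psi> t \<le> \<Psi> T * (K * (t - s)) ^ n / fact n" if "t \<in> {s..T}" for n t
    using that
  proof (induction n arbitrary: t)
    case 0
    then show ?case using \<Psi>m by simp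
  next
    case (Suc n)
    let ?g = "\<lambda>v. K * (\<Psi> T * (K * (v - s)) ^ n / fact n)"
    have "\<Psi> t \<le> (LINT v:{s..t}|lborel. ?g v)"
      unfolding \<Psi>_def[of t]
    proof (rule set_integral_mono[OF sub])
      show "t \<le> T" using Suc by simp
      show "set_integrable lborel {s..t} ?g" by (rule borel_integrable_atLeastAtMost') (intro continuous_intros; simp)
      fix v assume v: "v \<in> {s..t}"
      then have v': "v \<in> {s..T}" using Suc.prems by auto
      have "\<psi> v \<le> K * \<Psi> v" using le[OF v'] by (simp add: \<Psi>_def)
      also have "\<dots> \<le> ?g v" by (rule mult_left_mono[OF Suc.IH[OF v'] K])
      finally show "\<psi> v \<le> ?g v" .
    qed
    also have "\<dots> = \<Psi> T * (K * (t - s)) ^ Suc n / fact (Suc n) - \<Psi> T * (K * (s - s)) ^ Suc n / fact (Suc n)"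
    proof (rule LINT_FTC)
      show "s \<le> t" using Suc.prems by simp
      show "continuous_on UNIV ?g" by (intro continuous_intros; simp)
      fix v
      have "((\<lambda>v. \<Psi> T * (K * (v - s)) ^ Suc n / fact (Suc n)) has_real_derivative
          \<Psi> T * (real (Suc n) * (K * (v - s)) ^ n * K) / fact (Suc n)) (at v)"
        by (auto intro!: derivative_eq_intros simp del: fact_Suc power_Suc of_nat_Suc)
      also have "\<Psi> T * (real (Suc n) * (K * (v - s)) ^ n * K) / fact (Suc n) = ?g v"
        by (simp add: field_simps del: of_nat_Suc)
      finally show "((\<lambda>v. \<Psi> T * (K * (v - s)) ^ Suc n / fact (Suc n)) has_real_derivative ?g v) (at v)" .
    qed
    finally show ?case by simp
  qed
  have "(\<lambda>n. inverse (fact n) * (K * (T - s)) ^ n) \<longlonglongrightarrow> 0"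
    by (rule summable_LIMSEQ_zero[OF summable_exp])
  then have "(\<lambda>n. \<Psi> T * (inverse (fact n) * (K * (T - s)) ^ n)) \<longlonglongrightarrow> \<Psi> T * 0" by (rule tendsto_mult_left)
  then have "(\<lambda>n. \<Psi> T * (K * (T - s)) ^ n / fact n) \<longlonglongrightarrow> 0" by (simp add: field_simps)
  then have "\<Psi> T \<le> 0" by (rule LIMSEQ_le_const) (use step[of T] s in auto)
  then show ?thesis using \<Psi>0[of T] by (simp add: \<Psi>_def)
qed

context linear_control
begin

lemma time_integral_diff:
  assumes f: "L2 (Q s T) f" and g: "L2 (Q s T) g"
  shows "AE \<omega> in M. \<forall>t. time_integral s T f t \<omega> - time_integral s T g t \<omega> = time_integral s T (\<lambda>z. f z - g z) t \<omega>"
  using L2_Q_sections[OF f] L2_Q_sections[OF g]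
proof (eventually_elim, intro allI)
  fix \<omega> t
  let ?R = "restrict_space lborel {s..T}"
  interpret R: finite_measure ?R by (rule finite_measure_interval)
  assume L: "L2 ?R (\<lambda>\<tau>. f (\<omega>, \<tau>))" "L2 ?R (\<lambda>\<tau>. g (\<omega>, \<tau>))"
  have ind: "(indicator {..t} :: real \<Rightarrow> real) \<in> borel_measurable ?R" by (simp add: measurable_restrict_space1)
  have "integrable ?R (\<lambda>\<tau>. h \<tau> * indicator {..t} \<tau>)" if "L2 ?R h" for h
  proof -
    have "L2 ?R (\<lambda>\<tau>. indicator {..t} \<tau> * h \<tau>)"
      by (rule L2_bounded_mult[OF that ind, of 1]) (simp add: indicator_def)
    then show ?thesis using R.L2_integrable by (simp add: mult.commute)
  qed
  then show "time_integral s T f t \<omega> - time_integral s T g t \<omega> = time_integral s T (\<lambda>z. f z - g z) t \<omega>"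
    unfolding time_integral_def using L by (simp add: left_diff_distrib)
qed

text \<open>The feedback is a fixed vector times the negative part of the shifted state, hence
  Lipschitz. Admissibility of the control makes this negative part square integrable, whereas the
  state itself is not known to be so beforehand; the estimate therefore starts from the distance
  \<open>\<delta>\<close> of the negative parts. Agreement at \<open>T\<close> is all that the cost
  sees.\<close>

lemma closed_loop_unique:
  assumes s: "0 \<le> s" "s \<le> T"
    and x: "closed_loop_state M F W s T drift vol0 vol1 y feedback x"
    and x': "closed_loop_state M F W s T drift vol0 vol1 y feedback x'"
  shows "AE \<omega> in M. x T \<omega> = x' T \<omega>"
proof -
  define n where "n = (\<lambda>(x :: real \<Rightarrow> 'w \<Rightarrow> real) t \<omega>. max 0 (- (x t \<omega> + shift t)))"
  have fb: "feedback t (w t \<omega>) = (\<rho> / \<sigma>\<^sup>2 * n w t \<omega>, \<alpha> / b\<^sup>2 * n w t \<omega>)" for w t and \<omega> :: 'w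
  proof -
    have "(if z < 0 then (- A * z, - B * z) else (0, 0)) = (A * max 0 (- z), B * max 0 (- z))" for A B z :: real
      by (auto simp: max_def)
    then show ?thesis unfolding feedback_def n_def .
  qed
  have v0: "vol0 (feedback t (w t \<omega>)) = lam0 * n w t \<omega>" for w t and \<omega> :: 'w
    unfolding fb vol0_def lam0_def using pos by (simp add: power2_eq_square)
  have v1: "vol1 (feedback t (w t \<omega>)) = lam1 * n w t \<omega>" for w t and \<omega> :: 'w
    unfolding fb vol1_def lam1_def using pos by (simp add: power2_eq_square)
  have gn: "gain (feedback t (w t \<omega>)) = kap * n w t \<omega>" for w t and \<omega> :: 'w
    unfolding gain_vol v0 v1 kap_def by (simp add: power2_eq_square algebra_simps)
  note adm = x[unfolded closed_loop_state_def, THEN conjunct1] x'[unfolded closed_loop_state_def, THEN conjunct1]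
  note st = x[unfolded closed_loop_state_def, THEN conjunct2] x'[unfolded closed_loop_state_def, THEN conjunct2]
  have nL: "L2 (Q s T) (\<lambda>z. n w (snd z) (fst z))"
    if "(\<lambda>t \<omega>. feedback t (w t \<omega>)) \<in> admissible_controls M F s T" for w
  proof -
    \<comment> \<open>Recovered from the second component of the control, whose coefficient is
      positive, while \<open>\<rho>\<close> may vanish.\<close>
    have "L2 (Q s T) (\<lambda>z. b\<^sup>2 / \<alpha> * snd (feedback (snd z) (w (snd z) (fst z))))"
      by (rule L2_cmult[OF admissible_L2(2)[OF that s(2)]])
    then show ?thesis unfolding fb using pos by simp
  qed
  define \<delta> where "\<delta> z = n x (snd z) (fst z) - n x' (snd z) (fst z)" for z :: "'w \<times> real"
  have \<delta>L: "L2 (Q s T) \<delta>" unfolding \<delta>_def[abs_def] by (intro L2_diff nL adm)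
  obtain I0 I1 where I0: "is_ito_integral M F (W 0) s T (\<lambda>t \<omega>. vol0 (feedback t (x t \<omega>))) I0"
    and I1: "is_ito_integral M F (W 1) s T (\<lambda>t \<omega>. vol1 (feedback t (x t \<omega>))) I1"
    and eq: "AE \<omega> in M. \<forall>t\<in>{s..T}. x t \<omega> = (y + c * (t - s)
       + time_integral s T (\<lambda>z. gain (feedback (snd z) (x (snd z) (fst z)))) t \<omega> + I0 t \<omega> + I1 t \<omega>) + r * (LINT \<tau>:{s..t}|lborel. x \<tau> \<omega>)"
    by (rule state_representation[OF s(2) adm(1) st(1)])
  obtain I0' I1' where I0': "is_ito_integral M F (W 0) s T (\<lambda>t \<omega>. vol0 (feedback t (x' t \<omega>))) I0'"
    and I1': "is_ito_integral M F (W 1) s T (\<lambda>t \<omega>. vol1 (feedback t (x' t \<omega>))) I1'"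
    and eq': "AE \<omega> in M. \<forall>t\<in>{s..T}. x' t \<omega> = (y + c * (t - s)
       + time_integral s T (\<lambda>z. gain (feedback (snd z) (x' (snd z) (fst z)))) t \<omega> + I0' t \<omega> + I1' t \<omega>) + r * (LINT \<tau>:{s..t}|lborel. x' \<tau> \<omega>)"
    by (rule state_representation[OF s(2) adm(2) st(2)])
  have i01: "0 \<in> {0, 1 :: nat}" "1 \<in> {0, 1 :: nat}" by auto
  note J0 = ito_joint_version[OF I0 i01(1) s] and J1 = ito_joint_version[OF I1 i01(2) s]
    and J0' = ito_joint_version[OF I0' i01(1) s] and J1' = ito_joint_version[OF I1' i01(2) s]
  define U where "U = time_integral s T (\<lambda>z. kap * \<delta> z)"
  define D0 where "D0 t \<omega> = grid_limit s I0 t \<omega> - grid_limit s I0' t \<omega>" for t \<omega>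
  define D1 where "D1 t \<omega> = grid_limit s I1 t \<omega> - grid_limit s I1' t \<omega>" for t \<omega>
  define h where "h t \<omega> = U t \<omega> + D0 t \<omega> + D1 t \<omega>" for t \<omega>
  have k\<delta>: "L2 (Q s T) (\<lambda>z. kap * \<delta> z)" by (rule L2_cmult[OF \<delta>L])
  have hQ: "L2 (Q s T) (\<lambda>z. h (snd z) (fst z))"
    unfolding h_def U_def D0_def D1_def
    by (intro L2_add L2_diff time_integral_L2_Q[OF k\<delta> s(2)] J0(1) J1(1) J0'(1) J1'(1))
  define X where "X t \<omega> = x t \<omega> - x' t \<omega>" for t \<omega>
  have xc: "AE \<omega> in M. continuous_on {s..T} (\<lambda>t. x t \<omega>)" "AE \<omega> in M. continuous_on {s..T} (\<lambda>t. x' t \<omega>)"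
    using st by (simp_all add: state_process_def)
  have Xc: "AE \<omega> in M. continuous_on {s..T} (\<lambda>t. X t \<omega>)"
    using xc by eventually_elim (auto simp: X_def intro!: continuous_intros)
  have gL: "L2 (Q s T) (\<lambda>z. gain (feedback (snd z) (x (snd z) (fst z))))" "L2 (Q s T) (\<lambda>z. gain (feedback (snd z) (x' (snd z) (fst z))))"
    by (rule admissible_L2(3)[OF adm(1) s(2)] admissible_L2(3)[OF adm(2) s(2)])+
  have Xeq: "AE \<omega> in M. \<forall>t\<in>{s..T}. X t \<omega> = h t \<omega> + r * (LINT \<tau>:{s..t}|lborel. X \<tau> \<omega>)"
    using eq eq' xc J0(2) J0'(2) J1(2) J1'(2) time_integral_diff[OF gL]
  proof eventually_elim
    case (elim \<omega>)
    show ?case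
    proof
      fix t assume t: "t \<in> {s..T}"
      have "set_integrable lborel {s..t} (\<lambda>\<tau>. x \<tau> \<omega>)" "set_integrable lborel {s..t} (\<lambda>\<tau>. x' \<tau> \<omega>)"
        by (rule borel_integrable_atLeastAtMost', rule continuous_on_subset[OF elim(3)], use t in force)
          (rule borel_integrable_atLeastAtMost', rule continuous_on_subset[OF elim(4)], use t in force)
      then have "(LINT \<tau>:{s..t}|lborel. X \<tau> \<omega>) = (LINT \<tau>:{s..t}|lborel. x \<tau> \<omega>) - (LINT \<tau>:{s..t}|lborel. x' \<tau> \<omega>)"
        unfolding X_def by (rule set_integral_diff(2))
      then have "r * (LINT \<tau>:{s..t}|lborel. X \<tau> \<omega>) = r * (LINT \<tau>:{s..t}|lborel. x \<tau> \<omega>) - r * (LINT \<tau>:{s..t}|lborel. x' \<tau> \<omega>)"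
        by (simp add: right_diff_distrib)
      moreover have "U t \<omega> = time_integral s T (\<lambda>z. gain (feedback (snd z) (x (snd z) (fst z)))) t \<omega>
          - time_integral s T (\<lambda>z. gain (feedback (snd z) (x' (snd z) (fst z)))) t \<omega>"
        using elim(9) unfolding U_def \<delta>_def gn by (simp add: right_diff_distrib)
      moreover have "D0 t \<omega> = I0 t \<omega> - I0' t \<omega>" "D1 t \<omega> = I1 t \<omega> - I1' t \<omega>"
        using elim(5-8) t by (simp_all add: D0_def D1_def)
      moreover have "x t \<omega> = (y + c * (t - s)
        + time_integral s T (\<lambda>z. gain (feedback (snd z) (x (snd z) (fst z)))) t \<omega> + I0 t \<omega> + I1 t \<omega>) + r * (LINT \<tau>:{s..t}|lborel. x \<tau> \<omega>)"
        using elim(1) t by blast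
      moreover have "x' t \<omega> = (y + c * (t - s)
        + time_integral s T (\<lambda>z. gain (feedback (snd z) (x' (snd z) (fst z)))) t \<omega> + I0' t \<omega> + I1' t \<omega>) + r * (LINT \<tau>:{s..t}|lborel. x' \<tau> \<omega>)"
        using elim(2) t by blast
      ultimately show "X t \<omega> = h t \<omega> + r * (LINT \<tau>:{s..t}|lborel. X \<tau> \<omega>)"
        unfolding X_def[of t] h_def by linarith
    qed
  qed
  define \<Psi> where "\<Psi> t = (\<integral>z. (\<delta> z * indicator {..t} (snd z))\<^sup>2 \<partial>Q s T)" for t
  have \<Psi>0: "0 \<le> \<Psi> t" for t by (simp add: \<Psi>_def)
  have \<Psi>mono: "\<Psi> t \<le> \<Psi> t'" if "t \<le> t'" for t t'
    unfolding \<Psi>_def by (rule integral_mono'[OF L2_sq[OF L2_indicator[OF \<delta>L]]]) (use that in \<open>auto simp: indicator_def\<close>)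
  have \<Psi>k: "(\<integral>z. (k * \<delta> z * indicator {..t} (snd z))\<^sup>2 \<partial>Q s T) = k\<^sup>2 * \<Psi> t" for k t
    unfolding \<Psi>_def by (simp add: power_mult_distrib mult.assoc)
  \<comment> \<open>The factor 3 bounds the square of a sum of three terms; \<open>T - s\<close>
    comes from Cauchy-Schwarz in time, the coefficients of the Ito parts from the isometry.\<close>
  define K1 where "K1 = 3 * ((T - s) * kap\<^sup>2 + lam0\<^sup>2 + lam1\<^sup>2)"
  have K1: "0 \<le> K1" using s by (simp add: K1_def)
  have sect: "f \<in> borel_measurable (Q s T) \<Longrightarrow> t \<in> {s..T} \<Longrightarrow> (\<lambda>\<omega>. f (\<omega>, t)) \<in> borel_measurable M" for f :: "'w \<times> real \<Rightarrow> real" and t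
    using measurable_compose[OF measurable_Pair2'] by (auto simp: space_restrict_space)
  have hb: "L2 M (h t) \<and> (\<integral>\<omega>. (h t \<omega>)\<^sup>2 \<partial>M) \<le> K1 * \<Psi> t" if t: "t \<in> {s..T}" for t
  proof -
    have D: "L2 M (D0 t)" "(\<integral>\<omega>. (D0 t \<omega>)\<^sup>2 \<partial>M) = lam0\<^sup>2 * \<Psi> t"
      "L2 M (D1 t)" "(\<integral>\<omega>. (D1 t \<omega>)\<^sup>2 \<partial>M) = lam1\<^sup>2 * \<Psi> t"
    proof -
      have ae: "AE \<omega> in M. D0 t \<omega> = I0 t \<omega> - I0' t \<omega>" "AE \<omega> in M. D1 t \<omega> = I1 t \<omega> - I1' t \<omega>"
        using J0(2) J0'(2) by (eventually_elim, use t in \<open>simp add: D0_def\<close>)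
          (use J1(2) J1'(2) in \<open>eventually_elim, use t in \<open>simp add: D1_def\<close>\<close>)
      have m: "D0 t \<in> borel_measurable M" "D1 t \<in> borel_measurable M"
        using sect[OF L2_meas[OF L2_diff[OF J0(1) J0'(1)]] t] sect[OF L2_meas[OF L2_diff[OF J1(1) J1'(1)]] t]
        by (simp_all add: D0_def[abs_def] D1_def[abs_def])
      have L: "L2 M (\<lambda>\<omega>. I0 t \<omega> - I0' t \<omega>)" "L2 M (\<lambda>\<omega>. I1 t \<omega> - I1' t \<omega>)"
        by (intro L2_diff ito_L2[OF I0 i01(1) s t] ito_L2[OF I0' i01(1) s t])
          (intro L2_diff ito_L2[OF I1 i01(2) s t] ito_L2[OF I1' i01(2) s t])
      show "L2 M (D0 t)" by (rule L2_cong_AE[OF L(1) _ m(1)]) (use ae(1) in \<open>auto elim: eventually_mono\<close>)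
      show "L2 M (D1 t)" by (rule L2_cong_AE[OF L(2) _ m(2)]) (use ae(2) in \<open>auto elim: eventually_mono\<close>)
      have "(\<integral>\<omega>. (D0 t \<omega>)\<^sup>2 \<partial>M) = (\<integral>\<omega>. (I0 t \<omega> - I0' t \<omega>)\<^sup>2 \<partial>M)"
        by (rule integral_cong_AE) (use ae(1) m L in \<open>auto simp: L2_def elim: eventually_mono\<close>)
      also have "\<dots> = (\<integral>z. (lam0 * \<delta> z * indicator {..t} (snd z))\<^sup>2 \<partial>Q s T)"
        unfolding ito_diff_isometry[OF I0 I0' i01(1) s t] v0 \<delta>_def right_diff_distrib ..
      finally show "(\<integral>\<omega>. (D0 t \<omega>)\<^sup>2 \<partial>M) = lam0\<^sup>2 * \<Psi> t" unfolding \<Psi>k .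
      have "(\<integral>\<omega>. (D1 t \<omega>)\<^sup>2 \<partial>M) = (\<integral>\<omega>. (I1 t \<omega> - I1' t \<omega>)\<^sup>2 \<partial>M)"
        by (rule integral_cong_AE) (use ae(2) m L in \<open>auto simp: L2_def elim: eventually_mono\<close>)
      also have "\<dots> = (\<integral>z. (lam1 * \<delta> z * indicator {..t} (snd z))\<^sup>2 \<partial>Q s T)"
        unfolding ito_diff_isometry[OF I1 I1' i01(2) s t] v1 \<delta>_def right_diff_distrib ..
      finally show "(\<integral>\<omega>. (D1 t \<omega>)\<^sup>2 \<partial>M) = lam1\<^sup>2 * \<Psi> t" unfolding \<Psi>k .
    qed
    have UL: "L2 M (U t)" unfolding U_def by (rule time_integral_L2[OF k\<delta> s(2)])
    have Ub: "(\<integral>\<omega>. (U t \<omega>)\<^sup>2 \<partial>M) \<le> (T - s) * (kap\<^sup>2 * \<Psi> t)"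
      using time_integral_bound[OF k\<delta> s(2), of t] unfolding \<Psi>k U_def .
    have hL: "L2 M (h t)" unfolding h_def[abs_def] by (intro L2_add UL D)
    have "(\<integral>\<omega>. (h t \<omega>)\<^sup>2 \<partial>M) \<le> (\<integral>\<omega>. 3 * ((U t \<omega>)\<^sup>2 + (D0 t \<omega>)\<^sup>2 + (D1 t \<omega>)\<^sup>2) \<partial>M)"
    proof (rule integral_mono[OF L2_sq[OF hL]])
      show "integrable M (\<lambda>\<omega>. 3 * ((U t \<omega>)\<^sup>2 + (D0 t \<omega>)\<^sup>2 + (D1 t \<omega>)\<^sup>2))"
        using L2_sq[OF UL] L2_sq[OF D(1)] L2_sq[OF D(3)] by simp
      have "(p + q + w)\<^sup>2 \<le> 3 * (p\<^sup>2 + q\<^sup>2 + w\<^sup>2)" for p q w :: real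
        using zero_le_power2[of "p - q"] zero_le_power2[of "p - w"] zero_le_power2[of "q - w"]
        by (simp add: power2_eq_square algebra_simps)
      then show "(h t \<omega>)\<^sup>2 \<le> 3 * ((U t \<omega>)\<^sup>2 + (D0 t \<omega>)\<^sup>2 + (D1 t \<omega>)\<^sup>2)" for \<omega> unfolding h_def .
    qed
    also have "\<dots> = 3 * ((\<integral>\<omega>. (U t \<omega>)\<^sup>2 \<partial>M) + lam0\<^sup>2 * \<Psi> t + lam1\<^sup>2 * \<Psi> t)"
      using L2_sq[OF UL] L2_sq[OF D(1)] L2_sq[OF D(3)] D(2,4) by simp
    also have "\<dots> \<le> K1 * \<Psi> t" using Ub by (simp add: K1_def algebra_simps)
    finally show ?thesis using hL by blast
  qed
  define R where "R = r * exp (r * (T - s))"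
  \<comment> \<open>The resolvent adds a time integral of \<open>h\<close> with kernel bounded by
    \<open>R\<close>; one factor \<open>T - s\<close> comes from Cauchy-Schwarz, the other from
    integrating the bound on \<open>h\<close>.\<close>
  define K where "K = 2 * K1 + 2 * (T - s) * (R\<^sup>2 * ((T - s) * K1))"
  have K: "0 \<le> K" using s K1 by (simp add: K_def)
  have Xb: "L2 M (X t) \<and> (\<integral>\<omega>. (X t \<omega>)\<^sup>2 \<partial>M) \<le> K * \<Psi> t" if t: "t \<in> {s..T}" for t
  proof -
    define g where "g z = r * exp (r * (t - snd z)) * h (snd z) (fst z)" for z :: "'w \<times> real"
    have gb: "\<bar>r * exp (r * (t - snd z))\<bar> \<le> R" if "z \<in> space (Q s T)" for z :: "'w \<times> real"
      using that pos t unfolding R_def by (auto simp: space_Q)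
    have gQ: "L2 (Q s T) g" unfolding g_def
      by (rule L2_bounded_mult[OF hQ _ gb]) (use snd_Q[of s T] in measurable)
    have ae: "AE \<omega> in M. X t \<omega> = h t \<omega> + time_integral s T g t \<omega>"
      unfolding g_def[abs_def] by (rule volterra_L2[OF _ _ Xc Xeq]) (use t in auto)
    have hL: "L2 M (h t)" and hle: "(\<integral>\<omega>. (h t \<omega>)\<^sup>2 \<partial>M) \<le> K1 * \<Psi> t" using hb[OF t] by auto
    note GL = time_integral_L2[OF gQ s(2), of t]
    have XM: "X t \<in> borel_measurable M"
      using st t unfolding X_def[abs_def] by (intro borel_measurable_diff F_M[of _ t]) (auto simp: state_process_def)
    have XL: "L2 M (X t)" by (rule L2_cong_AE[OF L2_add[OF hL GL] _ XM]) (use ae in \<open>auto elim: eventually_mono\<close>)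
    have "(\<integral>\<omega>. (X t \<omega>)\<^sup>2 \<partial>M) \<le> (\<integral>\<omega>. 2 * (h t \<omega>)\<^sup>2 + 2 * (time_integral s T g t \<omega>)\<^sup>2 \<partial>M)"
    proof (rule integral_mono_AE[OF L2_sq[OF XL]])
      show "integrable M (\<lambda>\<omega>. 2 * (h t \<omega>)\<^sup>2 + 2 * (time_integral s T g t \<omega>)\<^sup>2)"
        using L2_sq[OF hL] L2_sq[OF GL] by simp
      have "(p + q)\<^sup>2 \<le> 2 * p\<^sup>2 + 2 * q\<^sup>2" for p q :: real
        using zero_le_power2[of "p - q"] by (simp add: power2_eq_square algebra_simps)
      then show "AE \<omega> in M. (X t \<omega>)\<^sup>2 \<le> 2 * (h t \<omega>)\<^sup>2 + 2 * (time_integral s T g t \<omega>)\<^sup>2"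
        using ae by (auto elim!: eventually_mono)
    qed
    also have "\<dots> = 2 * (\<integral>\<omega>. (h t \<omega>)\<^sup>2 \<partial>M) + 2 * (\<integral>\<omega>. (time_integral s T g t \<omega>)\<^sup>2 \<partial>M)"
      using L2_sq[OF hL] L2_sq[OF GL] by simp
    also have "\<dots> \<le> 2 * (K1 * \<Psi> t) + 2 * ((T - s) * (R\<^sup>2 * ((T - s) * (K1 * \<Psi> t))))"
    proof (intro add_mono mult_left_mono hle order_trans[OF time_integral_bound[OF gQ s(2)]])
      have "(\<integral>z. (g z * indicator {..t} (snd z))\<^sup>2 \<partial>Q s T) \<le> (\<integral>z. R\<^sup>2 * (h (snd z) (fst z) * indicator {..t} (snd z))\<^sup>2 \<partial>Q s T)"
      proof (rule integral_mono[OF L2_sq[OF L2_indicator[OF gQ]] integrable_mult_right[OF L2_sq[OF L2_indicator[OF hQ]]]])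
        fix z assume z: "z \<in> space (Q s T)"
        have "(r * exp (r * (t - snd z)))\<^sup>2 \<le> R\<^sup>2" using gb[OF z] pos by (intro power_mono) auto
        then have "(r * exp (r * (t - snd z)))\<^sup>2 * (h (snd z) (fst z) * indicator {..t} (snd z))\<^sup>2 \<le> R\<^sup>2 * (h (snd z) (fst z) * indicator {..t} (snd z))\<^sup>2"
          by (rule mult_right_mono) simp
        then show "(g z * indicator {..t} (snd z))\<^sup>2 \<le> R\<^sup>2 * (h (snd z) (fst z) * indicator {..t} (snd z))\<^sup>2"
          unfolding g_def power_mult_distrib[symmetric] by (simp only: mult.assoc)
      qed
      also have "\<dots> = R\<^sup>2 * (\<integral>z. (h (snd z) (fst z) * indicator {..t} (snd z))\<^sup>2 \<partial>Q s T)" by simp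
      also have "(\<integral>z. (h (snd z) (fst z) * indicator {..t} (snd z))\<^sup>2 \<partial>Q s T) \<le> (T - s) * (K1 * \<Psi> t)"
      proof -
        have "(\<integral>\<^sup>+z. ennreal ((h (snd z) (fst z) * indicator {..t} (snd z))\<^sup>2) \<partial>Q s T)
           = (\<integral>\<^sup>+\<tau>\<in>{s..T}. (\<integral>\<^sup>+\<omega>. ennreal ((h \<tau> \<omega> * indicator {..t} \<tau>)\<^sup>2) \<partial>M) \<partial>lborel)"
          by (subst nn_integral_Q_snd) (use L2_meas[OF L2_indicator[OF hQ]] in auto)
        also have "\<dots> \<le> (\<integral>\<^sup>+\<tau>\<in>{s..T}. ennreal (K1 * \<Psi> t) \<partial>lborel)"
        proof (rule nn_integral_mono)
          fix \<tau> :: real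
          show "(\<integral>\<^sup>+\<omega>. ennreal ((h \<tau> \<omega> * indicator {..t} \<tau>)\<^sup>2) \<partial>M) * indicator {s..T} \<tau> \<le> ennreal (K1 * \<Psi> t) * indicator {s..T} \<tau>"
          proof (cases "\<tau> \<in> {s..t}")
            case True
            then have \<tau>: "\<tau> \<in> {s..T}" using t by auto
            have "(\<integral>\<^sup>+\<omega>. ennreal ((h \<tau> \<omega>)\<^sup>2) \<partial>M) = ennreal (\<integral>\<omega>. (h \<tau> \<omega>)\<^sup>2 \<partial>M)" using hb[OF \<tau>] by (intro L2_nn) auto
            also have "\<dots> \<le> ennreal (K1 * \<Psi> t)"
              using hb[OF \<tau>] mult_left_mono[OF \<Psi>mono K1, of \<tau> t] True by (intro ennreal_leI) auto
            finally show ?thesis using True \<tau> by simp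
          next
            case False
            then show ?thesis using t by (auto simp: indicator_def)
          qed
        qed
        also have "\<dots> = ennreal ((T - s) * (K1 * \<Psi> t))"
          using s K1 \<Psi>0[of t] by (subst nn_integral_cmult_indicator) (simp_all add: ennreal_mult[symmetric] mult.commute)
        finally show ?thesis
          unfolding L2_nn[OF L2_indicator[OF hQ]] using s K1 \<Psi>0[of t] by (subst (asm) ennreal_le_iff) auto
      qed
      finally show "(\<integral>z. (g z * indicator {..t} (snd z))\<^sup>2 \<partial>Q s T) \<le> R\<^sup>2 * ((T - s) * (K1 * \<Psi> t))"
        by (simp add: mult_left_mono)
    qed (use s in auto)
    also have "\<dots> = K * \<Psi> t" by (simp add: K_def algebra_simps)
    finally show ?thesis using XL by blast
  qed
  \<comment> \<open>\<open>\<Psi>\<close> is the accumulated distance and \<open>\<psi>\<close> its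
    density in time. The state difference at \<open>t\<close> is bounded through
    \<open>\<Psi> t\<close>, so Gronwall's lemma applies to \<open>\<psi>\<close>.\<close>
  define \<psi> where "\<psi> t = (\<integral>\<omega>. (\<delta> (\<omega>, t))\<^sup>2 \<partial>M)" for t
  have \<Psi>\<psi>: "\<Psi> t = (LINT v:{s..t}|lborel. \<psi> v)" if t: "t \<in> {s..T}" for t
  proof -
    have "\<Psi> t = (LINT v:{s..T}|lborel. \<psi> v * indicator {..t} v)"
      unfolding \<Psi>_def integral_Q_snd[OF L2_sq[OF L2_indicator[OF \<delta>L]]] \<psi>_def Bochner_Integration.integral_mult_left_zero[symmetric]
      by (intro set_lebesgue_integral_cong) (auto intro!: Bochner_Integration.integral_cong simp: indicator_def)
    then show ?thesis using LINT_indicator[of t T s \<psi>] t by simp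
  qed
  have "(LINT v:{s..T}|lborel. \<psi> v) = 0"
  proof (rule gronwall_null[OF s(2) K])
    interpret P: pair_sigma_finite M "restrict_space lborel {s..T}" by (rule pair_sigma_finite_Q)
    have "integrable (restrict_space lborel {s..T}) \<psi>"
      unfolding \<psi>_def[abs_def]
    proof (rule P.integrable_snd)
      have "(\<lambda>(\<omega>, t). (\<delta> (\<omega>, t))\<^sup>2) = (\<lambda>z. (\<delta> z)\<^sup>2)" by auto
      then show "integrable (Q s T) (\<lambda>(\<omega>, t). (\<delta> (\<omega>, t))\<^sup>2)" using L2_sq[OF \<delta>L] by simp
    qed
    then show "set_integrable lborel {s..T} \<psi>" unfolding set_integrable_def by (subst (asm) integrable_restrict_space) auto
    show "0 \<le> \<psi> t" for t by (simp add: \<psi>_def)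
    fix t assume t: "t \<in> {s..T}"
    have "\<psi> t \<le> (\<integral>\<omega>. (X t \<omega>)\<^sup>2 \<partial>M)"
      unfolding \<psi>_def
    proof (rule integral_mono'[OF L2_sq])
      show "L2 M (X t)" using Xb[OF t] by blast
      fix \<omega>
      \<comment> \<open>The negative part is 1-Lipschitz and the shifts cancel; this closes the
        estimate.\<close>
      have "\<bar>\<delta> (\<omega>, t)\<bar> \<le> \<bar>X t \<omega>\<bar>" unfolding \<delta>_def X_def n_def by (auto simp: max_def)
      then show "(\<delta> (\<omega>, t))\<^sup>2 \<le> (X t \<omega>)\<^sup>2" by (simp add: abs_le_square_iff)
    qed simp
    then show "\<psi> t \<le> K * (LINT v:{s..t}|lborel. \<psi> v)" using Xb[OF t] \<Psi>\<psi>[OF t] by simp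
  qed
  then have "(\<integral>\<omega>. (X T \<omega>)\<^sup>2 \<partial>M) \<le> 0" and XL: "L2 M (X T)"
    using Xb[of T] \<Psi>\<psi>[of T] s by auto
  moreover have "0 \<le> (\<integral>\<omega>. (X T \<omega>)\<^sup>2 \<partial>M)" by simp
  ultimately have "(\<integral>\<omega>. (X T \<omega>)\<^sup>2 \<partial>M) = 0" by linarith
  then have "AE \<omega> in M. (X T \<omega>)\<^sup>2 = 0"
    using integral_nonneg_eq_0_iff_AE[OF L2_sq[OF XL]] by simp
  then show ?thesis by eventually_elim (simp add: X_def)
qed

end

section \<open>The Hamilton-Jacobi-Bellman equation\<close>

text \<open>The model case of the regularity across the boundary: continuously differentiable, but
  without a second derivative at 0.\<close>

lemma pos_part_square_derivative:
  "((\<lambda>z :: real. (max 0 z)\<^sup>2 / 2) has_real_derivative max 0 z) (at z)"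
proof -
  consider "z > 0" | "z < 0" | "z = 0" by linarith
  then show ?thesis
  proof cases
    case 1
    have "((\<lambda>z :: real. z\<^sup>2 / 2) has_real_derivative max 0 z) (at z)"
      using 1 by (auto intro!: derivative_eq_intros)
    then show ?thesis by (rule has_field_derivative_transform_within_open[of _ _ _ "{0<..}"]) (use 1 in auto)
  next
    case 2
    have "((\<lambda>z :: real. 0) has_real_derivative max 0 z) (at z)" using 2 by simp
    then show ?thesis by (rule has_field_derivative_transform_within_open[of _ _ _ "{..<0}"]) (use 2 in auto)
  next
    case 3
    have "((\<lambda>h :: real. max 0 h / 2) \<longlongrightarrow> max 0 0 / 2) (at 0)" by (intro tendsto_intros) simp
    moreover have "\<forall>\<^sub>F h :: real in at 0. max 0 h / 2 = ((max 0 (0 + h))\<^sup>2 / 2 - (max 0 0)\<^sup>2 / 2) / h"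
      by (auto simp: eventually_at_filter max_def power2_eq_square)
    ultimately have "((\<lambda>h :: real. ((max 0 (0 + h))\<^sup>2 / 2 - (max 0 0)\<^sup>2 / 2) / h) \<longlongrightarrow> max 0 0 / 2) (at 0)"
      by (rule Lim_transform_eventually)
    then show ?thesis unfolding 3 DERIV_def by simp
  qed
qed

lemma neg_part_square_derivative:
  "((\<lambda>z :: real. (min 0 z)\<^sup>2 / 2) has_real_derivative min 0 z) (at z)"
proof -
  have "((\<lambda>z :: real. (max 0 (- z))\<^sup>2 / 2) has_real_derivative max 0 (- z) * (- 1)) (at z)"
    by (rule DERIV_chain2[OF pos_part_square_derivative]) (auto intro!: derivative_eq_intros)
  moreover have "(max 0 (- z))\<^sup>2 = (min 0 z)\<^sup>2" for z :: real by (auto simp: max_def min_def)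
  moreover have "max 0 (- z) * (- 1) = min 0 z" by (auto simp: max_def min_def)
  ultimately show ?thesis by simp
qed

text \<open>Only an inequality, since at \<open>t = 0\<close> there are no earlier times to compare
  with; \<open>t < T\<close> leaves room on the right.\<close>

lemma right_derivative_local_max:
  fixes g :: "real \<Rightarrow> real"
  assumes D: "(g has_real_derivative D) (at t within {0..T})" and t: "0 \<le> t" "t < T"
    and max: "\<forall>\<^sub>F \<tau> in at t within {0..T}. g \<tau> \<le> g t"
  shows "D \<le> 0"
proof (rule ccontr)
  assume "\<not> D \<le> 0"
  then obtain e where e: "e > 0" "\<And>h. 0 < h \<Longrightarrow> t + h \<in> {0..T} \<Longrightarrow> h < e \<Longrightarrow> g t < g (t + h)"
    using has_real_derivative_pos_inc_right[OF D] by auto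
  obtain e' where e': "e' > 0" "\<And>\<tau>. \<tau> \<in> {0..T} \<Longrightarrow> \<tau> \<noteq> t \<Longrightarrow> dist \<tau> t < e' \<Longrightarrow> g \<tau> \<le> g t"
    using max unfolding eventually_at by auto
  \<comment> \<open>The step stays within both neighbourhoods and does not reach
    \<open>T\<close>.\<close>
  define h where "h = min (min e e') (T - t) / 2"
  have "min (min e e') (T - t) \<le> T - t" by simp
  then have "h \<le> (T - t) / 2" unfolding h_def by (rule divide_right_mono) simp
  moreover have h: "0 < h" "h < e" "h < e'" using e e' t by (auto simp: h_def min_def)
  ultimately have "t + h \<in> {0..T}" using t by auto
  note h = h this
  then show False using e(2)[of h] e'(2)[of "t + h"] by (auto simp: dist_real_def)
qed

text \<open>If \<open>D\<close> were positive, \<open>g'\<close> would be positive just to the right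
  of \<open>x\<close>, where it starts from 0, and \<open>g\<close> would increase there.\<close>

lemma local_max_derivatives:
  fixes g g' :: "real \<Rightarrow> real"
  assumes g: "\<And>y. (g has_real_derivative g' y) (at y)" and max: "\<forall>\<^sub>F y in at x. g y \<le> g x"
  shows "g' x = 0" and "(g' has_real_derivative D) (at x) \<Longrightarrow> D \<le> 0"
proof -
  obtain e where e: "e > 0" "\<And>y. y \<noteq> x \<Longrightarrow> dist y x < e \<Longrightarrow> g y \<le> g x"
    using max unfolding eventually_at by auto
  have e': "g y \<le> g x" if "\<bar>x - y\<bar> < e" for y
    using e(2)[of y] that by (cases "y = x") (auto simp: dist_real_def abs_minus_commute)
  show g'0: "g' x = 0" by (rule DERIV_local_max[OF g e(1)]) (use e' in auto)
  assume D: "(g' has_real_derivative D) (at x)"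
  show "D \<le> 0"
  proof (rule ccontr)
    assume "\<not> D \<le> 0"
    then obtain d where d: "d > 0" "\<And>h. 0 < h \<Longrightarrow> h < d \<Longrightarrow> g' x < g' (x + h)"
      using DERIV_pos_inc_right[OF D] by auto
    define h where "h = min d e / 2"
    have h: "0 < h" "h < d" "h < e" using d e by (auto simp: h_def)
    have "g x < g (x + h)"
    proof (rule DERIV_pos_imp_increasing_open[of x "x + h" g])
      show "x < x + h" using h by simp
      show "continuous_on {x..x + h} g" by (intro continuous_at_imp_continuous_on ballI DERIV_isCont[OF g])
      fix y assume y: "x < y" "y < x + h"
      show "\<exists>l. (g has_real_derivative l) (at y) \<and> 0 < l"
        using g[of y] d(2)[of "y - x"] y h g'0 by auto
    qed
    moreover have "g (x + h) \<le> g x" using e'[of "x + h"] h by simp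
    ultimately show False by simp
  qed
qed

lemma local_max_on_sections:
  assumes m: "local_max_on T h t x" and t: "t \<in> {0..T}"
  shows "\<forall>\<^sub>F \<tau> in at t within {0..T}. h \<tau> x \<le> h t x" and "\<forall>\<^sub>F y in at x. h t y \<le> h t x"
proof -
  obtain e where e: "e > 0" "\<And>z. z \<in> {0..T} \<times> UNIV \<Longrightarrow> z \<noteq> (t, x) \<Longrightarrow> dist z (t, x) < e \<Longrightarrow> h (fst z) (snd z) \<le> h t x"
    using m unfolding local_max_on_def eventually_at by auto
  show "\<forall>\<^sub>F \<tau> in at t within {0..T}. h \<tau> x \<le> h t x"
    unfolding eventually_at using e by (intro exI[of _ e]) (auto simp: dist_Pair_Pair dest!: spec[of _ x])
  show "\<forall>\<^sub>F y in at x. h t y \<le> h t x"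
    unfolding eventually_at using e t by (intro exI[of _ e]) (auto simp: dist_Pair_Pair)
qed

lemma local_min_max: "local_min_on T h t x \<longleftrightarrow> local_max_on T (\<lambda>t x. - h t x) t x"
  by (simp add: local_min_on_def local_max_on_def)

section \<open>The candidate value function and its Hamiltonian\<close>

context linear_control
begin

text \<open>Both branches in one formula, through the positive and the negative part of
  \<open>x + shift t\<close>; the exponents are \<open>2 * r\<close> and
  \<open>2 * (A1 + r) = 2 * r - kap\<close>. Either branch vanishes at the boundary together with
  its first derivative.\<close>

definition val :: "real \<Rightarrow> real \<Rightarrow> real" where
  "val t x = exp (2 * r * (T - t)) * ((max 0 (x + shift t))\<^sup>2 / 2)
    + exp ((2 * r - kap) * (T - t)) * ((min 0 (x + shift t))\<^sup>2 / 2)"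

definition val_x :: "real \<Rightarrow> real \<Rightarrow> real" where
  "val_x t x = exp (2 * r * (T - t)) * max 0 (x + shift t) + exp ((2 * r - kap) * (T - t)) * min 0 (x + shift t)"

definition val_t :: "real \<Rightarrow> real \<Rightarrow> real" where
  "val_t t x = - (r * exp (2 * r * (T - t)) * (max 0 (x + shift t))\<^sup>2)
    - (r - kap / 2) * exp ((2 * r - kap) * (T - t)) * (min 0 (x + shift t))\<^sup>2 - (c - r * shift t) * val_x t x"

lemma val_derivative_x: "((\<lambda>y. val t y) has_real_derivative val_x t x) (at x)"
proof -
  have "((\<lambda>y. (max 0 (y + shift t))\<^sup>2 / 2) has_real_derivative max 0 (x + shift t) * 1) (at x)"
    by (rule DERIV_chain2[OF pos_part_square_derivative]) (auto intro!: derivative_eq_intros)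
  moreover have "((\<lambda>y. (min 0 (y + shift t))\<^sup>2 / 2) has_real_derivative min 0 (x + shift t) * 1) (at x)"
    by (rule DERIV_chain2[OF neg_part_square_derivative]) (auto intro!: derivative_eq_intros)
  ultimately show ?thesis unfolding val_def val_x_def mult_1_right by (intro DERIV_add DERIV_cmult)
qed

lemma val_derivative_t: "((\<lambda>\<tau>. val \<tau> x) has_real_derivative val_t t x) (at t)"
proof -
  have sh: "((\<lambda>\<tau>. x + shift \<tau>) has_real_derivative - (c - r * shift t)) (at t)"
  proof -
    have e: "- c * exp (- r * (T - t)) = - (c - r * shift t)" using pos by (simp add: shift_def field_simps)
    show ?thesis using DERIV_add[OF DERIV_const[of x] shift_derivative[of t]] unfolding e by simp
  qed
  have 1: "((\<lambda>\<tau>. (max 0 (x + shift \<tau>))\<^sup>2 / 2) has_real_derivative max 0 (x + shift t) * - (c - r * shift t)) (at t)"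
    by (rule DERIV_chain2[OF pos_part_square_derivative sh])
  have 2: "((\<lambda>\<tau>. (min 0 (x + shift \<tau>))\<^sup>2 / 2) has_real_derivative min 0 (x + shift t) * - (c - r * shift t)) (at t)"
    by (rule DERIV_chain2[OF neg_part_square_derivative sh])
  have 3: "((\<lambda>\<tau>. exp (k * (T - \<tau>))) has_real_derivative - k * exp (k * (T - t))) (at t)" for k
    by (auto intro!: derivative_eq_intros)
  have D: "((\<lambda>\<tau>. val \<tau> x) has_real_derivative
      (- (2 * r) * exp (2 * r * (T - t)) * ((max 0 (x + shift t))\<^sup>2 / 2) + (max 0 (x + shift t) * - (c - r * shift t)) * exp (2 * r * (T - t)))
     + (- (2 * r - kap) * exp ((2 * r - kap) * (T - t)) * ((min 0 (x + shift t))\<^sup>2 / 2) + (min 0 (x + shift t) * - (c - r * shift t)) * exp ((2 * r - kap) * (T - t)))) (at t)"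
    unfolding val_def[abs_def] by (intro DERIV_add DERIV_mult 1 2 3)
  have "- (2 * r) * E * (m / 2) + (p * - k) * E + (- (2 * r - kap) * E' * (m' / 2) + (p' * - k) * E')
      = - (r * E * m) - (r - kap / 2) * E' * m' - k * (E * p + E' * p')" for E E' m m' p p' k
    by (simp add: field_simps)
  from DERIV_cong[OF D this] show ?thesis unfolding val_t_def val_x_def .
qed

lemma val_derivative_xx:
  assumes "x + shift t \<noteq> 0"
  shows "((\<lambda>y. val_x t y) has_real_derivative
    (if x + shift t > 0 then exp (2 * r * (T - t)) else exp ((2 * r - kap) * (T - t)))) (at x)"
proof (cases "x + shift t > 0")
  case True
  have "((\<lambda>y. exp (2 * r * (T - t)) * (y + shift t)) has_real_derivative exp (2 * r * (T - t))) (at x)"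
    by (auto intro!: derivative_eq_intros)
  then have "((\<lambda>y. val_x t y) has_real_derivative exp (2 * r * (T - t))) (at x)"
    by (rule has_field_derivative_transform_within_open[of _ _ _ "{- shift t<..}"]) (use True in \<open>auto simp: val_x_def max_def min_def\<close>)
  then show ?thesis using True by simp
next
  case False
  have "((\<lambda>y. exp ((2 * r - kap) * (T - t)) * (y + shift t)) has_real_derivative exp ((2 * r - kap) * (T - t))) (at x)"
    by (auto intro!: derivative_eq_intros)
  then have "((\<lambda>y. val_x t y) has_real_derivative exp ((2 * r - kap) * (T - t))) (at x)"
    by (rule has_field_derivative_transform_within_open[of _ _ _ "{..<- shift t}"]) (use False assms in \<open>auto simp: val_x_def max_def min_def\<close>)
  then show ?thesis using False by simp
qed

lemma val_continuous: "continuous_on A (\<lambda>(t, x). val t x)"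
  unfolding val_def shift_def case_prod_beta using pos by (auto intro!: continuous_intros)

definition hamiltonian :: "real \<Rightarrow> real \<Rightarrow> real \<times> real \<Rightarrow> real \<Rightarrow> real \<Rightarrow> real" where
  "hamiltonian t x u p P = p * drift x u + 1/2 * P * ((vol0 u)\<^sup>2 + (vol1 u)\<^sup>2)"

text \<open>On this side taking risk cannot help: both summands are nonnegative for admissible
  \<open>u\<close>, and both vanish at \<open>u = (0, 0)\<close>.\<close>

lemma hamiltonian_pos:
  assumes "x + shift t > 0"
  shows "val_t t x + hamiltonian t x u (val_x t x) (exp (2 * r * (T - t)))
    = exp (2 * r * (T - t)) * ((x + shift t) * gain u + ((vol0 u)\<^sup>2 + (vol1 u)\<^sup>2) / 2)"
proof -
  define z where "z = x + shift t"
  have m: "max 0 z = z" "min 0 z = 0" using assms by (auto simp: z_def)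
  have dr: "drift x u = r * z + gain u + (c - r * shift t)" by (simp add: drift_def gain_def z_def algebra_simps)
  show ?thesis unfolding hamiltonian_def val_t_def val_x_def z_def[symmetric] m dr
    by (simp add: power2_eq_square algebra_simps)
qed

text \<open>Completing the square in the two volatilities. The minimum 0 is attained where they
  equal \<open>- lam0 * (x + shift t)\<close> and \<open>- lam1 * (x + shift t)\<close>, and this is
  the origin of the feedback.\<close>

lemma hamiltonian_neg:
  assumes "x + shift t < 0"
  shows "val_t t x + hamiltonian t x u (val_x t x) (exp ((2 * r - kap) * (T - t)))
    = exp ((2 * r - kap) * (T - t)) * (((vol0 u + lam0 * (x + shift t))\<^sup>2 + (vol1 u + lam1 * (x + shift t))\<^sup>2) / 2)"
proof -
  define z where "z = x + shift t"
  define E where "E = exp ((2 * r - kap) * (T - t))"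
  have m: "max 0 z = 0" "min 0 z = z" using assms by (auto simp: z_def)
  have dr: "drift x u = r * z + (lam0 * vol0 u + lam1 * vol1 u) + (c - r * shift t)"
    unfolding gain_vol[symmetric] by (simp add: drift_def gain_def z_def algebra_simps)
  show ?thesis unfolding hamiltonian_def val_t_def val_x_def z_def[symmetric] E_def[symmetric] m dr
    unfolding kap_def by (simp add: power2_eq_square field_simps)
qed

text \<open>The factor \<open>k\<close> unifies the two notions: 1 for subsolutions, -1 for
  supersolutions. \<open>V\<close> is compared with \<open>val\<close> only on
  \<open>{0..T}\<close>, to which the local extremum refers.\<close>

lemma test_function_derivatives:
  assumes \<phi>: "C12_on T \<phi> \<phi>t \<phi>x \<phi>xx" and t: "0 \<le> t" "t < T" and k: "k = 1 \<or> k = - 1"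
    and V: "\<And>t x. t \<in> {0..T} \<Longrightarrow> V t x = val t x"
    and max: "local_max_on T (\<lambda>t x. k * (V t x - \<phi> t x)) t x"
  shows "k * (val_t t x - \<phi>t t x) \<le> 0" and "\<phi>x t x = val_x t x"
    and "x + shift t \<noteq> 0 \<Longrightarrow> k * ((if x + shift t > 0 then exp (2 * r * (T - t)) else exp ((2 * r - kap) * (T - t))) - \<phi>xx t x) \<le> 0"
proof -
  have tT: "t \<in> {0..T}" using t by auto
  have d: "((\<lambda>\<tau>. \<phi> \<tau> x) has_real_derivative \<phi>t t x) (at t within {0..T})"
    "\<And>y. ((\<lambda>z. \<phi> t z) has_real_derivative \<phi>x t y) (at y)"
    "((\<lambda>z. \<phi>x t z) has_real_derivative \<phi>xx t x) (at x)"
    using \<phi> tT unfolding C12_on_def by blast+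
  have 1: "\<forall>\<^sub>F \<tau> in at t within {0..T}. k * (val \<tau> x - \<phi> \<tau> x) \<le> k * (val t x - \<phi> t x)"
    using local_max_on_sections(1)[OF max tT] unfolding V[OF tT] eventually_at_filter
    by eventually_elim (use V in auto)
  have 2: "\<forall>\<^sub>F y in at x. k * (val t y - \<phi> t y) \<le> k * (val t x - \<phi> t x)"
    using local_max_on_sections(2)[OF max tT] unfolding V[OF tT] .
  show "k * (val_t t x - \<phi>t t x) \<le> 0"
    by (rule right_derivative_local_max[OF _ t 1])
      (intro DERIV_cmult DERIV_diff d has_field_derivative_at_within[OF val_derivative_t])
  have 3: "((\<lambda>y. k * (val t y - \<phi> t y)) has_real_derivative k * (val_x t y - \<phi>x t y)) (at y)" for y
    by (intro DERIV_cmult DERIV_diff d val_derivative_x)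
  show "\<phi>x t x = val_x t x" using local_max_derivatives(1)[OF 3 2] k by auto
  assume "x + shift t \<noteq> 0"
  then have "((\<lambda>y. k * (val_x t y - \<phi>x t y)) has_real_derivative
     k * ((if x + shift t > 0 then exp (2 * r * (T - t)) else exp ((2 * r - kap) * (T - t))) - \<phi>xx t x)) (at x)"
    by (intro DERIV_cmult DERIV_diff d val_derivative_xx)
  then show "k * ((if x + shift t > 0 then exp (2 * r * (T - t)) else exp ((2 * r - kap) * (T - t))) - \<phi>xx t x) \<le> 0"
    by (rule local_max_derivatives(2)[OF 3 2])
qed

lemma val_viscosity:
  assumes V: "\<And>t x. t \<in> {0..T} \<Longrightarrow> V t x = val t x"
  shows "viscosity_solution T hamiltonian (\<lambda>x. 1/2 * x\<^sup>2) V"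
proof -
  have c: "continuous_on ({0..T} \<times> UNIV) (\<lambda>(t, x). V t x)"
    by (rule continuous_on_eq[OF val_continuous]) (use V in auto)
  have fin: "V T x = 1/2 * x\<^sup>2" for x
    using V[of T x] pos by (simp add: val_def shift_def max_def min_def)
  \<comment> \<open>Degenerate ellipticity; it lets the second derivative of the test function
    replace that of the value function.\<close>
  have mono: "hamiltonian t x u p P \<le> hamiltonian t x u p P'" if "P \<le> P'" for t x u p P P'
    unfolding hamiltonian_def using that by (intro add_left_mono mult_right_mono) auto
  have "viscosity_subsolution T hamiltonian (\<lambda>x. 1/2 * x\<^sup>2) V"
    unfolding viscosity_subsolution_def
  proof (intro conjI c allI impI ballI)
    fix \<phi> \<phi>t \<phi>x \<phi>xx t x
    assume \<phi>: "C12_on T \<phi> \<phi>t \<phi>x \<phi>xx" and t: "t \<in> {0..<T}" and max: "local_max_on T (\<lambda>t x. V t x - \<phi> t x) t x"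
    have t': "0 \<le> t" "t < T" using t by auto
    note d = test_function_derivatives[OF \<phi> t' disjI1[OF refl] V, of x, simplified, OF max]
    have "0 \<le> \<phi>t t x + hamiltonian t x u (\<phi>x t x) (\<phi>xx t x)" if u: "u \<in> {0..} \<times> {0..}" for u
    proof -
      have gain: "0 \<le> gain u" using u pos by (auto simp: gain_def)
      consider "x + shift t > 0" | "x + shift t < 0" | "x + shift t = 0" by linarith
      then show ?thesis
      proof cases
        case 1
        have "0 \<le> val_t t x + hamiltonian t x u (val_x t x) (exp (2 * r * (T - t)))"
          unfolding hamiltonian_pos[OF 1] using mult_nonneg_nonneg[OF less_imp_le[OF 1] gain] by simp
        also have "\<dots> \<le> \<phi>t t x + hamiltonian t x u (\<phi>x t x) (\<phi>xx t x)"
          using d(1) d(3) 1 unfolding d(2) by (intro add_mono mono) auto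
        finally show ?thesis .
      next
        case 2
        have "0 \<le> val_t t x + hamiltonian t x u (val_x t x) (exp ((2 * r - kap) * (T - t)))"
          unfolding hamiltonian_neg[OF 2] by (intro mult_nonneg_nonneg) auto
        also have "\<dots> \<le> \<phi>t t x + hamiltonian t x u (\<phi>x t x) (\<phi>xx t x)"
          using d(1) d(3) 2 unfolding d(2) by (intro add_mono mono) auto
        finally show ?thesis .
      next
        case 3
        have tT: "t \<in> {0..T}" using t by auto
        have v0: "val t x = 0" "val_x t x = 0" "val_t t x = 0" using 3 by (simp_all add: val_def val_x_def val_t_def)
        have vn: "0 \<le> val t y" for y unfolding val_def by simp
        have ev: "\<forall>\<^sub>F y in at x. - \<phi> t y \<le> - \<phi> t x"
          using local_max_on_sections(2)[OF max tT]
        proof eventually_elim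
          case (elim y)
          then show ?case using V[OF tT] v0 vn[of y] by simp
        qed
        have D: "((\<lambda>y. - \<phi> t y) has_real_derivative - \<phi>x t y) (at y)" "((\<lambda>y. - \<phi>x t y) has_real_derivative - \<phi>xx t x) (at x)" for y
          using \<phi> tT unfolding C12_on_def by (auto intro!: DERIV_minus)
        have "- \<phi>xx t x \<le> 0" by (rule local_max_derivatives(2)[OF D(1) ev D(2)])
        then have "0 \<le> hamiltonian t x u (\<phi>x t x) (\<phi>xx t x)"
          unfolding hamiltonian_def d(2) v0 by simp
        then show ?thesis using d(1) v0 by simp
      qed
    qed
    \<comment> \<open>The infimum is an extended real, so \<open>\<phi>t t x\<close> is first moved
      to the other side as a finite lower bound.\<close>
    then have "- \<phi>t t x \<le> hamiltonian t x u (\<phi>x t x) (\<phi>xx t x)" if "u \<in> {0..} \<times> {0..}" for u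
      using that by fastforce
    then have "ereal (- \<phi>t t x) \<le> inf_hamiltonian hamiltonian t x (\<phi>x t x) (\<phi>xx t x)"
      unfolding inf_hamiltonian_def by (intro INF_greatest) simp
    then have "ereal (\<phi>t t x) + ereal (- \<phi>t t x) \<le> ereal (\<phi>t t x) + inf_hamiltonian hamiltonian t x (\<phi>x t x) (\<phi>xx t x)"
      by (rule add_left_mono)
    then show "0 \<le> ereal (\<phi>t t x) + inf_hamiltonian hamiltonian t x (\<phi>x t x) (\<phi>xx t x)"
      by (simp add: zero_ereal_def)
  qed (rule fin)
  moreover have "viscosity_supersolution T hamiltonian (\<lambda>x. 1/2 * x\<^sup>2) V"
    unfolding viscosity_supersolution_def
  proof (intro conjI c allI impI ballI)
    fix \<phi> \<phi>t \<phi>x \<phi>xx t x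
    assume \<phi>: "C12_on T \<phi> \<phi>t \<phi>x \<phi>xx" and t: "t \<in> {0..<T}" and min: "local_min_on T (\<lambda>t x. V t x - \<phi> t x) t x"
    have t': "0 \<le> t" "t < T" using t by auto
    have max: "local_max_on T (\<lambda>t x. - 1 * (V t x - \<phi> t x)) t x"
      using min unfolding local_min_max by simp
    note d = test_function_derivatives[OF \<phi> t' disjI2[OF refl] V max, simplified]
    \<comment> \<open>One good control suffices for a supersolution: zero on and above the boundary,
      the feedback below it. On the boundary the second derivative does not matter, because the zero
      control has no volatility, and \<open>\<phi>x t x\<close> vanishes.\<close>
    have "\<exists>u\<in>{0..} \<times> {0..}. \<phi>t t x + hamiltonian t x u (\<phi>x t x) (\<phi>xx t x) \<le> 0"
    proof -
      consider "x + shift t > 0" | "x + shift t < 0" | "x + shift t = 0" by linarith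
      then show ?thesis
      proof cases
        case 1
        have "\<phi>t t x + hamiltonian t x (0, 0) (\<phi>x t x) (\<phi>xx t x) \<le> val_t t x + hamiltonian t x (0, 0) (val_x t x) (exp (2 * r * (T - t)))"
          using d(1) d(3) 1 unfolding d(2) by (intro add_mono mono) auto
        also have "\<dots> = 0" unfolding hamiltonian_pos[OF 1] by (simp add: gain_def vol0_def vol1_def)
        finally show ?thesis by (intro bexI[of _ "(0, 0)"]) auto
      next
        case 2
        let ?u = "feedback t x"
        have u: "?u = (- (\<rho> / \<sigma>\<^sup>2) * (x + shift t), - (\<alpha> / b\<^sup>2) * (x + shift t))" using 2 by (simp add: feedback_def)
        have v: "vol0 ?u = - lam0 * (x + shift t)" "vol1 ?u = - lam1 * (x + shift t)"
          unfolding u vol0_def vol1_def lam0_def lam1_def using pos by (simp_all add: power2_eq_square)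
        have "\<phi>t t x + hamiltonian t x ?u (\<phi>x t x) (\<phi>xx t x) \<le> val_t t x + hamiltonian t x ?u (val_x t x) (exp ((2 * r - kap) * (T - t)))"
          using d(1) d(3) 2 unfolding d(2) by (intro add_mono mono) auto
        also have "\<dots> = 0" unfolding hamiltonian_neg[OF 2] v by simp
        finally have "\<phi>t t x + hamiltonian t x ?u (\<phi>x t x) (\<phi>xx t x) \<le> 0" .
        moreover have "0 \<le> - (\<rho> / \<sigma>\<^sup>2) * (x + shift t)" "0 \<le> - (\<alpha> / b\<^sup>2) * (x + shift t)"
          by (rule mult_nonpos_nonpos; use 2 pos in simp)+
        then have "?u \<in> {0..} \<times> {0..}" unfolding u by simp
        ultimately show ?thesis by (intro bexI[of _ ?u])
      next
        case 3
        have "hamiltonian t x (0, 0) (\<phi>x t x) (\<phi>xx t x) = 0"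
          unfolding hamiltonian_def d(2) using 3 by (simp add: vol0_def vol1_def val_x_def)
        moreover have "val_t t x = 0" using 3 by (simp add: val_x_def val_t_def)
        ultimately show ?thesis using d(1) by (intro bexI[of _ "(0, 0)"]) auto
      qed
    qed
    then obtain u where u: "u \<in> {0..} \<times> {0..}" "\<phi>t t x + hamiltonian t x u (\<phi>x t x) (\<phi>xx t x) \<le> 0" by blast
    have "inf_hamiltonian hamiltonian t x (\<phi>x t x) (\<phi>xx t x) \<le> ereal (hamiltonian t x u (\<phi>x t x) (\<phi>xx t x))"
      unfolding inf_hamiltonian_def by (rule INF_lower[OF u(1)])
    then have "ereal (\<phi>t t x) + inf_hamiltonian hamiltonian t x (\<phi>x t x) (\<phi>xx t x) \<le> ereal (\<phi>t t x) + ereal (hamiltonian t x u (\<phi>x t x) (\<phi>xx t x))"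
      by (rule add_left_mono)
    also have "\<dots> \<le> 0" using u(2) by simp
    finally show "ereal (\<phi>t t x) + inf_hamiltonian hamiltonian t x (\<phi>x t x) (\<phi>xx t x) \<le> 0" .
  qed (rule fin)
  ultimately show ?thesis by (simp add: viscosity_solution_def)
qed

text \<open>In this form the candidate is visibly half of the lower bound in
  \<open>cost_lower_bound\<close>.\<close>

lemma val_endpoint:
  "val s y = 1/2 * ((if endpoint s y \<ge> 0 then 1 else exp (- kap * (T - s))) * (endpoint s y)\<^sup>2)"
proof -
  have e: "(endpoint s y)\<^sup>2 = exp (2 * r * (T - s)) * (y + shift s)\<^sup>2"
    unfolding endpoint_shift power_mult_distrib exp_double[symmetric] by (simp add: mult.assoc)
  have sgn: "0 \<le> endpoint s y \<longleftrightarrow> 0 \<le> y + shift s" unfolding endpoint_shift by (simp add: zero_le_mult_iff)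
  have "exp ((2 * r - kap) * (T - s)) = exp (- kap * (T - s)) * exp (2 * r * (T - s))"
    unfolding exp_add[symmetric] by (simp add: algebra_simps)
  then show ?thesis unfolding val_def sgn e by (auto simp: max_def min_def)
qed

section \<open>Identification of the value function and optimality of the feedback\<close>

lemma closed_loop_exists:
  assumes "0 \<le> s" "s \<le> T"
  shows "\<exists>x. closed_loop_state M F W s T drift vol0 vol1 y feedback x \<and> terminal_cost M T x = val s y"
proof (cases "0 \<le> y + shift s")
  case True
  then have "0 \<le> endpoint s y" unfolding endpoint_shift by simp
  then show ?thesis using closed_loop_nonneg[OF assms True] unfolding terminal_cost_def val_endpoint by auto
next
  case False
  then have "\<not> 0 \<le> endpoint s y" unfolding endpoint_shift by (simp add: zero_le_mult_iff)
  then show ?thesis using closed_loop_neg[OF assms, of y] False unfolding terminal_cost_def val_endpoint by auto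
qed

text \<open>The infimum is attained by the feedback state. The case \<open>s = T\<close> is included
  and yields the terminal condition.\<close>

lemma value_function_eq:
  assumes s: "0 \<le> s" "s \<le> T"
  shows "value_function M F W T drift vol0 vol1 s y = val s y"
  unfolding value_function_def
proof (rule cInf_eq_minimum)
  obtain x where "closed_loop_state M F W s T drift vol0 vol1 y feedback x" "terminal_cost M T x = val s y"
    using closed_loop_exists[OF s] by blast
  then show "val s y \<in> {terminal_cost M T x | u x. u \<in> admissible_controls M F s T \<and> state_process M F W s T drift vol0 vol1 y u x}"
    unfolding closed_loop_state_def by (intro CollectI exI[of _ "\<lambda>t \<omega>. feedback t (x t \<omega>)"] exI[of _ x]) auto
next
  fix w assume "w \<in> {terminal_cost M T x | u x. u \<in> admissible_controls M F s T \<and> state_process M F W s T drift vol0 vol1 y u x}"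
  then obtain u x where "w = terminal_cost M T x" "u \<in> admissible_controls M F s T" "state_process M F W s T drift vol0 vol1 y u x" by blast
  then show "val s y \<le> w"
    using cost_lower_bound[OF s, of u y x] unfolding terminal_cost_def val_endpoint by simp
qed

text \<open>One closed-loop state of minimal cost has been constructed; uniqueness at time
  \<open>T\<close> transfers its cost to every other one.\<close>

lemma feedback_optimal: "optimal_feedback_control M F W T drift vol0 vol1 feedback"
  unfolding optimal_feedback_control_def
proof (intro ballI allI conjI impI)
  fix s y assume "s \<in> {0..<T}"
  then have s: "0 \<le> s" "s \<le> T" by auto
  obtain x' where x': "closed_loop_state M F W s T drift vol0 vol1 y feedback x'" "terminal_cost M T x' = val s y"
    using closed_loop_exists[OF s] by blast
  show "\<exists>x. closed_loop_state M F W s T drift vol0 vol1 y feedback x" using x' by blast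
  fix x assume x: "closed_loop_state M F W s T drift vol0 vol1 y feedback x"
  have m: "x T \<in> borel_measurable M" if "closed_loop_state M F W s T drift vol0 vol1 y feedback x" for x
    using that s by (intro F_M[of _ T]) (auto simp: closed_loop_state_def state_process_def)
  have "(\<integral>\<omega>. (x T \<omega>)\<^sup>2 \<partial>M) = (\<integral>\<omega>. (x' T \<omega>)\<^sup>2 \<partial>M)"
    by (rule integral_cong_AE)
      (use m[OF x] m[OF x'(1)] closed_loop_unique[OF s x x'(1)] in \<open>auto elim: eventually_mono\<close>)
  then show "terminal_cost M T x = value_function M F W T drift vol0 vol1 s y"
    unfolding value_function_eq[OF s] x'(2)[symmetric] by (simp add: terminal_cost_def)
qed

end

theorem theorem4p2:
  fixes M :: "'w measure"
    and W :: "nat \<Rightarrow> real \<Rightarrow> 'w \<Rightarrow> real"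
    and F :: "real \<Rightarrow> 'w measure"
    and a b r T \<sigma> \<mu> \<eta> \<theta> d \<gamma> A1 :: real
    and g1 :: "real \<Rightarrow> real"
    and f :: "real \<Rightarrow> real \<times> real \<Rightarrow> real"
    and \<beta>\<^sub>0 \<beta>\<^sub>1 :: "real \<times> real \<Rightarrow> real"
    and G :: "real \<Rightarrow> real \<Rightarrow> real \<times> real \<Rightarrow> real \<Rightarrow> real \<Rightarrow> real"
    and V :: "real \<Rightarrow> real \<Rightarrow> real"
    and ustar :: "real \<Rightarrow> real \<Rightarrow> real \<times> real"
  assumes "prob_space M" and "complete_measure M"
    and "\<And>i. i \<in> {0, 1, 2} \<Longrightarrow> brownian_motion M (W i)"
    and "independent_processes M {0, 1, 2} W"
    and F_def: "F = natural_filtration M {0, 1, 2} W"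
    and "a > 0" and "b > 0" and "r > 0" and "T > 0" and "\<sigma> \<noteq> 0"
    and "\<mu> \<ge> r"
    and "\<eta> > \<theta>" and "\<theta> > 0"
    and g1_def: "\<And>t. g1 t = (a*\<theta> - a*\<eta> + (d - \<gamma>)*r) * (exp (r*(T - t)) - 1) / r"
    and A1_def: "A1 = - ((\<mu> - r)\<^sup>2 / (2*\<sigma>\<^sup>2)) - a\<^sup>2*\<eta>\<^sup>2 / (2*b\<^sup>2)"
    and f_def: "\<And>x \<pi> q. f x (\<pi>, q) = r*x + a*\<eta>*q + (\<mu> - r)*\<pi> + a*\<theta> - a*\<eta> + (d - \<gamma>)*r"
    and \<beta>\<^sub>0_def: "\<And>\<pi> q. \<beta>\<^sub>0 (\<pi>, q) = b*q"
    and \<beta>\<^sub>1_def: "\<And>\<pi> q. \<beta>\<^sub>1 (\<pi>, q) = \<sigma>*\<pi>"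
    and G_def: "\<And>t x \<pi> q p P. G t x (\<pi>, q) p P =
        p * (r*x + a*\<eta>*q + (\<mu> - r)*\<pi> + a*\<theta> - a*\<eta> + (d - \<gamma>)*r)
          + 1/2 * P * (b\<^sup>2*q\<^sup>2 + \<sigma>\<^sup>2*\<pi>\<^sup>2)"
    and V_def: "\<And>s y. V s y = value_function M F W T f \<beta>\<^sub>0 \<beta>\<^sub>1 s y"
    and ustar_def: "\<And>t x. ustar t x =
        (if x + g1 t * exp (- r*(T - t)) < 0
         then (- ((\<mu> - r) / \<sigma>\<^sup>2) * (x + g1 t * exp (- r*(T - t))),
               - (a*\<eta> / b\<^sup>2) * (x + g1 t * exp (- r*(T - t))))
         else (0, 0))"
  shows "(\<forall>t\<in>{0..T}. \<forall>x. V t x =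
            (if x + g1 t * exp (- r*(T - t)) \<ge> 0
             then 1/2 * (exp (r*(T - t)) * x + g1 t)\<^sup>2
             else 1/2 * (exp ((A1 + r)*(T - t)) * x + exp ((T - t)*A1) * g1 t)\<^sup>2))
       \<and> viscosity_solution T G (\<lambda>x. 1/2 * x\<^sup>2) V
       \<and> optimal_feedback_control M F W T f \<beta>\<^sub>0 \<beta>\<^sub>1 ustar"
proof -
  define c where "c = a*\<theta> - a*\<eta> + (d - \<gamma>)*r"
  interpret prob_space M by fact
  \<comment> \<open>Positivity of \<open>a * \<eta>\<close> follows from \<open>a > 0\<close> and
    \<open>\<eta> > \<theta> > 0\<close>; nonnegativity of \<open>\<mu> - r\<close> is the
    assumption \<open>\<mu> \<ge> r\<close>.\<close>
  interpret linear_control M W F "a*\<eta>" "\<mu> - r" b \<sigma> r c T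
    by unfold_locales (use assms in \<open>auto\<close>)
  have f: "f = drift"
  proof (intro ext)
    fix x u show "f x u = drift x u"
      by (cases u) (simp only: f_def drift_def fst_conv snd_conv, simp add: c_def)
  qed
  have v: "\<beta>\<^sub>0 = vol0" "\<beta>\<^sub>1 = vol1"
    by (auto simp: fun_eq_iff \<beta>\<^sub>0_def \<beta>\<^sub>1_def vol0_def vol1_def)
  have G: "G = hamiltonian"
  proof (intro ext)
    fix t x u p P show "G t x u p P = hamiltonian t x u p P"
      by (cases u) (simp only: G_def hamiltonian_def drift_def vol0_def vol1_def fst_conv snd_conv,
          simp add: c_def power_mult_distrib algebra_simps)
  qed
  have ee: "exp (r*(T - t)) * exp (- r*(T - t)) = 1" for t by (simp add: exp_add[symmetric])
  have g1: "g1 t * exp (- r*(T - t)) = shift t" for t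
  proof -
    have "g1 t * exp (- r*(T - t)) = c * (exp (r*(T - t)) * exp (- r*(T - t)) - exp (- r*(T - t))) / r"
      unfolding g1_def c_def[symmetric] by (simp add: algebra_simps)
    then show ?thesis unfolding ee shift_def .
  qed
  have g1': "g1 t = exp (r*(T - t)) * shift t" for t
    unfolding g1[symmetric] using ee[of t] by (simp add: mult.left_commute)
  have u: "ustar = feedback"
    by (intro ext) (simp only: ustar_def feedback_def g1)
  \<comment> \<open>\<open>A1\<close> occurs inside a square, so it appears doubled there and
    matches the rate \<open>- kap\<close> of the lower bound.\<close>
  have A1: "A1 = - kap / 2"
    unfolding A1_def kap_def lam0_def lam1_def by (simp add: power_divide power_mult_distrib add_divide_distrib)
  have V: "V t x = val t x" if "t \<in> {0..T}" for t x
    unfolding V_def f v using value_function_eq that by auto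
  have "val t x = (if x + g1 t * exp (- r*(T - t)) \<ge> 0 then 1/2 * (exp (r*(T - t)) * x + g1 t)\<^sup>2
             else 1/2 * (exp ((A1 + r)*(T - t)) * x + exp ((T - t)*A1) * g1 t)\<^sup>2)" for t x
  proof -
    have 1: "exp (r*(T - t)) * x + g1 t = exp (r*(T - t)) * (x + shift t)"
      unfolding g1' by (simp add: distrib_left)
    have "exp ((A1 + r)*(T - t)) = exp ((T - t)*A1) * exp (r*(T - t))"
      unfolding exp_add[symmetric] by (simp add: algebra_simps)
    then have 2: "exp ((A1 + r)*(T - t)) * x + exp ((T - t)*A1) * g1 t = exp ((A1 + r)*(T - t)) * (x + shift t)"
      unfolding g1' by (simp add: distrib_left mult.assoc)
    have 3: "(exp (r*(T - t)))\<^sup>2 = exp (2 * r * (T - t))" "(exp ((A1 + r)*(T - t)))\<^sup>2 = exp ((2 * r - kap) * (T - t))"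
      unfolding exp_double[symmetric] A1 by (auto simp: field_simps)
    show ?thesis unfolding g1 1 2 power_mult_distrib 3 val_def by (auto simp: max_def min_def)
  qed
  then show ?thesis
    using V val_viscosity[OF V] feedback_optimal unfolding f v G u by simp
qed

end
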